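(* Let $d\ge2$ and let $I$ be an inner function in $B_d$. For $w\in B_d$ put $K_w(z)=(1-I(z)\overline{I(w)})\,C(z,w)$, $z\in B_d$ (the reproducing kernel of $I^*(H^2)$), and for $\alpha\in\mathbb{T}$ define \[ (U_\alpha K_w)(\zeta)=(1-\alpha\overline{I(w)})\,C(\zeta,w),\quad \zeta\in S_d. \] Then, for each $\alpha\in\mathbb{T}$, $U_\alpha$ has a unique extension to a unitary operator from $I^*(H^2)$ onto $L^2(\sigma_\alpha)$, where $\sigma_\alpha=\sigma_\alpha[I]$ is the Clark measure of $I$.
   Context: $B_d$ is the open unit ball of $\mathbb{C}^d$, $S_d=\partial B_d$, $\mathbb{D}=B_1$, $\mathbb{T}=\partial\mathbb{D}$; $\Sigma_d$ is the normalized Lebesgue measure on $S_d$. $C(z,\zeta)=(1-\langle z,\zeta\rangle)^{-d}$ is the Cauchy kernel. An inner function in $B_d$ is a holomorphic $I:B_d\to\mathbb{D}$ such that the radial limit $I(\zeta)=\lim_{r\to1-}I(r\zeta)$ satisfies $|I(\zeta)|=1$ for $\Sigma_d$-a.e. $\zeta\in S_d$. $H^2=H^2(B_d)$ is the Hardy space of holomorphic $f$ on $B_d$ with $\|f\|_{H^2}^2=\sup_{0<r<1}\int_{S_d}|f(r\zeta)|^2\,d\Sigma_d(\zeta)<\infty$ (a Hilbert space via boundary values in $L^2(\Sigma_d)$), and $I^*(H^2)=H^2\ominus IH^2$. The Clark measure $\sigma_\alpha[I]$ is the unique positive Borel measure on $S_d$ such that $\int_{S_d}\left(\frac{1-|z|^2}{|1-\langle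 z,\zeta\rangle|^2}\right)^d d\sigma_\alpha[I](\zeta)=\mathrm{Re}\,\frac{\alpha+I(z)}{\alpha-I(z)}$ for all $z\in B_d$. *)

theory Defs
  imports "HOL-Analysis.Analysis"
begin

definition cinner :: "complex^'n \<Rightarrow> complex^'n \<Rightarrow> complex" where
  "cinner z w = (\<Sum>i\<in>UNIV. z $ i * cnj (w $ i))"

(* Frechet differentiability over the complex numbers: the real derivative is complex linear. *)
definition holomorphic_in_ball :: "(complex^'n \<Rightarrow> complex) \<Rightarrow> bool" where
  "holomorphic_in_ball f \<longleftrightarrow>
     (\<forall>z\<in>ball 0 1. \<exists>L. (f has_derivative L) (at z) \<and> (\<forall>c v. L (c *s v) = c * L v))"

(* The surface measure of the Euclidean sphere, normalized to total mass 1, as the cone measure: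
   the mass of A is the proportion of the volume of the ball lying in the cone over A. *)
definition sphere_measure :: "(complex^'n) measure" where
  "sphere_measure =
     restrict_space (distr (uniform_measure lborel (ball 0 1)) borel (\<lambda>x. x /\<^sub>R norm x)) (sphere 0 1)"

definition radial_limit :: "(complex^'n \<Rightarrow> complex) \<Rightarrow> complex^'n \<Rightarrow> complex" where
  "radial_limit f \<zeta> = Lim (at_left 1) (\<lambda>r::real. f (r *\<^sub>R \<zeta>))"

definition inner_function :: "(complex^'n \<Rightarrow> complex) \<Rightarrow> bool" where
  "inner_function I \<longleftrightarrow>
     holomorphic_in_ball I \<and> I ` ball 0 1 \<subseteq> ball 0 1 \<and>
     (AE \<zeta> in sphere_measure.
        ((\<lambda>r::real. I (r *\<^sub>R \<zeta>)) \<longlongrightarrow> radial_limit I \<zeta>) (at_left 1) \<and> norm (radial_limit I \<zeta>) = 1)"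

(* Elements of L2 are represented by functions; equality in L2 is equality almost everywhere. *)
definition L2_space :: "'a measure \<Rightarrow> ('a \<Rightarrow> complex) set" where
  "L2_space M = {f \<in> borel_measurable M. integrable M (\<lambda>x. (norm (f x))\<^sup>2)}"

definition L2_inner :: "'a measure \<Rightarrow> ('a \<Rightarrow> complex) \<Rightarrow> ('a \<Rightarrow> complex) \<Rightarrow> complex" where
  "L2_inner M f g = (\<integral>x. f x * cnj (g x) \<partial>M)"

definition hardy_norm_sq :: "(complex^'n \<Rightarrow> complex) \<Rightarrow> ennreal" where
  "hardy_norm_sq f =
     (SUP r\<in>{0<..<1::real}. \<integral>\<^sup>+ \<zeta>. ennreal ((norm (f (r *\<^sub>R \<zeta>)))\<^sup>2) \<partial>sphere_measure)"

(* Functions on the ball are represented by total functions; values off the ball are irrelevant,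
   and equality in the Hardy space is equality on the ball. *)
definition hardy_space :: "(complex^'n \<Rightarrow> complex) set" where
  "hardy_space = {f. holomorphic_in_ball f \<and> hardy_norm_sq f < \<infinity>}"

definition hardy_inner :: "(complex^'n \<Rightarrow> complex) \<Rightarrow> (complex^'n \<Rightarrow> complex) \<Rightarrow> complex" where
  "hardy_inner f g = L2_inner sphere_measure (radial_limit f) (radial_limit g)"

definition model_space :: "(complex^'n \<Rightarrow> complex) \<Rightarrow> (complex^'n \<Rightarrow> complex) set" where
  "model_space I = {f \<in> hardy_space. \<forall>g\<in>hardy_space. hardy_inner f (\<lambda>z. I z * g z) = 0}"

definition cauchy_kernel :: "complex^'n \<Rightarrow> complex^'n \<Rightarrow> complex" where
  "cauchy_kernel z \<zeta> = 1 / (1 - cinner z \<zeta>) ^ CARD('n)"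

definition model_kernel :: "(complex^'n \<Rightarrow> complex) \<Rightarrow> complex^'n \<Rightarrow> complex^'n \<Rightarrow> complex" where
  "model_kernel I w z = (1 - I z * cnj (I w)) * cauchy_kernel z w"

(* The defining property of the Clark measure; the integral at z = 0 forces finite total mass. *)
definition clark_measure ::
    "(complex^'n \<Rightarrow> complex) \<Rightarrow> complex \<Rightarrow> (complex^'n) measure \<Rightarrow> bool" where
  "clark_measure I \<alpha> \<sigma> \<longleftrightarrow>
     sets \<sigma> = sets (restrict_space borel (sphere 0 1)) \<and>
     (\<forall>z\<in>ball 0 1. has_bochner_integral \<sigma>
        (\<lambda>\<zeta>. ((1 - (norm z)\<^sup>2) / (norm (1 - cinner z \<zeta>))\<^sup>2) ^ CARD('n))
        (Re ((\<alpha> + I z) / (\<alpha> - I z))))"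

(* A unitary operator from a subspace H of the Hardy space onto L2 of \<sigma>, acting on
   representatives: T sends functions equal on the ball to functions equal almost everywhere, is
   complex linear, preserves inner products and is surjective up to almost everywhere equality. *)
definition unitary_onto_L2 ::
    "(complex^'n \<Rightarrow> complex) set \<Rightarrow> (complex^'n) measure \<Rightarrow>
     ((complex^'n \<Rightarrow> complex) \<Rightarrow> complex^'n \<Rightarrow> complex) \<Rightarrow> bool" where
  "unitary_onto_L2 H \<sigma> T \<longleftrightarrow>
     (\<forall>f\<in>H. T f \<in> L2_space \<sigma>) \<and>
     (\<forall>f\<in>H. \<forall>g\<in>H. (\<forall>z\<in>ball 0 1. f z = g z) \<longrightarrow> (AE \<zeta> in \<sigma>. T f \<zeta> = T g \<zeta>)) \<and>
     (\<forall>f\<in>H. \<forall>g\<in>H. \<forall>a b. AE \<zeta> in \<sigma>. T (\<lambda>z. a * f z + b * g z) \<zeta> = a * T f \<zeta> + b * T g \<zeta>) \<and>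
     (\<forall>f\<in>H. \<forall>g\<in>H. L2_inner \<sigma> (T f) (T g) = hardy_inner f g) \<and>
     (\<forall>h\<in>L2_space \<sigma>. \<exists>f\<in>H. AE \<zeta> in \<sigma>. T f \<zeta> = h \<zeta>)"

definition clark_unitary_extension ::
    "(complex^'n \<Rightarrow> complex) \<Rightarrow> complex \<Rightarrow> (complex^'n) measure \<Rightarrow>
     ((complex^'n \<Rightarrow> complex) \<Rightarrow> complex^'n \<Rightarrow> complex) \<Rightarrow> bool" where
  "clark_unitary_extension I \<alpha> \<sigma> T \<longleftrightarrow>
     unitary_onto_L2 (model_space I) \<sigma> T \<and>
     (\<forall>w\<in>ball 0 1. AE \<zeta> in \<sigma>. T (model_kernel I w) \<zeta> = (1 - \<alpha> * cnj (I w)) * cauchy_kernel \<zeta> w)"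

end

theory Submission
  imports Defs "HOL-Complex_Analysis.Complex_Analysis" "HOL-Probability.Probability_Measure"
begin

text \<open>For \<open>h\<close> in \<open>L\<^sup>2(\<sigma>)\<close> put \<open>W h z = (1 - cnj \<alpha> * I z) * \<integral> h C(z,\<cdot>) d\<sigma>\<close>. Polarizing the
  identity that defines the Clark measure gives
  \<open>\<integral> C(z,\<cdot>) C(\<cdot>,w) d\<sigma> = (1 - I z * cnj (I w)) * C(z,w) / ((1 - cnj \<alpha> * I z) * (1 - \<alpha> * cnj (I w)))\<close>,
  so \<open>W\<close> takes \<open>C(\<cdot>,w)\<close> to a multiple of the reproducing kernel \<open>K\<^sub>w\<close> of the model space and is
  isometric on the span of these functions; the operator sought is the inverse of \<open>W\<close>.

  What remains is that the functions \<open>C(\<cdot>,w)\<close> span a dense subspace of \<open>L\<^sup>2(\<sigma>)\<close>. A function \<open>u\<close>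
  orthogonal to them is orthogonal to all functions holomorphic near the closed ball. Such \<open>u\<close> are
  stable under multiplication by \<open>cnj x\<^sub>j\<close>; once they are also stable under multiplication by \<open>x\<^sub>j\<close>,
  Stone-Weierstrass gives \<open>u = 0\<close>. So \<open>\<integral> cnj x\<^sub>j f cnj u d\<sigma>\<close> has to vanish. On the sphere
  \<open>cnj x\<^sub>j f\<close> is the average of the holomorphic \<open>\<partial>\<^sub>j f\<close> over the radius, up to an error that is
  small when \<open>f\<close> is bounded and small on a large ball. The dilates of \<open>cnj \<alpha> * I\<close> tend to \<open>1\<close> in
  \<open>L\<^sup>2(\<sigma>)\<close>, hence \<open>f\<close> may be replaced by its product with a high power of such a dilate, and
  these products are small on compact subsets of the ball.\<close>

section \<open>Averages over the sphere\<close>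

text \<open>The explicit formula runs from L2 of \<open>\<sigma>\<close> to the model space, which
  is why the inverse is constructed: \<open>W\<close> is defined on every \<open>h\<close> at once,
  so linearity is immediate and no well-definedness on combinations of kernels has to be checked.
  Two obstacles shape the rest. \<open>hardy_inner\<close> is defined through radial limits, so
  these must be shown to exist almost everywhere; restriction to discs through the origin reduces
  this to a maximal inequality on the circle, and the same slicing yields the Cauchy formula and the
  monotonicity of integral means. Secondly, radial limits exist only almost everywhere for
  \<open>sphere_measure\<close>, which gives no hold on \<open>\<sigma>\<close>. The holomorphic
  functions integrated against \<open>\<sigma>\<close> are therefore continuous on the sphere
  (dilates, kernels, functions on a larger ball), and information passes from one measure to the
  other by Fubini with the Poisson kernel. In one variable \<open>cnj x\<close> is
  \<open>1 / x\<close> on the circle; in several variables the conjugate coordinates have no such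
  expression, and the averaging over the radius replaces it.\<close>

lemma nn_integral_lborel_shift:
  fixes f :: "'a::euclidean_space \<Rightarrow> ennreal"
  assumes [measurable]: "f \<in> borel_measurable borel"
  shows "(\<integral>\<^sup>+ x. f (x + a) \<partial>lborel) = (\<integral>\<^sup>+ x. f x \<partial>lborel)"
proof -
  have "(\<integral>\<^sup>+ x. f x \<partial>lborel) = (\<integral>\<^sup>+ x. f x \<partial>distr lborel borel ((+) a))"
    by (simp add: lborel_distr_plus)
  also have "\<dots> = (\<integral>\<^sup>+ x. f (a + x) \<partial>lborel)"
    by (subst nn_integral_distr) auto
  finally show ?thesis by (simp add: add.commute)
qed

text \<open>Uniqueness of translation-invariant measures, run by hand: integrating
  \<open>indicator A (T x) * indicator (ball 0 1) y\<close> over both variables and shifting each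
  variable once moves \<open>T\<close> from \<open>A\<close> to the unit ball, where it has no
  effect because it preserves norms.\<close>

lemma lborel_distr_linear_isometry:
  fixes T :: "'a::euclidean_space \<Rightarrow> 'a"
  assumes "linear T" and norm_T: "\<And>x. norm (T x) = norm x"
  shows "distr lborel borel T = lborel"
proof -
  interpret linear T by fact
  have "inj T"
    by (rule injI) (metis diff norm_T norm_eq_zero right_minus_eq)
  then have "surj T"
    using \<open>linear T\<close> linear_injective_imp_surjective by blast
  have T_meas[measurable]: "T \<in> borel_measurable borel"
    by (intro borel_measurable_continuous_onI linear_continuous_on linear_conv_bounded_linear[THEN iffD1] assms)
  show ?thesis
  proof (rule measure_eqI)
    fix A :: "'a set" assume "A \<in> sets (distr lborel borel T)"
    then have A[measurable]: "A \<in> sets borel" by simp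
    define v where "v = emeasure lborel (ball (0::'a) 1)"
    have v: "v \<noteq> 0" "v \<noteq> \<infinity>"
      unfolding v_def using open_not_negligible[of "ball (0::'a) 1"] emeasure_lborel_ball_finite[of "0::'a" 1]
      by (auto simp: negligible_iff_emeasure0)
    let ?B = "ball (0::'a) 1"
    have [measurable]: "?B \<in> sets borel" by simp
    have ball_shift: "(\<integral>\<^sup>+ x. indicator ?B (y - T x) \<partial>lborel) = v" for y
    proof -
      obtain y' where y': "y = T y'" using \<open>surj T\<close> by (metis surjD)
      have "indicator ?B (y - T x) = (indicator (ball 0 1) (x + (- y')) :: ennreal)" for x
        by (simp add: y' indicator_def norm_T flip: diff) (simp add: norm_minus_commute)
      then show ?thesis
        using nn_integral_lborel_shift[OF borel_measurable_indicator, of "ball 0 1" "- y'"] by (simp add: v_def)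
    qed
    have "emeasure (distr lborel borel T) A * v
        = (\<integral>\<^sup>+ y. (\<integral>\<^sup>+ x. indicator A (T x) \<partial>lborel) * indicator ?B y \<partial>lborel)"
      by (simp add: nn_integral_cmult_indicator v_def nn_integral_distr[of T lborel borel "indicator A", symmetric])
    \<comment> \<open>Shifting \<open>x\<close> by a \<open>T\<close>-preimage of \<open>y\<close>
      couples the two variables, so that after the exchange of integrals \<open>y\<close> can be
      shifted back by \<open>T x\<close>.\<close>
    also have "\<dots> = (\<integral>\<^sup>+ y. (\<integral>\<^sup>+ x. indicator A (T x + y) * indicator ?B y \<partial>lborel) \<partial>lborel)"
    proof (rule nn_integral_cong)
      fix y :: 'a
      obtain y' where y': "y = T y'" using \<open>surj T\<close> by (metis surjD)
      have "(\<integral>\<^sup>+ x. indicator A (T x) \<partial>lborel) = (\<integral>\<^sup>+ x. indicator A (T (x + y')) \<partial>lborel)"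
        by (rule nn_integral_lborel_shift[symmetric]) measurable
      then show "(\<integral>\<^sup>+ x. indicator A (T x) \<partial>lborel) * indicator ?B y
          = (\<integral>\<^sup>+ x. indicator A (T x + y) * indicator ?B y \<partial>lborel)"
        by (subst nn_integral_multc) (auto simp: y' add)
    qed
    also have "\<dots> = (\<integral>\<^sup>+ x. (\<integral>\<^sup>+ y. indicator A (T x + y) * indicator ?B y \<partial>lborel) \<partial>lborel)"
      by (rule lborel_pair.Fubini'[symmetric]) measurable
    also have "\<dots> = (\<integral>\<^sup>+ x. (\<integral>\<^sup>+ y. indicator A y * indicator ?B (y - T x) \<partial>lborel) \<partial>lborel)"
    proof (rule nn_integral_cong)
      fix x :: 'a
      show "(\<integral>\<^sup>+ y. indicator A (T x + y) * indicator ?B y \<partial>lborel)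
          = (\<integral>\<^sup>+ y. indicator A y * indicator ?B (y - T x) \<partial>lborel)"
        using nn_integral_lborel_shift[of "\<lambda>y. indicator A y * indicator ?B (y - T x)" "T x"]
        by (simp add: add.commute)
    qed
    also have "\<dots> = (\<integral>\<^sup>+ y. (\<integral>\<^sup>+ x. indicator A y * indicator ?B (y - T x) \<partial>lborel) \<partial>lborel)"
      by (rule lborel_pair.Fubini') measurable
    also have "\<dots> = emeasure lborel A * v"
      by (subst nn_integral_cmult) (auto simp: ball_shift nn_integral_multc)
    finally show "emeasure (distr lborel borel T) A = emeasure lborel A"
      using v by (simp add: mult.commute[of _ v] ennreal_mult_cancel_left)
  qed simp
qed

lemma sets_sphere_measure [measurable_cong, simp]:
  "sets (sphere_measure :: (complex^'n) measure) = sets (restrict_space borel (sphere 0 1))"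
  by (simp add: sphere_measure_def sets_restrict_space)

lemma space_sphere_measure [simp]: "space (sphere_measure :: (complex^'n) measure) = sphere 0 1"
  by (simp add: sphere_measure_def space_restrict_space)

lemma emeasure_sphere_measure:
  fixes A :: "(complex^'n) set"
  assumes A: "A \<in> sets borel" "A \<subseteq> sphere 0 1"
  shows "emeasure sphere_measure A =
    emeasure lborel (ball 0 1 \<inter> {x. x /\<^sub>R norm x \<in> A}) / emeasure lborel (ball (0::complex^'n) 1)"
proof -
  have "{x. x /\<^sub>R norm x \<in> A} \<in> sets borel"
    using measurable_sets[of "\<lambda>x. x /\<^sub>R norm x" borel borel A] A by (auto simp: vimage_def)
  moreover have "emeasure sphere_measure A = emeasure (uniform_measure lborel (ball (0::complex^'n) 1)) {x. x /\<^sub>R norm x \<in> A}"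
    unfolding sphere_measure_def using A
    by (subst emeasure_restrict_space) (auto simp: emeasure_distr vimage_def)
  ultimately show ?thesis
    by (simp add: emeasure_uniform_measure)
qed

interpretation sphere: prob_space "sphere_measure :: (complex^'n) measure"
proof
  \<comment> \<open>Division by zero gives \<open>0\<close>, so the radial projection sends the
    centre off the sphere; this single null point is the only correction to the total mass.\<close>
  have "x \<in> ball 0 1 \<inter> {x. x /\<^sub>R norm x \<in> sphere 0 1} \<longleftrightarrow> x \<in> ball 0 1 - {0}" for x :: "complex^'n"
    by (cases "x = 0") auto
  then have eq: "ball 0 1 \<inter> {x. x /\<^sub>R norm x \<in> sphere 0 1} = ball 0 1 - {0::complex^'n}"
    by blast
  have "emeasure lborel (ball (0::complex^'n) 1) \<noteq> 0" "emeasure lborel (ball (0::complex^'n) 1) \<noteq> \<infinity>"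
    using open_not_negligible[of "ball (0::complex^'n) 1"] emeasure_lborel_ball_finite[of "0::complex^'n" 1]
    by (auto simp: negligible_iff_emeasure0)
  moreover have "emeasure lborel (ball 0 1 - {0::complex^'n}) = emeasure lborel (ball (0::complex^'n) 1)"
    by (subst emeasure_Diff) auto
  ultimately show "emeasure (sphere_measure :: (complex^'n) measure) (space sphere_measure) = 1"
    unfolding space_sphere_measure by (subst emeasure_sphere_measure) (simp_all only: eq, auto simp: ennreal_divide_self top.not_eq_extremum)
qed

text \<open>Radial projection commutes with a linear isometry, so the cone over a preimage is the
  preimage of the cone, and the invariance of Lebesgue measure applies.\<close>

lemma distr_sphere_measure_isometry:
  fixes U :: "complex^'n \<Rightarrow> complex^'n"
  assumes U: "linear U" "\<And>x. norm (U x) = norm x"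
  shows "distr sphere_measure sphere_measure U = sphere_measure"
    and "U \<in> sphere_measure \<rightarrow>\<^sub>M sphere_measure"
proof -
  interpret linear U by fact
  have U_meas[measurable]: "U \<in> borel_measurable borel"
    by (intro borel_measurable_continuous_onI linear_continuous_on linear_conv_bounded_linear[THEN iffD1] assms)
  show meas: "U \<in> sphere_measure \<rightarrow>\<^sub>M sphere_measure"
    using U by (auto simp: measurable_cong_sets[OF sets_sphere_measure sets_sphere_measure]
        intro!: measurable_restrict_space3)
  show "distr sphere_measure sphere_measure U = sphere_measure"
  proof (rule measure_eqI)
    fix A :: "(complex^'n) set" assume "A \<in> sets (distr sphere_measure sphere_measure U)"
    then have A[measurable]: "A \<in> sets borel" "A \<subseteq> sphere 0 1" and A': "A \<in> sets sphere_measure"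
      by (auto simp: sets_restrict_space)
    have B[measurable]: "{x. x /\<^sub>R norm x \<in> A} \<in> sets borel"
      using measurable_sets[of "\<lambda>x. x /\<^sub>R norm x" borel borel A] A by (auto simp: vimage_def)
    have "U -` A \<in> sets borel"
      using measurable_sets[OF U_meas A(1)] by simp
    moreover have "U -` A \<subseteq> sphere 0 1" using A U by auto
    ultimately have "emeasure (distr sphere_measure sphere_measure U) A =
        emeasure lborel (ball 0 1 \<inter> {x. x /\<^sub>R norm x \<in> U -` A}) / emeasure lborel (ball (0::complex^'n) 1)"
      using A' meas by (subst emeasure_distr) (auto simp: emeasure_sphere_measure Int_absorb2)
    also have "ball 0 1 \<inter> {x. x /\<^sub>R norm x \<in> U -` A} = U -` (ball 0 1 \<inter> {x. x /\<^sub>R norm x \<in> A})"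
      using U by (auto simp: scale)
    also have "emeasure lborel \<dots> = emeasure (distr lborel borel U) (ball 0 1 \<inter> {x. x /\<^sub>R norm x \<in> A})"
      by (subst emeasure_distr) auto
    also have "\<dots> = emeasure lborel (ball 0 1 \<inter> {x. x /\<^sub>R norm x \<in> A})"
      by (simp add: lborel_distr_linear_isometry[OF U])
    finally show "emeasure (distr sphere_measure sphere_measure U) A = emeasure sphere_measure A"
      using A by (simp add: emeasure_sphere_measure)
  qed simp
qed

text \<open>Integrals over the sphere are evaluated below by inserting such an average: the inner
  integral over the parameter is a one-variable integral that Cauchy's theorem can compute. Joint
  integrability follows from Tonelli, since each \<open>U t\<close> preserves the integral of the
  norm.\<close>

lemma integral_average:
  fixes F :: "'a \<Rightarrow> 'b::{banach, second_countable_topology}"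
  assumes "prob_space M" "prob_space N"
    and U: "(\<lambda>(x, t). U t x) \<in> M \<Otimes>\<^sub>M N \<rightarrow>\<^sub>M M"
    and inv: "\<And>t. t \<in> space N \<Longrightarrow> distr M M (U t) = M"
    and F: "integrable M F"
  shows "(\<integral>x. F x \<partial>M) = (\<integral>x. (\<integral>t. F (U t x) \<partial>N) \<partial>M)"
proof -
  interpret M: prob_space M by fact
  interpret N: prob_space N by fact
  interpret pair_sigma_finite M N ..
  note U[measurable]
  have F_meas[measurable]: "F \<in> borel_measurable M" using F by auto
  have Ut[measurable]: "U t \<in> M \<rightarrow>\<^sub>M M" if "t \<in> space N" for t
    using measurable_compose[OF measurable_Pair2'[OF that, of M] U] by simp
  have shift: "(\<integral>x. F (U t x) \<partial>M) = (\<integral>x. F x \<partial>M)" if "t \<in> space N" for t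
    using integral_distr[OF Ut[OF that] F_meas] by (simp add: inv[OF that])
  have nshift: "(\<integral>\<^sup>+x. norm (F (U t x)) \<partial>M) = (\<integral>\<^sup>+x. norm (F x) \<partial>M)" if "t \<in> space N" for t
    using nn_integral_distr[OF Ut[OF that], of "\<lambda>x. ennreal (norm (F x))"] by (simp add: inv[OF that])
  have [measurable]: "(\<lambda>(x, t). F (U t x)) \<in> borel_measurable (M \<Otimes>\<^sub>M N)"
    using measurable_compose[OF U F_meas] by (simp add: case_prod_unfold)
  have int: "integrable (M \<Otimes>\<^sub>M N) (\<lambda>(x, t). F (U t x))"
  proof (rule integrableI_bounded)
    have "(\<integral>\<^sup>+ z. norm (case z of (x, t) \<Rightarrow> F (U t x)) \<partial>(M \<Otimes>\<^sub>M N))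
        = (\<integral>\<^sup>+ t. (\<integral>\<^sup>+ x. norm (F (U t x)) \<partial>M) \<partial>N)"
      by (subst nn_integral_snd[symmetric]) (auto simp: case_prod_unfold)
    also have "\<dots> = (\<integral>\<^sup>+ t. (\<integral>\<^sup>+x. norm (F x) \<partial>M) \<partial>N)"
      by (rule nn_integral_cong) (rule nshift)
    also have "\<dots> < \<infinity>" using F by (simp add: N.emeasure_space_1 integrable_iff_bounded)
    finally show "(\<integral>\<^sup>+ z. norm (case z of (x, t) \<Rightarrow> F (U t x)) \<partial>(M \<Otimes>\<^sub>M N)) < \<infinity>" .
  qed measurable
  have "(\<integral>x. (\<integral>t. F (U t x) \<partial>N) \<partial>M) = (\<integral>t. (\<integral>x. F (U t x) \<partial>M) \<partial>N)"
    by (rule Fubini_integral[symmetric, OF int])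
  also have "\<dots> = (\<integral>t. (\<integral>x. F x \<partial>M) \<partial>N)"
    by (rule Bochner_Integration.integral_cong) (auto simp: shift)
  also have "\<dots> = (\<integral>x. F x \<partial>M)" by (simp add: N.prob_space)
  finally show ?thesis by simp
qed

lemma nn_integral_average:
  fixes F :: "'a \<Rightarrow> ennreal"
  assumes "prob_space M" "prob_space N"
    and U: "(\<lambda>(x, t). U t x) \<in> M \<Otimes>\<^sub>M N \<rightarrow>\<^sub>M M"
    and inv: "\<And>t. t \<in> space N \<Longrightarrow> distr M M (U t) = M"
    and F_meas[measurable]: "F \<in> borel_measurable M"
  shows "(\<integral>\<^sup>+x. F x \<partial>M) = (\<integral>\<^sup>+x. (\<integral>\<^sup>+t. F (U t x) \<partial>N) \<partial>M)"
proof -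
  interpret M: prob_space M by fact
  interpret N: prob_space N by fact
  interpret pair_sigma_finite M N ..
  have Ut[measurable]: "U t \<in> M \<rightarrow>\<^sub>M M" if "t \<in> space N" for t
    using measurable_compose[OF measurable_Pair2'[OF that, of M] U] by simp
  have [measurable]: "(\<lambda>(x, t). F (U t x)) \<in> borel_measurable (M \<Otimes>\<^sub>M N)"
    using measurable_compose[OF U F_meas] by (simp add: case_prod_unfold)
  have shift: "(\<integral>\<^sup>+x. F (U t x) \<partial>M) = (\<integral>\<^sup>+x. F x \<partial>M)" if "t \<in> space N" for t
    using nn_integral_distr[OF Ut[OF that], of F] F_meas by (simp add: inv[OF that])
  have "(\<integral>\<^sup>+x. (\<integral>\<^sup>+t. F (U t x) \<partial>N) \<partial>M) = (\<integral>\<^sup>+t. (\<integral>\<^sup>+x. F (U t x) \<partial>M) \<partial>N)"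
    by (rule Fubini'[symmetric]) measurable
  also have "\<dots> = (\<integral>\<^sup>+t. (\<integral>\<^sup>+x. F x \<partial>M) \<partial>N)"
    by (rule nn_integral_cong) (rule shift)
  finally show ?thesis by (simp add: N.emeasure_space_1)
qed

section \<open>Normalized integrals over the unit circle\<close>

definition unit_ivl :: "real measure" where
  "unit_ivl = restrict_space lborel {0..1}"

text \<open>One turn has parameter length \<open>1\<close>, so circle means over the probability
  space \<open>unit_ivl\<close> carry no factor \<open>2 * pi\<close>; functions on the circle
  become functions of period \<open>1\<close> on the line.\<close>

definition circ :: "real \<Rightarrow> complex" where
  "circ t = cis (2 * pi * t)"

lemma sets_unit_ivl [measurable_cong, simp]: "sets unit_ivl = sets (restrict_space borel {0..1})"
  by (simp add: unit_ivl_def sets_restrict_space)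

lemma space_unit_ivl [simp]: "space unit_ivl = {0..1}"
  by (simp add: unit_ivl_def space_restrict_space)

interpretation unit_ivl: prob_space unit_ivl
  by standard (simp add: unit_ivl_def space_restrict_space emeasure_restrict_space)

lemma continuous_circ [continuous_intros]: "continuous_on A f \<Longrightarrow> continuous_on A (\<lambda>x. circ (f x))"
  unfolding circ_def by (intro continuous_intros)

lemma norm_circ [simp]: "norm (circ t) = 1"
  by (simp add: circ_def)

lemma circ_nonzero [simp]: "circ t \<noteq> 0"
  by (simp add: circ_def)

lemma circ_cnj [simp]: "circ t * cnj (circ t) = 1" "cnj (circ t) * circ t = 1"
  by (simp_all add: circ_def cis_cnj cis_mult)

lemma circ_add: "circ (s + t) = circ s * circ t"
  by (simp add: circ_def cis_mult distrib_left)

lemma circ_of_int [simp]: "circ (of_int n) = 1"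
  by (metis circ_def cis_multiple_2pi Ints_of_int)

lemma
  fixes h :: "real \<Rightarrow> 'b::euclidean_space"
  assumes "continuous_on {0..1} h"
  shows integrable_unit_ivl: "integrable unit_ivl h"
    and integral_unit_ivl: "integral\<^sup>L unit_ivl h = integral {0..1} h"
proof -
  have s: "set_integrable lborel {0..1} h"
    using borel_integrable_atLeastAtMost'[OF assms] .
  then show "integrable unit_ivl h"
    by (simp add: unit_ivl_def integrable_restrict_space set_integrable_def)
  show "integral\<^sup>L unit_ivl h = integral {0..1} h"
    using set_borel_integral_eq_integral(2)[OF s]
    by (simp add: unit_ivl_def integral_restrict_space set_lebesgue_integral_def)
qed

text \<open>The path derivative is \<open>2 * pi * \<i> * circ t\<close>; keeping the factor
  \<open>circ t\<close> in the integrand leaves only a constant to divide by.\<close>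

lemma circle_contour_integral:
  assumes h: "(h has_contour_integral i) (circlepath 0 1)" and cont: "continuous_on (sphere 0 1) h"
  shows "(\<integral>t. h (circ t) * circ t \<partial>unit_ivl) = i / (2 * pi * \<i>)"
proof -
  have c: "circlepath 0 1 t = circ t" for t
    by (simp add: circlepath_def circ_def cis_conv_exp part_circlepath_def linepath_def algebra_simps)
  have "((\<lambda>t. h (circ t) * (2 * pi * \<i> * circ t)) has_integral i) {0..1}"
    using h unfolding has_contour_integral_def
    by (rule has_integral_eq[rotated])
       (auto simp: vector_derivative_circlepath01 c circ_def cis_conv_exp mult_ac)
  from has_integral_mult_right[OF this, of "1 / (2 * pi * \<i>)"]
  have "((\<lambda>t. h (circ t) * circ t) has_integral i / (2 * pi * \<i>)) {0..1}"
    by (simp add: field_simps)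
  moreover have "continuous_on {0..1} (\<lambda>t. h (circ t) * circ t)"
    by (intro continuous_intros continuous_on_compose2[OF cont]) auto
  ultimately show ?thesis
    by (simp add: integral_unit_ivl integral_unique)
qed

lemma circle_coefficient:
  assumes g: "g holomorphic_on ball 0 R" and R: "R > 1"
  shows "(\<integral>t. g (circ t) * cnj (circ t) ^ k \<partial>unit_ivl) = (deriv ^^ k) g 0 / fact k"
proof -
  have sub: "cball 0 1 \<subseteq> ball (0::complex) R" using R by auto
  have cont: "continuous_on (cball 0 1) g"
    using g sub holomorphic_on_imp_continuous_on holomorphic_on_subset by blast
  have "((\<lambda>u. g u / (u - 0) ^ Suc k) has_contour_integral (2 * pi * \<i>) / fact k * (deriv ^^ k) g 0) (circlepath 0 1)"
    using cont
    by (intro Cauchy_has_contour_integral_higher_derivative_circlepath holomorphic_on_subset[OF g]) (use sub in auto)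
  then have "(\<integral>t. g (circ t) / circ t ^ Suc k * circ t \<partial>unit_ivl) = (2 * pi * \<i>) / fact k * (deriv ^^ k) g 0 / (2 * pi * \<i>)"
    using cont by (intro circle_contour_integral) (auto intro!: continuous_intros intro: continuous_on_subset)
  moreover have "g (circ t) / circ t ^ Suc k * circ t = g (circ t) * cnj (circ t) ^ k" for t
  proof -
    have "cnj (circ t) = inverse (circ t)"
      by (metis circ_cnj(1) inverse_unique)
    moreover have "circ t ^ k * cnj (circ t) ^ k = 1"
      by (simp flip: power_mult_distrib)
    ultimately show ?thesis by (simp add: field_simps)
  qed
  ultimately show ?thesis by simp
qed

lemma circle_mean:
  assumes g: "g holomorphic_on ball 0 R" and R: "R > 1"
  shows "(\<integral>t. g (circ t) \<partial>unit_ivl) = g 0"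
  using circle_coefficient[OF assms, of 0] by simp

text \<open>Rescaling to the unit circle requires \<open>l \<noteq> 0\<close>; for
  \<open>l = 0\<close> both sides are those of the constant function \<open>g 0\<close>, whose
  higher coefficients vanish.\<close>

lemma circle_coefficient_scaled:
  assumes g: "g holomorphic_on ball 0 R" and l: "norm l < R"
  shows "(\<integral>t. g (l * circ t) * cnj (circ t) ^ k \<partial>unit_ivl) = (deriv ^^ k) g 0 / fact k * l ^ k"
proof (cases "l = 0")
  case True
  then show ?thesis
    using circle_coefficient[of "\<lambda>_. g 0" 2 k] by (cases k) simp_all
next
  case False
  have h: "(\<lambda>w. g (l * w)) holomorphic_on ball 0 (R / norm l)"
    using False by (intro holomorphic_on_compose_gen[OF _ g, unfolded o_def] holomorphic_intros)
      (auto simp: norm_mult field_simps)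
  have R: "R > 0" using l by (meson norm_ge_zero order_le_less_trans)
  have "(deriv ^^ k) (\<lambda>w. g (l * w)) 0 = l ^ k * (deriv ^^ k) g (l * 0)"
    using False R by (intro higher_deriv_compose_linear[OF g, of "ball 0 (R / norm l)"])
      (auto simp: norm_mult field_simps)
  with circle_coefficient[OF h] show ?thesis
    using False l by simp
qed

text \<open>On the unit circle \<open>cnj (circ t)\<close> is the inverse of \<open>circ t\<close>;
  this puts the one-variable Cauchy kernel into the form of \<open>cauchy_kernel\<close> in
  dimension one.\<close>

lemma circle_cauchy:
  assumes g: "g holomorphic_on ball 0 R" and R: "R > 1" and w: "norm w < 1"
  shows "(\<integral>t. g (circ t) / (1 - w * cnj (circ t)) \<partial>unit_ivl) = g w"
proof -
  have sub: "cball 0 1 \<subseteq> ball (0::complex) R" using R by auto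
  have cont: "continuous_on (cball 0 1) g"
    using g sub holomorphic_on_imp_continuous_on holomorphic_on_subset by blast
  have "((\<lambda>u. g u / (u - w)) has_contour_integral (2 * pi * \<i> * g w)) (circlepath 0 1)"
    using Cauchy_integral_circlepath[of 0 1 g w] cont w sub holomorphic_on_subset[OF g, of "ball 0 1"] R
    by (auto simp: subset_ball)
  then have "(\<integral>t. g (circ t) / (circ t - w) * circ t \<partial>unit_ivl) = (2 * pi * \<i> * g w) / (2 * pi * \<i>)"
    using cont w by (intro circle_contour_integral) (auto intro!: continuous_intros intro: continuous_on_subset)
  moreover have "g (circ t) / (circ t - w) * circ t = g (circ t) / (1 - w * cnj (circ t))" for t
  proof -
    have "circ t - w = circ t * (1 - w * cnj (circ t))"
      by (simp add: algebra_simps flip: mult.assoc)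
    then show ?thesis by simp
  qed
  ultimately show ?thesis by simp
qed

section \<open>Holomorphic functions in balls\<close>

unbundle no fps_syntax

lemma prob_unit_ivl [simp]: "measure unit_ivl {0..1} = 1"
  using unit_ivl.prob_space by simp

lemma prob_sphere_measure [simp]: "measure (sphere_measure :: (complex^'n) measure) (sphere 0 1) = 1"
  using sphere.prob_space by simp

section \<open>The Hermitian inner product and complex scaling\<close>

lemma cinner_add_left: "cinner (x + y) z = cinner x z + cinner y z"
  by (simp add: cinner_def distrib_right sum.distrib)

lemma cinner_scale_left [simp]: "cinner (c *s x) z = c * cinner x z"
  by (simp add: cinner_def sum_distrib_left mult_ac)

lemma cnj_cinner [simp]: "cnj (cinner x y) = cinner y x"
  by (simp add: cinner_def mult.commute)

lemma cinner_add_right: "cinner x (y + z) = cinner x y + cinner x z"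
  by (simp add: cinner_def distrib_left sum.distrib)

lemma cinner_scale_right [simp]: "cinner x (c *s y) = cnj c * cinner x y"
  by (simp add: cinner_def sum_distrib_left mult_ac)

lemma scaleR_eq_scale: "r *\<^sub>R (x::complex^'n) = complex_of_real r *s x"
  unfolding vec_eq_iff vector_scaleR_component vector_smult_component by (simp add: scaleR_conv_of_real)

lemma cinner_scaleR_left [simp]: "cinner (r *\<^sub>R x) z = of_real r * cinner x z"
  by (simp add: scaleR_eq_scale)

lemma cinner_scaleR_right [simp]: "cinner x (r *\<^sub>R z) = of_real r * cinner x z"
  by (simp add: scaleR_eq_scale)

lemma cinner_zero [simp]: "cinner 0 z = 0" "cinner z 0 = 0"
  by (simp_all add: cinner_def)

lemma cinner_diff_left: "cinner (x - y) z = cinner x z - cinner y z"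
  by (simp add: cinner_def left_diff_distrib sum_subtractf)

lemma cinner_diff_right: "cinner x (y - z) = cinner x y - cinner x z"
  by (simp add: cinner_def right_diff_distrib sum_subtractf)

lemma Re_cinner: "Re (cinner x y) = x \<bullet> y"
  by (simp add: cinner_def inner_vec_def inner_complex_def)

lemma cinner_self: "cinner x x = of_real ((norm x)\<^sup>2)"
proof -
  have "Im (cinner x x) = 0"
    by (simp add: cinner_def)
  then show ?thesis
    by (simp add: complex_eq_iff Re_cinner power2_norm_eq_inner)
qed

lemma norm_scale [simp]: "norm (c *s (x::complex^'n)) = norm c * norm x"
  by (simp add: norm_vec_def norm_mult L2_set_right_distrib)

lemma norm_cinner_le: "norm (cinner x y) \<le> norm x * norm y"
proof (cases "cinner x y = 0")
  case False
  \<comment> \<open>A unimodular factor makes the inner product real and nonnegative, so that the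
    real Cauchy-Schwarz inequality, which sees only the real part, bounds the full modulus.\<close>
  define u where "u = cnj (sgn (cinner x y))"
  have u: "norm u = 1" using False by (simp add: u_def norm_sgn)
  have "u * cinner x y = of_real (norm (cinner x y))"
    unfolding u_def sgn_eq using complex_norm_square[of "cinner x y"] False
    by (simp add: field_simps power2_eq_square)
  then have "norm (cinner x y) = Re (cinner (u *s x) y)"
    by simp
  also have "\<dots> \<le> norm (u *s x) * norm y"
    unfolding Re_cinner by (rule norm_cauchy_schwarz)
  finally show ?thesis using u by simp
qed simp

lemma pythagoras_cinner:
  assumes "cinner x y = 0"
  shows "(norm (x + y))\<^sup>2 = (norm x)\<^sup>2 + (norm y)\<^sup>2"
proof -
  have "x \<bullet> y = 0" using assms Re_cinner[of x y] by simp
  then show ?thesis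
    by (simp add: power2_norm_eq_inner inner_add_left inner_add_right inner_commute)
qed

lemma cinner_axis [simp]: "cinner z (axis i 1) = z $ i" "cinner (axis i 1) z = cnj (z $ i)"
proof -
  have "cinner z (axis i 1) = (\<Sum>j\<in>UNIV. if j = i then z $ j else 0)"
    unfolding cinner_def by (intro sum.cong) (auto simp: axis_def)
  then show "cinner z (axis i 1) = z $ i" by simp
  then show "cinner (axis i 1) z = cnj (z $ i)" by (metis cnj_cinner)
qed

lemma bounded_linear_cinner_left: "bounded_linear (\<lambda>z. cinner z w)"
  by (intro linear_conv_bounded_linear[THEN iffD1] linearI)
     (simp_all add: cinner_add_left scaleR_conv_of_real[where 'a=complex])

lemma bounded_linear_scale_left: "bounded_linear (\<lambda>c. c *s (q::complex^'n))"
  by (intro linear_conv_bounded_linear[THEN iffD1] linearI)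
     (simp_all add: vec_eq_iff distrib_right)

lemma continuous_on_cinner [continuous_intros]:
  assumes "continuous_on A f" "continuous_on A g"
  shows "continuous_on A (\<lambda>x. cinner (f x) (g x))"
  unfolding cinner_def by (intro continuous_intros assms)

lemma continuous_on_scale [continuous_intros]:
  fixes g :: "'a::topological_space \<Rightarrow> complex^'n"
  assumes "continuous_on A f" "continuous_on A g"
  shows "continuous_on A (\<lambda>x. f x *s g x)"
  unfolding vector_scalar_mult_def by (intro continuous_intros assms)

text \<open>The radius is a parameter because dilates and kernels live on balls larger than the unit
  ball; such functions are continuous on the sphere and can be integrated there directly.\<close>

definition hol_ball :: "real \<Rightarrow> (complex^'n \<Rightarrow> complex) \<Rightarrow> bool" where
  "hol_ball R f \<longleftrightarrow>
     (\<forall>z\<in>ball 0 R. \<exists>L. (f has_derivative L) (at z) \<and> (\<forall>c v. L (c *s v) = c * L v))"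

lemma hol_ball_1: "holomorphic_in_ball f \<longleftrightarrow> hol_ball 1 f"
  by (simp add: holomorphic_in_ball_def hol_ball_def)

lemma hol_ball_mono: "hol_ball R f \<Longrightarrow> r \<le> R \<Longrightarrow> hol_ball r f"
  by (auto simp: hol_ball_def)

lemma hol_ball_continuous: "hol_ball R f \<Longrightarrow> continuous_on (ball 0 R) f"
  unfolding hol_ball_def
  by (meson continuous_at_imp_continuous_on has_derivative_continuous)

lemma hol_ball_const [simp]: "hol_ball R (\<lambda>z. c)"
  unfolding hol_ball_def by (auto intro!: exI[of _ "\<lambda>_. 0"])

lemma hol_ball_cinner [simp]: "hol_ball R (\<lambda>z. cinner z a)"
  unfolding hol_ball_def
  by (auto intro!: exI[of _ "\<lambda>z. cinner z a"] bounded_linear_imp_has_derivative bounded_linear_cinner_left)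

lemma hol_ball_mult:
  fixes f g :: "complex^'n \<Rightarrow> complex"
  assumes "hol_ball R f" "hol_ball R g"
  shows "hol_ball R (\<lambda>z. f z * g z)"
  unfolding hol_ball_def
proof
  fix z :: "complex^'n" assume "z \<in> ball 0 R"
  then obtain L M where "(f has_derivative L) (at z)" "\<And>c v. L (c *s v) = c * L v"
     "(g has_derivative M) (at z)" "\<And>c v. M (c *s v) = c * M v"
    using assms unfolding hol_ball_def by blast
  then show "\<exists>L. ((\<lambda>z. f z * g z) has_derivative L) (at z) \<and> (\<forall>c v. L (c *s v) = c * L v)"
    by (intro exI[of _ "\<lambda>h. f z * M h + L h * g z"] conjI has_derivative_mult) (auto simp: algebra_simps)
qed

lemma hol_ball_add:
  fixes f g :: "complex^'n \<Rightarrow> complex"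
  assumes "hol_ball R f" "hol_ball R g"
  shows "hol_ball R (\<lambda>z. f z + g z)"
  unfolding hol_ball_def
proof
  fix z :: "complex^'n" assume "z \<in> ball 0 R"
  then obtain L M where "(f has_derivative L) (at z)" "\<And>c v. L (c *s v) = c * L v"
     "(g has_derivative M) (at z)" "\<And>c v. M (c *s v) = c * M v"
    using assms unfolding hol_ball_def by blast
  then show "\<exists>L. ((\<lambda>z. f z + g z) has_derivative L) (at z) \<and> (\<forall>c v. L (c *s v) = c * L v)"
    by (intro exI[of _ "\<lambda>h. L h + M h"]) (auto intro!: derivative_intros simp: algebra_simps)
qed

lemma hol_ball_power: "hol_ball R f \<Longrightarrow> hol_ball R (\<lambda>z. f z ^ k)"
  by (induction k) (auto intro: hol_ball_mult)

lemma hol_ball_scale_add: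
  fixes f :: "complex^'n \<Rightarrow> complex"
  assumes f: "hol_ball R f" and "\<And>z. z \<in> ball 0 r \<Longrightarrow> c *s z + b \<in> ball 0 R"
  shows "hol_ball r (\<lambda>z. f (c *s z + b))"
  unfolding hol_ball_def
proof
  fix z :: "complex^'n" assume "z \<in> ball 0 r"
  then obtain L where L: "(f has_derivative L) (at (c *s z + b))" "\<And>c v. L (c *s v) = c * L v"
    using assms unfolding hol_ball_def by blast
  have "bounded_linear (\<lambda>z::complex^'n. c *s z)"
    by (intro linear_conv_bounded_linear[THEN iffD1] linearI) (simp_all add: vec_eq_iff algebra_simps)
  then have "((\<lambda>z. c *s z + b) has_derivative (\<lambda>h. c *s h + 0)) (at z)"
    by (intro has_derivative_add bounded_linear_imp_has_derivative has_derivative_const)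
  from has_derivative_compose[OF this L(1)]
  show "\<exists>L. ((\<lambda>z. f (c *s z + b)) has_derivative L) (at z) \<and> (\<forall>c v. L (c *s v) = c * L v)"
    using L(2) by (intro exI[of _ "\<lambda>h. L (c *s h)"]) (auto simp: vec.scale_scale mult.commute)
qed

lemma hol_ball_dilate:
  assumes "hol_ball R f" "0 < r"
  shows "hol_ball (R / r) (\<lambda>z. f (r *\<^sub>R z))"
  using hol_ball_scale_add[OF assms(1), of "R / r" "of_real r" 0] assms(2)
  by (simp add: scaleR_eq_scale field_simps)

text \<open>Restriction to complex lines brings in one-variable complex analysis; complex linearity
  of the derivative is exactly what makes the restriction complex differentiable.\<close>

lemma hol_ball_line:
  fixes f :: "complex^'n \<Rightarrow> complex"
  assumes f: "hol_ball R f"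
  shows "(\<lambda>l. f (p + l *s q)) holomorphic_on {l. p + l *s q \<in> ball 0 R}"
proof -
  have fd: "(\<lambda>l. f (p + l *s q)) field_differentiable at l" if "p + l *s q \<in> ball 0 R" for l
  proof -
    obtain L where L: "(f has_derivative L) (at (p + l *s q))" "\<And>c v. L (c *s v) = c * L v"
      using assms \<open>p + l *s q \<in> ball 0 R\<close> unfolding hol_ball_def by blast
    have "((\<lambda>l. p + l *s q) has_derivative (\<lambda>h. 0 + h *s q)) (at l)"
      by (intro has_derivative_add bounded_linear_imp_has_derivative has_derivative_const bounded_linear_scale_left)
    from has_derivative_compose[OF this L(1)]
    have "((\<lambda>l. f (p + l *s q)) has_field_derivative L q) (at l)"
      by (simp add: has_field_derivative_def L(2) mult_commute_abs)
    then show ?thesis unfolding field_differentiable_def by (rule exI)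
  qed
  show ?thesis
  proof (rule holomorphic_onI)
    fix l assume "l \<in> {l. p + l *s q \<in> ball 0 R}"
    then have "p + l *s q \<in> ball 0 R" by (simp only: mem_Collect_eq)
    from field_differentiable_at_within[OF fd[OF this]]
    show "(\<lambda>l. f (p + l *s q)) field_differentiable (at l within {l. p + l *s q \<in> ball 0 R})" .
  qed
qed

lemma hol_ball_slice:
  assumes f: "hol_ball R f" and q: "norm q \<le> 1"
  shows "(\<lambda>l. f (l *s q)) holomorphic_on ball 0 R"
proof (rule holomorphic_on_subset)
  show "(\<lambda>l. f (l *s q)) holomorphic_on {l. 0 + l *s q \<in> ball 0 R}"
    using hol_ball_line[OF f, of 0 q] by simp
  show "ball 0 R \<subseteq> {l. 0 + l *s q \<in> ball 0 R}"
    using q by (auto intro: order.strict_trans1[OF mult_left_le])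
qed

lemma integrable_sphere_continuous:
  fixes f :: "complex^'n \<Rightarrow> 'b::{banach, second_countable_topology}"
  assumes "finite_measure M" and M: "sets M = sets (restrict_space borel (sphere 0 1))"
    and f: "continuous_on (sphere 0 1) f"
  shows "f \<in> borel_measurable M" and "integrable M f"
proof -
  interpret finite_measure M by fact
  show [measurable]: "f \<in> borel_measurable M"
    using borel_measurable_continuous_on_restrict[OF f] measurable_cong_sets[OF M refl] by blast
  have sp: "space M = sphere 0 1"
    using sets_eq_imp_space_eq[OF M] by (simp add: space_restrict_space)
  have "compact (f ` sphere 0 1)"
    by (intro compact_continuous_image f compact_sphere)
  then obtain B where "\<forall>y\<in>f ` sphere 0 1. norm y \<le> B"
    by (meson bounded_iff compact_imp_bounded)
  then show "integrable M f"
    by (intro integrable_const_bound[of _ B] AE_I2) (auto simp: sp)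
qed

lemmas integrable_sphere_measure = integrable_sphere_continuous[OF sphere.finite_measure_axioms sets_sphere_measure]

lemma measurable_sphere_flow:
  fixes U :: "real \<Rightarrow> complex^'n \<Rightarrow> complex^'n"
  assumes cont: "continuous_on UNIV (\<lambda>p. U (snd p) (fst p))"
    and norm_U: "\<And>t x. norm (U t x) = norm x"
  shows "(\<lambda>(x, t). U t x) \<in> sphere_measure \<Otimes>\<^sub>M unit_ivl \<rightarrow>\<^sub>M sphere_measure"
proof -
  have [measurable]: "(\<lambda>x. x) \<in> sphere_measure \<rightarrow>\<^sub>M (borel :: (complex^'n) measure)"
    by (rule integrable_sphere_measure(1)) (rule continuous_on_id)
  have [measurable]: "(\<lambda>t. t) \<in> unit_ivl \<rightarrow>\<^sub>M (borel :: real measure)"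
    unfolding measurable_cong_sets[OF sets_unit_ivl refl]
    by (intro borel_measurable_continuous_on_restrict continuous_on_id)
  have "(\<lambda>p. (\<lambda>x. x) (fst p)) \<in> sphere_measure \<Otimes>\<^sub>M unit_ivl \<rightarrow>\<^sub>M (borel :: (complex^'n) measure)"
    "(\<lambda>p. (\<lambda>x. x) (snd p)) \<in> sphere_measure \<Otimes>\<^sub>M unit_ivl \<rightarrow>\<^sub>M (borel :: real measure)"
    by measurable
  then have "(\<lambda>p. (fst p, snd p)) \<in> sphere_measure \<Otimes>\<^sub>M unit_ivl \<rightarrow>\<^sub>M (borel :: ((complex^'n) \<times> real) measure)"
    by (intro borel_measurable_Pair) auto
  then have "(\<lambda>p. U (snd p) (fst p)) \<in> sphere_measure \<Otimes>\<^sub>M unit_ivl \<rightarrow>\<^sub>M (borel :: (complex^'n) measure)"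
    by (drule_tac measurable_compose[OF _ borel_measurable_continuous_onI[OF cont]]) simp
  then have "(\<lambda>p. U (snd p) (fst p)) \<in> sphere_measure \<Otimes>\<^sub>M unit_ivl \<rightarrow>\<^sub>M restrict_space borel (sphere 0 1)"
    by (intro measurable_restrict_space2) (auto simp: space_pair_measure norm_U)
  then show ?thesis
    by (simp add: case_prod_unfold measurable_cong_sets[OF refl sets_sphere_measure])
qed

lemma sphere_average:
  fixes F :: "complex^'n \<Rightarrow> complex" and U :: "real \<Rightarrow> complex^'n \<Rightarrow> complex^'n"
  assumes cont: "continuous_on UNIV (\<lambda>p. U (snd p) (fst p))"
    and "\<And>t. linear (U t)"  "\<And>t x. norm (U t x) = norm x"
    and F: "integrable sphere_measure F"
  shows "(\<integral>x. F x \<partial>sphere_measure) = (\<integral>x. (\<integral>t. F (U t x) \<partial>unit_ivl) \<partial>sphere_measure)"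
  using assms
  by (intro integral_average[where U = U and F = F] sphere.prob_space_axioms unit_ivl.prob_space_axioms measurable_sphere_flow
      distr_sphere_measure_isometry) auto

lemma linear_scale: "linear (\<lambda>x::complex^'n. c *s x)"
  by (intro linearI) (simp_all add: vec_eq_iff algebra_simps)

lemma sphere_average_rotation:
  fixes F :: "complex^'n \<Rightarrow> complex"
  assumes "integrable sphere_measure F"
  shows "(\<integral>x. F x \<partial>sphere_measure) = (\<integral>x. (\<integral>t. F (circ t *s x) \<partial>unit_ivl) \<partial>sphere_measure)"
  by (rule sphere_average) (auto intro!: continuous_intros assms linear_scale)

lemma nn_sphere_average_rotation:
  fixes F :: "complex^'n \<Rightarrow> ennreal"
  assumes "F \<in> borel_measurable sphere_measure"
  shows "(\<integral>\<^sup>+x. F x \<partial>sphere_measure) = (\<integral>\<^sup>+x. (\<integral>\<^sup>+t. F (circ t *s x) \<partial>unit_ivl) \<partial>sphere_measure)"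
  by (intro nn_integral_average[where U = "\<lambda>t x. circ t *s x" and F = F] sphere.prob_space_axioms unit_ivl.prob_space_axioms measurable_sphere_flow
      distr_sphere_measure_isometry assms) (auto intro!: continuous_intros linear_scale)

text \<open>The squared norm of the monomial \<open>cinner z e ^ k\<close> in L2 of the sphere, kept
  as a complex number because it will multiply Taylor coefficients.\<close>

definition moment :: "nat \<Rightarrow> complex^'n \<Rightarrow> complex" where
  "moment k e = (\<integral>z. of_real ((norm (cinner z e)) ^ (2 * k)) \<partial>sphere_measure)"

text \<open>Two averages compute the pairing. Rotating only the part of \<open>z\<close> orthogonal
  to \<open>e\<close> replaces \<open>f z\<close> by its mean value, the value at the projection of
  \<open>z\<close> to the line of \<open>e\<close>; rotating \<open>z\<close> itself then extracts
  the coefficient of order \<open>k\<close> on that line. \<open>A\<close> stands for this Taylor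
  coefficient, given through its Fourier integrals on all circles of radius at most
  \<open>1\<close>.\<close>

lemma monomial_pairing:
  fixes f :: "complex^'n \<Rightarrow> complex"
  assumes f: "hol_ball R f" and R: "R > 1" and e: "norm e = 1"
    and A: "\<And>l. norm l \<le> 1 \<Longrightarrow> (\<integral>t. f ((l * circ t) *s e) * cnj (circ t) ^ k \<partial>unit_ivl) = l ^ k * A"
  shows "(\<integral>z. f z * cinner e z ^ k \<partial>sphere_measure) = A * moment k e"
proof -
  have cont: "continuous_on (cball 0 1) f"
    using hol_ball_continuous[OF f] R by (auto intro: continuous_on_subset)
  have ee: "cinner e e = 1" using e by (simp add: cinner_self)
  have ce: "norm (cinner z e) \<le> 1" if "norm z = 1" for z
    using norm_cinner_le[of z e] that e by simp
  define U where "U t z = cinner z e *s e + circ t *s (z - cinner z e *s e)" for t z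
  have orth: "cinner (cinner z e *s e) (c *s (z - cinner z e *s e)) = 0" for z c
    using ee by (simp add: cinner_diff_right)
  have norm_decomp: "(norm (cinner z e *s e + c *s (z - cinner z e *s e)))\<^sup>2 =
      (norm (cinner z e))\<^sup>2 + (norm c)\<^sup>2 * (norm (z - cinner z e *s e))\<^sup>2" for z c
    by (subst pythagoras_cinner[OF orth]) (simp only: norm_scale e mult_1_right power_mult_distrib)
  have "norm (U t z) = norm z" for t z
  proof -
    have "(norm (U t z))\<^sup>2 = (norm z)\<^sup>2"
      using norm_decomp[of z "circ t"] norm_decomp[of z 1] by (simp add: U_def)
    then show ?thesis by (simp add: power2_eq_iff_nonneg)
  qed
  moreover have "linear (U t)" for t
    unfolding U_def
    by (intro linearI) (simp_all add: vec_eq_iff algebra_simps cinner_add_left scaleR_conv_of_real[where 'a=complex])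
  moreover have "continuous_on UNIV (\<lambda>p. U (snd p) (fst p))"
    unfolding U_def by (intro continuous_intros)
  ultimately have "(\<integral>z. f z * cinner e z ^ k \<partial>sphere_measure)
      = (\<integral>z. (\<integral>t. f (U t z) * cinner e (U t z) ^ k \<partial>unit_ivl) \<partial>sphere_measure)"
    using cont by (intro sphere_average integrable_sphere_measure)
      (auto intro!: continuous_intros intro: continuous_on_subset)
  also have "\<dots> = (\<integral>z. f (cinner z e *s e) * cinner e z ^ k \<partial>sphere_measure)"
  proof (rule Bochner_Integration.integral_cong)
    fix z :: "complex^'n" assume z: "z \<in> space sphere_measure"
    then have nz: "norm z = 1" by simp
    have eU: "cinner e (U t z) = cinner e z" for t
      by (simp add: U_def cinner_add_right cinner_diff_right ee)
    \<comment> \<open>By orthogonality the squared norm on this line is an average of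
      \<open>1\<close> and \<open>(norm l)\<^sup>2\<close> with weights \<open>1 - b\<close> and
      \<open>b\<close>, so it stays below \<open>R\<^sup>2\<close> whenever
      \<open>norm l < R\<close>.\<close>
    have "(\<lambda>l. f (cinner z e *s e + l *s (z - cinner z e *s e))) holomorphic_on ball 0 R"
    proof (rule holomorphic_on_subset[OF hol_ball_line[OF f]], safe)
      fix l :: complex assume l: "l \<in> ball 0 R"
      have d: "(norm (cinner z e))\<^sup>2 + (norm (z - cinner z e *s e))\<^sup>2 = 1"
        using norm_decomp[of z 1] nz by simp
      define b where "b = (norm (z - cinner z e *s e))\<^sup>2"
      have b: "0 \<le> b" "b \<le> 1" "(norm (cinner z e))\<^sup>2 = 1 - b"
        using d by (auto simp: b_def) (metis le_add_same_cancel2 zero_le_power2)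
      have "(norm (cinner z e *s e + l *s (z - cinner z e *s e)))\<^sup>2 = 1 - b + (norm l)\<^sup>2 * b"
        using norm_decomp[of z l] b by (simp add: b_def)
      also have "\<dots> < R\<^sup>2"
      proof (cases "b = 0")
        case True then show ?thesis using R by (simp add: one_less_power)
      next
        case False
        have "(norm l)\<^sup>2 < R\<^sup>2" using l by (intro power_strict_mono) auto
        then have "(norm l)\<^sup>2 * b < R\<^sup>2 * b" using False b by simp
        moreover have "1 < R\<^sup>2" using R by (simp add: one_less_power)
        then have "1 * (1 - b) \<le> R\<^sup>2 * (1 - b)"
          using b by (intro mult_right_mono) auto
        ultimately have "1 - b + (norm l)\<^sup>2 * b < R\<^sup>2 * (1 - b) + R\<^sup>2 * b" by simp
        then show ?thesis by (simp add: algebra_simps)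
      qed
      finally show "cinner z e *s e + l *s (z - cinner z e *s e) \<in> ball 0 R"
        using R power_less_imp_less_base[of _ 2 R] by auto
    qed
    from circle_mean[OF this R] show "(\<integral>t. f (U t z) * cinner e (U t z) ^ k \<partial>unit_ivl) = f (cinner z e *s e) * cinner e z ^ k"
      by (simp add: eU) (simp add: U_def)
  qed simp
  also have "\<dots> = (\<integral>z. (\<integral>t. f (cinner (circ t *s z) e *s e) * cinner e (circ t *s z) ^ k \<partial>unit_ivl) \<partial>sphere_measure)"
    using cont by (intro sphere_average_rotation integrable_sphere_measure)
      (auto intro!: continuous_intros simp: e ce intro: continuous_on_subset elim!: continuous_on_compose2)
  also have "\<dots> = (\<integral>z. A * of_real ((norm (cinner z e)) ^ (2 * k)) \<partial>sphere_measure)"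
  proof (rule Bochner_Integration.integral_cong)
    fix z :: "complex^'n" assume z: "z \<in> space sphere_measure"
    then have nz: "norm z = 1" by simp
    have "(\<integral>t. f (cinner (circ t *s z) e *s e) * cinner e (circ t *s z) ^ k \<partial>unit_ivl)
       = (\<integral>t. cinner e z ^ k * (f ((cinner z e * circ t) *s e) * cnj (circ t) ^ k) \<partial>unit_ivl)"
      by (intro Bochner_Integration.integral_cong) (auto simp: mult_ac power_mult_distrib)
    also have "\<dots> = cinner e z ^ k * (cinner z e ^ k * A)"
      by (simp add: A[OF ce[OF nz]])
    also have "cinner e z ^ k * (cinner z e ^ k * A) = A * (cinner z e * cnj (cinner z e)) ^ k"
      by (simp add: power_mult_distrib mult_ac)
    also have "cinner z e * cnj (cinner z e) = of_real ((norm (cinner z e))\<^sup>2)"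
      by (metis complex_norm_square)
    finally show "(\<integral>t. f (cinner (circ t *s z) e *s e) * cinner e (circ t *s z) ^ k \<partial>unit_ivl)
        = A * of_real ((norm (cinner z e)) ^ (2 * k))"
      by (simp add: power_mult)
  qed simp
  also have "\<dots> = A * moment k e"
    by (simp add: moment_def)
  finally show ?thesis .
qed

section \<open>The Cauchy formula on the sphere\<close>

text \<open>The pairing of \<open>cinner z a ^ k\<close> with \<open>cinner z b ^ k\<close> can be
  evaluated along \<open>b\<close> and, after conjugation, along \<open>a\<close>. Comparing the two
  values and cancelling the power of \<open>cinner a b\<close> is what requires non-orthogonal
  directions.\<close>

lemma moment_eq_nonorth:
  fixes a b :: "complex^'n"
  assumes a: "norm a = 1" and b: "norm b = 1" and ab: "cinner b a \<noteq> 0"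
  shows "moment k a = moment k b"
proof -
  have pair: "(\<integral>z. cinner z a ^ k * cinner b z ^ k \<partial>sphere_measure) = cinner b a ^ k * moment k b"
    if "norm b = 1" for a b :: "complex^'n"
  proof (rule monomial_pairing[where R = 2])
    fix l :: complex
    have "cinner ((l * circ t) *s b) a ^ k * cnj (circ t) ^ k = l ^ k * cinner b a ^ k * (circ t * cnj (circ t)) ^ k" for t
      by (simp add: power_mult_distrib mult_ac del: circ_cnj)
    then show "(\<integral>t. cinner ((l * circ t) *s b) a ^ k * cnj (circ t) ^ k \<partial>unit_ivl) = l ^ k * cinner b a ^ k"
      by (simp add: unit_ivl.prob_space)
  qed (auto intro!: hol_ball_power that)
  have "cinner a b ^ k * moment k a = (\<integral>z. cinner z b ^ k * cinner a z ^ k \<partial>sphere_measure)"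
    by (simp add: pair a)
  also have "\<dots> = cnj (\<integral>z. cinner z a ^ k * cinner b z ^ k \<partial>sphere_measure)"
    unfolding Bochner_Integration.integral_cnj[symmetric]
    by (intro Bochner_Integration.integral_cong) (simp_all add: mult.commute)
  also have "\<dots> = cnj (cinner b a ^ k * moment k b)"
    by (simp add: pair b)
  also have "\<dots> = cinner a b ^ k * moment k b"
    by (simp add: moment_def flip: Bochner_Integration.integral_cnj)
  finally show ?thesis
    using ab by (metis cnj_cinner complex_cnj_zero_iff mult_cancel_left power_not_zero)
qed

lemma hol_ball_coord [simp]: "hol_ball R (\<lambda>z. z $ i)"
  using hol_ball_cinner[of R "axis i 1"] by simp

lemma axis_component: "axis i x $ j = (if j = i then x else 0)"
  by (simp add: axis_def)

lemma norm_axis_1 [simp]: "norm (axis i 1 :: complex^'n) = 1"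
proof -
  have "complex_of_real ((norm (axis i 1 :: complex^'n))\<^sup>2) = 1"
    unfolding cinner_self[symmetric] by (simp add: axis_component)
  then have "(norm (axis i 1 :: complex^'n))\<^sup>2 = 1"
    using of_real_eq_1_iff by blast
  then show ?thesis by (simp add: power2_eq_1_iff)
qed

lemma norm_diagonal:
  fixes i j :: "'n::finite"
  assumes "i \<noteq> j"
  shows "norm (of_real (1 / sqrt 2) *s (axis i 1 + axis j 1 :: complex^'n)) = 1"
proof -
  have "(norm (axis i 1 + axis j 1 :: complex^'n))\<^sup>2 = 2"
    by (subst pythagoras_cinner) (use assms in \<open>auto simp: axis_component\<close>)
  then have "norm (axis i 1 + axis j 1 :: complex^'n) = sqrt 2"
    by (metis norm_ge_zero real_sqrt_unique)
  then show ?thesis by (simp only: norm_scale) (simp add: norm_divide)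
qed

lemma moment_const:
  fixes e :: "complex^'n" and i :: 'n
  assumes "norm e = 1"
  shows "moment k e = moment k (axis i 1)"
proof -
  obtain j where "e $ j \<noteq> 0"
    using assms by (metis norm_zero vec_eq_iff zero_index zero_neq_one)
  then have 1: "moment k e = moment k (axis j 1)"
    by (intro moment_eq_nonorth[symmetric]) (auto simp: assms)
  show ?thesis
  proof (cases "i = j")
    case False
    \<comment> \<open>A unit vector orthogonal to neither axis links the two.\<close>
    define d :: "complex^'n" where "d = of_real (1 / sqrt 2) *s (axis i 1 + axis j 1)"
    have "norm d = 1" unfolding d_def using False by (rule norm_diagonal)
    moreover have "d $ i \<noteq> 0" "d $ j \<noteq> 0" using False by (auto simp: d_def axis_component)
    ultimately have "moment k (axis j 1) = moment k d" "moment k (axis i 1) = moment k d"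
      by (auto intro!: moment_eq_nonorth)
    then show ?thesis using 1 by simp
  qed (use 1 in simp)
qed

text \<open>Pairing \<open>z $ i ^ m * z $ j\<close> with the power \<open>Suc m\<close> of the
  diagonal direction produces the moment on one side. On the other side, rotating the coordinate
  \<open>j\<close> alone kills all terms of the binomial expansion except the one linear in
  \<open>cnj (z $ j)\<close>; the factor \<open>Suc m\<close> is its binomial coefficient.\<close>

lemma moment_mixed:
  fixes i j :: "'n::finite"
  assumes ij: "i \<noteq> j"
  shows "moment (Suc m) (axis i 1 :: complex^'n)
    = of_nat (Suc m) * (\<integral>z. of_real ((norm (z $ i)) ^ (2 * m) * (norm (z $ j))\<^sup>2) \<partial>(sphere_measure :: (complex^'n) measure))"
proof -
  define c :: complex where "c = of_real (1 / sqrt 2)"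
  define d :: "complex^'n" where "d = c *s (axis i 1 + axis j 1)"
  have d: "norm d = 1" unfolding d_def c_def using ij by (rule norm_diagonal)
  have c0: "c \<noteq> 0" by (simp add: c_def)
  have di: "d $ i = c" "d $ j = c" using ij by (auto simp: d_def axis_component)
  define f :: "complex^'n \<Rightarrow> complex" where "f = (\<lambda>z. cinner z (axis i 1) ^ m * cinner z (axis j 1))"
  have "(\<integral>z. f z * cinner d z ^ Suc m \<partial>sphere_measure) = c ^ Suc m * moment (Suc m) d"
  proof (rule monomial_pairing[where R = 2])
    fix l :: complex
    have "f ((l * circ t) *s d) * cnj (circ t) ^ Suc m = l ^ Suc m * c ^ Suc m * (circ t * cnj (circ t)) ^ Suc m" for t
      by (simp add: f_def di power_mult_distrib mult_ac del: circ_cnj)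
    then show "(\<integral>t. f ((l * circ t) *s d) * cnj (circ t) ^ Suc m \<partial>unit_ivl) = l ^ Suc m * c ^ Suc m"
      by (simp add: unit_ivl.prob_space)
  qed (auto simp: f_def d intro!: hol_ball_power hol_ball_mult hol_ball_cinner)
  moreover have "cinner d z = c * (cnj (z $ i) + cnj (z $ j))" for z
    by (simp add: d_def cinner_add_left distrib_left)
  then have "f z * cinner d z ^ Suc m = c ^ Suc m * (z $ i ^ m * z $ j * (cnj (z $ i) + cnj (z $ j)) ^ Suc m)" for z
    by (simp add: f_def power_mult_distrib mult_ac)
  ultimately have "moment (Suc m) d = (\<integral>z. z $ i ^ m * z $ j * (cnj (z $ i) + cnj (z $ j)) ^ Suc m \<partial>sphere_measure)"
    using c0 by (simp del: power_Suc)
  also have "\<dots> = (\<integral>z. (\<integral>t. z $ i ^ m * (circ t * z $ j) * (cnj (z $ i) + cnj (circ t * z $ j)) ^ Suc m \<partial>unit_ivl) \<partial>sphere_measure)"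
  proof -
    define U :: "real \<Rightarrow> complex^'n \<Rightarrow> complex^'n" where "U t z = (\<chi> k. (if k = j then circ t else 1) * z $ k)" for t z
    have "linear (U t)" for t
      unfolding U_def by (intro linearI) (simp_all add: vec_eq_iff algebra_simps)
    moreover have "norm (U t z) = norm z" for t z
      by (auto simp: norm_vec_def U_def norm_mult intro!: L2_set_cong)
    moreover have "continuous_on UNIV (\<lambda>p :: (complex^'n) \<times> real. (if k = j then circ (snd p) else 1) * fst p $ k)" for k
      by (cases "k = j") (auto intro!: continuous_intros)
    then have "continuous_on UNIV (\<lambda>p. U (snd p) (fst p))"
      unfolding U_def by (rule continuous_on_vec_lambda)
    ultimately have "(\<integral>z. z $ i ^ m * z $ j * (cnj (z $ i) + cnj (z $ j)) ^ Suc m \<partial>sphere_measure)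
      = (\<integral>z. (\<integral>t. U t z $ i ^ m * U t z $ j * (cnj (U t z $ i) + cnj (U t z $ j)) ^ Suc m \<partial>unit_ivl) \<partial>sphere_measure)"
      by (intro sphere_average integrable_sphere_measure continuous_intros)
    then show ?thesis using ij by (simp add: U_def del: power_Suc)
  qed
  also have "\<dots> = (\<integral>z. of_nat (Suc m) * of_real ((norm (z $ i)) ^ (2 * m) * (norm (z $ j))\<^sup>2) \<partial>sphere_measure)"
  proof (rule Bochner_Integration.integral_cong)
    fix z :: "complex^'n"
    define p where "p l = (z $ i + z $ j * l) ^ Suc m" for l
    have "p holomorphic_on ball 0 2" unfolding p_def by (intro holomorphic_intros)
    from circle_coefficient[OF this, of 1]
    have "(\<integral>t. p (circ t) * cnj (circ t) \<partial>unit_ivl) = deriv p 0" by simp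
    also have "deriv p 0 = of_nat (Suc m) * z $ i ^ m * z $ j"
    proof (rule DERIV_imp_deriv)
      have "((\<lambda>l. z $ i + z $ j * l) has_field_derivative z $ j) (at 0)"
        by (auto intro!: derivative_eq_intros)
      from DERIV_power[OF this, of "Suc m"]
      show "(p has_field_derivative of_nat (Suc m) * z $ i ^ m * z $ j) (at 0)"
        unfolding p_def by (simp add: mult_ac del: of_nat_Suc power_Suc)
    qed
    finally have "cnj (\<integral>t. p (circ t) * cnj (circ t) \<partial>unit_ivl) = of_nat (Suc m) * cnj (z $ i) ^ m * cnj (z $ j)"
      by simp
    then have I: "(\<integral>t. cnj (p (circ t)) * circ t \<partial>unit_ivl) = of_nat (Suc m) * cnj (z $ i) ^ m * cnj (z $ j)"
      by (simp flip: Bochner_Integration.integral_cnj)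
    have "(\<integral>t. z $ i ^ m * (circ t * z $ j) * (cnj (z $ i) + cnj (circ t * z $ j)) ^ Suc m \<partial>unit_ivl)
       = (\<integral>t. (z $ i ^ m * z $ j) * (cnj (p (circ t)) * circ t) \<partial>unit_ivl)"
      by (intro Bochner_Integration.integral_cong) (simp_all add: p_def mult_ac del: power_Suc)
    also have "\<dots> = of_nat (Suc m) * ((z $ i * cnj (z $ i)) ^ m * (z $ j * cnj (z $ j)))"
      by (simp only: integral_mult_right_zero I) (simp add: power_mult_distrib mult_ac)
    also have "\<dots> = of_nat (Suc m) * of_real ((norm (z $ i)) ^ (2 * m) * (norm (z $ j))\<^sup>2)"
      by (simp add: complex_norm_square[symmetric] power_mult)
    finally show "(\<integral>t. z $ i ^ m * (circ t * z $ j) * (cnj (z $ i) + cnj (circ t * z $ j)) ^ Suc m \<partial>unit_ivl)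
      = of_nat (Suc m) * of_real ((norm (z $ i)) ^ (2 * m) * (norm (z $ j))\<^sup>2)" .
  qed simp
  also have "\<dots> = of_nat (Suc m) * (\<integral>z. of_real ((norm (z $ i)) ^ (2 * m) * (norm (z $ j))\<^sup>2) \<partial>sphere_measure)"
    by simp
  finally show ?thesis using moment_const[OF d] by metis
qed

text \<open>On the sphere the squared moduli of the coordinates sum to \<open>1\<close>. Inserting
  this sum into the moment of order \<open>m\<close> gives the moment of order \<open>Suc m\<close>
  for \<open>j = i\<close> and, by \<open>moment_mixed\<close>, the same moment divided by
  \<open>Suc m\<close> for each of the other \<open>CARD('n) - 1\<close> coordinates.\<close>

lemma moment_recursion:
  fixes i :: "'n::finite"
  shows "of_nat (m + CARD('n)) * moment (Suc m) (axis i 1 :: complex^'n)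
    = of_nat (Suc m) * moment m (axis i 1 :: complex^'n)"
proof -
  let ?M = "\<lambda>k. moment k (axis i 1 :: complex^'n)"
  let ?J = "\<lambda>j. \<integral>z. complex_of_real ((norm (z $ i)) ^ (2 * m) * (norm (z $ j))\<^sup>2) \<partial>(sphere_measure :: (complex^'n) measure)"
  have "?M m = (\<integral>z. (\<Sum>j\<in>UNIV. of_real ((norm (z $ i)) ^ (2 * m) * (norm (z $ j))\<^sup>2)) \<partial>(sphere_measure :: (complex^'n) measure))"
    unfolding moment_def
  proof (rule Bochner_Integration.integral_cong)
    fix z :: "complex^'n" assume "z \<in> space sphere_measure"
    then have "(\<Sum>j\<in>UNIV. (norm (z $ j))\<^sup>2) = 1"
      by (simp add: norm_vec_def L2_set_def)
    then have "(norm (z $ i)) ^ (2 * m) = (norm (z $ i)) ^ (2 * m) * (\<Sum>j\<in>UNIV. (norm (z $ j))\<^sup>2)" by simp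
    also have "\<dots> = (\<Sum>j\<in>UNIV. (norm (z $ i)) ^ (2 * m) * (norm (z $ j))\<^sup>2)"
      by (rule sum_distrib_left)
    finally show "complex_of_real (norm (cinner z (axis i 1)) ^ (2 * m)) = (\<Sum>j\<in>UNIV. of_real ((norm (z $ i)) ^ (2 * m) * (norm (z $ j))\<^sup>2))"
      by (simp only: cinner_axis of_real_sum[symmetric])
  qed simp
  also have "\<dots> = (\<Sum>j\<in>UNIV. ?J j)"
    by (intro Bochner_Integration.integral_sum integrable_sphere_measure continuous_intros)
  also have "of_nat (Suc m) * \<dots> = (\<Sum>j\<in>UNIV. of_nat (Suc m) * ?J j)"
    by (rule sum_distrib_left)
  also have "\<dots> = (\<Sum>j\<in>UNIV. if j = i then of_nat (Suc m) * ?M (Suc m) else ?M (Suc m))"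
  proof (rule sum.cong)
    fix j show "of_nat (Suc m) * ?J j = (if j = i then of_nat (Suc m) * ?M (Suc m) else ?M (Suc m))"
    proof (cases "j = i")
      case True then show ?thesis
        by (simp add: moment_def power2_eq_square mult_ac)
    next
      case False
      then show ?thesis using moment_mixed[of i j m] by simp
    qed
  qed simp
  also have "\<dots> = of_nat (Suc m) * ?M (Suc m) + (\<Sum>j\<in>UNIV - {i}. ?M (Suc m))"
    by (subst sum.remove[of UNIV i]) auto
  also have "\<dots> = of_nat (m + CARD('n)) * ?M (Suc m)"
    by (simp add: card_Diff_singleton of_nat_diff Suc_leI algebra_simps)
  finally show ?thesis by simp
qed

text \<open>The reciprocals of the moments are the Taylor coefficients of
  \<open>1 / (1 - x) ^ CARD('n)\<close>; this match is the reason why the exponent of the Cauchy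
  kernel is the dimension.\<close>

lemma moment_value:
  fixes e :: "complex^'n"
  assumes "norm e = 1"
  shows "pochhammer (of_nat CARD('n)) k / fact k * moment k e = 1"
proof (induction k)
  case 0
  then show ?case by (simp add: moment_def sphere.prob_space)
next
  case (Suc k)
  have "of_nat (k + CARD('n)) * moment (Suc k) e = of_nat (Suc k) * moment k e"
    using moment_recursion[of k "undefined :: 'n"] moment_const[OF assms] by metis
  then have "of_nat (k + CARD('n)) / of_nat (Suc k) * moment (Suc k) e = moment k e"
    by (simp add: field_simps del: of_nat_Suc)
  moreover have "pochhammer (of_nat CARD('n)) (Suc k) / fact (Suc k) * moment (Suc k) e
     = pochhammer (of_nat CARD('n)) k / fact k * (of_nat (k + CARD('n)) / of_nat (Suc k) * moment (Suc k) e)"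
    by (simp add: pochhammer_Suc field_simps del: of_nat_Suc)
  ultimately show ?case using Suc by simp
qed

lemma binomial_kernel_series:
  fixes x :: complex
  assumes x: "norm x < 1"
  shows "(\<lambda>k. pochhammer (of_nat d) k / fact k * x ^ k) sums (1 / (1 - x) ^ d)"
proof -
  have "(\<lambda>n. ((- of_nat d) gchoose n) * (- x) ^ n) sums (1 + (- x)) powr (- of_nat d)"
    using x by (intro gen_binomial_complex) simp
  moreover have "((- of_nat d) gchoose n) * (- x) ^ n = pochhammer (of_nat d) n / fact n * x ^ n" for n
    unfolding gbinomial_pochhammer power_minus[of x n] by (cases "even n") simp_all
  moreover have "(1 - x) powr (- of_nat d) = 1 / (1 - x) ^ d"
  proof -
    have "1 - x \<noteq> 0" using x by auto
    then show ?thesis by (simp add: powr_minus powr_nat' divide_inverse)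
  qed
  ultimately show ?thesis by simp
qed

lemma binomial_kernel_summable:
  assumes "norm x < 1"
  shows "summable (\<lambda>k. norm (pochhammer (of_nat d) k / fact k * (x::complex) ^ k))"
proof -
  obtain r where r: "norm x < r" "r < 1" using assms dense by blast
  have "summable (\<lambda>k. pochhammer (of_nat d) k / fact k * (complex_of_real r) ^ k)"
    using binomial_kernel_series[of "of_real r" d] r norm_ge_zero[of x] by (auto simp: sums_iff)
  from powser_insidea[OF this] show ?thesis using r norm_ge_zero[of x] by (auto simp: norm_mult)
qed

text \<open>The kernel is expanded in powers of \<open>cinner w z\<close>, a multiple of
  \<open>cinner e z\<close> for a unit vector \<open>e\<close> in the direction of \<open>w\<close>.
  Termwise integration yields Taylor coefficients of the slice of \<open>f\<close> along
  \<open>e\<close> times moments, and the moments cancel the coefficients of the kernel.\<close>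

theorem cauchy_sphere:
  fixes f :: "complex^'n \<Rightarrow> complex"
  assumes f: "hol_ball R f" and R: "R > 1" and w: "norm w < 1"
  shows "(\<integral>z. f z * cauchy_kernel w z \<partial>sphere_measure) = f w"
proof -
  \<comment> \<open>At \<open>w = 0\<close> there is no direction; any unit vector serves, since
    then \<open>r = 0\<close>.\<close>
  define e where "e = (if w = 0 then axis undefined 1 else sgn w)"
  define r where "r = norm w"
  have e: "norm e = 1" by (simp add: e_def norm_sgn)
  have we: "w = of_real r *s e" by (simp add: e_def r_def sgn_div_norm flip: scaleR_eq_scale)
  have cont: "continuous_on (cball 0 1) f"
    using hol_ball_continuous[OF f] R by (auto intro: continuous_on_subset)
  define g where "g = (\<lambda>l. f (l *s e))"
  have g: "g holomorphic_on ball 0 R" unfolding g_def using hol_ball_slice[OF f] e by simp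
  define a where "a k = (deriv ^^ k) g 0 / fact k" for k
  define c :: "nat \<Rightarrow> complex" where "c k = pochhammer (of_nat CARD('n)) k / fact k" for k
  have pairing: "(\<integral>z. f z * cinner e z ^ k \<partial>sphere_measure) = a k * moment k e" for k
  proof (rule monomial_pairing[OF f R e])
    fix l :: complex assume "norm l \<le> 1"
    then show "(\<integral>t. f ((l * circ t) *s e) * cnj (circ t) ^ k \<partial>unit_ivl) = l ^ k * a k"
      using circle_coefficient_scaled[OF g, of l k] R by (simp add: g_def a_def mult.commute)
  qed
  have r: "0 \<le> r" "r < 1" using w by (auto simp: r_def)
  have wz: "norm (cinner w z) \<le> r" if "norm z = 1" for z
    using norm_cinner_le[of w z] that by (simp add: r_def)
  have "compact (f ` sphere 0 1)"
    by (intro compact_continuous_image compact_sphere continuous_on_subset[OF cont]) auto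
  then obtain B where "\<forall>y\<in>f ` sphere 0 1. norm y \<le> B"
    by (meson bounded_iff compact_imp_bounded)
  then have B: "norm (f z) \<le> B" if "norm z = 1" for z
    using that by simp
  have sum_c: "summable (\<lambda>k. norm (c k * of_real r ^ k))"
    unfolding c_def using r by (intro binomial_kernel_summable) simp
  have "(\<lambda>k. \<integral>z. f z * (c k * cinner w z ^ k) \<partial>sphere_measure) sums
        (\<integral>z. (\<Sum>k. f z * (c k * cinner w z ^ k)) \<partial>sphere_measure)"
  proof (rule sums_integral)
    show int: "integrable sphere_measure (\<lambda>z. f z * (c k * cinner w z ^ k))" for k
      by (intro integrable_sphere_measure continuous_intros continuous_on_subset[OF cont]) auto
    have bound: "norm (f z * (c k * cinner w z ^ k)) \<le> B * norm (c k * of_real r ^ k)" if "norm z = 1" for z k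
      unfolding norm_mult norm_power using that wz[of z] B[OF that] r order_trans[OF norm_ge_zero B[OF that]]
      by (intro mult_mono) (auto intro!: power_mono)
    show "AE z in sphere_measure. summable (\<lambda>k. norm (f z * (c k * cinner w z ^ k)))"
      by (rule AE_I2, rule summable_comparison_test'[OF summable_mult[OF sum_c, of B]])
         (use bound in auto)
    show "summable (\<lambda>k. \<integral>z. norm (f z * (c k * cinner w z ^ k)) \<partial>sphere_measure)"
    proof (rule summable_comparison_test'[OF summable_mult[OF sum_c, of B]])
      fix k
      have "(\<integral>z. norm (f z * (c k * cinner w z ^ k)) \<partial>sphere_measure) \<le> (\<integral>z. B * norm (c k * of_real r ^ k) \<partial>(sphere_measure :: (complex^'n) measure))"
        using int by (intro integral_mono) (use bound in auto)
      then show "norm (\<integral>z. norm (f z * (c k * cinner w z ^ k)) \<partial>sphere_measure) \<le> B * norm (c k * of_real r ^ k)"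
        by (simp add: sphere.prob_space)
    qed
  qed
  also have "(\<integral>z. (\<Sum>k. f z * (c k * cinner w z ^ k)) \<partial>sphere_measure) = (\<integral>z. f z * cauchy_kernel w z \<partial>sphere_measure)"
  proof (rule Bochner_Integration.integral_cong)
    fix z :: "complex^'n" assume "z \<in> space sphere_measure"
    then have "norm (cinner w z) < 1" using wz[of z] r by simp
    from sums_mult[OF binomial_kernel_series[OF this], of "f z" "CARD('n)"]
    show "(\<Sum>k. f z * (c k * cinner w z ^ k)) = f z * cauchy_kernel w z"
      by (simp add: c_def cauchy_kernel_def sums_iff)
  qed simp
  also have "(\<lambda>k. \<integral>z. f z * (c k * cinner w z ^ k) \<partial>sphere_measure) = (\<lambda>k. a k * of_real r ^ k)"
  proof
    fix k
    have "(\<integral>z. f z * (c k * cinner w z ^ k) \<partial>sphere_measure) = (\<integral>z. c k * of_real r ^ k * (f z * cinner e z ^ k) \<partial>sphere_measure)"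
      by (simp add: we power_mult_distrib mult_ac)
    also have "\<dots> = c k * of_real r ^ k * (a k * moment k e)"
      by (simp only: integral_mult_right_zero pairing)
    also have "\<dots> = (c k * moment k e) * (a k * of_real r ^ k)"
      by (simp add: mult_ac)
    finally show "(\<integral>z. f z * (c k * cinner w z ^ k) \<partial>sphere_measure) = a k * of_real r ^ k"
      unfolding c_def by (simp only: moment_value[OF e] mult_1_left)
  qed
  finally have "(\<lambda>k. a k * of_real r ^ k) sums (\<integral>z. f z * cauchy_kernel w z \<partial>sphere_measure)" .
  moreover have "(\<lambda>k. a k * of_real r ^ k) sums g (of_real r)"
    using holomorphic_power_series[OF g, of "of_real r"] r R by (simp add: a_def)
  ultimately have "g (of_real r) = (\<integral>z. f z * cauchy_kernel w z \<partial>sphere_measure)"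
    using sums_unique2 by blast
  then show ?thesis by (simp add: g_def flip: we)
qed

section \<open>Semi-inner product spaces\<close>

lemma of_real_norm_sq: "(complex_of_real (norm z))\<^sup>2 = z * cnj z"
  by (metis complex_norm_square of_real_power)

lemma borel_measurable_cnj [measurable (raw)]:
  "f \<in> borel_measurable M \<Longrightarrow> (\<lambda>x. cnj (f x)) \<in> borel_measurable M"
  by (rule measurable_compose[OF _ borel_measurable_continuous_onI]) (auto intro: continuous_intros)

text \<open>Elements are functions rather than classes, so \<open>nrm\<close> may vanish on nonzero
  functions and no definiteness is assumed. Both L2 of a measure and the Hardy space are instances,
  so the projection argument is proved once.\<close>

locale semi_inner_space =
  fixes X :: "('a \<Rightarrow> complex) set" and ip :: "('a \<Rightarrow> complex) \<Rightarrow> ('a \<Rightarrow> complex) \<Rightarrow> complex"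
  assumes add_closed: "f \<in> X \<Longrightarrow> g \<in> X \<Longrightarrow> (\<lambda>x. f x + g x) \<in> X"
    and scale_closed: "f \<in> X \<Longrightarrow> (\<lambda>x. c * f x) \<in> X"
    and ip_add: "f \<in> X \<Longrightarrow> g \<in> X \<Longrightarrow> h \<in> X \<Longrightarrow> ip (\<lambda>x. f x + g x) h = ip f h + ip g h"
    and ip_scale: "f \<in> X \<Longrightarrow> h \<in> X \<Longrightarrow> ip (\<lambda>x. c * f x) h = c * ip f h"
    and ip_cnj: "f \<in> X \<Longrightarrow> g \<in> X \<Longrightarrow> cnj (ip f g) = ip g f"
    and ip_nonneg: "f \<in> X \<Longrightarrow> 0 \<le> Re (ip f f)"
begin

definition nrm :: "('a \<Rightarrow> complex) \<Rightarrow> real" where "nrm f = sqrt (Re (ip f f))"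

lemma diff_closed: "f \<in> X \<Longrightarrow> g \<in> X \<Longrightarrow> (\<lambda>x. f x - g x) \<in> X"
  using add_closed[of f "\<lambda>x. (-1) * g x"] scale_closed[of g "-1"] by simp

lemma comb_closed: "f \<in> X \<Longrightarrow> g \<in> X \<Longrightarrow> (\<lambda>x. a * f x + b * g x) \<in> X"
  by (intro add_closed scale_closed)

lemma ip_add_right: "f \<in> X \<Longrightarrow> g \<in> X \<Longrightarrow> h \<in> X \<Longrightarrow> ip h (\<lambda>x. f x + g x) = ip h f + ip h g"
  by (metis (no_types, lifting) add_closed complex_cnj_add ip_add ip_cnj)

lemma ip_scale_right: "f \<in> X \<Longrightarrow> h \<in> X \<Longrightarrow> ip h (\<lambda>x. c * f x) = cnj c * ip h f"
  by (metis (no_types, lifting) scale_closed complex_cnj_mult ip_scale ip_cnj)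

lemma ip_diff: "f \<in> X \<Longrightarrow> g \<in> X \<Longrightarrow> h \<in> X \<Longrightarrow> ip (\<lambda>x. f x - g x) h = ip f h - ip g h"
  using ip_add[of f "\<lambda>x. (-1) * g x" h] scale_closed[of g "-1"] ip_scale[of g h "-1"] by simp

lemma ip_diff_right: "f \<in> X \<Longrightarrow> g \<in> X \<Longrightarrow> h \<in> X \<Longrightarrow> ip h (\<lambda>x. f x - g x) = ip h f - ip h g"
  using ip_add_right[of f "\<lambda>x. (-1) * g x" h] scale_closed[of g "-1"] ip_scale_right[of g h "-1"] by simp

lemma ip_comb: "f \<in> X \<Longrightarrow> g \<in> X \<Longrightarrow> h \<in> X \<Longrightarrow> ip (\<lambda>x. a * f x + b * g x) h = a * ip f h + b * ip g h"
  by (simp add: ip_add ip_scale scale_closed)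

lemma nrm_nonneg [simp]: "f \<in> X \<Longrightarrow> 0 \<le> nrm f"
  by (simp add: nrm_def ip_nonneg)

lemma nrm_sq: "f \<in> X \<Longrightarrow> (nrm f)\<^sup>2 = Re (ip f f)"
  by (simp add: nrm_def ip_nonneg)

lemma nrm_scale: "f \<in> X \<Longrightarrow> nrm (\<lambda>x. c * f x) = norm c * nrm f"
proof -
  assume f: "f \<in> X"
  have "ip (\<lambda>x. c * f x) (\<lambda>x. c * f x) = of_real ((norm c)\<^sup>2) * ip f f"
    using f by (simp add: ip_scale ip_scale_right scale_closed of_real_norm_sq mult_ac)
  then have "Re (ip (\<lambda>x. c * f x) (\<lambda>x. c * f x)) = (norm c)\<^sup>2 * Re (ip f f)"
    by simp
  then show ?thesis by (simp add: nrm_def real_sqrt_mult)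
qed

lemma nrm_sq_add:
  assumes "f \<in> X" "g \<in> X"
  shows "(nrm (\<lambda>x. f x + g x))\<^sup>2 = (nrm f)\<^sup>2 + (nrm g)\<^sup>2 + 2 * Re (ip f g)"
proof -
  have "Re (ip g f) = Re (ip f g)" using ip_cnj[OF assms] by (metis complex_cnj(1) complex.sel(1) cnj.simps(1))
  then show ?thesis
    using assms by (simp add: nrm_sq add_closed ip_add ip_add_right)
qed

lemma nrm_sq_diff:
  assumes "f \<in> X" "g \<in> X"
  shows "(nrm (\<lambda>x. f x - g x))\<^sup>2 = (nrm f)\<^sup>2 + (nrm g)\<^sup>2 - 2 * Re (ip f g)"
proof -
  have "Re (ip g f) = Re (ip f g)" using ip_cnj[OF assms] by (metis cnj.simps(1))
  then show ?thesis
    using assms by (simp add: nrm_sq diff_closed ip_diff ip_diff_right)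
qed

lemma cauchy_schwarz:
  assumes f: "f \<in> X" and g: "g \<in> X"
  shows "norm (ip f g) \<le> nrm f * nrm g"
proof -
  let ?p = "norm (ip f g)"
  \<comment> \<open>The scalar contains \<open>ip f g\<close> itself, which makes the mixed term
    real. Since the seminorm of \<open>g\<close> may be \<open>0\<close>, the optimal
    \<open>t\<close> is available only in one of the cases below.\<close>
  have quad: "0 \<le> (nrm f)\<^sup>2 - 2 * t * ?p\<^sup>2 + t\<^sup>2 * ?p\<^sup>2 * (nrm g)\<^sup>2" for t :: real
  proof -
    let ?c = "of_real t * ip f g"
    have cg: "(\<lambda>x. ?c * g x) \<in> X" using g by (rule scale_closed)
    have "ip f (\<lambda>x. ?c * g x) = of_real (t * ?p\<^sup>2)"
      by (simp only: ip_scale_right[OF g f]) (simp add: of_real_norm_sq mult_ac)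
    then have "Re (ip f (\<lambda>x. ?c * g x)) = t * ?p\<^sup>2" by simp
    moreover have "(nrm (\<lambda>x. ?c * g x))\<^sup>2 = t\<^sup>2 * ?p\<^sup>2 * (nrm g)\<^sup>2"
      by (simp only: nrm_scale[OF g] norm_mult) (simp add: power_mult_distrib)
    ultimately have "(nrm (\<lambda>x. f x - ?c * g x))\<^sup>2 = (nrm f)\<^sup>2 - 2 * t * ?p\<^sup>2 + t\<^sup>2 * ?p\<^sup>2 * (nrm g)\<^sup>2"
      by (simp only: nrm_sq_diff[OF f cg])
    then show ?thesis by (metis zero_le_power2)
  qed
  have "?p\<^sup>2 \<le> (nrm f * nrm g)\<^sup>2"
  proof (cases "nrm g = 0")
    case False
    have "0 \<le> (nrm f)\<^sup>2 - ?p\<^sup>2 / (nrm g)\<^sup>2"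
      using quad[of "1 / (nrm g)\<^sup>2"] False by (simp add: field_simps power2_eq_square)
    then show ?thesis using False by (simp add: field_simps power_mult_distrib)
  next
    case True
    show ?thesis
    proof (cases "?p = 0")
      case False
      then have "?p\<^sup>2 > 0" by simp
      \<comment> \<open>With a vanishing quadratic term the polynomial is affine in
        \<open>t\<close>; the chosen \<open>t\<close> would give it the value
        \<open>-1\<close>.\<close>
      then show ?thesis
        using quad[of "((nrm f)\<^sup>2 + 1) / (2 * ?p\<^sup>2)"] True by (simp add: field_simps)
    qed simp
  qed
  then show ?thesis
    using f g by (intro power2_le_imp_le[of ?p]) auto
qed

lemma nrm_triangle:
  assumes "f \<in> X" "g \<in> X"
  shows "nrm (\<lambda>x. f x + g x) \<le> nrm f + nrm g"
proof (rule power2_le_imp_le)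
  have "Re (ip f g) \<le> nrm f * nrm g"
    using cauchy_schwarz[OF assms] complex_Re_le_cmod[of "ip f g"] by linarith
  then show "(nrm (\<lambda>x. f x + g x))\<^sup>2 \<le> (nrm f + nrm g)\<^sup>2"
    using assms by (simp add: nrm_sq_add power2_sum)
qed (use assms in auto)

lemma nrm_diff_commute: "f \<in> X \<Longrightarrow> g \<in> X \<Longrightarrow> nrm (\<lambda>x. f x - g x) = nrm (\<lambda>x. g x - f x)"
  using nrm_scale[of "\<lambda>x. f x - g x" "-1"] by (simp add: diff_closed)

lemma nrm_triangle_diff:
  assumes "f \<in> X" "g \<in> X" "h \<in> X"
  shows "nrm (\<lambda>x. f x - h x) \<le> nrm (\<lambda>x. f x - g x) + nrm (\<lambda>x. g x - h x)"
  using nrm_triangle[of "\<lambda>x. f x - g x" "\<lambda>x. g x - h x"] assms by (simp add: diff_closed)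

lemma tendsto_ip_left:
  assumes f: "\<And>n. f n \<in> X" "l \<in> X" "g \<in> X" and lim: "(\<lambda>n. nrm (\<lambda>x. f n x - l x)) \<longlonglongrightarrow> 0"
  shows "(\<lambda>n. ip (f n) g) \<longlonglongrightarrow> ip l g"
proof (rule metric_tendsto_imp_tendsto)
  show "(\<lambda>n. nrm (\<lambda>x. f n x - l x) * nrm g) \<longlonglongrightarrow> 0"
    using tendsto_mult_right[OF lim, of "nrm g"] by simp
  show "\<forall>\<^sub>F n in sequentially. dist (ip (f n) g) (ip l g) \<le> dist (nrm (\<lambda>x. f n x - l x) * nrm g) 0"
  proof (rule always_eventually, rule allI)
    fix n
    have "dist (ip (f n) g) (ip l g) = norm (ip (\<lambda>x. f n x - l x) g)"
      using f by (simp add: dist_norm ip_diff)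
    also have "\<dots> \<le> nrm (\<lambda>x. f n x - l x) * nrm g"
      using f by (intro cauchy_schwarz diff_closed) auto
    finally show "dist (ip (f n) g) (ip l g) \<le> dist (nrm (\<lambda>x. f n x - l x) * nrm g) 0"
      by (simp add: dist_norm)
  qed
qed

lemma tendsto_ip_right:
  assumes f: "\<And>n. f n \<in> X" "l \<in> X" "g \<in> X" and lim: "(\<lambda>n. nrm (\<lambda>x. f n x - l x)) \<longlonglongrightarrow> 0"
  shows "(\<lambda>n. ip g (f n)) \<longlonglongrightarrow> ip g l"
  using tendsto_cnj[OF tendsto_ip_left[OF assms]] f by (simp add: ip_cnj)

text \<open>A minimizing sequence in \<open>D\<close> is Cauchy by the parallelogram law. Its limit
  need only lie in a possibly larger \<open>Y\<close>: this covers the span of the kernels with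
  \<open>Y\<close> all of L2, as well as the complete range of an isometry with
  \<open>Y = D\<close>.\<close>

lemma projection:
  assumes D: "D \<subseteq> X" "D \<noteq> {}" and comb: "\<And>f g a b. f \<in> D \<Longrightarrow> g \<in> D \<Longrightarrow> (\<lambda>x. a * f x + b * g x) \<in> D"
    and complete: "\<And>d. (\<And>n. d n \<in> D) \<Longrightarrow>
        (\<And>e. e > 0 \<Longrightarrow> \<exists>N. \<forall>m\<ge>N. \<forall>n\<ge>N. nrm (\<lambda>x. d m x - d n x) < e) \<Longrightarrow>
        \<exists>y\<in>Y. (\<lambda>n. nrm (\<lambda>x. d n x - y x)) \<longlonglongrightarrow> 0"
    and Y: "Y \<subseteq> X" and h: "h \<in> X"
  obtains y d where "y \<in> Y" "\<And>n. d n \<in> D" "(\<lambda>n. nrm (\<lambda>x. d n x - y x)) \<longlonglongrightarrow> 0"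
    "\<And>g. g \<in> D \<Longrightarrow> ip (\<lambda>x. h x - y x) g = 0"
proof -
  define N where "N d = (nrm (\<lambda>x. h x - d x))\<^sup>2" for d
  define m where "m = Inf (N ` D)"
  have bdd: "bdd_below (N ` D)"
    by (rule bdd_belowI[of _ 0]) (auto simp: N_def)
  have m_le: "m \<le> N d" if "d \<in> D" for d
    unfolding m_def using that bdd by (intro cINF_lower) auto
  have "\<exists>d\<in>D. N d < m + 1 / real (Suc n)" for n
  proof -
    have "Inf (N ` D) < m + 1 / real (Suc n)" unfolding m_def by simp
    then show ?thesis using bdd D(2) by (subst (asm) cINF_less_iff) auto
  qed
  then obtain d where d: "\<And>n. d n \<in> D" "\<And>n. N (d n) < m + 1 / real (Suc n)" by metis
  have dX: "d n \<in> X" for n using d D by auto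
  have par: "(nrm (\<lambda>x. d i x - d j x))\<^sup>2 \<le> 2 / real (Suc i) + 2 / real (Suc j)" for i j
  proof -
    define u where "u = (\<lambda>x. h x - d i x)"
    define v where "v = (\<lambda>x. h x - d j x)"
    have uv: "u \<in> X" "v \<in> X" using h dX by (auto simp: u_def v_def intro: diff_closed)
    \<comment> \<open>Midpoints of elements of \<open>D\<close> stay in \<open>D\<close>, so their
      distance to \<open>h\<close> is bounded below by the infimum.\<close>
    have mid: "(\<lambda>x. (1/2) * d i x + (1/2) * d j x) \<in> D" using comb d by blast
    have "(\<lambda>x. u x + v x) = (\<lambda>x. 2 * (h x - ((1/2) * d i x + (1/2) * d j x)))"
      by (auto simp: u_def v_def algebra_simps)
    then have "(nrm (\<lambda>x. u x + v x))\<^sup>2 = 4 * N (\<lambda>x. (1/2) * d i x + (1/2) * d j x)"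
      using mid D h by (simp only: nrm_scale[OF diff_closed] subset_iff N_def) (auto simp: power_mult_distrib)
    moreover have "(\<lambda>x. v x - u x) = (\<lambda>x. d i x - d j x)" by (auto simp: u_def v_def)
    then have "(nrm (\<lambda>x. d i x - d j x))\<^sup>2 = (nrm (\<lambda>x. v x - u x))\<^sup>2" by simp
    moreover have "(nrm (\<lambda>x. u x + v x))\<^sup>2 + (nrm (\<lambda>x. v x - u x))\<^sup>2 = 2 * N (d i) + 2 * N (d j)"
    proof -
      have "Re (ip v u) = Re (ip u v)" using ip_cnj[OF uv] by (metis cnj.simps(1))
      then show ?thesis by (simp add: nrm_sq_add[OF uv] nrm_sq_diff[OF uv(2,1)] N_def flip: u_def v_def)
    qed
    ultimately show ?thesis using m_le[OF mid] d(2)[of i] d(2)[of j] by simp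
  qed
  have "\<exists>y\<in>Y. (\<lambda>n. nrm (\<lambda>x. d n x - y x)) \<longlonglongrightarrow> 0"
  proof (rule complete)
    fix e :: real assume e: "e > 0"
    obtain K where K: "4 / e\<^sup>2 < real K" using reals_Archimedean2 by blast
    show "\<exists>N. \<forall>m\<ge>N. \<forall>n\<ge>N. nrm (\<lambda>x. d m x - d n x) < e"
    proof (intro exI allI impI)
      fix i j assume ij: "i \<ge> K" "j \<ge> K"
      have "4 / real (Suc K) < e\<^sup>2"
        using K e by (simp add: field_simps) (smt (verit) mult_nonneg_nonneg zero_le_power2)
      moreover have "2 / real (Suc i) \<le> 2 / real (Suc K)" "2 / real (Suc j) \<le> 2 / real (Suc K)"
        using ij by (auto simp: frac_le)
      ultimately have "(nrm (\<lambda>x. d i x - d j x))\<^sup>2 < e\<^sup>2" using par[of i j] by simp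
      then show "nrm (\<lambda>x. d i x - d j x) < e"
        using e by (simp add: power_less_imp_less_base)
    qed
  qed (use d in auto)
  then obtain y where y: "y \<in> Y" and lim: "(\<lambda>n. nrm (\<lambda>x. d n x - y x)) \<longlonglongrightarrow> 0" by blast
  have yX: "y \<in> X" using y Y by auto
  have orth: "ip (\<lambda>x. h x - y x) g = 0" if g: "g \<in> D" for g
  proof -
    have gX: "g \<in> X" using g D by auto
    let ?p = "\<lambda>n. ip (\<lambda>x. h x - d n x) g"
    have bound: "(norm (?p n))\<^sup>2 \<le> (1 / real (Suc n)) * (1 + (nrm g)\<^sup>2)" for n
    proof -
      \<comment> \<open>The optimal step would be \<open>1 / (nrm g)\<^sup>2\<close>; adding
        \<open>1\<close> avoids division by a vanishing seminorm and still gives a bound that tends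
        to \<open>0\<close> with \<open>n\<close>.\<close>
      define t where "t = 1 / (1 + (nrm g)\<^sup>2)"
      have pos: "1 + (nrm g)\<^sup>2 > 0" by (simp add: add_pos_nonneg)
      define c where "c = of_real t * ?p n"
      have u: "(\<lambda>x. h x - d n x) \<in> X" using h dX by (auto intro: diff_closed)
      have cg: "(\<lambda>x. c * g x) \<in> X" using gX by (rule scale_closed)
      have in_D: "(\<lambda>x. 1 * d n x + c * g x) \<in> D" using comb d g by blast
      have "m \<le> (nrm (\<lambda>x. (h x - d n x) - c * g x))\<^sup>2"
        using m_le[OF in_D] by (simp add: N_def algebra_simps)
      also have "\<dots> = N (d n) + (nrm (\<lambda>x. c * g x))\<^sup>2 - 2 * Re (ip (\<lambda>x. h x - d n x) (\<lambda>x. c * g x))"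
        using nrm_sq_diff[OF u cg] by (simp add: N_def)
      also have "ip (\<lambda>x. h x - d n x) (\<lambda>x. c * g x) = of_real (t * (norm (?p n))\<^sup>2)"
        by (simp only: ip_scale_right[OF gX u]) (simp add: c_def of_real_norm_sq mult_ac)
      also have "(nrm (\<lambda>x. c * g x))\<^sup>2 = t * (norm (?p n))\<^sup>2 * (t * (nrm g)\<^sup>2)"
        by (simp add: nrm_scale[OF gX] c_def norm_mult power_mult_distrib power2_eq_square)
      finally have "t * (norm (?p n))\<^sup>2 * (2 - t * (nrm g)\<^sup>2) \<le> N (d n) - m"
        by (simp add: algebra_simps)
      moreover have "t * (nrm g)\<^sup>2 \<le> 1" using pos by (simp add: t_def field_simps)
      moreover have "0 \<le> t * (norm (?p n))\<^sup>2" using pos by (simp add: t_def)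
      ultimately have "t * (norm (?p n))\<^sup>2 \<le> N (d n) - m"
        using mult_left_mono[of 1 "2 - t * (nrm g)\<^sup>2" "t * (norm (?p n))\<^sup>2"] by simp
      then have "t * (norm (?p n))\<^sup>2 \<le> 1 / real (Suc n)" using d(2)[of n] by simp
      then show ?thesis using pos by (simp add: t_def field_simps)
    qed
    have hd: "(\<lambda>n. nrm (\<lambda>x. (h x - d n x) - (h x - y x))) \<longlonglongrightarrow> 0"
      using lim nrm_diff_commute[OF dX yX] by simp
    have "(\<lambda>n. ?p n) \<longlonglongrightarrow> ip (\<lambda>x. h x - y x) g"
      by (rule tendsto_ip_left[OF _ _ gX hd]) (use h dX yX in \<open>auto intro: diff_closed\<close>)
    then have "(\<lambda>n. (norm (?p n))\<^sup>2) \<longlonglongrightarrow> (norm (ip (\<lambda>x. h x - y x) g))\<^sup>2"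
      by (intro tendsto_intros)
    moreover have "(\<lambda>n. (norm (?p n))\<^sup>2) \<longlonglongrightarrow> 0"
    proof (rule tendsto_sandwich[where f = "\<lambda>_. 0"])
      show "(\<lambda>n. (1 / real (Suc n)) * (1 + (nrm g)\<^sup>2)) \<longlonglongrightarrow> 0"
        using tendsto_mult_right[OF LIMSEQ_inverse_real_of_nat, of "1 + (nrm g)\<^sup>2"] by (simp add: inverse_eq_divide)
    qed (use bound in auto)
    ultimately have "(norm (ip (\<lambda>x. h x - y x) g))\<^sup>2 = 0" using LIMSEQ_unique by blast
    then show ?thesis by simp
  qed
  show ?thesis using that[OF y d(1) lim orth] .
qed

end

section \<open>Square-integrable functions: inner product, Fatou's lemma, completeness\<close>

lemma L2_mult_integrable:
  assumes "f \<in> L2_space M" "g \<in> L2_space M"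
  shows "integrable M (\<lambda>x. f x * cnj (g x))"
proof (rule Bochner_Integration.integrable_bound)
  have [measurable]: "f \<in> borel_measurable M" "g \<in> borel_measurable M" using assms by (auto simp: L2_space_def)
  show "integrable M (\<lambda>x. (norm (f x))\<^sup>2 + (norm (g x))\<^sup>2)"
    using assms by (auto simp: L2_space_def)
  show "(\<lambda>x. f x * cnj (g x)) \<in> borel_measurable M" by measurable
  have "norm (a * cnj b) \<le> (norm a)\<^sup>2 + (norm b)\<^sup>2" for a b :: complex
    using sum_squares_bound[of "norm a" "norm b"] mult_nonneg_nonneg[OF norm_ge_zero[of a] norm_ge_zero[of b]]
    unfolding norm_mult complex_mod_cnj by linarith
  then show "AE x in M. norm (f x * cnj (g x)) \<le> norm ((norm (f x))\<^sup>2 + (norm (g x))\<^sup>2)" by simp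
qed

lemma L2_add:
  assumes "f \<in> L2_space M" "g \<in> L2_space M"
  shows "(\<lambda>x. f x + g x) \<in> L2_space M"
proof -
  have [measurable]: "f \<in> borel_measurable M" "g \<in> borel_measurable M" using assms by (auto simp: L2_space_def)
  have "integrable M (\<lambda>x. (norm (f x + g x))\<^sup>2)"
  proof (rule Bochner_Integration.integrable_bound)
    show "integrable M (\<lambda>x. 2 * (norm (f x))\<^sup>2 + 2 * (norm (g x))\<^sup>2)"
      using assms by (auto simp: L2_space_def)
    have "(norm (a + b))\<^sup>2 \<le> 2 * (norm a)\<^sup>2 + 2 * (norm b)\<^sup>2" for a b :: complex
    proof -
      have "(norm (a + b))\<^sup>2 \<le> (norm a + norm b)\<^sup>2" by (intro power_mono norm_triangle_ineq) auto
      then show ?thesis using sum_squares_bound[of "norm a" "norm b"] by (simp add: power2_sum)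
    qed
    then show "AE x in M. norm ((norm (f x + g x))\<^sup>2) \<le> norm (2 * (norm (f x))\<^sup>2 + 2 * (norm (g x))\<^sup>2)" by simp
  qed measurable
  then show ?thesis by (simp add: L2_space_def)
qed

lemma L2_scale: "f \<in> L2_space M \<Longrightarrow> (\<lambda>x. c * f x) \<in> L2_space M"
  by (auto simp: L2_space_def norm_mult power_mult_distrib)

interpretation L2: semi_inner_space "L2_space M" "L2_inner M" for M :: "'a measure"
proof
  fix f g h :: "'a \<Rightarrow> complex" and c
  assume f: "f \<in> L2_space M" and g: "g \<in> L2_space M" and h: "h \<in> L2_space M"
  show "L2_inner M (\<lambda>x. f x + g x) h = L2_inner M f h + L2_inner M g h"
    unfolding L2_inner_def distrib_right using f g h
    by (intro Bochner_Integration.integral_add L2_mult_integrable)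
next
  fix f g :: "'a \<Rightarrow> complex"
  show "cnj (L2_inner M f g) = L2_inner M g f"
    by (simp add: L2_inner_def mult.commute flip: Bochner_Integration.integral_cnj)
next
  fix f :: "'a \<Rightarrow> complex"
  have "L2_inner M f f = (\<integral>x. of_real ((norm (f x))\<^sup>2) \<partial>M)"
    by (simp add: L2_inner_def of_real_norm_sq)
  then show "0 \<le> Re (L2_inner M f f)"
    by (simp add: integral_complex_of_real del: of_real_power)
qed (auto intro: L2_add L2_scale simp: L2_inner_def mult.assoc)

lemma L2_nrm: "L2.nrm M f = sqrt (\<integral>x. (norm (f x))\<^sup>2 \<partial>M)"
proof -
  have "L2_inner M f f = (\<integral>x. of_real ((norm (f x))\<^sup>2) \<partial>M)"
    by (simp add: L2_inner_def of_real_norm_sq)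
  then show ?thesis
    by (simp add: L2.nrm_def integral_complex_of_real del: of_real_power)
qed

lemma L2_nrm_le:
  assumes [measurable]: "f \<in> borel_measurable M"
    and le: "(\<integral>\<^sup>+x. ennreal ((norm (f x))\<^sup>2) \<partial>M) \<le> ennreal (c\<^sup>2)" and c: "0 \<le> c"
  shows "f \<in> L2_space M" "L2.nrm M f \<le> c"
proof -
  have int: "integrable M (\<lambda>x. (norm (f x))\<^sup>2)"
    using le by (intro integrableI_nonneg) (auto simp: top.not_eq_extremum[symmetric] dest: order_le_less_trans[OF _ ennreal_less_top])
  then show "f \<in> L2_space M" by (simp add: L2_space_def)
  have "(\<integral>x. (norm (f x))\<^sup>2 \<partial>M) \<le> c\<^sup>2"
    using le nn_integral_eq_integral[OF int] by (simp add: ennreal_le_iff)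
  then show "L2.nrm M f \<le> c"
    unfolding L2_nrm using c by (intro real_le_lsqrt) auto
qed

lemma nn_integral_L2_nrm:
  assumes "f \<in> L2_space M"
  shows "(\<integral>\<^sup>+x. ennreal ((norm (f x))\<^sup>2) \<partial>M) = ennreal ((L2.nrm M f)\<^sup>2)"
  using assms by (subst nn_integral_eq_integral) (auto simp: L2_space_def L2_nrm)

text \<open>Lets a pointwise limit inherit a norm bound; it serves for completeness, for radial
  limits and for limits of images under \<open>W\<close>.\<close>

lemma L2_fatou:
  assumes F: "\<And>n. F n \<in> L2_space M" and [measurable]: "g \<in> borel_measurable M"
    and lim: "AE x in M. (\<lambda>n. F n x) \<longlonglongrightarrow> g x"
    and le: "\<forall>\<^sub>F n in sequentially. L2.nrm M (F n) \<le> c" and c: "0 \<le> c"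
  shows "g \<in> L2_space M" "L2.nrm M g \<le> c"
proof -
  have [measurable]: "F n \<in> borel_measurable M" for n using F by (auto simp: L2_space_def)
  have "(\<integral>\<^sup>+x. ennreal ((norm (g x))\<^sup>2) \<partial>M) = (\<integral>\<^sup>+x. liminf (\<lambda>n. ennreal ((norm (F n x))\<^sup>2)) \<partial>M)"
  proof (rule nn_integral_cong_AE, use lim in eventually_elim)
    fix x assume "(\<lambda>n. F n x) \<longlonglongrightarrow> g x"
    then have "(\<lambda>n. ennreal ((norm (F n x))\<^sup>2)) \<longlonglongrightarrow> ennreal ((norm (g x))\<^sup>2)"
      by (intro tendsto_ennrealI tendsto_intros)
    then show "ennreal ((norm (g x))\<^sup>2) = liminf (\<lambda>n. ennreal ((norm (F n x))\<^sup>2))"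
      by (rule lim_imp_Liminf[symmetric, OF trivial_limit_sequentially])
  qed
  also have "\<dots> \<le> liminf (\<lambda>n. \<integral>\<^sup>+x. ennreal ((norm (F n x))\<^sup>2) \<partial>M)"
    by (rule nn_integral_liminf) measurable
  also have "\<dots> = liminf (\<lambda>n. ennreal ((L2.nrm M (F n))\<^sup>2))"
    using F by (simp add: nn_integral_L2_nrm)
  also have "\<dots> \<le> liminf (\<lambda>n. ennreal (c\<^sup>2))"
  proof (rule Liminf_mono, use le in eventually_elim)
    fix n assume "L2.nrm M (F n) \<le> c"
    then show "ennreal ((L2.nrm M (F n))\<^sup>2) \<le> ennreal (c\<^sup>2)"
      using F by (intro ennreal_leI power_mono) auto
  qed
  also have "\<dots> = ennreal (c\<^sup>2)" by (simp add: Liminf_const)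
  finally show "g \<in> L2_space M" "L2.nrm M g \<le> c" using L2_nrm_le[of g M c] c by auto
qed

lemma L2_integrable:
  assumes "finite_measure M" "f \<in> L2_space M"
  shows "integrable M f"
    and "(\<integral>x. norm (f x) \<partial>M) \<le> L2.nrm M f * sqrt (measure M (space M))"
proof -
  interpret finite_measure M by fact
  have one: "(\<lambda>_. 1) \<in> L2_space M" by (simp add: L2_space_def)
  show "integrable M f" using L2_mult_integrable[OF assms(2) one] by simp
  have nf: "(\<lambda>x. of_real (norm (f x))) \<in> L2_space M" using assms by (auto simp: L2_space_def)
  have "norm (L2_inner M (\<lambda>x. of_real (norm (f x))) (\<lambda>_. 1)) \<le> L2.nrm M (\<lambda>x. of_real (norm (f x))) * L2.nrm M (\<lambda>_. 1)"
    by (rule L2.cauchy_schwarz[OF nf one])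
  then show "(\<integral>x. norm (f x) \<partial>M) \<le> L2.nrm M f * sqrt (measure M (space M))"
    by (simp add: L2_inner_def L2_nrm integral_complex_of_real)
qed

text \<open>The Riesz-Fischer argument: a fast subsequence has increments summable in L1, because
  the measure is finite, and so converges almost everywhere; \<open>L2_fatou\<close> then compares
  the full sequence with this limit.\<close>

theorem L2_complete:
  assumes M: "finite_measure M" and d: "\<And>n. d n \<in> L2_space M"
    and cauchy: "\<And>e. e > 0 \<Longrightarrow> \<exists>N. \<forall>m\<ge>N. \<forall>n\<ge>N. L2.nrm M (\<lambda>x. d m x - d n x) < e"
  shows "\<exists>y\<in>L2_space M. (\<lambda>n. L2.nrm M (\<lambda>x. d n x - y x)) \<longlonglongrightarrow> 0"
proof -
  interpret finite_measure M by fact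
  have [measurable]: "d n \<in> borel_measurable M" for n using d by (auto simp: L2_space_def)
  obtain N where N: "\<And>k m n. m \<ge> N k \<Longrightarrow> n \<ge> N k \<Longrightarrow> L2.nrm M (\<lambda>x. d m x - d n x) < (1/2) ^ k"

  proof -
    have "\<exists>N. \<forall>m\<ge>N. \<forall>n\<ge>N. L2.nrm M (\<lambda>x. d m x - d n x) < (1/2) ^ k" for k
      by (rule cauchy) simp
    then show ?thesis using that by metis
  qed
  \<comment> \<open>Partial sums of \<open>N\<close> give indices that are both nondecreasing and at
    least \<open>N k\<close>.\<close>
  define p where "p k = (\<Sum>i\<le>k. N i)" for k
  have pN: "p k \<ge> N k" for k unfolding p_def by (rule member_le_sum) auto
  have pmono: "p k \<le> p (Suc k)" for k by (simp add: p_def)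
  have diff_L2: "(\<lambda>x. d i x - d j x) \<in> L2_space M" for i j using d by (intro L2.diff_closed)
  have int: "integrable M (\<lambda>x. d (p (Suc k)) x - d (p k) x)" for k
    using L2_integrable(1)[OF M diff_L2] .
  have bound: "(\<integral>x. norm (d (p (Suc k)) x - d (p k) x) \<partial>M) \<le> (1/2) ^ k * sqrt (measure M (space M))" for k
  proof -
    have "L2.nrm M (\<lambda>x. d (p (Suc k)) x - d (p k) x) \<le> (1/2) ^ k"
      using N[of k "p (Suc k)" "p k"] pN[of k] pmono[of k] by simp
    then have "L2.nrm M (\<lambda>x. d (p (Suc k)) x - d (p k) x) * sqrt (measure M (space M)) \<le> (1/2) ^ k * sqrt (measure M (space M))"
      by (rule mult_right_mono) simp
    with L2_integrable(2)[OF M diff_L2] show ?thesis by (rule order_trans)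
  qed
  have "AE x in M. summable (\<lambda>k. norm (d (p (Suc k)) x - d (p k) x))"
  proof -
    have "(\<integral>\<^sup>+x. (\<Sum>k. ennreal (norm (d (p (Suc k)) x - d (p k) x))) \<partial>M)
       = (\<Sum>k. \<integral>\<^sup>+x. ennreal (norm (d (p (Suc k)) x - d (p k) x)) \<partial>M)"
      by (rule nn_integral_suminf) measurable
    also have "\<dots> = (\<Sum>k. ennreal (\<integral>x. norm (d (p (Suc k)) x - d (p k) x) \<partial>M))"
      using int by (intro suminf_cong nn_integral_eq_integral) auto
    also have "\<dots> \<le> (\<Sum>k. ennreal ((1/2) ^ k * sqrt (measure M (space M))))"
      using bound by (intro suminf_le ennreal_leI) auto
    also have "\<dots> = ennreal (\<Sum>k. (1/2) ^ k * sqrt (measure M (space M)))"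
      by (rule suminf_ennreal2) (auto intro!: summable_mult2 summable_geometric)
    also have "\<dots> < \<infinity>" by simp
    finally have "AE x in M. (\<Sum>k. ennreal (norm (d (p (Suc k)) x - d (p k) x))) \<noteq> \<infinity>"
      by (intro nn_integral_noteq_infinite) auto
    then show ?thesis
      by eventually_elim (auto intro: summable_suminf_not_top)
  qed
  define y where "y x = lim (\<lambda>k. d (p k) x)" for x
  have [measurable]: "y \<in> borel_measurable M" unfolding y_def by measurable
  have lim_y: "AE x in M. (\<lambda>k. d (p k) x) \<longlonglongrightarrow> y x"
    using \<open>AE x in M. summable (\<lambda>k. norm (d (p (Suc k)) x - d (p k) x))\<close>
  proof eventually_elim
    fix x assume "summable (\<lambda>k. norm (d (p (Suc k)) x - d (p k) x))"
    then have "convergent (\<lambda>n. \<Sum>k<n. d (p (Suc k)) x - d (p k) x)"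
      unfolding summable_iff_convergent[symmetric] by (rule summable_norm_cancel)
    then have "convergent (\<lambda>n. d (p n) x - d (p 0) x)"
      by (simp only: sum_lessThan_telescope[of "\<lambda>k. d (p k) x"])
    then have "convergent (\<lambda>n. (d (p n) x - d (p 0) x) + d (p 0) x)"
      by (rule convergent_add[OF _ convergent_const])
    then show "(\<lambda>k. d (p k) x) \<longlonglongrightarrow> y x"
      by (simp add: y_def convergent_LIMSEQ_iff)
  qed
  have key: "(\<lambda>x. d n x - y x) \<in> L2_space M \<and> L2.nrm M (\<lambda>x. d n x - y x) \<le> (1/2) ^ k" if "n \<ge> N k" for n k
  proof -
    have "\<forall>\<^sub>F i in sequentially. L2.nrm M (\<lambda>x. d n x - d (p i) x) \<le> (1/2) ^ k"
    proof (rule eventually_sequentiallyI[of k])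
      fix i assume "k \<le> i"
      then have "p k \<le> p i" by (rule lift_Suc_mono_le[of p, OF pmono])
      then show "L2.nrm M (\<lambda>x. d n x - d (p i) x) \<le> (1/2) ^ k"
        using N[of k n "p i"] that pN[of k] by simp
    qed
    moreover have "AE x in M. (\<lambda>i. d n x - d (p i) x) \<longlonglongrightarrow> d n x - y x"
      using lim_y by eventually_elim (intro tendsto_intros)
    ultimately show ?thesis
      using L2_fatou[of "\<lambda>i x. d n x - d (p i) x" M "\<lambda>x. d n x - y x" "(1/2) ^ k"] diff_L2 by auto
  qed
  \<comment> \<open>\<open>key\<close> controls only differences with \<open>y\<close>, so
    membership of \<open>y\<close> is read off from a difference of two members.\<close>
  have "(\<lambda>x. d (N 0) x - (d (N 0) x - y x)) \<in> L2_space M"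
    by (rule L2.diff_closed[OF d]) (use key[of 0 "N 0"] in simp)
  then have y: "y \<in> L2_space M" by simp
  have "(\<lambda>n. L2.nrm M (\<lambda>x. d n x - y x)) \<longlonglongrightarrow> 0"
  proof (rule LIMSEQ_I)
    fix e :: real assume "e > 0"
    then obtain k where "(1/2) ^ k < e" using real_arch_pow_inv[of e "1/2"] by auto
    then show "\<exists>no. \<forall>n\<ge>no. norm (L2.nrm M (\<lambda>x. d n x - y x) - 0) < e"
      using key[of k] by (intro exI[of _ "N k"]) (auto simp: L2.nrm_nonneg intro: order_le_less_trans)
  qed
  with y show ?thesis by blast
qed

section \<open>The maximal inequality for Poisson integrals\<close>

text \<open>The Poisson kernel of the unit disc at radius \<open>r\<close> and angle
  \<open>2 * pi * t\<close>.\<close>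

definition poisson :: "real \<Rightarrow> real \<Rightarrow> real" where
  "poisson r t = (1 - r\<^sup>2) / (1 - 2 * r * cos (2 * pi * t) + r\<^sup>2)"

lemma norm_one_minus_circ: "(norm (1 - of_real r * circ t))\<^sup>2 = 1 - 2 * r * cos (2 * pi * t) + r\<^sup>2"
proof -
  have "(norm (1 - of_real r * circ t))\<^sup>2 = (1 - r * cos (2 * pi * t))\<^sup>2 + (r * sin (2 * pi * t))\<^sup>2"
    by (simp add: cmod_power2 circ_def)
  also have "\<dots> = 1 - 2 * r * cos (2 * pi * t) + r\<^sup>2 * ((sin (2 * pi * t))\<^sup>2 + (cos (2 * pi * t))\<^sup>2)"
    by algebra
  finally show ?thesis by simp
qed

lemma poisson_denom_pos:
  assumes "0 \<le> r" "r < 1"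
  shows "0 < 1 - 2 * r * cos (2 * pi * t) + r\<^sup>2"
proof -
  have "norm (of_real r * circ t) < 1" using assms by (simp add: norm_mult)
  then have "1 - of_real r * circ t \<noteq> 0" by (metis eq_iff_diff_eq_0 less_irrefl norm_one)
  then have "(norm (1 - of_real r * circ t))\<^sup>2 > 0" by simp
  then show ?thesis by (simp only: norm_one_minus_circ)
qed

lemma poisson_nonneg: "0 \<le> r \<Longrightarrow> r < 1 \<Longrightarrow> 0 \<le> poisson r t"
  unfolding poisson_def using poisson_denom_pos[of r t]
  by (intro divide_nonneg_pos) (auto simp: power_le_one)

lemma continuous_poisson: "0 \<le> r \<Longrightarrow> r < 1 \<Longrightarrow> continuous_on A (poisson r)"
  unfolding poisson_def using poisson_denom_pos[of r]
  by (intro continuous_intros) (auto simp: less_le)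

lemma poisson_reflect: "poisson r (1 - t) = poisson r t"
  using cos_diff[of "2 * pi" "2 * pi * t"] by (simp add: poisson_def right_diff_distrib)

lemma DERIV_poisson:
  assumes "0 \<le> r" "r < 1"
  shows "(poisson r has_real_derivative
    - ((1 - r\<^sup>2) * (4 * pi * r * sin (2 * pi * t))) / (1 - 2 * r * cos (2 * pi * t) + r\<^sup>2)\<^sup>2) (at t)"
proof -
  have "((\<lambda>t. (1 - r\<^sup>2) / (1 - 2 * r * cos (2 * pi * t) + r\<^sup>2)) has_real_derivative
    - ((1 - r\<^sup>2) * (4 * pi * r * sin (2 * pi * t))) / (1 - 2 * r * cos (2 * pi * t) + r\<^sup>2)\<^sup>2) (at t)"
    using poisson_denom_pos[OF assms, of t]
    by (auto intro!: derivative_eq_intros simp: power2_eq_square)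
  then show ?thesis by (simp add: poisson_def[abs_def])
qed

text \<open>Applied to open intervals exceeding the range in use, which gives two-sided derivatives
  at the endpoints of that range.\<close>

lemma antiderivative_on_interval:
  fixes f :: "real \<Rightarrow> real"
  assumes "continuous_on UNIV f"
  obtains A where "\<And>x. a < x \<Longrightarrow> x < b \<Longrightarrow> (A has_real_derivative f x) (at x)"
proof
  fix x assume x: "a < x" "x < b"
  have "((\<lambda>x. integral {a..x} f) has_real_derivative f x) (at x within {a..b})"
    using assms x by (intro integral_has_real_derivative) (auto intro: continuous_on_subset)
  moreover have "at x within {a..b} = at x"
    using x by (intro at_within_interior) auto
  ultimately show "((\<lambda>x. integral {a..x} f) has_real_derivative f x) (at x)" by simp
qed

lemma integral_antiderivative:
  fixes f :: "real \<Rightarrow> real"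
  assumes "c \<le> d" "\<And>x. c \<le> x \<Longrightarrow> x \<le> d \<Longrightarrow> (A has_real_derivative f x) (at x)"
  shows "integral {c..d} f = A d - A c"
  using assms by (intro integral_unique fundamental_theorem_of_calculus)
    (auto simp: has_real_derivative_iff_has_vector_derivative[symmetric] intro: has_field_derivative_at_within)

text \<open>The symmetric averages \<open>H\<close> enter through integration by parts, written as monotonicity of
  \<open>Q\<close>: its derivative is the product of the nonpositive \<open>H\<close> and the derivative of the kernel,
  which is nonpositive on the half circle.\<close>

lemma poisson_layer_cake:
  fixes g :: "real \<Rightarrow> real"
  assumes cont: "continuous_on UNIV g" and per: "\<And>x. g (x + 1) = g x" and r: "0 \<le> r" "r < 1"
    and avg: "\<And>h. 0 < h \<Longrightarrow> h \<le> 1/2 \<Longrightarrow> integral {s - h..s + h} g \<le> 2 * h * l"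
  shows "integral {0..1} (\<lambda>t. poisson r t * (g (s + t) - l)) \<le> 0"
proof -
  obtain A where A: "\<And>x. s - 1 < x \<Longrightarrow> x < s + 1 \<Longrightarrow> (A has_real_derivative g x) (at x)"
    using antiderivative_on_interval[OF cont, of "s - 1" "s + 1"] by blast
  have "continuous_on UNIV (\<lambda>t. poisson r t * (g (s + t) - l))"
    by (intro continuous_intros continuous_poisson r continuous_on_compose2[OF cont]) auto
  then obtain B where B: "\<And>x. -1 < x \<Longrightarrow> x < 2 \<Longrightarrow> (B has_real_derivative poisson r x * (g (s + x) - l)) (at x)"
    using antiderivative_on_interval[of _ "-1" 2] by blast
  \<comment> \<open>\<open>H h\<close> is the integral of \<open>g - l\<close> over the symmetric
    interval of radius \<open>h\<close>. The bracket subtracted in \<open>Q\<close> is the weighted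
    integral over the two arcs \<open>{0..h}\<close> and \<open>{1 - h..1}\<close>, which meet at
    \<open>h = 1/2\<close> and then cover the circle.\<close>
  define H where "H h = A (s + h) - A (s - h) - 2 * h * l" for h
  define Q where "Q h = poisson r h * H h - (B h - B 0 + B 1 - B (1 - h))" for h
  have H: "H h \<le> 0" if "0 \<le> h" "h \<le> 1/2" for h
  proof (cases "h = 0")
    case False
    have "integral {s - h..s + h} g = A (s + h) - A (s - h)"
      using that by (intro integral_antiderivative A) auto
    then show ?thesis using avg[of h] that False by (simp add: H_def)
  qed (simp add: H_def)
  have "Q 0 \<le> Q (1/2)"
  proof (rule DERIV_nonneg_imp_nondecreasing[of 0 "1/2" Q])
    fix h :: real assume h: "0 \<le> h" "h \<le> 1/2"
    define P' where "P' = - ((1 - r\<^sup>2) * (4 * pi * r * sin (2 * pi * h))) / (1 - 2 * r * cos (2 * pi * h) + r\<^sup>2)\<^sup>2"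
    have P: "(poisson r has_real_derivative P') (at h)"
      unfolding P'_def by (rule DERIV_poisson[OF r])
    have A1: "((\<lambda>h. A (s + h)) has_real_derivative g (s + h) * 1) (at h)"
      using h by (intro DERIV_chain2[OF A]) (auto intro!: derivative_eq_intros)
    have A2: "((\<lambda>h. A (s - h)) has_real_derivative g (s - h) * (- 1)) (at h)"
      using h by (intro DERIV_chain2[OF A]) (auto intro!: derivative_eq_intros)
    have B2: "((\<lambda>h. B (1 - h)) has_real_derivative poisson r (1 - h) * (g (s + (1 - h)) - l) * (- 1)) (at h)"
      using h by (intro DERIV_chain2[OF B]) (auto intro!: derivative_eq_intros)
    have B1: "(B has_real_derivative poisson r h * (g (s + h) - l)) (at h)"
      using h by (intro B) auto
    have "g (s + (1 - h)) = g (s - h)" using per[of "s - h"] by (simp add: algebra_simps)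
    moreover have L: "((\<lambda>h. 2 * h * l) has_real_derivative 2 * l) (at h)"
      by (auto intro!: derivative_eq_intros)
    have HD: "(H has_real_derivative (g (s + h) * 1 - g (s - h) * (- 1) - 2 * l)) (at h)"
      unfolding H_def[abs_def] by (intro DERIV_diff A1 A2 L)
    have BD: "((\<lambda>h. B h - B 0 + B 1 - B (1 - h)) has_real_derivative
        (poisson r h * (g (s + h) - l) - 0 + 0 - poisson r (1 - h) * (g (s + (1 - h)) - l) * (- 1))) (at h)"
      by (intro DERIV_diff DERIV_add B1 B2 DERIV_const)
    note DERIV_diff[OF DERIV_mult[OF P HD] BD, folded Q_def]
    ultimately have "(Q has_real_derivative P' * H h) (at h)"
      by (simp add: poisson_reflect algebra_simps)
    moreover have "P' \<le> 0"
      unfolding P'_def using h r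
      by (intro divide_nonpos_nonneg) (auto intro!: mult_nonneg_nonneg sin_ge_zero simp: power_le_one)
    ultimately show "\<exists>y. (Q has_real_derivative y) (at h) \<and> 0 \<le> y"
      using H[OF h] mult_nonpos_nonpos by blast
  qed simp
  moreover have "poisson r (1/2) * H (1/2) \<le> 0"
    using H[of "1/2"] poisson_nonneg[OF r] by (intro mult_nonneg_nonpos) auto
  \<comment> \<open>\<open>Q 0 = 0\<close>, and at \<open>h = 1/2\<close> the two midpoint values of
    \<open>B\<close> cancel, so \<open>B 1 - B 0\<close> is at most the boundary term.\<close>
  ultimately have "B 1 - B 0 \<le> 0"
    by (simp add: Q_def) (simp add: H_def)
  moreover have "integral {0..1} (\<lambda>t. poisson r t * (g (s + t) - l)) = B 1 - B 0"
    by (intro integral_antiderivative B) auto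
  ultimately show ?thesis by simp
qed

text \<open>The inequality is subharmonicity of the squared modulus: the Poisson formula holds with
  equality for the holomorphic square of \<open>G\<close>, and moduli are taken afterwards. That
  formula is the Cauchy formula for the square divided by \<open>1 - r u\<close>; the constant
  \<open>G = 1\<close> gives the total mass of the kernel.\<close>

lemma poisson_integrals:
  assumes G: "G holomorphic_on ball 0 R" "R > 1" and r: "0 \<le> r" "r < 1"
  shows "(norm (G (of_real r * circ s)))\<^sup>2 \<le> integral {0..1} (\<lambda>t. poisson r t * (norm (G (circ (s + t))))\<^sup>2)"
    and "integral {0..1} (poisson r) = 1"
proof -
  have key: "(\<integral>t. of_real (poisson r t) * (G (circ (s + t)))\<^sup>2 \<partial>unit_ivl) = (G (of_real r * circ s))\<^sup>2"
    if G: "G holomorphic_on ball 0 R" "R > 1" for G s R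
  proof -
    \<comment> \<open>A radius above \<open>1\<close>, yet small enough that \<open>1 - r u\<close>
      has no zero in the disc: \<open>r * (2 / (1 + r)) < 1\<close>.\<close>
    define R' where "R' = min R (2 / (1 + r))"
    have R': "R' > 1" "R' \<le> R" using G r by (auto simp: R'_def field_simps)
    have rR': "r * R' < 1"
    proof -
      have "r * R' \<le> r * (2 / (1 + r))" using r by (intro mult_left_mono) (auto simp: R'_def)
      also have "\<dots> < 1" using r by (simp add: field_simps)
      finally show ?thesis .
    qed
    define F where "F u = (G (u * circ s))\<^sup>2 / (1 - of_real r * u)" for u
    have "F holomorphic_on ball 0 R'"
      unfolding F_def
    proof (intro holomorphic_intros holomorphic_on_compose_gen[OF _ G(1), unfolded o_def])
      fix u :: complex assume u: "u \<in> ball 0 R'"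
      have "norm (of_real r * u) \<le> r * R'" using u r by (auto simp: norm_mult intro: mult_left_mono)
      then show "1 - of_real r * u \<noteq> 0" using rR' by (metis eq_iff_diff_eq_0 less_le_not_le norm_one order_le_less_trans order.refl)
    qed (use R' in \<open>auto simp: norm_mult\<close>)
    from circle_cauchy[OF this R'(1), of "of_real r"]
    have "(\<integral>t. F (circ t) / (1 - of_real r * cnj (circ t)) \<partial>unit_ivl) = F (of_real r)"
      using r by simp
    moreover have "F (circ t) / (1 - of_real r * cnj (circ t)) = of_real (poisson r t / (1 - r\<^sup>2)) * (G (circ (s + t)))\<^sup>2" for t
    proof -
      define D where "D = 1 - 2 * r * cos (2 * pi * t) + r\<^sup>2"
      have D: "(1 - of_real r * circ t) * (1 - of_real r * cnj (circ t)) = of_real D"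
        unfolding D_def using complex_norm_square[of "1 - of_real r * circ t"] by (simp add: norm_one_minus_circ)
      have "F (circ t) / (1 - of_real r * cnj (circ t)) = (G (circ (s + t)))\<^sup>2 / ((1 - of_real r * circ t) * (1 - of_real r * cnj (circ t)))"
        unfolding F_def circ_add[of s t] by (simp only: divide_divide_eq_left mult.commute[of "circ t" "circ s"])
      also have "\<dots> = of_real (1 / D) * (G (circ (s + t)))\<^sup>2" unfolding D by simp
      also have "1 - r\<^sup>2 \<noteq> 0" using r by (simp add: power2_eq_1_iff)
      then have "1 / D = poisson r t / (1 - r\<^sup>2)" unfolding poisson_def D_def[symmetric] by simp
      finally show ?thesis .
    qed
    moreover have "F (of_real r) = (G (of_real r * circ s))\<^sup>2 / of_real (1 - r\<^sup>2)"
      by (simp add: F_def power2_eq_square)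
    ultimately have "(\<integral>t. of_real (1 / (1 - r\<^sup>2)) * (of_real (poisson r t) * (G (circ (s + t)))\<^sup>2) \<partial>unit_ivl) = (G (of_real r * circ s))\<^sup>2 / of_real (1 - r\<^sup>2)"
      by (simp add: mult_ac)
    moreover have "1 - r\<^sup>2 \<noteq> 0" using r by (simp add: power2_eq_1_iff)
    ultimately show ?thesis
      by (simp only: integral_mult_right_zero) (simp add: field_simps del: of_real_diff of_real_power)
  qed
  have contG: "continuous_on (cball 0 1) G"
    using G by (intro holomorphic_on_imp_continuous_on holomorphic_on_subset[OF G(1)]) auto
  have cont: "continuous_on UNIV (\<lambda>t. (norm (G (circ (s + t))))\<^sup>2)"
    by (intro continuous_intros continuous_on_compose2[OF contG]) auto
  have "(norm (G (of_real r * circ s)))\<^sup>2 = norm (\<integral>t. of_real (poisson r t) * (G (circ (s + t)))\<^sup>2 \<partial>unit_ivl)"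
    using key[OF G] by (simp add: norm_power)
  also have "\<dots> \<le> (\<integral>t. norm (of_real (poisson r t) * (G (circ (s + t)))\<^sup>2) \<partial>unit_ivl)"
    by (rule integral_norm_bound)
  also have "\<dots> = (\<integral>t. poisson r t * (norm (G (circ (s + t))))\<^sup>2 \<partial>unit_ivl)"
    by (simp add: norm_mult norm_power poisson_nonneg r)
  also have "\<dots> = integral {0..1} (\<lambda>t. poisson r t * (norm (G (circ (s + t))))\<^sup>2)"
    by (intro integral_unit_ivl continuous_intros continuous_poisson r continuous_on_subset[OF cont]) auto
  finally show "(norm (G (of_real r * circ s)))\<^sup>2 \<le> integral {0..1} (\<lambda>t. poisson r t * (norm (G (circ (s + t))))\<^sup>2)" .
  have "(\<integral>t. complex_of_real (poisson r t) \<partial>unit_ivl) = 1"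
    using key[of "\<lambda>_. 1" 2 0] by simp
  then have "(\<integral>t. poisson r t \<partial>unit_ivl) = 1"
    by (simp add: integral_complex_of_real)
  then show "integral {0..1} (poisson r) = 1"
    by (subst (asm) integral_unit_ivl) (auto intro: continuous_poisson r)
qed

text \<open>Contrapositive of \<open>poisson_layer_cake\<close>: if all symmetric averages were at
  most \<open>l\<close>, so would be the Poisson integral, which dominates the value inside the
  disc.\<close>

lemma maximal_point:
  assumes G: "G holomorphic_on ball 0 R" "R > 1" and r: "0 \<le> r" "r < 1"
    and l: "l < (norm (G (of_real r * circ s)))\<^sup>2"
  shows "\<exists>h. 0 < h \<and> h \<le> 1/2 \<and> 2 * h * l < integral {s - h..s + h} (\<lambda>t. (norm (G (circ t)))\<^sup>2)"
proof (rule ccontr)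
  assume neg: "\<not> ?thesis"
  define g where "g t = (norm (G (circ t)))\<^sup>2" for t
  have contG: "continuous_on (cball 0 1) G"
    using G by (intro holomorphic_on_imp_continuous_on holomorphic_on_subset[OF G(1)]) auto
  have cont: "continuous_on UNIV g"
    unfolding g_def by (intro continuous_intros continuous_on_compose2[OF contG]) auto
  have per: "g (x + 1) = g x" for x using circ_of_int[of 1] by (simp add: g_def circ_add)
  have "integral {0..1} (\<lambda>t. poisson r t * (g (s + t) - l)) \<le> 0"
    using neg by (intro poisson_layer_cake cont per r) (auto simp: g_def[abs_def] not_less)
  moreover have i1: "(\<lambda>t. poisson r t * g (s + t)) integrable_on {0..1}"
    by (intro integrable_continuous_real continuous_intros continuous_poisson r continuous_on_compose2[OF cont]) auto
  have i2: "(\<lambda>t. poisson r t * l) integrable_on {0..1}"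
    by (intro integrable_continuous_real continuous_intros continuous_poisson r)
  have "integral {0..1} (\<lambda>t. poisson r t * (g (s + t) - l))
      = integral {0..1} (\<lambda>t. poisson r t * g (s + t)) - integral {0..1} (\<lambda>t. poisson r t * l)"
    using Henstock_Kurzweil_Integration.integral_diff[OF i1 i2] by (simp add: right_diff_distrib)
  ultimately show False
    using poisson_integrals(1)[OF G r, of s] poisson_integrals(2)[OF G r] l by (simp add: g_def)
qed

text \<open>The weak-type maximal inequality by Vitali's covering lemma. The constant
  \<open>15\<close> is the product of \<open>5\<close>, from enlarging the disjoint intervals, and
  \<open>3\<close>, because these intervals lie within three periods of \<open>g\<close>.\<close>

lemma vitali_maximal:
  fixes g :: "real \<Rightarrow> real"
  assumes cont: "continuous_on UNIV g" and per: "\<And>x. g (x + 1) = g x" and nonneg: "\<And>x. 0 \<le> g x"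
    and l: "0 < l" and E: "E \<subseteq> {0..1}" "E \<in> sets borel"
    and avg: "\<And>s. s \<in> E \<Longrightarrow> \<exists>h. 0 < h \<and> h \<le> 1/2 \<and> 2 * h * l < integral {s - h..s + h} g"
  shows "emeasure lborel E \<le> ennreal (15 / l) * (\<integral>\<^sup>+t\<in>{0..1}. ennreal (g t) \<partial>lborel)"
proof -
  obtain h where h: "\<And>s. s \<in> E \<Longrightarrow> 0 < h s \<and> h s \<le> 1/2 \<and> 2 * h s * l < integral {s - h s..s + h s} g"
    using avg by metis
  have [measurable]: "g \<in> borel_measurable borel" using cont by (rule borel_measurable_continuous_onI)
  obtain C where C: "countable C" "C \<subseteq> E"
     "pairwise (\<lambda>i j. disjnt (cball i (h i)) (cball j (h j))) C"
     and cov: "\<And>i. i \<in> E \<Longrightarrow> \<exists>j. j \<in> C \<and> \<not> disjnt (cball i (h i)) (cball j (h j)) \<and> cball i (h i) \<subseteq> ball j (5 * h j)"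
    using Vitali_covering_lemma_cballs_balls[where K = E and r = h and B = "1/2" and a = "\<lambda>x. x"] h by blast
  \<comment> \<open>The measure with density \<open>g\<close> turns the sum of integrals over
    disjoint intervals into the mass of their union.\<close>
  define \<nu> where "\<nu> = density lborel (\<lambda>x. ennreal (g x))"
  have nu: "\<nu> {c..d} = ennreal (integral {c..d} g)" if "c \<le> d" for c d
  proof -
    have "\<nu> {c..d} = (\<integral>\<^sup>+x. ennreal (g x) * indicator {c..d} x \<partial>lborel)"
      unfolding \<nu>_def by (subst emeasure_density) auto
    also have "\<dots> = (\<integral>\<^sup>+x. ennreal (indicator {c..d} x *\<^sub>R g x) \<partial>lborel)"
      by (intro nn_integral_cong) (simp add: indicator_def)
    also have si: "set_integrable lborel {c..d} g"
      by (intro borel_integrable_atLeastAtMost' continuous_on_subset[OF cont]) auto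
    have "(\<integral>\<^sup>+x. ennreal (indicator {c..d} x *\<^sub>R g x) \<partial>lborel) = ennreal (LINT x:{c..d}|lborel. g x)"
      using si unfolding set_integrable_def set_lebesgue_integral_def
      by (intro nn_integral_eq_integral) (auto simp: nonneg)
    also have "(LINT x:{c..d}|lborel. g x) = integral {c..d} g"
      by (rule set_borel_integral_eq_integral(2)[OF si])
    finally show ?thesis .
  qed
  have "emeasure lborel E = (\<integral>\<^sup>+x. indicator E x \<partial>lborel)" using E by simp
  also have "\<dots> \<le> (\<integral>\<^sup>+x. (\<integral>\<^sup>+j. indicator (ball j (5 * h j)) x \<partial>count_space C) \<partial>lborel)"
  proof (rule nn_integral_mono)
    fix x :: real
    show "(indicator E x :: ennreal) \<le> (\<integral>\<^sup>+j. indicator (ball j (5 * h j)) x \<partial>count_space C)"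
    proof (cases "x \<in> E")
      case True
      then obtain j where j: "j \<in> C" "cball x (h x) \<subseteq> ball j (5 * h j)" using cov by blast
      moreover have "x \<in> cball x (h x)" using h[OF True] by simp
      ultimately have "x \<in> ball j (5 * h j)" by blast
      then have "(1::ennreal) = indicator (ball j (5 * h j)) x" by simp
      also have "\<dots> \<le> (\<integral>\<^sup>+j. indicator (ball j (5 * h j)) x \<partial>count_space C)"
        using j(1) by (rule nn_integral_ge_point)
      finally show ?thesis using True by simp
    qed simp
  qed
  also have "\<dots> = (\<integral>\<^sup>+j. (\<integral>\<^sup>+x. indicator (ball j (5 * h j)) x \<partial>lborel) \<partial>count_space C)"
    by (rule nn_integral_count_space_nn_integral) (use C in \<open>auto intro!: borel_measurable_indicator\<close>)
  also have "\<dots> \<le> (\<integral>\<^sup>+j. ennreal (5 / l) * \<nu> (cball j (h j)) \<partial>count_space C)"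
  proof (rule nn_integral_mono)
    fix j assume "j \<in> space (count_space C)"
    then have j: "j \<in> E" using C by auto
    have "(\<integral>\<^sup>+x. indicator (ball j (5 * h j)) x \<partial>lborel) = ennreal (10 * h j)"
      using h[OF j] by (simp add: ball_eq_greaterThanLessThan)
    also have "\<dots> \<le> ennreal (5 / l * integral {j - h j..j + h j} g)"
      using h[OF j] l by (intro ennreal_leI) (simp add: field_simps)
    also have "\<dots> = ennreal (5 / l) * \<nu> (cball j (h j))"
      using l h[OF j] by (subst ennreal_mult') (auto simp: cball_eq_atLeastAtMost nu)
    finally show "(\<integral>\<^sup>+x. indicator (ball j (5 * h j)) x \<partial>lborel) \<le> ennreal (5 / l) * \<nu> (cball j (h j))" .
  qed
  also have "\<dots> = ennreal (5 / l) * (\<integral>\<^sup>+j. \<nu> (cball j (h j)) \<partial>count_space C)"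
    by (rule nn_integral_cmult) auto
  also have "(\<integral>\<^sup>+j. \<nu> (cball j (h j)) \<partial>count_space C) = \<nu> (\<Union>j\<in>C. cball j (h j))"
    using C by (intro emeasure_UN_countable[symmetric])
      (auto simp: \<nu>_def disjoint_family_on_def pairwise_def disjnt_def)
  also have "\<dots> \<le> \<nu> {-1..2}"
  proof (rule emeasure_mono)
    show "(\<Union>j\<in>C. cball j (h j)) \<subseteq> {-1..2}"
    proof safe
      fix j x assume j: "j \<in> C" and x: "x \<in> cball j (h j)"
      have "j \<in> {0..1}" "h j \<le> 1/2" using j C E h by auto
      then show "x \<in> {-1..2}" using x by (auto simp: cball_eq_atLeastAtMost)
    qed
  qed (simp add: \<nu>_def)
  also have "\<nu> {-1..2} = 3 * \<nu> {0..1}"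
  proof -
    obtain A where A: "\<And>x. -3 < x \<Longrightarrow> x < 3 \<Longrightarrow> (A has_real_derivative g x) (at x)"
      using antiderivative_on_interval[OF cont, of "-3" 3] by blast
    have AI: "integral {c..d} g = A d - A c" if "-3 < c" "c \<le> d" "d < 3" for c d
      using that by (intro integral_antiderivative A) auto
    have shift: "A (x + 1) - A x = A 1 - A 0" if "x \<in> {-1..1}" for x
    proof -
      have "((\<lambda>x. A (x + 1) - A x) has_real_derivative 0) (at y within {-1..1})" if "y \<in> {-1..1}" for y
      proof -
        have "((\<lambda>x. A (x + 1)) has_real_derivative g (y + 1) * 1) (at y)"
          using that by (intro DERIV_chain2[OF A]) (auto intro!: derivative_eq_intros)
        then have "((\<lambda>x. A (x + 1) - A x) has_real_derivative g (y + 1) * 1 - g y) (at y)"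
          using A[of y] that by (intro DERIV_diff) auto
        then show ?thesis by (auto simp: per intro: has_field_derivative_at_within)
      qed
      then obtain c where "\<forall>x\<in>{-1..1}. A (x + 1) - A x = c"
        using has_field_derivative_zero_constant[of "{-1..1}" "\<lambda>x. A (x + 1) - A x"] by auto
      with that show ?thesis by (metis add_0 atLeastAtMost_iff neg_le_0_iff_le zero_le_one)
    qed
    have "integral {-1..2} g = 3 * integral {0..1} g"
      using shift[of "-1"] shift[of 1] by (simp add: AI)
    then show ?thesis by (simp add: nu ennreal_mult')
  qed
  also have "ennreal (5 / l) * (3 * \<nu> {0..1}) = ennreal (15 / l) * \<nu> {0..1}"
  proof -
    have "ennreal (5 / l) * 3 = ennreal (5 / l) * ennreal 3" by simp
    also have "\<dots> = ennreal (15 / l)" using l by (subst ennreal_mult[symmetric]) auto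
    finally show ?thesis by (simp add: mult.assoc[symmetric])
  qed
  also have "\<nu> {0..1} = (\<integral>\<^sup>+t\<in>{0..1}. ennreal (g t) \<partial>lborel)"
    unfolding \<nu>_def by (subst emeasure_density) auto
  finally show ?thesis by (simp add: mult_left_mono)
qed

text \<open>A superlevel set of the radial maximal function of the squared modulus. Radius
  \<open>1\<close> is excluded because holomorphy in the ball says nothing about the values of
  \<open>f\<close> on the sphere.\<close>

definition maximal_set :: "(complex^'n \<Rightarrow> complex) \<Rightarrow> real \<Rightarrow> (complex^'n) set" where
  "maximal_set f l = {z \<in> sphere 0 1. \<exists>r\<in>{0..<1}. l < (norm (f (r *\<^sub>R z)))\<^sup>2}"

lemma scaleR_in_ball: "z \<in> sphere 0 1 \<Longrightarrow> 0 \<le> r \<Longrightarrow> r < R \<Longrightarrow> r *\<^sub>R (z::complex^'n) \<in> ball 0 R"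
  by auto

text \<open>Each radius contributes a relatively open set, so even the uncountable union over all
  radii is open and hence Borel.\<close>

lemma sets_maximal_set:
  fixes f :: "complex^'n \<Rightarrow> complex"
  assumes f: "hol_ball 1 f"
  shows "maximal_set f l \<in> sets sphere_measure"
proof -
  have "maximal_set f l = (\<Union>r\<in>{0..<1}. {z \<in> sphere 0 1. l < (norm (f (r *\<^sub>R z)))\<^sup>2})"
    by (auto simp: maximal_set_def)
  moreover have "openin (top_of_set (sphere 0 1)) {z \<in> sphere 0 1. l < (norm (f (r *\<^sub>R z)))\<^sup>2}" if "r \<in> {0..<1}" for r
  proof -
    have "continuous_on (sphere 0 1) (\<lambda>z. (norm (f (r *\<^sub>R z)))\<^sup>2)"
      using that scaleR_in_ball[of _ r 1] by (intro continuous_intros continuous_on_compose2[OF hol_ball_continuous[OF f]]) auto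
    from continuous_openin_preimage_gen[OF this, of "{l<..}"]
    show ?thesis by (simp add: vimage_def Int_def conj_commute)
  qed
  ultimately have "openin (top_of_set (sphere 0 1)) (maximal_set f l)" by auto
  then obtain U where "open U" "maximal_set f l = sphere 0 1 \<inter> U" by (auto simp: openin_open)
  then show ?thesis by (auto simp: sets_restrict_space)
qed

lemma nn_integral_unit_ivl:
  assumes "f \<in> borel_measurable borel"
  shows "(\<integral>\<^sup>+t. f t \<partial>unit_ivl) = (\<integral>\<^sup>+t\<in>{0..1}. f t \<partial>lborel)"
  unfolding unit_ivl_def using assms by (subst nn_integral_restrict_space) auto

text \<open>The circle through a point of the sphere bounds a slice disc, to which
  \<open>vitali_maximal\<close> applies; rotation invariance integrates the slice estimate over the
  sphere. Holomorphy beyond radius \<open>1\<close> makes the boundary values continuous.\<close>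

lemma maximal_inequality_smooth:
  fixes f :: "complex^'n \<Rightarrow> complex"
  assumes f: "hol_ball R f" and R: "R > 1" and l: "l > 0"
  shows "emeasure sphere_measure (maximal_set f l)
    \<le> ennreal (15 / l) * (\<integral>\<^sup>+z. ennreal ((norm (f z))\<^sup>2) \<partial>sphere_measure)"
proof -
  have f1: "hol_ball 1 f" by (rule hol_ball_mono[OF f]) (use R in simp)
  note [measurable] = sets_maximal_set[OF f1, of l]
  have contf: "continuous_on (cball 0 1) f"
    using hol_ball_continuous[OF f] R by (auto intro: continuous_on_subset)
  have fm [measurable]: "f \<in> borel_measurable sphere_measure"
    by (intro integrable_sphere_measure(1) continuous_on_subset[OF contf]) auto
  have slice: "(\<integral>\<^sup>+t. indicator (maximal_set f l) (circ t *s z) \<partial>unit_ivl)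
      \<le> ennreal (15 / l) * (\<integral>\<^sup>+t. ennreal ((norm (f (circ t *s z)))\<^sup>2) \<partial>unit_ivl)"
    if z: "z \<in> sphere 0 1" for z
  proof -
    define G where "G u = f (u *s z)" for u
    have G: "G holomorphic_on ball 0 R" unfolding G_def using hol_ball_slice[OF f] z by simp
    define g where "g t = (norm (G (circ t)))\<^sup>2" for t
    have contG: "continuous_on (cball 0 1) G"
      using R by (intro holomorphic_on_imp_continuous_on holomorphic_on_subset[OF G]) auto
    have cont: "continuous_on UNIV g"
      unfolding g_def by (intro continuous_intros continuous_on_compose2[OF contG]) auto
    define E where "E = {t \<in> {0..1}. circ t *s z \<in> maximal_set f l}"
    have scale: "r *\<^sub>R (circ t *s z) = (of_real r * circ t) *s z" for r t
      by (simp add: scaleR_eq_scale)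
    have Ealt: "E = {0..1} \<inter> (\<Union>r\<in>{0..<1}. {t. l < (norm (G (of_real r * circ t)))\<^sup>2})"
      using z by (auto simp: E_def maximal_set_def G_def scale)
    have "open {t. l < (norm (G (of_real r * circ t)))\<^sup>2}" if "r \<in> {0..<1}" for r
      using that by (intro open_Collect_less continuous_intros continuous_on_compose2[OF contG])
        (auto simp: norm_mult)
    then have E_sets: "E \<in> sets borel" unfolding Ealt by (intro sets.Int[OF _ borel_open[OF open_UN]]) auto
    have "emeasure lborel E \<le> ennreal (15 / l) * (\<integral>\<^sup>+t\<in>{0..1}. ennreal (g t) \<partial>lborel)"
    proof (rule vitali_maximal[OF cont _ _ l _ E_sets])
      show "g (x + 1) = g x" for x using circ_of_int[of 1] by (simp add: g_def circ_add)
      show "\<exists>h>0. h \<le> 1 / 2 \<and> 2 * h * l < integral {s - h..s + h} g" if s: "s \<in> E" for s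
      proof -
        obtain r where r: "r \<in> {0..<1}" "l < (norm (G (of_real r * circ s)))\<^sup>2"
          using s by (auto simp: Ealt)
        then show ?thesis unfolding g_def[abs_def]
          using maximal_point[OF G R, of r l s] by auto
      qed
    qed (auto simp: g_def E_def)
    moreover have "(\<integral>\<^sup>+t. indicator (maximal_set f l) (circ t *s z) \<partial>unit_ivl) = emeasure lborel E"
    proof -
      have "(\<integral>\<^sup>+t. indicator (maximal_set f l) (circ t *s z) \<partial>unit_ivl) = (\<integral>\<^sup>+t. indicator E t \<partial>unit_ivl)"
        by (intro nn_integral_cong) (auto simp: E_def indicator_def)
      also have "\<dots> = (\<integral>\<^sup>+t\<in>{0..1}. indicator E t \<partial>lborel)"
        using E_sets by (intro nn_integral_unit_ivl) auto
      also have "\<dots> = (\<integral>\<^sup>+t. indicator E t \<partial>lborel)"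
        by (intro nn_integral_cong) (auto simp: E_def indicator_def)
      finally show ?thesis using E_sets by simp
    qed
    moreover have "(\<integral>\<^sup>+t. ennreal ((norm (f (circ t *s z)))\<^sup>2) \<partial>unit_ivl) = (\<integral>\<^sup>+t\<in>{0..1}. ennreal (g t) \<partial>lborel)"
      using borel_measurable_continuous_onI[OF cont]
      by (simp add: g_def[abs_def] G_def nn_integral_unit_ivl)
    ultimately show ?thesis by simp
  qed
  have "emeasure sphere_measure (maximal_set f l) = (\<integral>\<^sup>+z. indicator (maximal_set f l) z \<partial>sphere_measure)"
    by (rule nn_integral_indicator[symmetric]) (rule sets_maximal_set[OF f1])
  also have "\<dots> = (\<integral>\<^sup>+z. (\<integral>\<^sup>+t. indicator (maximal_set f l) (circ t *s z) \<partial>unit_ivl) \<partial>sphere_measure)"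
    by (rule nn_sphere_average_rotation) measurable
  also have "\<dots> \<le> (\<integral>\<^sup>+z. ennreal (15 / l) * (\<integral>\<^sup>+t. ennreal ((norm (f (circ t *s z)))\<^sup>2) \<partial>unit_ivl) \<partial>sphere_measure)"
    by (intro nn_integral_mono slice) simp
  also have "\<dots> = ennreal (15 / l) * (\<integral>\<^sup>+z. (\<integral>\<^sup>+t. ennreal ((norm (f (circ t *s z)))\<^sup>2) \<partial>unit_ivl) \<partial>sphere_measure)"
  proof (rule nn_integral_cmult)
    have "(\<lambda>(z::complex^'n, t). circ t *s z) \<in> sphere_measure \<Otimes>\<^sub>M unit_ivl \<rightarrow>\<^sub>M sphere_measure"
      by (rule measurable_sphere_flow) (auto intro!: continuous_intros)
    moreover have "(\<lambda>z. ennreal ((norm (f z))\<^sup>2)) \<in> borel_measurable sphere_measure" by measurable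
    ultimately have "(\<lambda>p. ennreal ((norm (f (case p of (z, t) \<Rightarrow> circ t *s z)))\<^sup>2)) \<in> borel_measurable (sphere_measure \<Otimes>\<^sub>M unit_ivl)"
      by (rule measurable_compose)
    from unit_ivl.borel_measurable_nn_integral_fst[OF this]
    show "(\<lambda>z. \<integral>\<^sup>+t. ennreal ((norm (f (circ t *s z)))\<^sup>2) \<partial>unit_ivl) \<in> borel_measurable sphere_measure"
      by simp
  qed
  also have "(\<integral>\<^sup>+z. (\<integral>\<^sup>+t. ennreal ((norm (f (circ t *s z)))\<^sup>2) \<partial>unit_ivl) \<partial>sphere_measure) = (\<integral>\<^sup>+z. ennreal ((norm (f z))\<^sup>2) \<partial>sphere_measure)"
    by (rule nn_sphere_average_rotation[symmetric]) measurable
  finally show ?thesis .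
qed

text \<open>The maximal sets of the dilates increase to that of \<open>f\<close>, because a radius
  below \<open>s n\<close> is \<open>s n\<close> times a radius below \<open>1\<close>; the estimate
  for dilates then passes to the limit by continuity of the measure from below.\<close>

lemma maximal_inequality:
  fixes f :: "complex^'n \<Rightarrow> complex"
  assumes f: "hol_ball 1 f" and l: "l > 0"
  shows "emeasure sphere_measure (maximal_set f l) \<le> ennreal (15 / l) * hardy_norm_sq f"
proof -
  define s where "s n = 1 - 1 / real (n + 2)" for n
  have s: "0 < s n" "s n < 1" for n by (auto simp: s_def field_simps)
  define F where "F n z = f (s n *\<^sub>R z)" for n z
  have F: "hol_ball (1 / s n) (F n)" for n
    unfolding F_def using s by (intro hol_ball_dilate[OF f]) auto
  have F1: "hol_ball 1 (F n)" for n using s[of n] by (intro hol_ball_mono[OF F[of n]]) (auto simp: field_simps)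
  have smono: "s m \<le> s n" if "m \<le> n" for m n using that by (simp add: s_def frac_le)
  have step: "\<exists>r'\<in>{0..<1}. l < (norm (f (s n *\<^sub>R r' *\<^sub>R z)))\<^sup>2"
    if "q < s n" "0 \<le> q" "l < (norm (f (q *\<^sub>R z)))\<^sup>2" for q n and z :: "complex^'n"
  proof
    show "q / s n \<in> {0..<1}" using that s[of n] by simp
    show "l < (norm (f (s n *\<^sub>R (q / s n) *\<^sub>R z)))\<^sup>2" using that s[of n] by simp
  qed
  have inc: "incseq (\<lambda>n. maximal_set (F n) l)"
  proof (rule incseq_SucI, rule subsetI)
    fix n z assume "z \<in> maximal_set (F n) l"
    then obtain r where z: "z \<in> sphere 0 1" and r: "0 \<le> r" "r < 1" "l < (norm (f ((s n * r) *\<^sub>R z)))\<^sup>2"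
      by (auto simp: maximal_set_def F_def)
    have "s n * r < s (Suc n)" using mult_strict_left_mono[OF r(2) s(1)[of n]] smono[of n "Suc n"] by linarith
    then show "z \<in> maximal_set (F (Suc n)) l"
      using step[of "s n * r" "Suc n" z] r s[of n] z by (auto simp: maximal_set_def F_def)
  qed
  have "maximal_set f l = (\<Union>n. maximal_set (F n) l)"
  proof safe
    fix z assume "z \<in> maximal_set f l"
    then obtain r where z: "z \<in> sphere 0 1" and r: "0 \<le> r" "r < 1" "l < (norm (f (r *\<^sub>R z)))\<^sup>2"
      by (auto simp: maximal_set_def)
    obtain n where "1 / (1 - r) < real n" using reals_Archimedean2 by blast
    then have "r < s n" using r by (simp add: s_def field_simps)
    then show "z \<in> (\<Union>n. maximal_set (F n) l)"
      using step[of r n z] r z by (auto simp: maximal_set_def F_def)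
  next
    fix n z assume "z \<in> maximal_set (F n) l"
    then obtain r where z: "z \<in> sphere 0 1" and r: "0 \<le> r" "r < 1" "l < (norm (f ((s n * r) *\<^sub>R z)))\<^sup>2"
      by (auto simp: maximal_set_def F_def)
    have "s n * r < 1" using mult_strict_left_mono[OF r(2) s(1)[of n]] s(2)[of n] by linarith
    then have "s n * r \<in> {0..<1}" using r(1) s(1)[of n] by simp
    then show "z \<in> maximal_set f l" using z r unfolding maximal_set_def by blast
  qed
  then have "emeasure sphere_measure (maximal_set f l) = (SUP n. emeasure sphere_measure (maximal_set (F n) l))"
    using inc sets_maximal_set[OF F1] by (subst SUP_emeasure_incseq) auto
  also have "\<dots> \<le> ennreal (15 / l) * hardy_norm_sq f"
  proof (rule SUP_least)
    fix n
    have "emeasure sphere_measure (maximal_set (F n) l) \<le> ennreal (15 / l) * (\<integral>\<^sup>+z. ennreal ((norm (F n z))\<^sup>2) \<partial>sphere_measure)"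
      using s[of n] by (intro maximal_inequality_smooth[OF F _ l]) auto
    also have "\<dots> \<le> ennreal (15 / l) * hardy_norm_sq f"
      unfolding hardy_norm_sq_def F_def using s[of n] by (intro mult_left_mono SUP_upper) auto
    finally show "emeasure sphere_measure (maximal_set (F n) l) \<le> ennreal (15 / l) * hardy_norm_sq f" .
  qed
  finally show ?thesis .
qed

section \<open>The Hardy space and radial limits\<close>

text \<open>Only the product \<open>r * s\<close> enters the series, and its coefficients are
  nonnegative; these two facts give \<open>dil_pairing\<close> and \<open>dil_mono\<close>.\<close>

lemma parseval_circle:
  assumes g: "g holomorphic_on ball 0 1" and r: "0 \<le> r" "r < 1" and s: "0 \<le> s" "s < 1"
  shows "(\<lambda>k. of_real ((norm ((deriv ^^ k) g 0 / fact k))\<^sup>2 * (r * s) ^ k)) sums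
    (\<integral>t. g (of_real r * circ t) * cnj (g (of_real s * circ t)) \<partial>unit_ivl)"
proof -
  define a where "a k = (deriv ^^ k) g 0 / fact k" for k
  have cont: "continuous_on (ball 0 1) g" using g by (rule holomorphic_on_imp_continuous_on)
  have cont_circ: "continuous_on A (\<lambda>t. g (of_real q * circ t))" if "0 \<le> q" "q < 1" for q and A :: "real set"
    using that by (intro continuous_on_compose2[OF cont] continuous_intros) (auto simp: norm_mult)
  have "compact (g ` cball 0 s)"
    using s by (intro compact_continuous_image continuous_on_subset[OF cont]) auto
  then obtain B where "\<forall>y\<in>g ` cball 0 s. norm y \<le> B" by (meson bounded_iff compact_imp_bounded)
  then have B: "norm (g (of_real s * circ t)) \<le> B" for t using s by (simp add: norm_mult)
  obtain q where q: "r < q" "q < 1" using r dense by blast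
  have "summable (\<lambda>k. a k * of_real q ^ k)"
    using holomorphic_power_series[OF g, of "of_real q"] q r by (auto simp: sums_iff a_def)
  from powser_insidea[OF this, of "of_real r"]
  have sum_a: "summable (\<lambda>k. norm (a k * of_real r ^ k))" using q r by simp
  define F where "F k t = a k * of_real r ^ k * (circ t ^ k * cnj (g (of_real s * circ t)))" for k t
  have contF: "continuous_on {0..1} (F k)" for k
    unfolding F_def[abs_def] by (intro continuous_intros cont_circ s)
  have bound: "norm (F k t) \<le> norm (a k * of_real r ^ k) * B" for k t
    using B[of t] by (simp add: F_def norm_mult norm_power mult_left_mono)
  have "(\<lambda>k. \<integral>t. F k t \<partial>unit_ivl) sums (\<integral>t. (\<Sum>k. F k t) \<partial>unit_ivl)"
  proof (rule sums_integral)
    show int: "integrable unit_ivl (F k)" for k by (rule integrable_unit_ivl[OF contF])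
    show "AE t in unit_ivl. summable (\<lambda>k. norm (F k t))"
      by (rule AE_I2, rule summable_comparison_test'[OF summable_mult2[OF sum_a, of B]]) (use bound in auto)
    show "summable (\<lambda>k. \<integral>t. norm (F k t) \<partial>unit_ivl)"
    proof (rule summable_comparison_test'[OF summable_mult2[OF sum_a, of B]])
      fix k
      have "(\<integral>t. norm (F k t) \<partial>unit_ivl) \<le> (\<integral>t. norm (a k * of_real r ^ k) * B \<partial>unit_ivl)"
        using int by (intro integral_mono) (use bound in auto)
      then show "norm (\<integral>t. norm (F k t) \<partial>unit_ivl) \<le> norm (a k * of_real r ^ k) * B" by simp
    qed
  qed
  also have "(\<integral>t. (\<Sum>k. F k t) \<partial>unit_ivl) = (\<integral>t. g (of_real r * circ t) * cnj (g (of_real s * circ t)) \<partial>unit_ivl)"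
  proof (rule Bochner_Integration.integral_cong)
    fix t
    have "(\<lambda>k. a k * (of_real r * circ t) ^ k) sums g (of_real r * circ t)"
      using holomorphic_power_series[OF g, of "of_real r * circ t"] r by (simp add: norm_mult a_def)
    from sums_mult2[OF this, of "cnj (g (of_real s * circ t))"]
    show "(\<Sum>k. F k t) = g (of_real r * circ t) * cnj (g (of_real s * circ t))"
      by (simp add: F_def power_mult_distrib mult_ac sums_iff)
  qed simp
  also have "(\<lambda>k. \<integral>t. F k t \<partial>unit_ivl) = (\<lambda>k. of_real ((norm (a k))\<^sup>2 * (r * s) ^ k))"
  proof
    fix k
    have "(\<integral>t. cnj (g (of_real s * circ t) * cnj (circ t) ^ k) \<partial>unit_ivl) = cnj (a k * of_real s ^ k)"
      using circle_coefficient_scaled[OF g, of "of_real s" k] s by (subst Bochner_Integration.integral_cnj) (simp add: a_def)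
    then have "(\<integral>t. F k t \<partial>unit_ivl) = a k * of_real r ^ k * cnj (a k * of_real s ^ k)"
      unfolding F_def by (simp only: integral_mult_right_zero) (simp add: mult.commute)
    also have "\<dots> = (a k * cnj (a k)) * of_real ((r * s) ^ k)"
      by (simp add: power_mult_distrib)
    also have "a k * cnj (a k) = of_real ((norm (a k))\<^sup>2)" by (simp only: complex_norm_square)
    finally show "(\<integral>t. F k t \<partial>unit_ivl) = of_real ((norm (a k))\<^sup>2 * (r * s) ^ k)" by simp
  qed
  finally show ?thesis by (simp add: a_def)
qed

definition dil :: "(complex^'n \<Rightarrow> complex) \<Rightarrow> real \<Rightarrow> complex^'n \<Rightarrow> complex" where
  "dil f r z = f (r *\<^sub>R z)"

text \<open>A fixed sequence of radii increasing to \<open>1\<close>, for theorems that need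
  sequences; the shift by \<open>2\<close> keeps all terms strictly between \<open>0\<close> and
  \<open>1\<close>.\<close>

definition rad :: "nat \<Rightarrow> real" where
  "rad n = 1 - 1 / real (n + 2)"

lemma rad [simp]: "0 < rad n" "rad n < 1" "0 \<le> rad n" "rad n \<le> 1" "rad n \<noteq> 1"
  by (auto simp: rad_def field_simps)

lemma rad_tendsto: "rad \<longlonglongrightarrow> 1"
proof -
  have "(\<lambda>n. 1 - inverse (real (Suc (n + 1)))) \<longlonglongrightarrow> 1 - 0"
    by (intro tendsto_intros LIMSEQ_ignore_initial_segment[OF LIMSEQ_inverse_real_of_nat, of 1])
  then show ?thesis by (simp add: rad_def[abs_def] inverse_eq_divide)
qed

lemma rad_at_left: "filterlim rad (at_left 1) sequentially"
  using rad_tendsto by (simp add: filterlim_at)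

lemma rad_eventually: "r < 1 \<Longrightarrow> \<forall>\<^sub>F n in sequentially. r \<le> rad n"
  using order_tendstoD(1)[OF rad_tendsto] by (rule eventually_mono) auto

abbreviation nrmS :: "(complex^'n \<Rightarrow> complex) \<Rightarrow> real" where
  "nrmS \<equiv> L2.nrm sphere_measure"

lemma hol_ball_uminus: "hol_ball R f \<Longrightarrow> hol_ball R (\<lambda>z. - f z)"
  using hol_ball_mult[OF hol_ball_const[of R "-1"]] by simp

lemma hol_ball_diff: "hol_ball R f \<Longrightarrow> hol_ball R g \<Longrightarrow> hol_ball R (\<lambda>z. f z - g z)"
  using hol_ball_add[OF _ hol_ball_uminus] by fastforce

lemma hol_ball_dil:
  assumes "hol_ball 1 f" "0 < r"
  shows "hol_ball (1 / r) (dil f r)"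
  using hol_ball_dilate[OF assms] by (simp add: dil_def[abs_def])

lemma hol_ball_dil_1:
  assumes "hol_ball 1 f" "0 < r" "r < 1"
  shows "hol_ball 1 (dil f r)"
  by (rule hol_ball_mono[OF hol_ball_dil[OF assms(1,2)]]) (use assms in auto)

lemma continuous_dil:
  fixes f :: "complex^'n \<Rightarrow> complex"
  assumes "hol_ball 1 f" "0 \<le> r" "r < 1"
  shows "continuous_on (sphere 0 1) (dil f r)"
  unfolding dil_def[abs_def] using assms(2,3) scaleR_in_ball[of _ r 1]
  by (intro continuous_on_compose2[OF hol_ball_continuous[OF assms(1)]] continuous_intros) auto

lemma continuous_L2:
  fixes f :: "complex^'n \<Rightarrow> complex"
  assumes "finite_measure M" "sets M = sets (restrict_space borel (sphere 0 1))" "continuous_on (sphere 0 1) f"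
  shows "f \<in> L2_space M"
  unfolding L2_space_def using integrable_sphere_continuous(1)[OF assms]
    integrable_sphere_continuous(2)[OF assms(1,2), of "\<lambda>x. (norm (f x))\<^sup>2", OF
      continuous_on_power[OF continuous_on_norm[OF assms(3)]]]
  by simp

lemma dil_L2:
  fixes f :: "complex^'n \<Rightarrow> complex"
  assumes "hol_ball 1 f" "0 \<le> r" "r < 1"
  shows "dil f r \<in> L2_space sphere_measure"
  by (intro continuous_L2 sphere.finite_measure_axioms sets_sphere_measure continuous_dil assms)

text \<open>Used to replace the mixed pairing of two dilates by the squared norm of a single dilate,
  at the geometric mean of the radii. It holds slice by slice because the Parseval series sees only
  the product of the radii.\<close>

lemma dil_pairing:
  fixes f :: "complex^'n \<Rightarrow> complex"
  assumes f: "hol_ball 1 f" and r: "0 \<le> r" "r < 1" and s: "0 \<le> s" "s < 1"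
    and r': "0 \<le> r'" "r' < 1" and s': "0 \<le> s'" "s' < 1" and eq: "r * s = r' * s'"
  shows "L2_inner sphere_measure (dil f r) (dil f s) = L2_inner sphere_measure (dil f r') (dil f s')"
proof -
  have avg: "L2_inner sphere_measure (dil f r) (dil f s)
    = (\<integral>z. (\<integral>t. f (r *\<^sub>R (circ t *s z)) * cnj (f (s *\<^sub>R (circ t *s z))) \<partial>unit_ivl) \<partial>sphere_measure)"
    if "0 \<le> r" "r < 1" "0 \<le> s" "s < 1" for r s
    unfolding L2_inner_def using that
    by (subst sphere_average_rotation)
       (auto simp: dil_def intro!: integrable_sphere_measure continuous_intros continuous_dil[OF f, unfolded dil_def[abs_def]])
  show ?thesis
    unfolding avg[OF r s] avg[OF r' s']
  proof (rule Bochner_Integration.integral_cong)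
    fix z :: "complex^'n" assume "z \<in> space sphere_measure"
    then have g: "(\<lambda>l. f (l *s z)) holomorphic_on ball 0 1"
      by (intro hol_ball_slice[OF f]) simp
    show "(\<integral>t. f (r *\<^sub>R (circ t *s z)) * cnj (f (s *\<^sub>R (circ t *s z))) \<partial>unit_ivl)
      = (\<integral>t. f (r' *\<^sub>R (circ t *s z)) * cnj (f (s' *\<^sub>R (circ t *s z))) \<partial>unit_ivl)"
      using parseval_circle[OF g r s] parseval_circle[OF g r' s'] eq
      by (simp add: scaleR_eq_scale sums_unique2)
  qed simp
qed

text \<open>On every slice the mean square is a power series in the radius with nonnegative
  coefficients.\<close>

lemma dil_mono:
  fixes f :: "complex^'n \<Rightarrow> complex"
  assumes f: "hol_ball 1 f" and r: "0 \<le> r" "r \<le> s" "s < 1"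
  shows "nrmS (dil f r) \<le> nrmS (dil f s)"
proof -
  have avg: "ennreal ((nrmS (dil f r))\<^sup>2)
    = (\<integral>\<^sup>+z. (\<integral>\<^sup>+t. ennreal ((norm (f (r *\<^sub>R (circ t *s z))))\<^sup>2) \<partial>unit_ivl) \<partial>sphere_measure)"
    if "0 \<le> r" "r < 1" for r
  proof -
    have [measurable]: "dil f r \<in> borel_measurable sphere_measure"
      using dil_L2[OF f that] by (simp add: L2_space_def)
    show ?thesis
      unfolding nn_integral_L2_nrm[OF dil_L2[OF f that], symmetric]
      by (subst nn_sphere_average_rotation, measurable) (simp add: dil_def)
  qed
  have "ennreal ((nrmS (dil f r))\<^sup>2) \<le> ennreal ((nrmS (dil f s))\<^sup>2)"
    unfolding avg[OF r(1) order_le_less_trans[OF r(2,3)]] avg[OF order_trans[OF r(1,2)] r(3)]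
  proof (rule nn_integral_mono)
    fix z :: "complex^'n" assume "z \<in> space sphere_measure"
    then have g: "(\<lambda>l. f (l *s z)) holomorphic_on ball 0 1"
      by (intro hol_ball_slice[OF f]) simp
    let ?V = "\<lambda>r. \<integral>t. (norm (f (r *\<^sub>R (circ t *s z))))\<^sup>2 \<partial>unit_ivl"
    have V: "(\<lambda>k. (norm ((deriv ^^ k) (\<lambda>l. f (l *s z)) 0 / fact k))\<^sup>2 * (r * r) ^ k) sums ?V r
       \<and> (\<integral>\<^sup>+t. ennreal ((norm (f (r *\<^sub>R (circ t *s z))))\<^sup>2) \<partial>unit_ivl) = ennreal (?V r)" if r: "0 \<le> r" "r < 1" for r
    proof
      have "(\<integral>t. f ((of_real r * circ t) *s z) * cnj (f ((of_real r * circ t) *s z)) \<partial>unit_ivl) = complex_of_real (?V r)"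
        by (simp add: scaleR_eq_scale integral_complex_of_real[symmetric] complex_norm_square del: of_real_power)
      with parseval_circle[OF g r r]
      show "(\<lambda>k. (norm ((deriv ^^ k) (\<lambda>l. f (l *s z)) 0 / fact k))\<^sup>2 * (r * r) ^ k) sums ?V r"
        by (simp only: sums_of_real_iff)
      have "continuous_on {0..1} (\<lambda>t. f ((of_real r * circ t) *s z))"
        by (intro continuous_on_compose2[OF holomorphic_on_imp_continuous_on[OF g]] continuous_intros)
           (use r in \<open>auto simp: norm_mult\<close>)
      then have "integrable unit_ivl (\<lambda>t. (norm (f (r *\<^sub>R (circ t *s z))))\<^sup>2)"
        by (intro integrable_unit_ivl continuous_intros) (simp add: scaleR_eq_scale)
      then show "(\<integral>\<^sup>+t. ennreal ((norm (f (r *\<^sub>R (circ t *s z))))\<^sup>2) \<partial>unit_ivl) = ennreal (?V r)"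
        by (intro nn_integral_eq_integral) auto
    qed
    have "?V r \<le> ?V s"
      by (rule sums_le[OF _ conjunct1[OF V] conjunct1[OF V]]) (use r in \<open>auto intro!: mult_left_mono power_mono mult_mono\<close>)
    then show "(\<integral>\<^sup>+t. ennreal ((norm (f (r *\<^sub>R (circ t *s z))))\<^sup>2) \<partial>unit_ivl)
       \<le> (\<integral>\<^sup>+t. ennreal ((norm (f (s *\<^sub>R (circ t *s z))))\<^sup>2) \<partial>unit_ivl)"
      using V[of r] V[of s] r by (simp add: ennreal_leI)
  qed
  then have "(nrmS (dil f r))\<^sup>2 \<le> (nrmS (dil f s))\<^sup>2" by (simp add: ennreal_le_iff)
  then show ?thesis
    using r by (intro power2_le_imp_le[of "nrmS (dil f r)"] L2.nrm_nonneg dil_L2 f) auto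
qed

lemma hardy_norm_sq_dil:
  fixes f :: "complex^'n \<Rightarrow> complex"
  assumes "hol_ball 1 f"
  shows "hardy_norm_sq f = (SUP r\<in>{0<..<1}. ennreal ((nrmS (dil f r))\<^sup>2))"
  unfolding hardy_norm_sq_def
  by (intro SUP_cong refl) (simp add: nn_integral_L2_nrm[symmetric] dil_L2 assms, simp add: dil_def)

lemma hardyI:
  fixes f :: "complex^'n \<Rightarrow> complex"
  assumes f: "hol_ball 1 f" and "\<And>r. 0 < r \<Longrightarrow> r < 1 \<Longrightarrow> nrmS (dil f r) \<le> B"
  shows "f \<in> hardy_space"
proof -
  have "hardy_norm_sq f \<le> ennreal (B\<^sup>2)"
    unfolding hardy_norm_sq_dil[OF f]
    using assms by (intro SUP_least ennreal_leI power_mono L2.nrm_nonneg dil_L2) auto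
  then show ?thesis
    using f by (auto simp: hardy_space_def hol_ball_1 intro: order_le_less_trans)
qed

lemma hardy_hol: "f \<in> hardy_space \<Longrightarrow> hol_ball 1 f"
  by (simp add: hardy_space_def hol_ball_1)

lemma hardyE:
  fixes f :: "complex^'n \<Rightarrow> complex"
  assumes f: "f \<in> hardy_space"
  obtains B where "0 \<le> B" "\<And>r. 0 \<le> r \<Longrightarrow> r < 1 \<Longrightarrow> nrmS (dil f r) \<le> B"
proof -
  have hol: "hol_ball 1 f" using f by (rule hardy_hol)
  obtain c where c: "0 \<le> c" "hardy_norm_sq f = ennreal c"
    using f by (cases "hardy_norm_sq f") (auto simp: hardy_space_def)
  have pos: "nrmS (dil f r) \<le> sqrt c" if "0 < r" "r < 1" for r
  proof -
    have "ennreal ((nrmS (dil f r))\<^sup>2) \<le> ennreal c"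
      unfolding c(2)[symmetric] hardy_norm_sq_dil[OF hol] using that by (intro SUP_upper) auto
    then show ?thesis using c by (intro real_le_rsqrt) (simp add: ennreal_le_iff)
  qed
  \<comment> \<open>The supremum in \<open>hardy_norm_sq\<close> runs over positive radii; radius
    \<open>0\<close> is reached by comparison with a larger one.\<close>
  have "nrmS (dil f r) \<le> sqrt c" if "0 \<le> r" "r < 1" for r
    using dil_mono[OF hol that(1), of "(r + 1) / 2"] pos[of "(r + 1) / 2"] that by simp
  with c show ?thesis by (intro that[of "sqrt c"]) auto
qed

lemma dil_diff_sq:
  fixes f :: "complex^'n \<Rightarrow> complex"
  assumes f: "hol_ball 1 f" and r: "0 \<le> r" "r < 1" and s: "0 \<le> s" "s < 1"
  shows "(nrmS (\<lambda>z. dil f r z - dil f s z))\<^sup>2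
    = (nrmS (dil f r))\<^sup>2 + (nrmS (dil f s))\<^sup>2 - 2 * (nrmS (dil f (sqrt (r * s))))\<^sup>2"
proof -
  have rs: "0 \<le> sqrt (r * s)" "sqrt (r * s) < 1"
    using r s by (auto simp: real_sqrt_lt_1_iff intro: mult_strict_mono[of r 1 s 1, simplified] le_less_trans[OF mult_left_le])
  have "L2_inner sphere_measure (dil f r) (dil f s) = L2_inner sphere_measure (dil f (sqrt (r * s))) (dil f (sqrt (r * s)))"
    using r s by (intro dil_pairing f rs) auto
  then have "Re (L2_inner sphere_measure (dil f r) (dil f s)) = (nrmS (dil f (sqrt (r * s))))\<^sup>2"
    by (simp add: L2.nrm_sq[OF dil_L2[OF f rs]])
  then show ?thesis by (simp add: L2.nrm_sq_diff dil_L2 f r s)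
qed

text \<open>Once the radii are at least \<open>r0\<close>, so is their geometric mean, and all three
  squared norms in \<open>dil_diff_sq\<close> lie within \<open>e\<^sup>2 / 2\<close> of the same
  supremum.\<close>

lemma hardy_cauchy:
  fixes f :: "complex^'n \<Rightarrow> complex"
  assumes f: "f \<in> hardy_space" and e: "e > 0"
  obtains r0 where "0 < r0" "r0 < 1"
    "\<And>r s. r0 \<le> r \<Longrightarrow> r < 1 \<Longrightarrow> r0 \<le> s \<Longrightarrow> s < 1 \<Longrightarrow> nrmS (\<lambda>z. dil f r z - dil f s z) < e"
proof -
  have hol: "hol_ball 1 f" using f by (rule hardy_hol)
  obtain B where B: "0 \<le> B" "\<And>r. 0 \<le> r \<Longrightarrow> r < 1 \<Longrightarrow> nrmS (dil f r) \<le> B" using hardyE[OF f] by blast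
  let ?S = "(\<lambda>r. (nrmS (dil f r))\<^sup>2) ` {0<..<1}"
  have bdd: "bdd_above ?S"
    using B by (intro bdd_aboveI[of _ "B\<^sup>2"]) (auto intro!: power_mono L2.nrm_nonneg dil_L2 hol)
  have ne: "{0<..<1::real} \<noteq> {}" using dense[of 0 "1::real"] by auto
  have "Sup ?S - e\<^sup>2 / 2 < Sup ?S" using e by simp
  then obtain r0 where r0: "0 < r0" "r0 < 1" "Sup ?S - e\<^sup>2 / 2 < (nrmS (dil f r0))\<^sup>2"
    using ne bdd by (subst (asm) less_cSUP_iff) auto
  have "nrmS (\<lambda>z. dil f r z - dil f s z) < e" if rs: "r0 \<le> r" "r < 1" "r0 \<le> s" "s < 1" for r s
  proof -
    have up: "(nrmS (dil f q))\<^sup>2 \<le> Sup ?S" if "r0 \<le> q" "q < 1" for q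
      using that r0 bdd by (intro cSUP_upper) auto
    have "r0 * r0 \<le> r * s" using rs r0 by (intro mult_mono) auto
    then have q1: "r0 \<le> sqrt (r * s)" using r0 by (intro real_le_rsqrt) (simp add: power2_eq_square)
    have "r * s < 1 * 1" using rs r0 by (intro mult_strict_mono) auto
    then have q2: "sqrt (r * s) < 1" by simp
    have "(nrmS (dil f r0))\<^sup>2 \<le> (nrmS (dil f (sqrt (r * s))))\<^sup>2"
      using q1 q2 r0 by (intro power_mono dil_mono hol L2.nrm_nonneg dil_L2) auto
    then have "(nrmS (\<lambda>z. dil f r z - dil f s z))\<^sup>2 < e\<^sup>2"
      using up[of r] up[of s] rs r0 by (simp add: dil_diff_sq[OF hol])
    then show ?thesis using e by (simp add: power_less_imp_less_base)
  qed
  with r0 show ?thesis using that by blast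
qed

lemma hardy_dilate_close:
  fixes f :: "complex^'n \<Rightarrow> complex"
  assumes f: "f \<in> hardy_space" and e: "e > 0"
  obtains s where "0 < s" "s < 1" "hardy_norm_sq (\<lambda>z. f z - dil f s z) \<le> ennreal (e\<^sup>2)"
proof -
  have hol: "hol_ball 1 f" using f by (rule hardy_hol)
  obtain r0 where r0: "0 < r0" "r0 < 1"
    "\<And>r s. r0 \<le> r \<Longrightarrow> r < 1 \<Longrightarrow> r0 \<le> s \<Longrightarrow> s < 1 \<Longrightarrow> nrmS (\<lambda>z. dil f r z - dil f s z) < e"
    using hardy_cauchy[OF f e] by metis
  \<comment> \<open>With \<open>s * s = r0\<close>, every \<open>q \<ge> s\<close> has both
    \<open>q\<close> and \<open>s * q\<close> at least \<open>r0\<close>, so the Cauchy estimate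
    covers the dilates of the difference.\<close>
  define s where "s = sqrt r0"
  have s: "0 < s" "s < 1" "s * s = r0" using r0 by (auto simp: s_def)
  have sr0: "r0 \<le> s" using mult_left_le[of s s] s by simp
  define g where "g = (\<lambda>z. f z - dil f s z)"
  have g: "hol_ball 1 g" unfolding g_def using hol hol_ball_dil_1[OF hol] s by (intro hol_ball_diff) auto
  have "nrmS (dil g r) \<le> e" if r: "0 < r" "r < 1" for r
  proof -
    define q where "q = max r s"
    have q: "r \<le> q" "s \<le> q" "q < 1" "0 < q" using r s by (auto simp: q_def)
    have "r0 \<le> s * q" using s q mult_left_mono[of s q s] by simp
    moreover have "s * q < 1 * 1" using s q by (intro mult_strict_mono) auto
    ultimately have "nrmS (\<lambda>z. dil f q z - dil f (s * q) z) < e"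
      using r0(3)[of q "s * q"] sr0 q by simp
    moreover have "dil g q = (\<lambda>z. dil f q z - dil f (s * q) z)"
      by (auto simp: g_def dil_def)
    moreover have "nrmS (dil g r) \<le> nrmS (dil g q)" using r q by (intro dil_mono g) auto
    ultimately show ?thesis by simp
  qed
  then have "hardy_norm_sq g \<le> ennreal (e\<^sup>2)"
    unfolding hardy_norm_sq_dil[OF g] by (intro SUP_least ennreal_leI power_mono L2.nrm_nonneg dil_L2 g) auto
  with s show ?thesis using that unfolding g_def by blast
qed

section \<open>Existence and measurability of radial limits\<close>

lemma tendsto_at_left_1_cauchy:
  fixes h :: "real \<Rightarrow> 'a::complete_space"
  assumes "\<And>e. e > 0 \<Longrightarrow> \<exists>r0<1. \<forall>r s. r0 \<le> r \<longrightarrow> r < 1 \<longrightarrow> r0 \<le> s \<longrightarrow> s < 1 \<longrightarrow> dist (h r) (h s) \<le> e"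
  shows "\<exists>l. (h \<longlongrightarrow> l) (at_left 1)"
proof -
  have "Cauchy (\<lambda>n. h (rad n))"
  proof (rule metric_CauchyI)
    fix e :: real assume e: "e > 0"
    then obtain r0 where r0: "r0 < 1" "\<And>r s. r0 \<le> r \<Longrightarrow> r < 1 \<Longrightarrow> r0 \<le> s \<Longrightarrow> s < 1 \<Longrightarrow> dist (h r) (h s) \<le> e / 2"
      using assms[of "e / 2"] by auto
    obtain N where N: "\<And>n. n \<ge> N \<Longrightarrow> r0 \<le> rad n"
      using rad_eventually[OF r0(1)] by (auto simp: eventually_sequentially)
    have "dist (h (rad m)) (h (rad n)) < e" if "m \<ge> N" "n \<ge> N" for m n
      using r0(2)[OF N[OF that(1)] _ N[OF that(2)]] e by fastforce
    then show "\<exists>M. \<forall>m\<ge>M. \<forall>n\<ge>M. dist (h (rad m)) (h (rad n)) < e" by blast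
  qed
  then obtain l where l: "(\<lambda>n. h (rad n)) \<longlonglongrightarrow> l" using Cauchy_convergent convergent_def by blast
  have "(h \<longlongrightarrow> l) (at_left 1)"
  proof (rule tendstoI)
    fix e :: real assume e: "e > 0"
    then obtain r0 where r0: "r0 < 1" "\<And>r s. r0 \<le> r \<Longrightarrow> r < 1 \<Longrightarrow> r0 \<le> s \<Longrightarrow> s < 1 \<Longrightarrow> dist (h r) (h s) \<le> e / 2"
      using assms[of "e / 2"] by auto
    have "\<forall>\<^sub>F n in sequentially. r0 \<le> rad n \<and> dist (h (rad n)) l < e / 2"
      using rad_eventually[OF r0(1)] tendstoD[OF l, of "e / 2"] e by (auto intro: eventually_conj)
    then obtain n where n: "r0 \<le> rad n" "dist (h (rad n)) l < e / 2"
      using eventually_happens'[OF sequentially_bot] by blast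
    have "dist (h r) l < e" if "r0 < r" "r < 1" for r
      using dist_triangle[of "h r" l "h (rad n)"] r0(2)[of r "rad n"] n that by simp
    then show "\<forall>\<^sub>F r in at_left 1. dist (h r) l < e"
      using r0(1) by (auto simp: eventually_at_left[of r0])
  qed
  then show ?thesis by blast
qed

text \<open>The maximal function argument: \<open>f\<close> differs from a dilate, which is
  continuous across the sphere, by a function of small Hardy norm, and the maximal inequality
  confines the points of large deviation to sets of small measure.\<close>

theorem radial_limit_exists:
  fixes f :: "complex^'n \<Rightarrow> complex"
  assumes f: "f \<in> hardy_space"
  shows "AE z in sphere_measure. \<exists>l. ((\<lambda>r. f (r *\<^sub>R z)) \<longlongrightarrow> l) (at_left 1)"
proof -
  have hol: "hol_ball 1 f" using f by (rule hardy_hol)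
  have "AE z in sphere_measure. \<exists>s. 0 < s \<and> s < 1 \<and> z \<notin> maximal_set (\<lambda>z. f z - dil f s z) (d\<^sup>2)" if d: "d > 0" for d
  proof -
    have "\<exists>s. 0 < s \<and> s < 1 \<and> hardy_norm_sq (\<lambda>z. f z - dil f s z) \<le> ennreal ((1 / real (Suc n))\<^sup>2)" for n
      by (rule hardy_dilate_close[OF f, of "1 / real (Suc n)"]) auto
    then obtain s where s: "\<And>n. 0 < s n" "\<And>n. s n < 1"
      "\<And>n. hardy_norm_sq (\<lambda>z. f z - dil f (s n) z) \<le> ennreal ((1 / real (Suc n))\<^sup>2)" by metis
    define E where "E n = maximal_set (\<lambda>z. f z - dil f (s n) z) (d\<^sup>2)" for n
    have hol_n: "hol_ball 1 (\<lambda>z. f z - dil f (s n) z)" for n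
      using s by (intro hol_ball_diff hol hol_ball_dil_1)
    have E: "E n \<in> sets sphere_measure" for n unfolding E_def by (rule sets_maximal_set[OF hol_n])
    \<comment> \<open>A point is good as soon as it lies outside one of the sets \<open>E n\<close>,
      so the exceptional set is their intersection.\<close>
    have "emeasure sphere_measure (\<Inter>n. E n) \<le> ennreal (15 / d\<^sup>2 * (1 / real (Suc n))\<^sup>2)" for n
    proof -
      have "emeasure sphere_measure (\<Inter>n. E n) \<le> emeasure sphere_measure (E n)"
        using E by (intro emeasure_mono) auto
      also have "\<dots> \<le> ennreal (15 / d\<^sup>2) * hardy_norm_sq (\<lambda>z. f z - dil f (s n) z)"
        unfolding E_def using d by (intro maximal_inequality hol_n) auto
      also have "\<dots> \<le> ennreal (15 / d\<^sup>2) * ennreal ((1 / real (Suc n))\<^sup>2)"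
        by (intro mult_left_mono s) auto
      finally show ?thesis using d by (subst ennreal_mult') auto
    qed
    moreover have "(\<lambda>n. ennreal (15 / d\<^sup>2 * (1 / real (Suc n))\<^sup>2)) \<longlonglongrightarrow> ennreal (15 / d\<^sup>2 * 0\<^sup>2)"
      using LIMSEQ_inverse_real_of_nat by (intro tendsto_ennrealI tendsto_intros) (simp add: inverse_eq_divide)
    ultimately have "emeasure sphere_measure (\<Inter>n. E n) \<le> 0"
      using LIMSEQ_le_const[of "\<lambda>n. ennreal (15 / d\<^sup>2 * (1 / real (Suc n))\<^sup>2)" 0] by auto
    then have "(\<Inter>n. E n) \<in> null_sets sphere_measure"
      using E by (auto simp: null_sets_def intro!: sets.countable_INT'')
    then have "AE z in sphere_measure. z \<notin> (\<Inter>n. E n)" by (rule AE_not_in)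
    then show ?thesis by eventually_elim (use s in \<open>auto simp: E_def\<close>)
  qed
  then have "AE z in sphere_measure. \<forall>n. \<exists>s. 0 < s \<and> s < 1 \<and> z \<notin> maximal_set (\<lambda>z. f z - dil f s z) ((1 / real (Suc n))\<^sup>2)"
    by (simp add: AE_all_countable)
  moreover have "AE z in sphere_measure. z \<in> (sphere 0 1 :: (complex^'n) set)"
    using AE_space[of "sphere_measure :: (complex^'n) measure"] by simp
  ultimately show ?thesis
  proof eventually_elim
    fix z :: "complex^'n"
    assume ex: "\<forall>n. \<exists>s. 0 < s \<and> s < 1 \<and> z \<notin> maximal_set (\<lambda>z. f z - dil f s z) ((1 / real (Suc n))\<^sup>2)" and z: "z \<in> sphere 0 1"
    show "\<exists>l. ((\<lambda>r. f (r *\<^sub>R z)) \<longlongrightarrow> l) (at_left 1)"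
    proof (rule tendsto_at_left_1_cauchy)
      fix e :: real assume e: "e > 0"
      \<comment> \<open>Four errors of size \<open>d\<close> add up: two from passing to the dilate
        and two from the continuity of the dilate at the sphere.\<close>
      obtain n where "4 / e < real n" using reals_Archimedean2 by blast
      then have n: "4 * (1 / real (Suc n)) \<le> e" using e by (simp add: field_simps)
      define d where "d = 1 / real (Suc n)"
      have d: "0 < d" "4 * d \<le> e" using n by (auto simp: d_def)
      obtain s where s: "0 < s" "s < 1" "z \<notin> maximal_set (\<lambda>z. f z - dil f s z) (d\<^sup>2)"
        using ex unfolding d_def by blast
      have close: "dist (f (r *\<^sub>R z)) (f ((s * r) *\<^sub>R z)) \<le> d" if "0 \<le> r" "r < 1" for r
      proof -
        have "(norm (f (r *\<^sub>R z) - dil f s (r *\<^sub>R z)))\<^sup>2 \<le> d\<^sup>2"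
          using s(3) z that by (auto simp: maximal_set_def not_less)
        then show ?thesis using d by (auto simp: dist_norm dil_def intro: power2_le_imp_le)
      qed
      have "isCont (\<lambda>r. f ((s * r) *\<^sub>R z)) 1"
      proof -
        have "isCont f ((s * 1) *\<^sub>R z)"
          using hol_ball_continuous[OF hol] z s by (auto simp: continuous_on_eq_continuous_at)
        then show ?thesis by (rule continuous_within_compose3) (intro continuous_intros)
      qed
      then obtain t where t: "t > 0" "\<And>r. dist r 1 < t \<Longrightarrow> dist (f ((s * r) *\<^sub>R z)) (f ((s * 1) *\<^sub>R z)) < d"
        using d unfolding continuous_at_eps_delta by metis
      define r0 where "r0 = max 0 (1 - t / 2)"
      have "dist (f (r *\<^sub>R z)) (f (q *\<^sub>R z)) \<le> e" if "r0 \<le> r" "r < 1" "r0 \<le> q" "q < 1" for r q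
      proof -
        have dr: "dist r 1 < t" "dist q 1 < t" using that t by (auto simp: r0_def dist_real_def)
        have "dist (f (r *\<^sub>R z)) (f ((s * r) *\<^sub>R z)) \<le> d" "dist (f (q *\<^sub>R z)) (f ((s * q) *\<^sub>R z)) \<le> d"
          using that by (auto intro!: close simp: r0_def)
        moreover note t(2)[OF dr(1)] t(2)[OF dr(2)]
        moreover have "dist (f (r *\<^sub>R z)) (f (q *\<^sub>R z)) \<le> dist (f (r *\<^sub>R z)) (f ((s * r) *\<^sub>R z)) + dist (f ((s * r) *\<^sub>R z)) (f ((s * 1) *\<^sub>R z))
           + dist (f ((s * q) *\<^sub>R z)) (f ((s * 1) *\<^sub>R z)) + dist (f (q *\<^sub>R z)) (f ((s * q) *\<^sub>R z))"
          by (smt (verit) dist_commute dist_triangle)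
        ultimately show ?thesis using d by linarith
      qed
      then show "\<exists>r0<1. \<forall>r q. r0 \<le> r \<longrightarrow> r < 1 \<longrightarrow> r0 \<le> q \<longrightarrow> q < 1 \<longrightarrow> dist (f (r *\<^sub>R z)) (f (q *\<^sub>R z)) \<le> e"
        using t by (intro exI[of _ r0]) (auto simp: r0_def)
    qed
  qed
qed

lemma open_contains_rat:
  assumes "open (U :: real set)" "x \<in> U"
  shows "\<exists>p::rat. of_rat p \<in> U"
proof -
  obtain e where e: "e > 0" "ball x e \<subseteq> U" using assms open_contains_ball by blast
  obtain p where "x < of_rat p" "of_rat p < x + e" using of_rat_dense[of x "x + e"] e by auto
  then show ?thesis using e by (intro exI[of _ p]) (auto simp: subset_iff dist_real_def)
qed

text \<open>Reduces the Cauchy condition on an interval of radii to rational radii, so that the set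
  of convergence is described by countably many conditions.\<close>

lemma dist_le_from_rats:
  fixes h :: "real \<Rightarrow> 'a::metric_space"
  assumes h: "continuous_on {a<..<1} h"
    and le: "\<And>p q::rat. a < of_rat p \<Longrightarrow> of_rat p < (1::real) \<Longrightarrow> a < of_rat q \<Longrightarrow> of_rat q < (1::real) \<Longrightarrow> dist (h (of_rat p)) (h (of_rat q)) \<le> e"
    and r: "a < r" "r < 1" and s: "a < s" "s < 1"
  shows "dist (h r) (h s) \<le> e"
proof (rule ccontr)
  assume "\<not> ?thesis"
  then have gt: "e < dist (h r) (h s)" by simp
  have op: "open {x \<in> {a<..<1}. e < dist (h x) y}" for y
  proof -
    have "continuous_on {a<..<1} (\<lambda>x. dist (h x) y)" using h by (intro continuous_intros)
    from continuous_open_preimage[OF this open_greaterThanLessThan open_greaterThan, of e]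
    show ?thesis by (simp add: vimage_def Int_def)
  qed
  obtain p :: rat where p: "a < of_rat p" "of_rat p < (1::real)" "e < dist (h (of_rat p)) (h s)"
    using open_contains_rat[OF op, of r "h s"] gt r by auto
  then obtain q :: rat where "a < of_rat q" "of_rat q < (1::real)" "e < dist (h (of_rat q)) (h (of_rat p))"
    using open_contains_rat[OF op, of s "h (of_rat p)"] s by (auto simp: dist_commute)
  then show False using le[of q p] p by simp
qed

lemma radial_limit_eq:
  "((\<lambda>r. f (r *\<^sub>R z)) \<longlongrightarrow> l) (at_left 1) \<Longrightarrow> radial_limit f z = l"
  unfolding radial_limit_def by (rule tendsto_Lim) (simp add: trivial_limit_at_left_real)

text \<open>The sphere measure lives on the Borel sets only, so convergence almost everywhere does
  not suffice: the total function \<open>radial_limit f\<close> has to be identified at every point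
  of the sphere, also where the limit fails to exist.\<close>

lemma radial_limit_measurable:
  fixes f :: "complex^'n \<Rightarrow> complex"
  assumes f: "hol_ball 1 f"
  shows "radial_limit f \<in> borel_measurable sphere_measure"
proof -
  \<comment> \<open>Radii outside the unit interval get the value \<open>0\<close>, so that
    \<open>h\<close> is measurable for every rational index.\<close>
  define h where "h q = (if 0 \<le> q \<and> q < 1 then dil f q else (\<lambda>_. 0))" for q
  have [measurable]: "h q \<in> borel_measurable sphere_measure" for q
    using dil_L2[OF f, of q] by (auto simp: h_def L2_space_def)
  define C where "C z \<longleftrightarrow> (\<forall>n::nat. \<exists>m::nat. \<forall>p q::rat. rad m < of_rat p \<longrightarrow> of_rat p < (1::real) \<longrightarrow> rad m < of_rat q \<longrightarrow> of_rat q < (1::real)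
     \<longrightarrow> dist (h (of_rat p) z) (h (of_rat q) z) \<le> 1 / real (Suc n))" for z
  have [measurable]: "Measurable.pred sphere_measure C" unfolding C_def by measurable
  have C: "C z \<longleftrightarrow> (\<exists>l. ((\<lambda>r. f (r *\<^sub>R z)) \<longlongrightarrow> l) (at_left 1))" if z: "z \<in> sphere 0 1" for z
  proof
    assume "C z"
    show "\<exists>l. ((\<lambda>r. f (r *\<^sub>R z)) \<longlongrightarrow> l) (at_left 1)"
    proof (rule tendsto_at_left_1_cauchy)
      fix e :: real assume e: "e > 0"
      obtain n where "1 / e < real n" using reals_Archimedean2 by blast
      then have n: "1 / real (Suc n) \<le> e" using e by (simp add: field_simps)
      obtain m where m: "\<And>p q::rat. rad m < of_rat p \<Longrightarrow> of_rat p < (1::real) \<Longrightarrow> rad m < of_rat q \<Longrightarrow> of_rat q < (1::real)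
         \<Longrightarrow> dist (h (of_rat p) z) (h (of_rat q) z) \<le> 1 / real (Suc n)"
        using \<open>C z\<close> unfolding C_def by metis
      have "dist (f (r *\<^sub>R z)) (f (s *\<^sub>R z)) \<le> 1 / real (Suc n)" if rs: "rad m < r" "r < 1" "rad m < s" "s < 1" for r s
      proof (rule dist_le_from_rats[where h = "\<lambda>r. f (r *\<^sub>R z)" and a = "rad m"])
        have "r *\<^sub>R z \<in> ball 0 1" if "r \<in> {rad m<..<1}" for r
          using that z less_trans[OF rad(1)[of m], of r] by auto
        then show "continuous_on {rad m<..<1} (\<lambda>r. f (r *\<^sub>R z))"
          by (intro continuous_on_compose2[OF hol_ball_continuous[OF f]] continuous_intros) auto
        fix p q :: rat assume pq: "rad m < of_rat p" "of_rat p < (1::real)" "rad m < of_rat q" "of_rat q < (1::real)"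
        have "0 < (of_rat p :: real)" "0 < (of_rat q :: real)" using pq less_trans[OF rad(1)[of m]] by blast+
        then show "dist (f (of_rat p *\<^sub>R z)) (f (of_rat q *\<^sub>R z)) \<le> 1 / real (Suc n)"
          using m[OF pq] pq by (simp add: h_def dil_def)
      qed (use rs in auto)
      moreover obtain r0 where "rad m < r0" "r0 < 1" using dense[OF rad(2)[of m]] by blast
      ultimately show "\<exists>r0<1. \<forall>r s. r0 \<le> r \<longrightarrow> r < 1 \<longrightarrow> r0 \<le> s \<longrightarrow> s < 1 \<longrightarrow> dist (f (r *\<^sub>R z)) (f (s *\<^sub>R z)) \<le> e"
        using n by (intro exI[of _ r0]) (meson less_le_trans order_trans)
    qed
  next
    assume "\<exists>l. ((\<lambda>r. f (r *\<^sub>R z)) \<longlongrightarrow> l) (at_left 1)"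
    then obtain l where l: "((\<lambda>r. f (r *\<^sub>R z)) \<longlongrightarrow> l) (at_left 1)" by blast
    show "C z" unfolding C_def
    proof
      fix n :: nat
      have "\<forall>\<^sub>F r in at_left 1. dist (f (r *\<^sub>R z)) l < 1 / (2 * real (Suc n))"
        using l by (rule tendstoD) simp
      then obtain b where b: "b < 1" "\<And>r. b < r \<Longrightarrow> r < 1 \<Longrightarrow> dist (f (r *\<^sub>R z)) l < 1 / (2 * real (Suc n))"
        using eventually_at_left[of 0 "1::real"] by auto
      obtain m where m: "b \<le> rad m"
        using eventually_happens'[OF sequentially_bot rad_eventually[OF b(1)]] by blast
      have "dist (h (of_rat p) z) (h (of_rat q) z) \<le> 1 / real (Suc n)"
        if pq: "rad m < of_rat p" "of_rat p < (1::real)" "rad m < of_rat q" "of_rat q < (1::real)" for p q :: rat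
      proof -
        have "0 < (of_rat p :: real)" "0 < (of_rat q :: real)" using pq less_trans[OF rad(1)[of m]] by blast+
        then have eqs: "h (of_rat p) z = f (of_rat p *\<^sub>R z)" "h (of_rat q) z = f (of_rat q *\<^sub>R z)"
          using pq by (simp_all add: h_def dil_def)
        have "dist (f (of_rat p *\<^sub>R z)) l < 1 / (2 * real (Suc n))" "dist (f (of_rat q *\<^sub>R z)) l < 1 / (2 * real (Suc n))"
          using b(2)[of "of_rat p"] b(2)[of "of_rat q"] pq m by auto
        then have "dist (f (of_rat p *\<^sub>R z)) (f (of_rat q *\<^sub>R z)) < 1 / (2 * real (Suc n)) + 1 / (2 * real (Suc n))"
          by (intro order_le_less_trans[OF dist_triangle2 add_strict_mono])
        also have "\<dots> = 1 / real (Suc n)" by (simp add: field_simps)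
        finally show ?thesis unfolding eqs by (rule less_imp_le)
      qed
      then show "\<exists>m. \<forall>p q::rat. rad m < of_rat p \<longrightarrow> of_rat p < (1::real) \<longrightarrow> rad m < of_rat q \<longrightarrow> of_rat q < (1::real)
         \<longrightarrow> dist (h (of_rat p) z) (h (of_rat q) z) \<le> 1 / real (Suc n)" by blast
    qed
  qed
  \<comment> \<open>Without a limit, \<open>Lim\<close> is a description under a constantly false
    predicate, so its value is the same at all such points.\<close>
  have "radial_limit f z = (if C z then lim (\<lambda>n. h (rad n) z) else (THE l. False))" if z: "z \<in> sphere 0 1" for z
  proof (cases "C z")
    case True
    then obtain l where l: "((\<lambda>r. f (r *\<^sub>R z)) \<longlongrightarrow> l) (at_left 1)" using C[OF z] by blast
    have "(\<lambda>n. f (rad n *\<^sub>R z)) \<longlonglongrightarrow> l" using filterlim_compose[OF l rad_at_left] .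
    then have "lim (\<lambda>n. h (rad n) z) = l" by (simp add: h_def dil_def limI)
    then show ?thesis using True radial_limit_eq[OF l] by simp
  next
    case False
    then have "(\<lambda>l. ((\<lambda>r. f (r *\<^sub>R z)) \<longlongrightarrow> l) (at_left 1)) = (\<lambda>l. False)" using C[OF z] by auto
    then show ?thesis using False by (simp add: radial_limit_def t2_space_class.Lim_def)
  qed
  then have "radial_limit f \<in> borel_measurable sphere_measure \<longleftrightarrow>
     (\<lambda>z. if C z then lim (\<lambda>n. h (rad n) z) else (THE l. False)) \<in> borel_measurable sphere_measure"
    by (intro measurable_cong) simp
  moreover have "(\<lambda>z. if C z then lim (\<lambda>n. h (rad n) z) else (THE l. False)) \<in> borel_measurable sphere_measure"
    by measurable
  ultimately show ?thesis by (rule iffD2)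
qed

lemma radial_limit_AE:
  fixes f :: "complex^'n \<Rightarrow> complex"
  assumes f: "f \<in> hardy_space"
  shows "AE z in sphere_measure. ((\<lambda>r. f (r *\<^sub>R z)) \<longlongrightarrow> radial_limit f z) (at_left 1)"
  using radial_limit_exists[OF f] by eventually_elim (metis radial_limit_eq)

lemma radial_limit_seq_AE:
  fixes f :: "complex^'n \<Rightarrow> complex"
  assumes f: "f \<in> hardy_space"
  shows "AE z in sphere_measure. (\<lambda>n. dil f (rad n) z) \<longlonglongrightarrow> radial_limit f z"
  using radial_limit_AE[OF f] unfolding dil_def
  by eventually_elim (rule filterlim_compose[OF _ rad_at_left])

text \<open>Dilates are Cauchy in norm and converge almost everywhere along \<open>rad\<close>;
  Fatou's lemma identifies the norm limit with the radial limit.\<close>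

lemma radial_limit_L2:
  fixes f :: "complex^'n \<Rightarrow> complex"
  assumes f: "f \<in> hardy_space"
  shows "radial_limit f \<in> L2_space sphere_measure"
    and "(\<lambda>n. nrmS (\<lambda>z. dil f (rad n) z - radial_limit f z)) \<longlonglongrightarrow> 0"
proof -
  have hol: "hol_ball 1 f" using f by (rule hardy_hol)
  note [measurable] = radial_limit_measurable[OF hol]
  have d: "dil f (rad n) \<in> L2_space sphere_measure" for n by (intro dil_L2 hol) auto
  have key: "(\<lambda>z. dil f (rad n) z - radial_limit f z) \<in> L2_space sphere_measure \<and> nrmS (\<lambda>z. dil f (rad n) z - radial_limit f z) \<le> e"
    if "0 < r0" "r0 < 1" and r0: "\<And>r s. r0 \<le> r \<Longrightarrow> r < 1 \<Longrightarrow> r0 \<le> s \<Longrightarrow> s < 1 \<Longrightarrow> nrmS (\<lambda>z. dil f r z - dil f s z) < e"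
      and n: "r0 \<le> rad n" and e: "e > 0" for r0 n e
  proof -
    have "AE z in sphere_measure. (\<lambda>m. dil f (rad n) z - dil f (rad m) z) \<longlonglongrightarrow> dil f (rad n) z - radial_limit f z"
      using radial_limit_seq_AE[OF f] by eventually_elim (intro tendsto_intros)
    moreover have "\<forall>\<^sub>F m in sequentially. nrmS (\<lambda>z. dil f (rad n) z - dil f (rad m) z) \<le> e"
      using rad_eventually[OF \<open>r0 < 1\<close>] by eventually_elim (use r0 n in \<open>auto intro: less_imp_le\<close>)
    moreover have "(\<lambda>z. dil f (rad n) z - radial_limit f z) \<in> borel_measurable sphere_measure"
      using d[of n] by (auto simp: L2_space_def)
    ultimately show ?thesis
      using L2_fatou[of "\<lambda>m z. dil f (rad n) z - dil f (rad m) z" sphere_measure "\<lambda>z. dil f (rad n) z - radial_limit f z" e]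
        L2.diff_closed[OF d d] e by auto
  qed
  obtain r0 where r0: "0 < r0" "r0 < 1" "\<And>r s. r0 \<le> r \<Longrightarrow> r < 1 \<Longrightarrow> r0 \<le> s \<Longrightarrow> s < 1 \<Longrightarrow> nrmS (\<lambda>z. dil f r z - dil f s z) < 1"
    using hardy_cauchy[OF f, of 1] by (metis zero_less_one)
  obtain n where n: "r0 \<le> rad n"
    using eventually_happens'[OF sequentially_bot rad_eventually[OF r0(2)]] by blast
  have "(\<lambda>z. dil f (rad n) z - (dil f (rad n) z - radial_limit f z)) \<in> L2_space sphere_measure"
    by (rule L2.diff_closed[OF d]) (use key[OF r0 n] in simp)
  then show "radial_limit f \<in> L2_space sphere_measure" by simp
  show "(\<lambda>n. nrmS (\<lambda>z. dil f (rad n) z - radial_limit f z)) \<longlonglongrightarrow> 0"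
  proof (rule LIMSEQ_I)
    fix e :: real assume e: "e > 0"
    obtain r0 where r0: "0 < r0" "r0 < 1" "\<And>r s. r0 \<le> r \<Longrightarrow> r < 1 \<Longrightarrow> r0 \<le> s \<Longrightarrow> s < 1 \<Longrightarrow> nrmS (\<lambda>z. dil f r z - dil f s z) < e / 2"
      using hardy_cauchy[OF f, of "e / 2"] e by (metis half_gt_zero)
    obtain N where N: "\<And>n. n \<ge> N \<Longrightarrow> r0 \<le> rad n"
      using rad_eventually[OF r0(2)] by (auto simp: eventually_sequentially)
    have "norm (nrmS (\<lambda>z. dil f (rad n) z - radial_limit f z) - 0) < e" if "n \<ge> N" for n
      using key[OF r0 N[OF that]] e L2.nrm_nonneg[of "\<lambda>z. dil f (rad n) z - radial_limit f z" sphere_measure] by simp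
    then show "\<exists>N. \<forall>n\<ge>N. norm (nrmS (\<lambda>z. dil f (rad n) z - radial_limit f z) - 0) < e" by blast
  qed
qed

text \<open>Turns the inner product of boundary values into a limit of pairings of continuous
  functions, so that algebraic identities and the reproducing property can be proved for
  dilates.\<close>

lemma hardy_inner_limit:
  fixes f g :: "complex^'n \<Rightarrow> complex"
  assumes f: "f \<in> hardy_space" and g: "g \<in> hardy_space"
  shows "(\<lambda>n. L2_inner sphere_measure (dil f (rad n)) (dil g (rad n))) \<longlonglongrightarrow> hardy_inner f g"
proof -
  note F = radial_limit_L2[OF f] and G = radial_limit_L2[OF g]
  have df: "dil f (rad n) \<in> L2_space sphere_measure" and dg: "dil g (rad n) \<in> L2_space sphere_measure" for n
    by (intro dil_L2 hardy_hol f g; simp)+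
  obtain B where B: "0 \<le> B" "\<And>r. 0 \<le> r \<Longrightarrow> r < 1 \<Longrightarrow> nrmS (dil g r) \<le> B" using hardyE[OF g] by blast
  have "(\<lambda>n. L2_inner sphere_measure (\<lambda>z. dil f (rad n) z - radial_limit f z) (dil g (rad n))) \<longlonglongrightarrow> 0"
  proof (rule Lim_null_comparison)
    show "\<forall>\<^sub>F n in sequentially. norm (L2_inner sphere_measure (\<lambda>z. dil f (rad n) z - radial_limit f z) (dil g (rad n)))
        \<le> nrmS (\<lambda>z. dil f (rad n) z - radial_limit f z) * B"
      by (intro always_eventually allI order_trans[OF L2.cauchy_schwarz] mult_left_mono B L2.nrm_nonneg L2.diff_closed df dg F) auto
    show "(\<lambda>n. nrmS (\<lambda>z. dil f (rad n) z - radial_limit f z) * B) \<longlonglongrightarrow> 0"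
      using tendsto_mult_right[OF F(2), of B] by simp
  qed
  moreover have "(\<lambda>n. L2_inner sphere_measure (radial_limit f) (dil g (rad n))) \<longlonglongrightarrow> hardy_inner f g"
    unfolding hardy_inner_def by (rule L2.tendsto_ip_right[OF dg G(1) F(1) G(2)])
  ultimately have "(\<lambda>n. L2_inner sphere_measure (\<lambda>z. dil f (rad n) z - radial_limit f z) (dil g (rad n))
      + L2_inner sphere_measure (radial_limit f) (dil g (rad n))) \<longlonglongrightarrow> 0 + hardy_inner f g"
    by (rule tendsto_add)
  then show ?thesis by (simp add: L2.ip_diff df dg F)
qed

text \<open>Linearity is transferred from the dilates through \<open>hardy_inner_limit\<close>;
  symmetry and positivity are inherited from L2, applied to the radial limits.\<close>

interpretation H2: semi_inner_space "hardy_space :: (complex^'n \<Rightarrow> complex) set" hardy_inner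
proof
  fix f g h :: "complex^'n \<Rightarrow> complex" and c
  have d: "dil f (rad n) \<in> L2_space sphere_measure" if "f \<in> hardy_space" for f :: "complex^'n \<Rightarrow> complex" and n
    using that by (intro dil_L2 hardy_hol) auto
  show add: "(\<lambda>x. f x + g x) \<in> hardy_space" if f: "f \<in> hardy_space" and g: "g \<in> hardy_space"
    for f g :: "complex^'n \<Rightarrow> complex"
  proof -
    obtain B where B: "0 \<le> B" "\<And>r. 0 \<le> r \<Longrightarrow> r < 1 \<Longrightarrow> nrmS (dil f r) \<le> B" using hardyE[OF f] by blast
    obtain C where C: "0 \<le> C" "\<And>r. 0 \<le> r \<Longrightarrow> r < 1 \<Longrightarrow> nrmS (dil g r) \<le> C" using hardyE[OF g] by blast
    show ?thesis
    proof (rule hardyI)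
      fix r :: real assume r: "0 < r" "r < 1"
      have "nrmS (\<lambda>x. dil f r x + dil g r x) \<le> nrmS (dil f r) + nrmS (dil g r)"
        using r by (intro L2.nrm_triangle dil_L2 hardy_hol f g) auto
      then show "nrmS (dil (\<lambda>x. f x + g x) r) \<le> B + C"
        using B(2)[of r] C(2)[of r] r by (simp add: dil_def[abs_def])
    qed (intro hol_ball_add hardy_hol f g)
  qed
  show scale: "(\<lambda>x. c * f x) \<in> hardy_space" if f: "f \<in> hardy_space" for f :: "complex^'n \<Rightarrow> complex" and c
  proof -
    obtain B where B: "0 \<le> B" "\<And>r. 0 \<le> r \<Longrightarrow> r < 1 \<Longrightarrow> nrmS (dil f r) \<le> B" using hardyE[OF f] by blast
    show ?thesis
    proof (rule hardyI)
      fix r :: real assume r: "0 < r" "r < 1"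
      have "nrmS (\<lambda>x. c * dil f r x) = norm c * nrmS (dil f r)"
        using r by (intro L2.nrm_scale dil_L2 hardy_hol f) auto
      then show "nrmS (dil (\<lambda>x. c * f x) r) \<le> norm c * B"
        using B(2)[of r] r by (simp add: dil_def[abs_def] mult_left_mono)
    qed (intro hol_ball_mult hol_ball_const hardy_hol f)
  qed
  show "hardy_inner (\<lambda>x. f x + g x) h = hardy_inner f h + hardy_inner g h"
    if f: "f \<in> hardy_space" and g: "g \<in> hardy_space" and h: "h \<in> hardy_space"
  proof -
    have "L2_inner sphere_measure (dil (\<lambda>x. f x + g x) (rad n)) (dil h (rad n))
       = L2_inner sphere_measure (dil f (rad n)) (dil h (rad n)) + L2_inner sphere_measure (dil g (rad n)) (dil h (rad n))" for n
      using L2.ip_add[OF d[OF f, of n] d[OF g, of n] d[OF h, of n]] by (simp add: dil_def[abs_def])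
    then show ?thesis
      using hardy_inner_limit[OF add[OF f g] h] tendsto_add[OF hardy_inner_limit[OF f h] hardy_inner_limit[OF g h]]
      by (simp add: LIMSEQ_unique)
  qed
  show "hardy_inner (\<lambda>x. c * f x) h = c * hardy_inner f h"
    if f: "f \<in> hardy_space" and h: "h \<in> hardy_space"
  proof -
    have "L2_inner sphere_measure (dil (\<lambda>x. c * f x) (rad n)) (dil h (rad n))
       = c * L2_inner sphere_measure (dil f (rad n)) (dil h (rad n))" for n
      using L2.ip_scale[OF d[OF f, of n] d[OF h, of n]] by (simp add: dil_def[abs_def])
    then show ?thesis
      using hardy_inner_limit[OF scale[OF f, of c] h] tendsto_mult_left[OF hardy_inner_limit[OF f h], of c]
      by (simp add: LIMSEQ_unique)
  qed
  show "cnj (hardy_inner f g) = hardy_inner g f" if "f \<in> hardy_space" "g \<in> hardy_space"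
    unfolding hardy_inner_def using that by (intro L2.ip_cnj radial_limit_L2)
  show "0 \<le> Re (hardy_inner f f)" if "f \<in> hardy_space"
    unfolding hardy_inner_def using that by (intro L2.ip_nonneg radial_limit_L2)
qed

lemma hardy_nrm_limit:
  assumes f: "f \<in> hardy_space"
  shows "(\<lambda>n. nrmS (dil f (rad n))) \<longlonglongrightarrow> H2.nrm f"
  unfolding H2.nrm_def L2.nrm_def using hardy_inner_limit[OF f f] by (intro tendsto_intros)

lemma dil_le_hardy_nrm:
  assumes f: "f \<in> hardy_space" and r: "0 \<le> r" "r < 1"
  shows "nrmS (dil f r) \<le> H2.nrm f"
proof (rule tendsto_lowerbound[OF hardy_nrm_limit[OF f]])
  show "\<forall>\<^sub>F n in sequentially. nrmS (dil f r) \<le> nrmS (dil f (rad n))"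
    using rad_eventually[OF r(2)] by eventually_elim (rule dil_mono[OF hardy_hol[OF f] r(1)], auto)
qed simp

lemma hardy_nrm_le:
  assumes f: "f \<in> hardy_space" and "\<And>r. 0 < r \<Longrightarrow> r < 1 \<Longrightarrow> nrmS (dil f r) \<le> B"
  shows "H2.nrm f \<le> B"
  by (rule tendsto_upperbound[OF hardy_nrm_limit[OF f]]) (use assms in auto)

lemma hardy_bounded:
  assumes f: "hol_ball 1 f" and B: "\<And>z. z \<in> ball 0 1 \<Longrightarrow> norm (f z) \<le> B"
  shows "f \<in> hardy_space"
proof (rule hardyI[OF f])
  fix r :: real assume r: "0 < r" "r < 1"
  have B0: "0 \<le> B" using B[of 0] norm_ge_zero[of "f 0"] by (simp del: norm_ge_zero)
  have "(\<integral>z. (norm (dil f r z))\<^sup>2 \<partial>sphere_measure) \<le> (\<integral>z. B\<^sup>2 \<partial>(sphere_measure :: (complex^'a) measure))"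
    using dil_L2[OF f, of r] r
    by (intro integral_mono) (auto simp: L2_space_def dil_def intro!: power_mono B)
  then show "nrmS (dil f r) \<le> B"
    unfolding L2_nrm using B0 by (intro real_le_lsqrt) auto
qed

section \<open>The Cauchy kernel as reproducing kernel of the Hardy space\<close>

lemma hol_ball_compose:
  fixes f :: "complex^'n \<Rightarrow> complex"
  assumes f: "hol_ball R f" and g: "\<And>z. z \<in> ball 0 R \<Longrightarrow> g field_differentiable at (f z)"
  shows "hol_ball R (\<lambda>z. g (f z))"
  unfolding hol_ball_def
proof
  fix z :: "complex^'n" assume z: "z \<in> ball 0 R"
  then obtain L where L: "(f has_derivative L) (at z)" "\<And>c v. L (c *s v) = c * L v"
    using f unfolding hol_ball_def by blast
  obtain D where "(g has_field_derivative D) (at (f z))" using g[OF z] by (auto simp: field_differentiable_def)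
  then have "(g has_derivative (*) D) (at (f z))" by (simp add: has_field_derivative_def)
  from has_derivative_compose[OF L(1) this]
  show "\<exists>L. ((\<lambda>z. g (f z)) has_derivative L) (at z) \<and> (\<forall>c v. L (c *s v) = c * L v)"
    by (intro exI[of _ "\<lambda>h. D * L h"]) (auto simp: L(2))
qed

lemma one_minus_cinner_ne:
  assumes "norm z * norm w < 1"
  shows "1 - cinner z w \<noteq> 0"
  using norm_cinner_le[of z w] assms by (metis eq_iff_diff_eq_0 norm_one not_less)

lemma cauchy_kernel_cnj [simp]: "cnj (cauchy_kernel z w) = cauchy_kernel w z"
  by (simp add: cauchy_kernel_def)

lemma hol_ball_cauchy_kernel:
  fixes w :: "complex^'n"
  assumes "R * norm w < 1 \<or> R * norm w = 1 \<and> w \<noteq> 0"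
  shows "hol_ball R (\<lambda>z. cauchy_kernel z w)"
  unfolding cauchy_kernel_def
proof (rule hol_ball_compose[OF hol_ball_cinner, where g = "\<lambda>u. 1 / (1 - u) ^ CARD('n)"])
  fix z :: "complex^'n" assume z: "z \<in> ball 0 R"
  have "norm z * norm w < 1"
  proof (cases "w = 0")
    case False
    then have "norm z * norm w < R * norm w" using z by simp
    then show ?thesis using assms by linarith
  qed simp
  then have "1 - cinner z w \<noteq> 0" by (rule one_minus_cinner_ne)
  then show "(\<lambda>u. 1 / (1 - u) ^ CARD('n)) field_differentiable at (cinner z w)"
    by (intro derivative_intros) auto
qed

lemma cauchy_kernel_bound:
  fixes w :: "complex^'n"
  assumes z: "norm z \<le> 1" and w: "norm w < 1"
  shows "norm (cauchy_kernel z w) \<le> 1 / (1 - norm w) ^ CARD('n)"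
    and "norm (cauchy_kernel w z) \<le> 1 / (1 - norm w) ^ CARD('n)"
proof -
  have "norm (cinner z w) \<le> 1 * norm w"
    using norm_cinner_le[of z w] mult_right_mono[OF z norm_ge_zero[of w]] by linarith
  then have "1 - norm w \<le> norm (1 - cinner z w)"
    using norm_triangle_ineq2[of 1 "cinner z w"] by simp
  then have "(1 - norm w) ^ CARD('n) \<le> norm (1 - cinner z w) ^ CARD('n)"
    using w by (intro power_mono) auto
  then show le: "norm (cauchy_kernel z w) \<le> 1 / (1 - norm w) ^ CARD('n)"
    unfolding cauchy_kernel_def norm_divide norm_power norm_one using w \<open>1 - norm w \<le> norm (1 - cinner z w)\<close>
    by (intro divide_left_mono mult_pos_pos zero_less_power) auto
  then show "norm (cauchy_kernel w z) \<le> 1 / (1 - norm w) ^ CARD('n)"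
    by (metis cauchy_kernel_cnj complex_mod_cnj)
qed

lemma cauchy_kernel_hardy:
  fixes w :: "complex^'n"
  assumes w: "norm w < 1"
  shows "(\<lambda>z. cauchy_kernel z w) \<in> hardy_space"
  using w by (intro hardy_bounded[where B = "1 / (1 - norm w) ^ CARD('n)"] hol_ball_cauchy_kernel cauchy_kernel_bound(1)) auto

text \<open>The dilate of the kernel at \<open>w\<close> is the kernel at
  \<open>rad n *\<^sub>R w\<close>, and the Cauchy formula evaluates the dilate of \<open>f\<close>
  at that point; hence two factors \<open>rad n\<close> before the limit.\<close>

theorem hardy_reproducing:
  fixes w :: "complex^'n"
  assumes f: "f \<in> hardy_space" and w: "norm w < 1"
  shows "hardy_inner f (\<lambda>z. cauchy_kernel z w) = f w"
proof -
  have hol: "hol_ball 1 f" using f by (rule hardy_hol)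
  have "L2_inner sphere_measure (dil f (rad n)) (dil (\<lambda>z. cauchy_kernel z w) (rad n)) = f ((rad n * rad n) *\<^sub>R w)" for n
  proof -
    have "norm (rad n *\<^sub>R w) < 1" using mult_strict_mono[of "rad n" 1 "norm w" 1] w by simp
    moreover have "hol_ball (1 / rad n) (dil f (rad n))" by (rule hol_ball_dil[OF hol]) simp
    ultimately have "(\<integral>z. dil f (rad n) z * cauchy_kernel (rad n *\<^sub>R w) z \<partial>sphere_measure) = dil f (rad n) (rad n *\<^sub>R w)"
      by (intro cauchy_sphere[where R = "1 / rad n"]) auto
    then show ?thesis
      by (simp add: L2_inner_def dil_def) (simp add: cauchy_kernel_def)
  qed
  moreover have "(\<lambda>n. f ((rad n * rad n) *\<^sub>R w)) \<longlonglongrightarrow> f ((1 * 1) *\<^sub>R w)"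
  proof (rule isCont_tendsto_compose[of "(1 * 1) *\<^sub>R w" f])
    show "isCont f ((1 * 1) *\<^sub>R w)"
      using hol_ball_continuous[OF hol] w by (auto simp: continuous_on_eq_continuous_at)
    show "(\<lambda>n. (rad n * rad n) *\<^sub>R w) \<longlonglongrightarrow> (1 * 1) *\<^sub>R w" by (intro tendsto_intros rad_tendsto)
  qed
  ultimately show ?thesis
    using hardy_inner_limit[OF f cauchy_kernel_hardy[OF w]] by (simp add: LIMSEQ_unique)
qed

section \<open>The model space\<close>

lemma inner_function_hol: "inner_function I \<Longrightarrow> hol_ball 1 I"
  by (simp add: inner_function_def hol_ball_1)

lemma inner_function_lt_1: "inner_function I \<Longrightarrow> norm z < 1 \<Longrightarrow> norm (I z) < 1"
  by (fastforce simp: inner_function_def)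

lemma hardy_dominated:
  fixes f g :: "complex^'n \<Rightarrow> complex"
  assumes f: "hol_ball 1 f" and g: "g \<in> hardy_space" and le: "\<And>z. z \<in> ball 0 1 \<Longrightarrow> norm (f z) \<le> norm (g z)"
  shows "f \<in> hardy_space"
proof -
  obtain B where B: "0 \<le> B" "\<And>r. 0 \<le> r \<Longrightarrow> r < 1 \<Longrightarrow> nrmS (dil g r) \<le> B" using hardyE[OF g] by blast
  show ?thesis
  proof (rule hardyI[OF f])
    fix r :: real assume r: "0 < r" "r < 1"
    have "(\<integral>z. (norm (dil f r z))\<^sup>2 \<partial>sphere_measure) \<le> (\<integral>z. (norm (dil g r z))\<^sup>2 \<partial>sphere_measure)"
      using dil_L2[OF f, of r] dil_L2[OF hardy_hol[OF g], of r] r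
      by (intro integral_mono) (auto simp: L2_space_def dil_def intro!: power_mono le)
    then have "nrmS (dil f r) \<le> nrmS (dil g r)" by (simp add: L2_nrm)
    then show "nrmS (dil f r) \<le> B" using B(2)[of r] r by simp
  qed
qed

lemma inner_mult_hardy:
  assumes I: "inner_function I" and g: "g \<in> hardy_space"
  shows "(\<lambda>z. I z * g z) \<in> hardy_space"
proof (rule hardy_dominated[OF _ g])
  show "hol_ball 1 (\<lambda>z. I z * g z)" by (intro hol_ball_mult inner_function_hol I hardy_hol g)
  fix z :: "complex^'a" assume "z \<in> ball 0 1"
  then show "norm (I z * g z) \<le> norm (g z)"
    using inner_function_lt_1[OF I, of z] by (simp add: norm_mult mult_left_le_one_le)
qed

text \<open>Here the unimodularity of the radial limits of \<open>I\<close> enters. Radial limits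
  are multiplicative wherever those of both factors exist, hence almost everywhere.\<close>

lemma inner_mult_isometry:
  fixes I :: "complex^'n \<Rightarrow> complex"
  assumes I: "inner_function I" and f: "f \<in> hardy_space" and g: "g \<in> hardy_space"
  shows "hardy_inner (\<lambda>z. I z * f z) (\<lambda>z. I z * g z) = hardy_inner f g"
proof -
  have rl: "AE z in sphere_measure. radial_limit (\<lambda>z. I z * f z) z = radial_limit I z * radial_limit f z"
    if f: "f \<in> hardy_space" for f
  proof -
    have "AE z in sphere_measure. ((\<lambda>r. I (r *\<^sub>R z)) \<longlongrightarrow> radial_limit I z) (at_left 1)"
      using I by (auto simp: inner_function_def)
    with radial_limit_AE[OF f] show ?thesis
      by eventually_elim (intro radial_limit_eq tendsto_mult)
  qed
  have "AE z in sphere_measure. norm (radial_limit I z) = 1"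
    using I by (auto simp: inner_function_def)
  with rl[OF f] rl[OF g] have "AE z in sphere_measure. radial_limit (\<lambda>z. I z * f z) z * cnj (radial_limit (\<lambda>z. I z * g z) z)
     = radial_limit f z * cnj (radial_limit g z)"
  proof eventually_elim
    fix z assume 1: "radial_limit (\<lambda>z. I z * f z) z = radial_limit I z * radial_limit f z"
      "radial_limit (\<lambda>z. I z * g z) z = radial_limit I z * radial_limit g z" and 2: "norm (radial_limit I z) = 1"
    have "radial_limit I z * cnj (radial_limit I z) = 1" using complex_norm_square[of "radial_limit I z"] 2 by simp
    then show "radial_limit (\<lambda>z. I z * f z) z * cnj (radial_limit (\<lambda>z. I z * g z) z)
     = radial_limit f z * cnj (radial_limit g z)"
      unfolding 1 by (simp add: mult_ac)
  qed
  moreover have [measurable]: "radial_limit f \<in> borel_measurable sphere_measure" "radial_limit g \<in> borel_measurable sphere_measure"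
    "radial_limit (\<lambda>z. I z * f z) \<in> borel_measurable sphere_measure" "radial_limit (\<lambda>z. I z * g z) \<in> borel_measurable sphere_measure"
    by (intro radial_limit_measurable hardy_hol f g inner_mult_hardy I)+
  ultimately show ?thesis
    unfolding hardy_inner_def L2_inner_def by (intro integral_cong_AE) measurable
qed

lemma model_kernel_alt:
  "model_kernel I w = (\<lambda>z. cauchy_kernel z w - cnj (I w) * (I z * cauchy_kernel z w))"
  by (rule ext) (simp add: model_kernel_def algebra_simps)

lemma model_space_hardy: "f \<in> model_space I \<Longrightarrow> f \<in> hardy_space"
  by (simp add: model_space_def)

text \<open>Paired with \<open>I z * g z\<close>, both terms of the kernel contribute
  \<open>cnj (I w * g w)\<close>: the first by the reproducing property, the second because
  multiplication by \<open>I\<close> is isometric. They cancel.\<close>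

lemma model_kernel_in_model_space:
  fixes w :: "complex^'n"
  assumes I: "inner_function I" and w: "norm w < 1"
  shows "model_kernel I w \<in> model_space I"
proof -
  let ?k = "\<lambda>z. cauchy_kernel z w"
  have k: "?k \<in> hardy_space" by (rule cauchy_kernel_hardy[OF w])
  have Ik: "(\<lambda>z. I z * ?k z) \<in> hardy_space" by (rule inner_mult_hardy[OF I k])
  have cIk: "(\<lambda>z. cnj (I w) * (I z * ?k z)) \<in> hardy_space" by (rule H2.scale_closed[OF Ik])
  have "model_kernel I w \<in> hardy_space"
    unfolding model_kernel_alt by (rule H2.diff_closed[OF k cIk])
  moreover have "hardy_inner (model_kernel I w) (\<lambda>z. I z * g z) = 0" if g: "g \<in> hardy_space" for g
  proof -
    have Ig: "(\<lambda>z. I z * g z) \<in> hardy_space" by (rule inner_mult_hardy[OF I g])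
    have "hardy_inner ?k (\<lambda>z. I z * g z) = cnj (I w * g w)"
      using H2.ip_cnj[OF Ig k] hardy_reproducing[OF Ig w] by simp
    moreover have "hardy_inner ?k g = cnj (g w)"
      using H2.ip_cnj[OF g k] hardy_reproducing[OF g w] by simp
    ultimately show ?thesis
      unfolding model_kernel_alt H2.ip_diff[OF k cIk Ig] H2.ip_scale[OF Ik Ig] inner_mult_isometry[OF I k g]
      by simp
  qed
  ultimately show ?thesis by (simp add: model_space_def)
qed

text \<open>The second term of the kernel is a multiple of \<open>I\<close> times a Hardy function,
  to which the model space is orthogonal; the Cauchy kernel alone remains.\<close>

lemma model_reproducing:
  fixes w :: "complex^'n"
  assumes I: "inner_function I" and w: "norm w < 1" and f: "f \<in> model_space I"
  shows "hardy_inner f (model_kernel I w) = f w"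
proof -
  let ?k = "\<lambda>z. cauchy_kernel z w"
  have k: "?k \<in> hardy_space" by (rule cauchy_kernel_hardy[OF w])
  have Ik: "(\<lambda>z. I z * ?k z) \<in> hardy_space" by (rule inner_mult_hardy[OF I k])
  have cIk: "(\<lambda>z. cnj (I w) * (I z * ?k z)) \<in> hardy_space" by (rule H2.scale_closed[OF Ik])
  have fH: "f \<in> hardy_space" using f by (rule model_space_hardy)
  have "hardy_inner f (\<lambda>z. I z * ?k z) = 0" using f k by (auto simp: model_space_def)
  then show ?thesis
    unfolding model_kernel_alt H2.ip_diff_right[OF k cIk fH] H2.ip_scale_right[OF Ik fH]
    by (simp add: hardy_reproducing[OF fH w])
qed

lemma model_space_comb:
  assumes I: "inner_function I" and f: "f \<in> model_space I" and g: "g \<in> model_space I"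
  shows "(\<lambda>z. a * f z + b * g z) \<in> model_space I"
proof -
  have "hardy_inner (\<lambda>z. a * f z + b * g z) (\<lambda>z. I z * h z) = 0" if h: "h \<in> hardy_space" for h
    using H2.ip_comb[OF model_space_hardy[OF f] model_space_hardy[OF g] inner_mult_hardy[OF I h], of a b] f g h
    by (simp add: model_space_def)
  then show ?thesis
    using H2.comb_closed[OF model_space_hardy[OF f] model_space_hardy[OF g], of a b] by (simp add: model_space_def)
qed

text \<open>A function holomorphic in the first and antiholomorphic in the second variable is
  determined by the diagonal. With first argument \<open>P + u *s Q\<close> and second argument
  \<open>P + cnj v *s Q\<close>, put \<open>u = x + \<i> * y\<close> and
  \<open>v = x - \<i> * y\<close>: real \<open>x\<close>, \<open>y\<close> give diagonal points,
  complex ones fill a neighbourhood of \<open>(u, v) = (0, 0)\<close>, and \<open>u = 1\<close>,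
  \<open>v = -1\<close> give \<open>a\<close> and \<open>b\<close>. One-variable continuation is
  applied in \<open>y\<close>, \<open>x\<close>, \<open>u\<close> and \<open>v\<close> in
  turn.\<close>

lemma polarization:
  fixes E :: "complex^'n \<Rightarrow> complex^'n \<Rightarrow> complex"
  assumes hol: "\<And>p q p' q'. (\<lambda>u. E (p + u *s q) (p' + cnj u *s q')) holomorphic_on
      {u. p + u *s q \<in> ball 0 1 \<and> p' + cnj u *s q' \<in> ball 0 1}"
    and diag: "\<And>z. z \<in> ball 0 1 \<Longrightarrow> E z z = 0" and a: "a \<in> ball 0 1" and b: "b \<in> ball 0 1"
  shows "E a b = 0"
proof -
  define P where "P = (1/2::real) *\<^sub>R (a + b)"
  define Q where "Q = (1/2::real) *\<^sub>R (a - b)"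
  have aPQ: "a = P + 1 *s Q" and bPQ: "b = P + cnj (-1) *s Q"
    by (simp_all add: P_def Q_def algebra_simps flip: scaleR_add_left scaleR_diff_left)
  have P: "norm P < 1"
  proof -
    have "norm P \<le> (norm a + norm b) / 2" using norm_triangle_ineq[of a b] by (simp add: P_def)
    then show ?thesis using a b by simp
  qed
  \<comment> \<open>\<open>x\<close> and \<open>y\<close> below \<open>e\<close> give
    \<open>u\<close> and \<open>v\<close> below \<open>2 * e\<close>, which keeps both arguments in
    the ball; the added \<open>1\<close> covers \<open>a = b\<close>, where
    \<open>Q = 0\<close>.\<close>
  define e where "e = (1 - norm P) / (2 * (norm Q + 1))"
  have e: "e > 0" unfolding e_def using P by (intro divide_pos_pos) (auto intro: add_nonneg_pos)
  have near: "P + u *s Q \<in> ball 0 1" if "norm u < 2 * e" for u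
  proof -
    have "norm u * norm Q \<le> 2 * e * norm Q" using that by (intro mult_right_mono) auto
    also have "\<dots> < 2 * e * (norm Q + 1)" using e by simp
    also have "\<dots> = 1 - norm P"
    proof -
      have "2 * (p / (2 * N)) * N = p" if "N \<noteq> 0" for p N :: real using that by simp
      moreover have "norm Q + 1 \<noteq> 0" using norm_ge_zero[of Q] by linarith
      ultimately show ?thesis unfolding e_def by blast
    qed
    finally show ?thesis using norm_triangle_ineq[of P "u *s Q"] by simp
  qed
  have real_islimpt: "0 islimpt (of_real ` {-e<..<e} :: complex set)"
  proof (rule islimptI)
    fix T :: "complex set" assume "0 \<in> T" "open T"
    then obtain d where d: "d > 0" "ball 0 d \<subseteq> T" using open_contains_ball by blast
    define x where "x = min (e/2) (d/2)"
    have x: "0 < x" "x < e" "x < d" using e d by (auto simp: x_def)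
    then show "\<exists>y\<in>of_real ` {-e<..<e}. y \<in> T \<and> y \<noteq> (0::complex)"
      using d by (intro bexI[of _ "of_real x"]) (auto simp: subset_iff)
  qed
  have xy: "E (P + (x + \<i> * y) *s Q) (P + cnj (x - \<i> * y) *s Q) = 0" if x: "norm x < e" and y: "norm y < e" for x y
  proof -
    have sum2: "norm (x + \<i> * y) < 2 * e" "norm (cnj (x - \<i> * y)) < 2 * e" if "norm x < e" "norm y < e" for x y :: complex
      unfolding complex_mod_cnj
      using norm_triangle_ineq[of x "\<i> * y"] norm_triangle_ineq4[of x "\<i> * y"] that by (simp_all add: norm_mult)
    have step1: "E (P + (of_real x + \<i> * y) *s Q) (P + cnj (of_real x - \<i> * y) *s Q) = 0" if x: "\<bar>x\<bar> < e" and y: "norm y < e" for x :: real and y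
    proof -
      let ?h = "\<lambda>y. E (P + of_real x *s Q + y *s (\<i> *s Q)) (P + of_real x *s Q + cnj y *s (\<i> *s Q))"
      have id: "?h y = E (P + (of_real x + \<i> * y) *s Q) (P + cnj (of_real x - \<i> * y) *s Q)" for y
        by (rule arg_cong2[where f = E]) (simp_all add: vec_eq_iff algebra_simps)
      have "?h y = 0"
      proof (rule analytic_continuation[where S = "ball 0 e" and f = ?h and U = "of_real ` {-e<..<e}" and \<xi> = 0])
        show "?h holomorphic_on ball 0 e"
        proof (rule holomorphic_on_subset[OF hol], safe)
          fix y :: complex assume "y \<in> ball 0 e"
          then have "P + (of_real x + \<i> * y) *s Q \<in> ball 0 1" "P + cnj (of_real x - \<i> * y) *s Q \<in> ball 0 1"
            using x by (intro near sum2; simp)+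
          then show "P + of_real x *s Q + y *s (\<i> *s Q) \<in> ball 0 1" "P + of_real x *s Q + cnj y *s (\<i> *s Q) \<in> ball 0 1"
            by (simp_all add: vec.scale_left_distrib add.assoc mult.commute)
        qed
        fix z :: complex assume "z \<in> of_real ` {-e<..<e}"
        then obtain t :: real where t: "z = of_real t" "\<bar>t\<bar> < e" by auto
        have "P + (of_real x + \<i> * z) *s Q \<in> ball 0 1" using x t by (intro near sum2) auto
        then show "?h z = 0" unfolding id by (simp add: diag t)
      qed (use e y real_islimpt in \<open>auto\<close>)
      then show ?thesis by (simp only: id)
    qed
    let ?h = "\<lambda>x. E (P + (\<i> * y) *s Q + x *s Q) (P + cnj (- (\<i> * y)) *s Q + cnj x *s Q)"
    have id: "?h x = E (P + (x + \<i> * y) *s Q) (P + cnj (x - \<i> * y) *s Q)" for x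
      by (rule arg_cong2[where f = E]) (simp_all add: vec_eq_iff algebra_simps)
    have "?h x = 0"
    proof (rule analytic_continuation[where S = "ball 0 e" and f = ?h and U = "of_real ` {-e<..<e}" and \<xi> = 0])
      show "?h holomorphic_on ball 0 e"
      proof (rule holomorphic_on_subset[OF hol], safe)
        fix x :: complex assume "x \<in> ball 0 e"
        then have "P + (x + \<i> * y) *s Q \<in> ball 0 1" "P + cnj (x - \<i> * y) *s Q \<in> ball 0 1"
          using y by (intro near sum2; simp)+
        moreover have "P + (x + \<i> * y) *s Q = P + (\<i> * y) *s Q + x *s Q"
            "P + cnj (x - \<i> * y) *s Q = P + cnj (- (\<i> * y)) *s Q + cnj x *s Q"
          by (simp_all add: vec_eq_iff algebra_simps)
        ultimately show "P + (\<i> * y) *s Q + x *s Q \<in> ball 0 1" "P + cnj (- (\<i> * y)) *s Q + cnj x *s Q \<in> ball 0 1"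
          by (simp_all only:)
      qed
      fix z :: complex assume "z \<in> of_real ` {-e<..<e}"
      then obtain t :: real where t: "z = of_real t" "\<bar>t\<bar> < e" by auto
      then show "?h z = 0" unfolding id t(1) by (intro step1 y)
    qed (use e x real_islimpt in \<open>auto\<close>)
    then show ?thesis by (simp only: id)
  qed
  have uv: "E (P + u *s Q) (P + cnj v *s Q) = 0" if "norm u < e" "norm v < e" for u v
  proof -
    define x where "x = (u + v) / 2"
    define y where "y = - \<i> * (u - v) / 2"
    have "norm x < e" "norm y < e"
      using norm_triangle_ineq[of u v] norm_triangle_ineq4[of u v] that by (simp_all add: x_def y_def norm_mult norm_divide)
    from xy[OF this] show ?thesis by (simp add: x_def y_def field_simps)
  qed
  \<comment> \<open>A slice of the ball along a complex line is convex, hence connected, and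
    contains both the small disc and the target parameter.\<close>
  have conv: "convex {u. P' + u *s Q \<in> ball 0 1}" for P' :: "complex^'n"
  proof -
    have "{u. P' + u *s Q \<in> ball 0 1} = (\<lambda>u. u *s Q) -` ((\<lambda>x. x - P') ` ball 0 1)"
      by (auto simp: image_iff intro!: bexI[of _ "P' + _ *s Q"])
    then show ?thesis
      using convex_linear_vimage[OF bounded_linear.linear[OF bounded_linear_scale_left[of Q]], of "(\<lambda>x. x - P') ` ball 0 1"]
      by (simp add: convex_translation_subtract)
  qed
  have step4: "E (P + 1 *s Q) (P + cnj v *s Q) = 0" if v: "norm v < e" for v
  proof (rule analytic_continuation[where f = "\<lambda>u. E (P + u *s Q) (P + cnj v *s Q)" and S = "{u. P + u *s Q \<in> ball 0 1}" and U = "ball 0 e" and \<xi> = 0])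
    have Pv: "P + cnj v *s Q \<in> ball 0 1" using v e by (intro near) simp
    then show "(\<lambda>u. E (P + u *s Q) (P + cnj v *s Q)) holomorphic_on {u. P + u *s Q \<in> ball 0 1}"
      using hol[of P Q "P + cnj v *s Q" 0] by simp
    show "open {u. P + u *s Q \<in> ball 0 1}"
      using open_vimage[OF open_ball[of 0 1], of "\<lambda>u. P + u *s Q"] by (simp add: vimage_def continuous_intros)
    show "connected {u. P + u *s Q \<in> ball 0 1}" by (intro convex_connected conv)
    show "1 \<in> {u. P + u *s Q \<in> ball 0 1}" using a aPQ by simp
    show "0 islimpt ball (0::complex) e" using e by (simp add: islimpt_ball)
    show "ball 0 e \<subseteq> {u. P + u *s Q \<in> ball 0 1}" using near e by fastforce
  qed (use uv v P in auto)
  have "E (P + 1 *s Q) (P + cnj (-1) *s Q) = 0"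
  proof (rule analytic_continuation[where f = "\<lambda>v. E (P + 1 *s Q) (P + cnj v *s Q)" and S = "{u. P + cnj u *s Q \<in> ball 0 1}" and U = "ball 0 e" and \<xi> = 0])
    have "P + 1 *s Q \<in> ball 0 1" using a aPQ by simp
    then show "(\<lambda>v. E (P + 1 *s Q) (P + cnj v *s Q)) holomorphic_on {u. P + cnj u *s Q \<in> ball 0 1}"
      using hol[of "P + 1 *s Q" 0 P Q] by simp
    show "open {u. P + cnj u *s Q \<in> ball 0 1}"
      using open_vimage[OF open_ball[of 0 1], of "\<lambda>u. P + cnj u *s Q"] by (simp add: vimage_def continuous_intros)
    have "{u. P + cnj u *s Q \<in> ball 0 1} = cnj ` {u. P + u *s Q \<in> ball 0 1}"
      by (auto simp: image_iff intro!: exI[of _ "cnj _"])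
    then show "connected {u. P + cnj u *s Q \<in> ball 0 1}"
      using connected_continuous_image[OF continuous_on_cnj[OF continuous_on_id] convex_connected[OF conv[of P]]] by simp
    show "-1 \<in> {u. P + cnj u *s Q \<in> ball 0 1}" using b bPQ by simp
    show "0 islimpt ball (0::complex) e" using e by (simp add: islimpt_ball)
    show "ball 0 e \<subseteq> {u. P + cnj u *s Q \<in> ball 0 1}"
    proof
      fix u :: complex assume "u \<in> ball 0 e"
      then show "u \<in> {u. P + cnj u *s Q \<in> ball 0 1}" using near[of "cnj u"] e by simp
    qed
  qed (use step4 P in auto)
  then show ?thesis by (simp only: aPQ[symmetric] bPQ[symmetric])
qed

text \<open>Cauchy estimates turn the local uniform bound on \<open>f\<close> into a bound on its
  derivative and thus on the difference quotients, which is the majorant for dominated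
  convergence.\<close>

lemma holomorphic_on_param_integral:
  fixes f :: "complex \<Rightarrow> 'a \<Rightarrow> complex"
  assumes M: "finite_measure M" and S: "open S"
    and hol: "\<And>x. x \<in> space M \<Longrightarrow> (\<lambda>u. f u x) holomorphic_on S"
    and meas: "\<And>u. u \<in> S \<Longrightarrow> f u \<in> borel_measurable M"
    and bound: "\<And>u. u \<in> S \<Longrightarrow> \<exists>r>0. \<exists>B. cball u r \<subseteq> S \<and> (\<forall>v\<in>cball u r. \<forall>x\<in>space M. norm (f v x) \<le> B)"
  shows "(\<lambda>u. \<integral>x. f u x \<partial>M) holomorphic_on S"
proof (rule holomorphic_onI)
  interpret finite_measure M by fact
  fix u assume u: "u \<in> S"
  then obtain r B where r: "r > 0" "cball u r \<subseteq> S" and B: "\<And>v x. v \<in> cball u r \<Longrightarrow> x \<in> space M \<Longrightarrow> norm (f v x) \<le> B"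
    using bound[OF u] by blast
  define D where "D x = deriv (\<lambda>v. f v x) u" for x
  define q where "q v x = (f v x - f u x) / (v - u)" for v x
  \<comment> \<open>Half the radius leaves room for a Cauchy estimate around every point of the
    smaller disc.\<close>
  have dbound: "norm (deriv (\<lambda>v. f v x) v) \<le> B / (r / 2)" if v: "v \<in> ball u (r / 2)" and x: "x \<in> space M" for v x
  proof -
    have sub: "cball v (r / 2) \<subseteq> cball u r"
    proof
      fix y assume "y \<in> cball v (r / 2)"
      then show "y \<in> cball u r" using v dist_triangle[of u y v] by simp
    qed
    have "norm ((deriv ^^ 1) (\<lambda>v. f v x) v) \<le> fact 1 * B / (r / 2) ^ 1"
    proof (rule Cauchy_inequality)
      show "continuous_on (cball v (r / 2)) (\<lambda>v. f v x)"
        by (intro holomorphic_on_imp_continuous_on holomorphic_on_subset[OF hol[OF x]]) (use sub r in blast)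
      show "(\<lambda>v. f v x) holomorphic_on ball v (r / 2)"
        by (intro holomorphic_on_subset[OF hol[OF x]]) (use sub r ball_subset_cball in blast)
      fix y assume "norm (v - y) = r / 2"
      then have "y \<in> cball v (r / 2)" by (simp add: dist_norm)
      then show "norm (f y x) \<le> B" using sub x by (intro B) blast
    qed (use r in auto)
    then show ?thesis by simp
  qed
  have qbound: "norm (q v x) \<le> B / (r / 2)" if v: "v \<in> ball u (r / 2)" "v \<noteq> u" and x: "x \<in> space M" for v x
  proof -
    have "norm (f v x - f u x) \<le> B / (r / 2) * norm (v - u)"
    proof (rule field_differentiable_bound[where S = "ball u (r / 2)" and f' = "deriv (\<lambda>v. f v x)"])
      fix z assume z: "z \<in> ball u (r / 2)"
      then have "z \<in> cball u r" using r by simp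
      then have "z \<in> S" using r by blast
      then show "((\<lambda>v. f v x) has_field_derivative deriv (\<lambda>v. f v x) z) (at z within ball u (r / 2))"
        using hol[OF x] S holomorphic_derivI by blast
      show "norm (deriv (\<lambda>v. f v x) z) \<le> B / (r / 2)" by (rule dbound[OF z x])
    qed (use v r in auto)
    then show ?thesis using v by (simp add: q_def norm_divide field_simps)
  qed
  have uq: "(\<lambda>n. q (X n) x) \<longlonglongrightarrow> D x" if X: "\<And>n. X n \<noteq> u" "X \<longlonglongrightarrow> u" and x: "x \<in> space M" for X x
  proof -
    have "((\<lambda>v. f v x) has_field_derivative D x) (at u)"
      unfolding D_def using hol[OF x] S u by (rule holomorphic_derivI)
    then have "((\<lambda>v. (f v x - f u x) / (v - u)) \<longlongrightarrow> D x) (at u)"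
      by (simp add: has_field_derivative_iff)
    moreover have "filterlim X (at u) sequentially" using X by (simp add: filterlim_at)
    ultimately show ?thesis unfolding q_def by (rule filterlim_compose)
  qed
  define F where "F v = (\<integral>x. f v x \<partial>M)" for v
  have int_f: "integrable M (f v)" if v: "v \<in> cball u r" for v
    by (rule integrable_const_bound[of _ B]) (use v r B meas in auto)
  have "((\<lambda>v. (F v - F u) / (v - u)) \<longlongrightarrow> (\<integral>x. D x \<partial>M)) (at u)"
    unfolding tendsto_at_iff_sequentially comp_def
  proof safe
    fix X :: "nat \<Rightarrow> complex" assume X: "\<forall>i. X i \<in> UNIV - {u}" "X \<longlonglongrightarrow> u"
    obtain N where N: "\<And>n. n \<ge> N \<Longrightarrow> X n \<in> ball u (r / 2)"
      using tendstoD[OF X(2), of "r / 2"] r by (auto simp: eventually_sequentially dist_commute)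
    have "(\<lambda>n. \<integral>x. q (X (n + N)) x \<partial>M) \<longlonglongrightarrow> (\<integral>x. D x \<partial>M)"
    proof (rule integral_dominated_convergence[where w = "\<lambda>_. B / (r / 2)"])
      have XS: "X (n + N) \<in> S" for n using N[of "n + N"] r by (auto simp: subset_iff)
      show m: "q (X (n + N)) \<in> borel_measurable M" for n
        unfolding q_def[abs_def] using meas[OF XS] meas[OF u] by measurable
      have "AE x in M. (\<lambda>n. q (X (n + N)) x) \<longlonglongrightarrow> D x"
        by (rule AE_I2, rule LIMSEQ_ignore_initial_segment, rule uq) (use X in auto)
      then show "AE x in M. (\<lambda>n. q (X (n + N)) x) \<longlonglongrightarrow> D x" .
      show "D \<in> borel_measurable M"
        by (rule borel_measurable_LIMSEQ_metric[OF m], rule LIMSEQ_ignore_initial_segment, rule uq) (use X in auto)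
      show "AE x in M. norm (q (X (n + N)) x) \<le> B / (r / 2)" for n
        by (rule AE_I2, rule qbound) (use N X in auto)
    qed simp
    moreover have "(\<integral>x. q (X (n + N)) x \<partial>M) = (F (X (n + N)) - F u) / (X (n + N) - u)" for n
    proof -
      have "X (n + N) \<in> cball u r" using N[of "n + N"] r by simp
      then show ?thesis unfolding q_def F_def using int_f[of "X (n + N)"] int_f[of u] r by simp
    qed
    ultimately have "(\<lambda>n. (F (X (n + N)) - F u) / (X (n + N) - u)) \<longlonglongrightarrow> (\<integral>x. D x \<partial>M)" by simp
    then show "(\<lambda>n. (F (X n) - F u) / (X n - u)) \<longlonglongrightarrow> (\<integral>x. D x \<partial>M)"
      by (rule LIMSEQ_offset)
  qed
  then have "(F has_field_derivative (\<integral>x. D x \<partial>M)) (at u)" by (simp add: has_field_derivative_iff)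
  then have "F field_differentiable at u" by (auto simp: field_differentiable_def)
  then show "(\<lambda>u. \<integral>x. f u x \<partial>M) field_differentiable at u within S"
    unfolding F_def by (rule field_differentiable_at_within)
qed

section \<open>Cauchy transforms of the Clark measure\<close>

text \<open>A continuous factor on a compact product is bounded and measurable for the restricted
  Borel sets, which leaves integrability of \<open>h\<close> as the only condition. Exchanges of
  \<open>\<sigma>\<close> with the sphere measure or with \<open>unit_ivl\<close> go through this
  form.\<close>

lemma fubini_compact:
  fixes F :: "'a::euclidean_space \<Rightarrow> 'b::euclidean_space \<Rightarrow> complex"
  assumes M: "finite_measure M" "sets M = sets (restrict_space borel K)" "compact K"
    and N: "finite_measure N" "sets N = sets (restrict_space borel L)" "compact L"
    and F: "continuous_on (K \<times> L) (\<lambda>p. F (fst p) (snd p))" and h: "integrable N h"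
  shows "(\<integral>x. (\<integral>y. F x y * h y \<partial>N) \<partial>M) = (\<integral>y. (\<integral>x. F x y * h y \<partial>M) \<partial>N)"
proof -
  interpret M: finite_measure M by fact
  interpret N: finite_measure N by fact
  interpret pair_sigma_finite M N ..
  have sp: "space M = K" "space N = L"
    using sets_eq_imp_space_eq[OF M(2)] sets_eq_imp_space_eq[OF N(2)] by (simp_all add: space_restrict_space)
  have KL: "compact (K \<times> L)" using M(3) N(3) by (rule compact_Times)
  then have "compact ((\<lambda>p. F (fst p) (snd p)) ` (K \<times> L))" by (rule compact_continuous_image[OF F])
  then obtain B where "\<forall>y\<in>(\<lambda>p. F (fst p) (snd p)) ` (K \<times> L). norm y \<le> B" by (meson bounded_iff compact_imp_bounded)
  then have B: "norm (F x y) \<le> max B 0" if "x \<in> K" "y \<in> L" for x y using that by (fastforce intro: max.coboundedI1)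
  have mM: "(\<lambda>x. x) \<in> borel_measurable M" and mN: "(\<lambda>x. x) \<in> borel_measurable N"
    unfolding measurable_cong_sets[OF M(2) refl] measurable_cong_sets[OF N(2) refl]
    by (intro borel_measurable_continuous_on_restrict continuous_on_id)+
  have "(\<lambda>p. (fst p, snd p)) \<in> borel_measurable (M \<Otimes>\<^sub>M N)"
    using measurable_compose[OF measurable_fst mM] measurable_compose[OF measurable_snd mN]
    by (rule borel_measurable_Pair)
  from measurable_compose[OF this borel_measurable_continuous_on_indicator[OF borel_closed[OF compact_imp_closed[OF KL]] F]]
  have "(\<lambda>p. indicator (K \<times> L) p *\<^sub>R F (fst p) (snd p)) \<in> borel_measurable (M \<Otimes>\<^sub>M N)" by simp
  then have [measurable]: "(\<lambda>p. F (fst p) (snd p)) \<in> borel_measurable (M \<Otimes>\<^sub>M N)"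
    by (rule measurable_cong[THEN iffD1, rotated]) (auto simp: space_pair_measure sp)
  have [measurable]: "h \<in> borel_measurable N" using h by auto
  have int: "integrable (M \<Otimes>\<^sub>M N) (\<lambda>(x, y). F x y * h y)"
  proof (rule integrableI_bounded)
    show [measurable]: "(\<lambda>(x, y). F x y * h y) \<in> borel_measurable (M \<Otimes>\<^sub>M N)"
      unfolding case_prod_unfold by measurable
    have "(\<integral>\<^sup>+p. ennreal (norm (case p of (x, y) \<Rightarrow> F x y * h y)) \<partial>(M \<Otimes>\<^sub>M N))
        = (\<integral>\<^sup>+y. (\<integral>\<^sup>+x. ennreal (norm (F x y * h y)) \<partial>M) \<partial>N)"
      by (subst nn_integral_snd[symmetric]) (auto simp: case_prod_unfold)
    also have "\<dots> \<le> (\<integral>\<^sup>+y. (\<integral>\<^sup>+x. ennreal (max B 0 * norm (h y)) \<partial>M) \<partial>N)"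
      using B by (intro nn_integral_mono ennreal_leI) (auto simp: sp norm_mult intro!: mult_right_mono)
    also have "\<dots> = (\<integral>\<^sup>+y. ennreal (norm (h y)) \<partial>N) * (ennreal (max B 0) * emeasure M (space M))"
      by (subst nn_integral_multc[symmetric]) (auto simp: ennreal_mult mult_ac)
    also have "emeasure M (space M) < top"
      using M.emeasure_finite[of "space M"] unfolding infinity_ennreal_def less_top .
    then have "(\<integral>\<^sup>+y. ennreal (norm (h y)) \<partial>N) * (ennreal (max B 0) * emeasure M (space M)) < \<infinity>"
      using h by (auto simp: integrable_iff_bounded ennreal_mult_less_top)
    finally show "(\<integral>\<^sup>+p. ennreal (norm (case p of (x, y) \<Rightarrow> F x y * h y)) \<partial>(M \<Otimes>\<^sub>M N)) < \<infinity>" .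
  qed
  show ?thesis using Fubini_integral[OF int] by simp
qed

lemma integrable_mult_continuous:
  fixes M :: "(complex^'n) measure" and h g :: "complex^'n \<Rightarrow> complex"
  assumes M: "finite_measure M" "sets M = sets (restrict_space borel (sphere 0 1))"
    and h: "integrable M h" and g: "continuous_on (sphere 0 1) g"
  shows "integrable M (\<lambda>x. h x * g x)"
proof -
  have sp: "space M = sphere 0 1" using sets_eq_imp_space_eq[OF M(2)] by (simp add: space_restrict_space)
  have [measurable]: "g \<in> borel_measurable M" by (rule integrable_sphere_continuous(1)[OF M g])
  have "compact (g ` sphere 0 1)" by (intro compact_continuous_image g compact_sphere)
  then obtain B where "\<forall>y\<in>g ` sphere 0 1. norm y \<le> B" by (meson bounded_iff compact_imp_bounded)
  then have B: "norm (g x) \<le> B" if "norm x = 1" for x using that by simp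
  show ?thesis
  proof (rule Bochner_Integration.integrable_bound[of M "\<lambda>x. of_real B * h x"])
    show "integrable M (\<lambda>x. of_real B * h x)" using h by simp
    show "(\<lambda>x. h x * g x) \<in> borel_measurable M" using h by measurable
    show "AE x in M. norm (h x * g x) \<le> norm (of_real B * h x)"
    proof (rule AE_I2)
      fix x assume "x \<in> space M"
      then have "norm (g x) \<le> \<bar>B\<bar>" using B[of x] by (simp add: sp)
      then show "norm (h x * g x) \<le> norm (of_real B * h x)" by (simp add: norm_mult mult.commute mult_right_mono)
    qed
  qed
qed

lemma cinner_ne_1: "norm z * norm w < 1 \<Longrightarrow> cinner z w \<noteq> 1"
  using one_minus_cinner_ne[of z w] by auto

lemma continuous_on_cauchy_kernel:
  fixes f g :: "'a::topological_space \<Rightarrow> complex^'n"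
  assumes "continuous_on A f" "continuous_on A g" "\<And>x. x \<in> A \<Longrightarrow> norm (f x) * norm (g x) < 1"
  shows "continuous_on A (\<lambda>x. cauchy_kernel (f x) (g x))"
  unfolding cauchy_kernel_def using assms by (intro continuous_intros) (auto simp: cinner_ne_1)

text \<open>The second-order remainder is uniform over the disc of radius \<open>\<rho>\<close>, so
  that the error in differentiating a Cauchy transform is uniform in the point of the
  sphere.\<close>

lemma kernel_power_taylor:
  assumes rho: "0 < \<rho>" "\<rho> < 1"
  obtains K where "0 \<le> K"
    "\<And>x y. norm x \<le> \<rho> \<Longrightarrow> norm y \<le> \<rho> \<Longrightarrow>
      norm (1 / (1 - y) ^ d - 1 / (1 - x) ^ d - deriv (\<lambda>x. 1 / (1 - x :: complex) ^ d) x * (y - x)) \<le> K * (norm (y - x))\<^sup>2"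
proof -
  define \<phi> :: "complex \<Rightarrow> complex" where "\<phi> = (\<lambda>x. 1 / (1 - x) ^ d)"
  have hol: "\<phi> holomorphic_on ball 0 1" unfolding \<phi>_def by (intro holomorphic_intros) auto
  have hol_n: "(deriv ^^ i) \<phi> holomorphic_on ball 0 1" for i by (rule holomorphic_higher_deriv[OF hol]) simp
  have "compact ((deriv ^^ 2) \<phi> ` cball 0 \<rho>)"
    by (intro compact_continuous_image holomorphic_on_imp_continuous_on holomorphic_on_subset[OF hol_n]) (use rho in auto)
  then obtain K where "\<forall>y\<in>(deriv ^^ 2) \<phi> ` cball 0 \<rho>. norm y \<le> K" by (meson bounded_iff compact_imp_bounded)
  then have K: "norm ((deriv ^^ 2) \<phi> x) \<le> K" if "x \<in> cball 0 \<rho>" for x using that by simp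
  have K0: "0 \<le> K" using order_trans[OF norm_ge_zero K[of 0]] rho by simp
  show ?thesis
  proof (rule that[OF K0])
    fix x y :: complex assume xy: "norm x \<le> \<rho>" "norm y \<le> \<rho>"
    have "norm ((deriv ^^ 0) \<phi> y - (\<Sum>i\<le>1. (deriv ^^ i) \<phi> x * (y - x) ^ i / fact i)) \<le> K * norm (y - x) ^ Suc 1 / fact 1"
    proof (rule complex_Taylor[where S = "cball 0 \<rho>"])
      fix i and x :: complex assume "x \<in> cball 0 \<rho>"
      then have "x \<in> ball 0 1" using rho by auto
      then show "((deriv ^^ i) \<phi> has_field_derivative (deriv ^^ Suc i) \<phi> x) (at x within cball 0 \<rho>)"
        using holomorphic_derivI[OF hol_n[of i] open_ball] by simp
    next
      fix x :: complex assume "x \<in> cball 0 \<rho>"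
      then show "norm ((deriv ^^ Suc 1) \<phi> x) \<le> K" using K by (simp add: numeral_2_eq_2)
    qed (use xy in auto)
    then show "norm (1 / (1 - y) ^ d - 1 / (1 - x) ^ d - deriv (\<lambda>x. 1 / (1 - x) ^ d) x * (y - x)) \<le> K * (norm (y - x))\<^sup>2"
      by (simp add: \<phi>_def numeral_2_eq_2 algebra_simps)
  qed
qed

text \<open>The candidate derivative integrates the derivative of the kernel against
  \<open>h\<close>; it is complex linear because \<open>cinner\<close> is so in its first argument,
  and the remainder is quadratic in the increment.\<close>

lemma hol_ball_cauchy_transform:
  fixes M :: "(complex^'n) measure"
  assumes M: "finite_measure M" "sets M = sets (restrict_space borel (sphere 0 1))" and h: "integrable M h"
  shows "hol_ball 1 (\<lambda>z. \<integral>x. h x * cauchy_kernel z x \<partial>M)"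
  unfolding hol_ball_def
proof
  have sp: "space M = sphere 0 1" using sets_eq_imp_space_eq[OF M(2)] by (simp add: space_restrict_space)
  fix z :: "complex^'n" assume "z \<in> ball 0 1"
  then have z: "norm z < 1" by simp
  \<comment> \<open>Halfway between \<open>norm z\<close> and \<open>1\<close>, so that all points
    near \<open>z\<close> obey the same bound.\<close>
  define \<rho> where "\<rho> = (1 + norm z) / 2"
  have rho: "0 < \<rho>" "\<rho> < 1" using z norm_ge_zero[of z] by (auto simp: \<rho>_def simp del: norm_ge_zero intro: add_pos_nonneg)
  define \<phi>' :: "complex \<Rightarrow> complex" where "\<phi>' = deriv (\<lambda>x. 1 / (1 - x) ^ CARD('n))"
  obtain K where K: "0 \<le> K"
    "\<And>x y. norm x \<le> \<rho> \<Longrightarrow> norm y \<le> \<rho> \<Longrightarrow>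
      norm (1 / (1 - y) ^ CARD('n) - 1 / (1 - x) ^ CARD('n) - \<phi>' x * (y - x)) \<le> K * (norm (y - x))\<^sup>2"
    using kernel_power_taylor[OF rho, of "CARD('n)"] unfolding \<phi>'_def by blast
  have cn: "norm (cinner y x) \<le> norm y" if "norm x = 1" for x y :: "complex^'n" using norm_cinner_le[of y x] that by simp
  have "\<phi>' holomorphic_on ball 0 1" unfolding \<phi>'_def by (intro holomorphic_deriv holomorphic_intros) auto
  then have cont_phi: "continuous_on (ball 0 1) \<phi>'" by (rule holomorphic_on_imp_continuous_on)
  have cont1: "continuous_on (sphere 0 1) (\<lambda>x. \<phi>' (cinner z x))"
    by (intro continuous_on_compose2[OF cont_phi] continuous_intros) (auto intro: order_le_less_trans[OF cn z])
  have int_phi: "integrable M (\<lambda>x. h x * \<phi>' (cinner z x))" by (rule integrable_mult_continuous[OF M h cont1])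
  have int_L: "integrable M (\<lambda>x. h x * (\<phi>' (cinner z x) * cinner v x))" for v
    by (intro integrable_mult_continuous[OF M h] continuous_intros cont1)
  define L where "L v = (\<integral>x. h x * (\<phi>' (cinner z x) * cinner v x) \<partial>M)" for v
  have L_scale: "L (c *s v) = c * L v" for c v
    unfolding L_def by (subst integral_mult_right_zero[symmetric]) (simp add: mult_ac)
  have bl: "bounded_linear L"
  proof (rule bounded_linear_intro)
    show "L (v + w) = L v + L w" for v w
      unfolding L_def using int_L by (simp add: cinner_add_left distrib_left)
    show "L (r *\<^sub>R v) = r *\<^sub>R L v" for r v
      using L_scale[of "of_real r" v] by (simp add: scaleR_eq_scale scaleR_conv_of_real[where 'a = complex])
    show "norm (L v) \<le> norm v * (\<integral>x. norm (h x * \<phi>' (cinner z x)) \<partial>M)" for v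
    proof -
      have "norm (L v) \<le> (\<integral>x. norm (h x * (\<phi>' (cinner z x) * cinner v x)) \<partial>M)"
        unfolding L_def by (rule integral_norm_bound)
      also have "\<dots> \<le> (\<integral>x. norm v * norm (h x * \<phi>' (cinner z x)) \<partial>M)"
      proof (rule integral_mono)
        fix x assume "x \<in> space M"
        then have "norm (h x * \<phi>' (cinner z x)) * norm (cinner v x) \<le> norm (h x * \<phi>' (cinner z x)) * norm v"
          using cn[of x v] by (intro mult_left_mono) (auto simp: sp)
        then show "norm (h x * (\<phi>' (cinner z x) * cinner v x)) \<le> norm v * norm (h x * \<phi>' (cinner z x))"
          by (simp add: norm_mult mult_ac)
      qed (use int_L int_phi in auto)
      finally show ?thesis by simp
    qed
  qed
  have int_C: "integrable M (\<lambda>x. h x * cauchy_kernel y x)" if "norm y < 1" for y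
    by (intro integrable_mult_continuous[OF M h] continuous_on_cauchy_kernel continuous_intros) (use that in auto)
  define C where "C = K * (\<integral>x. norm (h x) \<partial>M)"
  have "((\<lambda>z. \<integral>x. h x * cauchy_kernel z x \<partial>M) has_derivative L) (at z)"
  proof (rule has_derivativeI_sandwich[where e = "(1 - norm z) / 2" and H = "\<lambda>y. C * norm (y - z)"])
    show "0 < (1 - norm z) / 2" using z by simp
    show "((\<lambda>y. C * norm (y - z)) \<longlongrightarrow> 0) (at z)"
      by (rule tendsto_eq_intros refl | simp)+
    fix y assume y: "y \<noteq> z" "dist y z < (1 - norm z) / 2"
    have ny: "norm y \<le> \<rho>" using y(2) norm_triangle_ineq2[of y z] unfolding \<rho>_def dist_norm by argo
    have nz: "norm z \<le> \<rho>" using z by (simp add: \<rho>_def)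
    have diff: "(\<integral>x. h x * cauchy_kernel y x \<partial>M) - (\<integral>x. h x * cauchy_kernel z x \<partial>M) - L (y - z)
       = (\<integral>x. h x * (cauchy_kernel y x - cauchy_kernel z x - \<phi>' (cinner z x) * cinner (y - z) x) \<partial>M)"
      unfolding L_def using int_C[of y] int_C[of z] int_L[of "y - z"] ny rho z by (simp add: right_diff_distrib)
    have "norm ((\<integral>x. h x * cauchy_kernel y x \<partial>M) - (\<integral>x. h x * cauchy_kernel z x \<partial>M) - L (y - z))
      \<le> (\<integral>x. norm (h x * (cauchy_kernel y x - cauchy_kernel z x - \<phi>' (cinner z x) * cinner (y - z) x)) \<partial>M)"
      unfolding diff by (rule integral_norm_bound)
    also have "\<dots> \<le> (\<integral>x. K * (norm (y - z))\<^sup>2 * norm (h x) \<partial>M)"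
    proof (rule integral_mono)
      show "integrable M (\<lambda>x. norm (h x * (cauchy_kernel y x - cauchy_kernel z x - \<phi>' (cinner z x) * cinner (y - z) x)))"
        by (intro integrable_norm integrable_mult_continuous[OF M h] continuous_intros continuous_on_cauchy_kernel cont1)
           (use ny rho z in auto)
      fix x assume "x \<in> space M"
      then have x: "norm x = 1" by (simp add: sp)
      have "norm (cauchy_kernel y x - cauchy_kernel z x - \<phi>' (cinner z x) * (cinner y x - cinner z x)) \<le> K * (norm (cinner y x - cinner z x))\<^sup>2"
        unfolding cauchy_kernel_def using cn[OF x, of y] cn[OF x, of z] ny nz by (intro K(2)) auto
      also have "\<dots> \<le> K * (norm (y - z))\<^sup>2"
        using cn[OF x, of "y - z"] K(1) by (intro mult_left_mono power_mono) (auto simp: cinner_diff_left)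
      finally have "norm (h x) * norm (cauchy_kernel y x - cauchy_kernel z x - \<phi>' (cinner z x) * cinner (y - z) x) \<le> norm (h x) * (K * (norm (y - z))\<^sup>2)"
        by (intro mult_left_mono) (auto simp: cinner_diff_left)
      then show "norm (h x * (cauchy_kernel y x - cauchy_kernel z x - \<phi>' (cinner z x) * cinner (y - z) x)) \<le> K * (norm (y - z))\<^sup>2 * norm (h x)"
        by (simp add: norm_mult mult_ac)
    qed (use h in auto)
    also have "\<dots> = C * norm (y - z) * norm (y - z)" by (simp add: C_def power2_eq_square mult_ac)
    finally show "norm ((\<integral>x. h x * cauchy_kernel y x \<partial>M) - (\<integral>x. h x * cauchy_kernel z x \<partial>M) - L (y - z)) / norm (y - z) \<le> C * norm (y - z)"
      using y by (simp add: divide_le_eq)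
  qed (rule bl)
  then show "\<exists>L. ((\<lambda>z. \<integral>x. h x * cauchy_kernel z x \<partial>M) has_derivative L) (at z) \<and> (\<forall>c v. L (c *s v) = c * L v)"
    using L_scale by blast
qed

text \<open>The invariant Poisson kernel of the ball, in the form in which it occurs in
  \<open>clark_measure\<close>; inside the ball it is the squared modulus of the Cauchy kernel
  divided by \<open>cauchy_kernel z z\<close>.\<close>

definition poisson_kernel :: "complex^'n \<Rightarrow> complex^'n \<Rightarrow> real" where
  "poisson_kernel z \<zeta> = ((1 - (norm z)\<^sup>2) / (norm (1 - cinner z \<zeta>))\<^sup>2) ^ CARD('n)"

lemma poisson_kernel_eq:
  fixes z \<zeta> :: "complex^'n"
  shows "complex_of_real (poisson_kernel z \<zeta>) = of_real ((1 - (norm z)\<^sup>2) ^ CARD('n)) * (cauchy_kernel z \<zeta> * cauchy_kernel \<zeta> z)"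
proof -
  have "complex_of_real ((norm (1 - cinner z \<zeta>))\<^sup>2) = (1 - cinner z \<zeta>) * (1 - cinner \<zeta> z)"
    by (subst complex_norm_square) simp
  then have "complex_of_real (poisson_kernel z \<zeta>) = (of_real (1 - (norm z)\<^sup>2) / ((1 - cinner z \<zeta>) * (1 - cinner \<zeta> z))) ^ CARD('n)"
    by (simp only: poisson_kernel_def of_real_power of_real_divide)
  then show ?thesis
    by (simp add: cauchy_kernel_def power_divide power_mult_distrib)
qed

lemma cauchy_kernel_self: "cauchy_kernel z (z :: complex^'n) = of_real (1 / (1 - (norm z)\<^sup>2) ^ CARD('n))"
  by (simp add: cauchy_kernel_def cinner_self)

text \<open>The conjugate of \<open>cauchy_kernel w z\<close> is holomorphic in \<open>z\<close>
  beyond the closed ball, so the Cauchy formula applies to its product with \<open>f\<close>; its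
  value at \<open>w\<close> is then divided out.\<close>

theorem poisson_kernel_reproduces:
  fixes f :: "complex^'n \<Rightarrow> complex"
  assumes f: "hol_ball R f" and R: "R > 1" and w: "norm w < 1"
  shows "(\<integral>z. f z * of_real (poisson_kernel w z) \<partial>sphere_measure) = f w"
proof -
  \<comment> \<open>Above \<open>1\<close>, yet small enough that \<open>cauchy_kernel z w\<close>
    has no pole in the ball of this radius.\<close>
  define R' where "R' = min R (2 / (1 + norm w))"
  have pos: "0 < 1 + norm w" by (simp add: add_pos_nonneg)
  have R': "R' > 1" "R' \<le> R" using R w pos by (auto simp: R'_def field_simps)
  have "R' * norm w \<le> 2 / (1 + norm w) * norm w" by (intro mult_right_mono) (auto simp: R'_def)
  also have "\<dots> < 1" using w pos by (simp add: field_simps)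
  finally have "hol_ball R' (\<lambda>z. f z * cauchy_kernel z w)"
    by (intro hol_ball_mult hol_ball_mono[OF f R'(2)] hol_ball_cauchy_kernel) auto
  from cauchy_sphere[OF this R'(1) w]
  have "(\<integral>z. f z * cauchy_kernel z w * cauchy_kernel w z \<partial>sphere_measure) = f w * cauchy_kernel w w" .
  moreover have "f z * of_real (poisson_kernel w z) = of_real ((1 - (norm w)\<^sup>2) ^ CARD('n)) * (f z * cauchy_kernel z w * cauchy_kernel w z)" for z
    by (simp only: poisson_kernel_eq mult_ac)
  ultimately have "(\<integral>z. f z * of_real (poisson_kernel w z) \<partial>sphere_measure) = of_real ((1 - (norm w)\<^sup>2) ^ CARD('n)) * (f w * cauchy_kernel w w)"
    by (simp only: integral_mult_right_zero)
  moreover have "(1 - (norm w)\<^sup>2) ^ CARD('n) \<noteq> 0" using w by (simp add: abs_square_eq_1)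
  ultimately show ?thesis by (simp add: cauchy_kernel_self del: of_real_power of_real_diff)
qed

section \<open>The pairing of Cauchy kernels under the Clark measure, and the dilates of
  \<open>I\<close>\<close>

locale clark_setting =
  fixes I :: "complex^'n \<Rightarrow> complex" and \<alpha> :: complex and \<sigma> :: "(complex^'n) measure"
  assumes inner: "inner_function I" and alpha: "norm \<alpha> = 1" and clark: "clark_measure I \<alpha> \<sigma>"
begin

lemma sets_sigma: "sets \<sigma> = sets (restrict_space borel (sphere 0 1))"
  using clark by (simp add: clark_measure_def)

lemma space_sigma: "space \<sigma> = sphere 0 1"
  using sets_eq_imp_space_eq[OF sets_sigma] by (simp add: space_restrict_space)

lemma clark_integral:
  assumes "norm z < 1"
  shows "has_bochner_integral \<sigma> (poisson_kernel z) (Re ((\<alpha> + I z) / (\<alpha> - I z)))"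
  using clark assms by (simp add: clark_measure_def poisson_kernel_def[abs_def])

lemma finite_sigma: "finite_measure \<sigma>"
proof
  have "integrable \<sigma> (\<lambda>_. 1 :: real)"
    using clark_integral[of 0] by (simp add: poisson_kernel_def[abs_def] has_bochner_integral_iff)
  then show "emeasure \<sigma> (space \<sigma>) \<noteq> \<infinity>" by (simp add: integrable_iff_bounded top.not_eq_extremum)
qed

sublocale finite_measure \<sigma> by (rule finite_sigma)

lemma I_hol: "hol_ball 1 I" using inner by (rule inner_function_hol)

lemma I_lt: "norm z < 1 \<Longrightarrow> norm (I z) < 1" using inner by (rule inner_function_lt_1)

lemma alpha_cnj: "cnj \<alpha> * \<alpha> = 1" "\<alpha> * cnj \<alpha> = 1"
  using complex_norm_square[of \<alpha>] alpha by (simp_all add: mult.commute)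

lemma factor: "1 - cnj \<alpha> * I z = cnj \<alpha> * (\<alpha> - I z)" "1 - \<alpha> * cnj (I z) = \<alpha> * (cnj \<alpha> - cnj (I z))"
  by (simp_all add: right_diff_distrib alpha_cnj)

lemma nonzero:
  assumes "norm z < 1"
  shows "\<alpha> - I z \<noteq> 0" "1 - cnj \<alpha> * I z \<noteq> 0" "1 - \<alpha> * cnj (I z) \<noteq> 0"
proof -
  show 1: "\<alpha> - I z \<noteq> 0" using I_lt[OF assms] alpha by auto
  have "\<alpha> \<noteq> 0" using alpha by auto
  then show "1 - cnj \<alpha> * I z \<noteq> 0" unfolding factor using 1 by simp
  have "cnj (\<alpha> - I z) \<noteq> 0" using 1 complex_cnj_zero_iff by blast
  then show "1 - \<alpha> * cnj (I z) \<noteq> 0" unfolding factor using \<open>\<alpha> \<noteq> 0\<close> by simp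
qed

lemma Re_quotient: "Re ((\<alpha> + I z) / (\<alpha> - I z)) = (1 - (norm (I z))\<^sup>2) / (norm (\<alpha> - I z))\<^sup>2"
proof -
  have "(Re \<alpha>)\<^sup>2 + (Im \<alpha>)\<^sup>2 = 1" using alpha cmod_power2[of \<alpha>] by simp
  then have "(Re \<alpha> + Re (I z)) * (Re \<alpha> - Re (I z)) + (Im \<alpha> + Im (I z)) * (Im \<alpha> - Im (I z)) = 1 - ((Re (I z))\<^sup>2 + (Im (I z))\<^sup>2)"
    by algebra
  then show ?thesis by (simp add: Re_divide cmod_power2)
qed

text \<open>The value to be proved for the pairing of two Cauchy kernels in L2 of
  \<open>\<sigma>\<close>; the factor \<open>1 - cnj \<alpha> * I z\<close> of its denominator is
  the one by which \<open>W\<close> multiplies.\<close>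

definition kernel :: "complex^'n \<Rightarrow> complex^'n \<Rightarrow> complex" where
  "kernel z w = (1 - I z * cnj (I w)) / ((1 - cnj \<alpha> * I z) * (1 - \<alpha> * cnj (I w))) * cauchy_kernel z w"

text \<open>This is the defining identity of the Clark measure, once the Poisson kernel is factored
  into Cauchy kernels and the real part is computed by \<open>Re_quotient\<close>.\<close>

lemma clark_kernel_diagonal:
  assumes z: "norm z < 1"
  shows "(\<integral>x. cauchy_kernel z x * cauchy_kernel x z \<partial>\<sigma>) = kernel z z"
proof -
  have "(\<integral>x. complex_of_real (poisson_kernel z x) \<partial>\<sigma>) = of_real ((1 - (norm (I z))\<^sup>2) / (norm (\<alpha> - I z))\<^sup>2)"
    using clark_integral[OF z] by (simp add: has_bochner_integral_iff integral_complex_of_real Re_quotient)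
  then have "of_real ((1 - (norm z)\<^sup>2) ^ CARD('n)) * (\<integral>x. cauchy_kernel z x * cauchy_kernel x z \<partial>\<sigma>) = of_real ((1 - (norm (I z))\<^sup>2) / (norm (\<alpha> - I z))\<^sup>2)"
    by (simp only: poisson_kernel_eq integral_mult_right_zero)
  moreover have "(1 - (norm z)\<^sup>2) ^ CARD('n) \<noteq> 0" using z by (simp add: abs_square_eq_1)
  moreover have "X = Y * of_real (1 / c)" if "of_real c * X = Y" "c \<noteq> 0" for X Y :: complex and c :: real
    using that by (auto simp: field_simps)
  ultimately have "(\<integral>x. cauchy_kernel z x * cauchy_kernel x z \<partial>\<sigma>) = of_real ((1 - (norm (I z))\<^sup>2) / (norm (\<alpha> - I z))\<^sup>2) * cauchy_kernel z z"
    unfolding cauchy_kernel_self by blast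
  moreover have "(1 - cnj \<alpha> * I z) * (1 - \<alpha> * cnj (I z)) = of_real ((norm (\<alpha> - I z))\<^sup>2)"
    unfolding factor complex_norm_square using alpha_cnj by (simp add: mult_ac)
  moreover have "1 - I z * cnj (I z) = of_real (1 - (norm (I z))\<^sup>2)"
    using complex_norm_square[of "I z"] by simp
  ultimately show ?thesis unfolding kernel_def by simp
qed

text \<open>Supplies the hypothesis of \<open>polarization\<close> for both sides. The conjugate
  parameter in the second slot meets the conjugation in \<open>cinner\<close> and in
  \<open>cnj (I w)\<close>, so each factor is holomorphic in \<open>u\<close>.\<close>

lemma holomorphic_curve:
  fixes p q p' q' :: "complex^'n"
  defines "S \<equiv> {u. p + u *s q \<in> ball 0 1 \<and> p' + cnj u *s q' \<in> ball 0 1}"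
  shows "open S"
    and "(\<lambda>u. \<integral>x. cauchy_kernel (p + u *s q) x * cauchy_kernel x (p' + cnj u *s q') \<partial>\<sigma>) holomorphic_on S"
    and "(\<lambda>u. kernel (p + u *s q) (p' + cnj u *s q')) holomorphic_on S"
proof -
  have "open ((\<lambda>u. p + u *s q) -` ball 0 1 \<inter> (\<lambda>u. p' + cnj u *s q') -` ball 0 1)"
    by (intro open_Int open_vimage open_ball continuous_intros)
  then show S: "open S" by (simp add: S_def vimage_def Int_def)
  have expand: "1 - cinner (p + u *s q) x = 1 - cinner p x - u * cinner q x"
    "1 - cinner x (p' + cnj u *s q') = 1 - cinner x p' - u * cinner x q'" for u x
    by (simp_all add: cinner_add_left cinner_add_right)
  show "(\<lambda>u. \<integral>x. cauchy_kernel (p + u *s q) x * cauchy_kernel x (p' + cnj u *s q') \<partial>\<sigma>) holomorphic_on S"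
  proof (rule holomorphic_on_param_integral[OF finite_sigma S])
    fix x assume "x \<in> space \<sigma>"
    then have x: "norm x = 1" by (simp add: space_sigma)
    have "1 - cinner p x - u * cinner q x \<noteq> 0" "1 - cinner x p' - u * cinner x q' \<noteq> 0" if "u \<in> S" for u
      unfolding expand[symmetric] using that x by (auto simp: S_def cinner_ne_1)
    then show "(\<lambda>u. cauchy_kernel (p + u *s q) x * cauchy_kernel x (p' + cnj u *s q')) holomorphic_on S"
      unfolding cauchy_kernel_def expand by (intro holomorphic_intros) auto
  next
    fix u assume "u \<in> S"
    then show "(\<lambda>x. cauchy_kernel (p + u *s q) x * cauchy_kernel x (p' + cnj u *s q')) \<in> borel_measurable \<sigma>"
      by (intro integrable_sphere_continuous(1)[OF finite_sigma sets_sigma] continuous_intros continuous_on_cauchy_kernel)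
         (auto simp: S_def)
  next
    fix u assume "u \<in> S"
    then obtain r where r: "r > 0" "cball u r \<subseteq> S" using S open_contains_cball by blast
    \<comment> \<open>Maximal norms over a compact disc of parameters stay below \<open>1\<close>,
      which bounds both Cauchy kernels uniformly on the sphere.\<close>
    obtain m where m: "m \<in> cball u r" "\<And>v. v \<in> cball u r \<Longrightarrow> norm (p + v *s q) \<le> norm (p + m *s q)"
      using continuous_attains_sup[of "cball u r" "\<lambda>v. norm (p + v *s q)"] r by (fastforce intro!: continuous_intros)
    obtain m' where m': "m' \<in> cball u r" "\<And>v. v \<in> cball u r \<Longrightarrow> norm (p' + cnj v *s q') \<le> norm (p' + cnj m' *s q')"
      using continuous_attains_sup[of "cball u r" "\<lambda>v. norm (p' + cnj v *s q')"] r by (fastforce intro!: continuous_intros)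
    define a where "a = norm (p + m *s q)"
    define b where "b = norm (p' + cnj m' *s q')"
    have ab: "a < 1" "b < 1" using m(1) m'(1) r by (auto simp: a_def b_def S_def subset_iff)
    have "norm (cauchy_kernel (p + v *s q) x * cauchy_kernel x (p' + cnj v *s q')) \<le> 1 / (1 - a) ^ CARD('n) * (1 / (1 - b) ^ CARD('n))"
      if v: "v \<in> cball u r" and x: "x \<in> space \<sigma>" for v x
    proof -
      have mono: "1 / (1 - norm y) ^ CARD('n) \<le> 1 / (1 - c) ^ CARD('n)" if "norm y \<le> c" "c < 1" for c and y :: "complex^'n"
        using that by (intro divide_left_mono power_mono mult_pos_pos zero_less_power) auto
      have "norm (p + v *s q) \<le> a" "norm (p' + cnj v *s q') \<le> b" using m(2)[OF v] m'(2)[OF v] by (simp_all add: a_def b_def)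
      then have "norm (cauchy_kernel (p + v *s q) x) \<le> 1 / (1 - a) ^ CARD('n)" "norm (cauchy_kernel x (p' + cnj v *s q')) \<le> 1 / (1 - b) ^ CARD('n)"
        using cauchy_kernel_bound[of x "p + v *s q"] cauchy_kernel_bound[of x "p' + cnj v *s q'"] x ab mono[of "p + v *s q" a] mono[of "p' + cnj v *s q'" b]
        by (auto simp: space_sigma)
      then show ?thesis unfolding norm_mult using ab by (intro mult_mono) auto
    qed
    then show "\<exists>r>0. \<exists>B. cball u r \<subseteq> S \<and> (\<forall>v\<in>cball u r. \<forall>x\<in>space \<sigma>.
        norm (cauchy_kernel (p + v *s q) x * cauchy_kernel x (p' + cnj v *s q')) \<le> B)"
      using r by blast
  qed
  have I1: "(\<lambda>u. I (p + u *s q)) holomorphic_on S"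
    by (rule holomorphic_on_subset[OF hol_ball_line[OF I_hol]]) (auto simp: S_def)
  have "(\<lambda>u. I (p' + u *s q')) holomorphic_on cnj ` S"
    by (rule holomorphic_on_subset[OF hol_ball_line[OF I_hol]]) (auto simp: S_def)
  from holomorphic_on_compose_cnj_cnj[OF this S]
  have I2: "(\<lambda>u. cnj (I (p' + cnj u *s q'))) holomorphic_on S" by (simp add: o_def)
  have expand2: "cinner (p + u *s q) (p' + cnj u *s q') = cinner p p' + u * cinner q p' + u * cinner p q' + u * (u * cinner q q')" for u
    by (simp add: cinner_add_left cinner_add_right algebra_simps)
  show "(\<lambda>u. kernel (p + u *s q) (p' + cnj u *s q')) holomorphic_on S"
    unfolding kernel_def cauchy_kernel_def
  proof (intro holomorphic_intros I1 I2)
    fix u assume "u \<in> S"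
    then have n: "norm (p + u *s q) < 1" "norm (p' + cnj u *s q') < 1" by (auto simp: S_def)
    show "(1 - cnj \<alpha> * I (p + u *s q)) * (1 - \<alpha> * cnj (I (p' + cnj u *s q'))) \<noteq> 0"
      using nonzero[OF n(1)] nonzero[OF n(2)] by simp
    have "norm (p + u *s q) * norm (p' + cnj u *s q') < 1 * 1" by (intro mult_strict_mono) (use n in auto)
    then show "(1 - cinner (p + u *s q) (p' + cnj u *s q')) ^ CARD('n) \<noteq> 0"
      using one_minus_cinner_ne by simp
  next
    show "(\<lambda>u. cinner (p + u *s q) (p' + cnj u *s q')) holomorphic_on S"
      unfolding expand2 by (intro holomorphic_intros)
  qed
qed

theorem clark_kernel:
  assumes "norm z < 1" "norm w < 1"
  shows "(\<integral>x. cauchy_kernel z x * cauchy_kernel x w \<partial>\<sigma>) = kernel z w"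
proof -
  have "(\<integral>x. cauchy_kernel z x * cauchy_kernel x w \<partial>\<sigma>) - kernel z w = 0"
  proof (rule polarization[where E = "\<lambda>z w. (\<integral>x. cauchy_kernel z x * cauchy_kernel x w \<partial>\<sigma>) - kernel z w"])
    fix p q p' q' :: "complex^'n"
    show "(\<lambda>u. (\<integral>x. cauchy_kernel (p + u *s q) x * cauchy_kernel x (p' + cnj u *s q') \<partial>\<sigma>) - kernel (p + u *s q) (p' + cnj u *s q')) holomorphic_on
      {u. p + u *s q \<in> ball 0 1 \<and> p' + cnj u *s q' \<in> ball 0 1}"
      by (intro holomorphic_intros holomorphic_curve)
  qed (use assms in \<open>auto simp: clark_kernel_diagonal\<close>)
  then show ?thesis by simp
qed

abbreviation nrm\<sigma> :: "(complex^'n \<Rightarrow> complex) \<Rightarrow> real" where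
  "nrm\<sigma> \<equiv> L2.nrm \<sigma>"

lemma L2_sigma_continuous: "continuous_on (sphere 0 1) f \<Longrightarrow> f \<in> L2_space \<sigma>"
  by (rule continuous_L2[OF finite_sigma sets_sigma])

lemma hardy_nrm_I: "I \<in> hardy_space" "H2.nrm I = 1"
proof -
  have one: "(\<lambda>_ :: complex^'n. 1) \<in> hardy_space"
    by (rule hardy_bounded[where B = 1]) auto
  show "I \<in> hardy_space" using inner_mult_hardy[OF inner one] by simp
  have "radial_limit (\<lambda>_. 1 :: complex) z = 1" for z :: "complex^'n"
    by (rule radial_limit_eq) simp
  then have "hardy_inner (\<lambda>_ :: complex^'n. 1) (\<lambda>_. 1) = 1"
    by (simp add: hardy_inner_def L2_inner_def)
  then show "H2.nrm I = 1"
    using inner_mult_isometry[OF inner one one] by (simp add: H2.nrm_def)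
qed

text \<open>The Poisson kernel is symmetric under moving the dilation from one variable to the other, so
  Fubini turns the mean of a dilate over \<open>\<sigma>\<close> into a mean over the sphere; there
  \<open>\<bar>\<alpha> - I\<bar> * P \<le> sqrt (1 - \<bar>I\<bar>\<^sup>2) * sqrt P\<close> and \<open>\<bar>I\<bar> \<longlongrightarrow> 1\<close>.\<close>

lemma clark_mean:
  assumes f: "hol_ball 1 f" and r: "0 < r" "r < 1"
  shows "(\<integral>x. f ((r * r) *\<^sub>R x) \<partial>\<sigma>)
    = (\<integral>z. dil f r z * of_real ((1 - (norm (dil I r z))\<^sup>2) / (norm (\<alpha> - dil I r z))\<^sup>2) \<partial>sphere_measure)"
proof -
  have cont: "continuous_on (sphere 0 1 \<times> sphere 0 1) (\<lambda>p. dil f r (fst p) * of_real (poisson_kernel (r *\<^sub>R fst p) (snd p)))"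
  proof (intro continuous_intros continuous_on_compose2[OF continuous_dil[OF f]])
    have ne: "norm (1 - cinner (r *\<^sub>R fst p) (snd p)) \<noteq> 0" if "p \<in> sphere 0 1 \<times> sphere 0 1" for p :: "(complex^'n) \<times> (complex^'n)"
      using one_minus_cinner_ne[of "r *\<^sub>R fst p" "snd p"] r that by (auto simp del: cinner_scaleR_left)
    then show "continuous_on (sphere 0 1 \<times> sphere 0 1) (\<lambda>p. poisson_kernel (r *\<^sub>R fst p) (snd p :: complex^'n))"
      unfolding poisson_kernel_def by (intro continuous_intros) auto
  qed (use r in auto)
  have "(\<integral>x. f ((r * r) *\<^sub>R x) \<partial>\<sigma>) = (\<integral>x. (\<integral>z. dil f r z * of_real (poisson_kernel (r *\<^sub>R z) x) \<partial>sphere_measure) \<partial>\<sigma>)"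
  proof (rule Bochner_Integration.integral_cong)
    fix x assume "x \<in> space \<sigma>"
    then have x: "norm x = 1" by (simp add: space_sigma)
    \<comment> \<open>The kernel reproduces the dilate of \<open>f\<close> at the point
      \<open>r *\<^sub>R x\<close>, which is a second dilation; hence the radius
      \<open>r * r\<close> in the statement.\<close>
    have "(\<integral>z. dil f r z * of_real (poisson_kernel (r *\<^sub>R x) z) \<partial>sphere_measure) = dil f r (r *\<^sub>R x)"
      using r x by (intro poisson_kernel_reproduces[where R = "1 / r"] hol_ball_dil[OF f]) auto
    moreover have "poisson_kernel (r *\<^sub>R x) z = poisson_kernel (r *\<^sub>R z) x" if z: "norm z = 1" for z
    proof -
      have "norm (1 - cinner (r *\<^sub>R x) z) = norm (cnj (1 - cinner (r *\<^sub>R x) z))" by (simp only: complex_mod_cnj)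
      also have "\<dots> = norm (1 - cinner (r *\<^sub>R z) x)" by simp
      finally show ?thesis using x z by (simp add: poisson_kernel_def)
    qed
    then have "(\<integral>z. dil f r z * of_real (poisson_kernel (r *\<^sub>R x) z) \<partial>sphere_measure) = (\<integral>z. dil f r z * of_real (poisson_kernel (r *\<^sub>R z) x) \<partial>sphere_measure)"
      by (intro Bochner_Integration.integral_cong) auto
    ultimately show "f ((r * r) *\<^sub>R x) = (\<integral>z. dil f r z * of_real (poisson_kernel (r *\<^sub>R z) x) \<partial>sphere_measure)"
      by (simp add: dil_def)
  qed simp
  also have "\<dots> = (\<integral>z. (\<integral>x. dil f r z * of_real (poisson_kernel (r *\<^sub>R z) x) \<partial>\<sigma>) \<partial>sphere_measure)"
    using fubini_compact[OF sphere.finite_measure_axioms sets_sphere_measure compact_sphere finite_sigma sets_sigma compact_sphere cont, of "\<lambda>_. 1"]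
    by simp
  also have "\<dots> = (\<integral>z. dil f r z * of_real ((1 - (norm (dil I r z))\<^sup>2) / (norm (\<alpha> - dil I r z))\<^sup>2) \<partial>sphere_measure)"
  proof (rule Bochner_Integration.integral_cong)
    fix z :: "complex^'n" assume "z \<in> space sphere_measure"
    then have "norm (r *\<^sub>R z) < 1" using r by simp
    from clark_integral[OF this]
    show "(\<integral>x. dil f r z * of_real (poisson_kernel (r *\<^sub>R z) x) \<partial>\<sigma>)
       = dil f r z * of_real ((1 - (norm (dil I r z))\<^sup>2) / (norm (\<alpha> - dil I r z))\<^sup>2)"
      by (simp add: has_bochner_integral_iff integral_complex_of_real Re_quotient dil_def del: of_real_divide of_real_diff of_real_power)
  qed simp
  finally show ?thesis .
qed

lemma dilates_to_alpha:
  "(\<lambda>n. nrm\<sigma> (\<lambda>x. I ((rad n * rad n) *\<^sub>R x) - \<alpha>)) \<longlonglongrightarrow> 0"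
proof -
  define P where "P r z = (1 - (norm (dil I r z))\<^sup>2) / (norm (\<alpha> - dil I r z))\<^sup>2" for r z
  define m where "m = measure \<sigma> (space \<sigma>)"
  have lt: "norm (dil I (rad n) z) < 1" if "norm z = 1" for n z
    unfolding dil_def using that by (intro I_lt) simp
  have ne: "norm (\<alpha> - dil I (rad n) z) > 0" if "norm z = 1" for n z
    using lt[OF that, of n] alpha by auto
  have P0: "0 \<le> P (rad n) z" if "norm z = 1" for n z
    unfolding P_def using lt[OF that, of n] by (intro divide_nonneg_nonneg) (auto simp: power_le_one)
  have contI: "continuous_on (sphere 0 1) (dil I (rad n))" for n by (intro continuous_dil I_hol) auto
  have contP: "continuous_on (sphere 0 1) (P (rad n))" for n
    unfolding P_def[abs_def] using ne by (intro continuous_intros contI) auto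
  have mean1: "of_real m = (\<integral>z. complex_of_real (P (rad n) z) \<partial>sphere_measure)" for n
    using clark_mean[of "\<lambda>_. 1" "rad n"] by (simp add: m_def P_def dil_def[of "\<lambda>_. 1"] scaleR_conv_of_real)
  have meanI: "(\<integral>x. I ((rad n * rad n) *\<^sub>R x) \<partial>\<sigma>) = (\<integral>z. dil I (rad n) z * of_real (P (rad n) z) \<partial>sphere_measure)" for n
    using clark_mean[OF I_hol, of "rad n"] by (simp add: P_def)
  have bound: "(nrm\<sigma> (\<lambda>x. I ((rad n * rad n) *\<^sub>R x) - \<alpha>))\<^sup>2 \<le> 2 * (sqrt (1 - (nrmS (dil I (rad n)))\<^sup>2) * sqrt m)" for n
  proof -
    have rr: "0 \<le> rad n * rad n" "rad n * rad n < 1" using mult_strict_mono[of "rad n" 1 "rad n" 1] by auto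
    have contJ: "continuous_on (sphere 0 1) (\<lambda>x. I ((rad n * rad n) *\<^sub>R x))"
      using continuous_dil[OF I_hol rr] by (simp add: dil_def[abs_def])
    have intJ: "integrable \<sigma> (\<lambda>x. I ((rad n * rad n) *\<^sub>R x))"
      by (rule integrable_sphere_continuous(2)[OF finite_sigma sets_sigma contJ])
    have "(nrm\<sigma> (\<lambda>x. I ((rad n * rad n) *\<^sub>R x) - \<alpha>))\<^sup>2 = (\<integral>x. (norm (I ((rad n * rad n) *\<^sub>R x) - \<alpha>))\<^sup>2 \<partial>\<sigma>)"
      by (simp add: L2_nrm)
    \<comment> \<open>Since \<open>norm \<alpha> = 1\<close> and the values of \<open>I\<close> have
      modulus at most \<open>1\<close>, the squared distance is bounded by a quantity linear in
      \<open>I\<close>, which \<open>clark_mean\<close> can evaluate.\<close>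
    also have "\<dots> \<le> (\<integral>x. 2 * Re (1 - cnj \<alpha> * I ((rad n * rad n) *\<^sub>R x)) \<partial>\<sigma>)"
    proof (rule integral_mono)
      show "integrable \<sigma> (\<lambda>x. (norm (I ((rad n * rad n) *\<^sub>R x) - \<alpha>))\<^sup>2)"
        by (intro integrable_sphere_continuous(2)[OF finite_sigma sets_sigma] continuous_intros contJ)
      show "integrable \<sigma> (\<lambda>x. 2 * Re (1 - cnj \<alpha> * I ((rad n * rad n) *\<^sub>R x)))"
        by (intro integrable_sphere_continuous(2)[OF finite_sigma sets_sigma] continuous_intros contJ)
      fix x assume "x \<in> space \<sigma>"
      then have "norm ((rad n * rad n) *\<^sub>R x) < 1" using rr by (simp add: space_sigma)
      then have "(norm (I ((rad n * rad n) *\<^sub>R x)))\<^sup>2 \<le> 1" using I_lt by (simp add: power_le_one less_imp_le)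
      moreover have "(norm (a - \<alpha>))\<^sup>2 = (norm a)\<^sup>2 + 1 - 2 * Re (cnj \<alpha> * a)" for a
      proof -
        have "(Re \<alpha>)\<^sup>2 + (Im \<alpha>)\<^sup>2 = 1" using alpha cmod_power2[of \<alpha>] by simp
        moreover have "(norm (a - \<alpha>))\<^sup>2 = (Re a - Re \<alpha>)\<^sup>2 + (Im a - Im \<alpha>)\<^sup>2" "(norm a)\<^sup>2 = (Re a)\<^sup>2 + (Im a)\<^sup>2"
          by (simp_all add: cmod_power2)
        moreover have "Re (cnj \<alpha> * a) = Re \<alpha> * Re a + Im \<alpha> * Im a" by simp
        ultimately show ?thesis by algebra
      qed
      ultimately show "(norm (I ((rad n * rad n) *\<^sub>R x) - \<alpha>))\<^sup>2 \<le> 2 * Re (1 - cnj \<alpha> * I ((rad n * rad n) *\<^sub>R x))" by simp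
    qed
    also have "\<dots> = 2 * Re (of_real m - cnj \<alpha> * (\<integral>x. I ((rad n * rad n) *\<^sub>R x) \<partial>\<sigma>))"
    proof -
      have "(\<integral>x. 1 - cnj \<alpha> * I ((rad n * rad n) *\<^sub>R x) \<partial>\<sigma>) = of_real m - cnj \<alpha> * (\<integral>x. I ((rad n * rad n) *\<^sub>R x) \<partial>\<sigma>)"
        using intJ by (simp add: m_def scaleR_conv_of_real)
      moreover have "integrable \<sigma> (\<lambda>x. 1 - cnj \<alpha> * I ((rad n * rad n) *\<^sub>R x))" using intJ by simp
      ultimately show ?thesis by (simp only: integral_mult_right_zero integral_Re)
    qed
    also have "of_real m - cnj \<alpha> * (\<integral>x. I ((rad n * rad n) *\<^sub>R x) \<partial>\<sigma>) = (\<integral>z. (1 - cnj \<alpha> * dil I (rad n) z) * of_real (P (rad n) z) \<partial>sphere_measure)"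
    proof -
      have "integrable sphere_measure (\<lambda>z. complex_of_real (P (rad n) z))"
           "integrable sphere_measure (\<lambda>z. cnj \<alpha> * (dil I (rad n) z * complex_of_real (P (rad n) z)))"
        by (intro integrable_sphere_measure continuous_intros contI contP)+
      then show ?thesis
        unfolding mean1[of n] meanI[of n] by (simp add: left_diff_distrib mult.assoc flip: integral_mult_right_zero)
    qed
    also have "Re \<dots> \<le> norm \<dots>" by (rule complex_Re_le_cmod)
    also have "\<dots> \<le> (\<integral>z. norm ((1 - cnj \<alpha> * dil I (rad n) z) * of_real (P (rad n) z)) \<partial>sphere_measure)"
      by (rule integral_norm_bound)
    \<comment> \<open>Splitting into two square roots prepares Cauchy-Schwarz: one factor has the
      constant norm \<open>sqrt m\<close>, and the norm of the other tends to \<open>0\<close>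
      because \<open>I\<close> has Hardy norm \<open>1\<close>.\<close>
    also have "\<dots> = Re (L2_inner sphere_measure (\<lambda>z. of_real (sqrt (1 - (norm (dil I (rad n) z))\<^sup>2))) (\<lambda>z. of_real (sqrt (P (rad n) z))))"
    proof -
      have "L2_inner sphere_measure (\<lambda>z. of_real (sqrt (1 - (norm (dil I (rad n) z))\<^sup>2))) (\<lambda>z. of_real (sqrt (P (rad n) z)))
         = (\<integral>z. complex_of_real (norm ((1 - cnj \<alpha> * dil I (rad n) z) * of_real (P (rad n) z))) \<partial>sphere_measure)"
        unfolding L2_inner_def
      proof (rule Bochner_Integration.integral_cong)
        fix z :: "complex^'n" assume "z \<in> space sphere_measure"
        then have z: "norm z = 1" by simp
        have "norm (1 - cnj \<alpha> * dil I (rad n) z) = norm (\<alpha> - dil I (rad n) z)"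
          using factor(1)[of "rad n *\<^sub>R z"] alpha by (simp add: dil_def norm_mult)
        then have "norm ((1 - cnj \<alpha> * dil I (rad n) z) * of_real (P (rad n) z)) = norm (\<alpha> - dil I (rad n) z) * P (rad n) z"
          using P0[OF z] by (simp add: norm_mult)
        also have "\<dots> = sqrt (1 - (norm (dil I (rad n) z))\<^sup>2) * sqrt (P (rad n) z)"
        proof -
          define s where "s = sqrt (1 - (norm (dil I (rad n) z))\<^sup>2)"
          define t where "t = norm (\<alpha> - dil I (rad n) z)"
          have s: "0 \<le> s" "1 - (norm (dil I (rad n) z))\<^sup>2 = s\<^sup>2"
            using lt[OF z, of n] by (auto simp: s_def power_le_one)
          have t: "t > 0" using ne[OF z] by (simp add: t_def)
          have "sqrt (P (rad n) z) = s / t"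
            using s t by (simp add: P_def real_sqrt_divide flip: t_def)
          moreover have "t * P (rad n) z = s * (s / t)"
            using s t by (simp add: P_def power2_eq_square flip: t_def)
          ultimately show ?thesis by (simp add: s_def t_def)
        qed
        finally show "complex_of_real (sqrt (1 - (norm (dil I (rad n) z))\<^sup>2)) * cnj (complex_of_real (sqrt (P (rad n) z)))
           = complex_of_real (norm ((1 - cnj \<alpha> * dil I (rad n) z) * of_real (P (rad n) z)))" by simp
      qed simp
      then show ?thesis by (simp add: integral_complex_of_real)
    qed
    also have "\<dots> \<le> norm (L2_inner sphere_measure (\<lambda>z. of_real (sqrt (1 - (norm (dil I (rad n) z))\<^sup>2))) (\<lambda>z. of_real (sqrt (P (rad n) z))))"
      by (rule complex_Re_le_cmod)
    also have "\<dots> \<le> nrmS (\<lambda>z. of_real (sqrt (1 - (norm (dil I (rad n) z))\<^sup>2))) * nrmS (\<lambda>z. of_real (sqrt (P (rad n) z)))"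
      by (intro L2.cauchy_schwarz continuous_L2 sphere.finite_measure_axioms sets_sphere_measure continuous_intros contI contP)
    also have "nrmS (\<lambda>z. of_real (sqrt (P (rad n) z))) = sqrt m"
    proof -
      have "(\<integral>z. (norm (complex_of_real (sqrt (P (rad n) z))))\<^sup>2 \<partial>sphere_measure) = (\<integral>z. P (rad n) z \<partial>sphere_measure)"
        using P0 by (intro Bochner_Integration.integral_cong) auto
      also have "\<dots> = m" using mean1[of n] by (simp add: integral_complex_of_real)
      finally show ?thesis by (simp add: L2_nrm)
    qed
    also have "nrmS (\<lambda>z. of_real (sqrt (1 - (norm (dil I (rad n) z))\<^sup>2))) = sqrt (1 - (nrmS (dil I (rad n)))\<^sup>2)"
    proof -
      have "(\<integral>z. (norm (complex_of_real (sqrt (1 - (norm (dil I (rad n) z))\<^sup>2))))\<^sup>2 \<partial>sphere_measure) = (\<integral>z. 1 - (norm (dil I (rad n) z))\<^sup>2 \<partial>sphere_measure)"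
        using lt by (intro Bochner_Integration.integral_cong) (auto simp: power_le_one less_imp_le)
      also have "\<dots> = 1 - (\<integral>z. (norm (dil I (rad n) z))\<^sup>2 \<partial>sphere_measure)"
      proof -
        have "integrable sphere_measure (\<lambda>z. (norm (dil I (rad n) z))\<^sup>2)"
          by (intro integrable_sphere_measure continuous_intros contI)
        then show ?thesis by simp
      qed
      finally show ?thesis by (simp add: L2_nrm)
    qed
    finally show ?thesis by simp
  qed
  have "(\<lambda>n. 2 * (sqrt (1 - (nrmS (dil I (rad n)))\<^sup>2) * sqrt m)) \<longlonglongrightarrow> 2 * (sqrt (1 - (H2.nrm I)\<^sup>2) * sqrt m)"
    by (intro tendsto_intros hardy_nrm_limit hardy_nrm_I)
  then have lim: "(\<lambda>n. 2 * (sqrt (1 - (nrmS (dil I (rad n)))\<^sup>2) * sqrt m)) \<longlonglongrightarrow> 0"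
    by (simp add: hardy_nrm_I)
  have "(\<lambda>n. (nrm\<sigma> (\<lambda>x. I ((rad n * rad n) *\<^sub>R x) - \<alpha>))\<^sup>2) \<longlonglongrightarrow> 0"
    by (rule tendsto_sandwich[OF _ _ tendsto_const lim]) (use bound in auto)
  then have "(\<lambda>n. sqrt ((nrm\<sigma> (\<lambda>x. I ((rad n * rad n) *\<^sub>R x) - \<alpha>))\<^sup>2)) \<longlonglongrightarrow> sqrt 0"
    by (rule tendsto_real_sqrt)
  moreover have "nrm\<sigma> f \<ge> 0" for f by (simp add: L2_nrm)
  ultimately show ?thesis by simp
qed

end

section \<open>Density of the Cauchy kernels\<close>

lemma line_has_field_derivative:
  assumes L: "(f has_derivative L) (at (p + l *s q))" "\<And>c v. L (c *s v) = c * L v"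
  shows "((\<lambda>l. f (p + l *s (q :: complex^'n))) has_field_derivative L q) (at l)"
proof -
  have "((\<lambda>l. p + l *s q) has_derivative (\<lambda>h. 0 + h *s q)) (at l)"
    by (intro has_derivative_add bounded_linear_imp_has_derivative has_derivative_const bounded_linear_scale_left)
  from has_derivative_compose[OF this L(1)] show ?thesis
    by (simp add: has_field_derivative_def L(2) mult_commute_abs)
qed

text \<open>Cauchy's inequality with a radius that may depend on the direction; near the sphere this
  makes tangential derivatives less singular than radial ones.\<close>

lemma directional_derivative_bound:
  fixes f :: "complex^'n \<Rightarrow> complex"
  assumes f: "hol_ball R f" and L: "(f has_derivative L) (at p)" "\<And>c v. L (c *s v) = c * L v"
    and r: "r > 0" and bound: "\<And>l. norm l \<le> r \<Longrightarrow> p + l *s v \<in> ball 0 R \<and> norm (f (p + l *s v)) \<le> C"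
  shows "norm (L v) \<le> C / r"
proof -
  have hol: "(\<lambda>l. f (p + l *s v)) holomorphic_on cball 0 r"
    by (rule holomorphic_on_subset[OF hol_ball_line[OF f]]) (use bound in auto)
  have "norm ((deriv ^^ 1) (\<lambda>l. f (p + l *s v)) 0) \<le> fact 1 * C / r ^ 1"
    by (rule Cauchy_inequality)
       (use r bound hol in \<open>auto intro: holomorphic_on_subset holomorphic_on_imp_continuous_on\<close>)
  moreover have "((\<lambda>l. f (p + l *s v)) has_field_derivative L v) (at 0)"
    using L by (intro line_has_field_derivative) auto
  then have "deriv (\<lambda>l. f (p + l *s v)) 0 = L v" by (rule DERIV_imp_deriv)
  ultimately show ?thesis by simp
qed

text \<open>This is \<open>\<rho>\<close> times the partial derivative in coordinate
  \<open>j\<close>, as a circle average of translates of \<open>f\<close>. In this form a functional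
  that vanishes on functions holomorphic beyond the closed ball kills it by Fubini.\<close>

definition coord_deriv :: "(complex^'n \<Rightarrow> complex) \<Rightarrow> real \<Rightarrow> 'n \<Rightarrow> complex^'n \<Rightarrow> complex" where
  "coord_deriv f \<rho> j z = (\<integral>s. f (z + (of_real \<rho> * circ s) *s axis j 1) * cnj (circ s) \<partial>unit_ivl)"

text \<open>The choice \<open>1 + 2 * \<rho> = R\<close> keeps the parameter disc of radius
  \<open>2\<close> inside the domain, so the unit circle of the average lies in its
  interior.\<close>

lemma coord_deriv_eq:
  fixes f :: "complex^'n \<Rightarrow> complex"
  assumes f: "hol_ball R f" and R: "R > 1" and \<rho>: "\<rho> = (R - 1) / 2" and z: "norm z \<le> 1"
    and L: "(f has_derivative L) (at z)" "\<And>c v. L (c *s v) = c * L v"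
  shows "coord_deriv f \<rho> j z = of_real \<rho> * L (axis j 1)"
proof -
  let ?q = "of_real \<rho> *s axis j 1 :: complex^'n"
  have \<rho>0: "\<rho> > 0" using R \<rho> by simp
  have "(\<lambda>l. f (z + l *s ?q)) holomorphic_on ball 0 2"
  proof (rule holomorphic_on_subset[OF hol_ball_line[OF f]], safe)
    fix l :: complex assume "l \<in> ball 0 2"
    then have "norm l * \<rho> < 2 * \<rho>" using \<rho>0 by simp
    moreover have "norm (l *s ?q) = norm l * \<rho>" using \<rho>0 by (simp add: norm_mult)
    moreover have "1 + 2 * \<rho> = R" using \<rho> by (simp add: field_simps)
    ultimately have "norm (z + l *s ?q) < R"
      using norm_triangle_ineq[of z "l *s ?q"] z by linarith
    then show "z + l *s ?q \<in> ball 0 R" by (simp only: mem_ball_0)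
  qed
  from circle_coefficient[OF this, of 1]
  have "(\<integral>s. f (z + circ s *s ?q) * cnj (circ s) \<partial>unit_ivl) = deriv (\<lambda>l. f (z + l *s ?q)) 0" by simp
  also have "\<dots> = L ?q"
    using L by (intro DERIV_imp_deriv line_has_field_derivative) auto
  also have "\<dots> = of_real \<rho> * L (axis j 1)" by (rule L(2))
  finally show ?thesis by (simp add: coord_deriv_def mult.commute)
qed

lemma coord_deriv_continuous:
  fixes f :: "complex^'n \<Rightarrow> complex"
  assumes f: "hol_ball R f" and R: "R > 1" and \<rho>: "\<rho> = (R - 1) / 2"
  shows "continuous_on (cball 0 1) (coord_deriv f \<rho> j)"
    and "continuous_on (cball 0 1 \<times> UNIV) (\<lambda>p. f (fst p + (of_real \<rho> * circ (snd p)) *s axis j 1) * cnj (circ (snd p)))"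
proof -
  show cont: "continuous_on (cball 0 1 \<times> UNIV) (\<lambda>p. f (fst p + (of_real \<rho> * circ (snd p)) *s axis j 1) * cnj (circ (snd p)))"
  proof (intro continuous_intros continuous_on_compose2[OF hol_ball_continuous[OF f]])
    show "(\<lambda>p. fst p + (of_real \<rho> * circ (snd p)) *s axis j 1) ` (cball 0 1 \<times> UNIV) \<subseteq> ball 0 R"
    proof safe
      fix z :: "complex^'n" and s :: real assume "z \<in> cball 0 1"
      moreover have "norm ((of_real \<rho> * circ s) *s axis j 1 :: complex^'n) = \<rho>" using R \<rho> by (simp add: norm_mult)
      moreover have "1 + \<rho> < R" using R \<rho> by (simp add: field_simps)
      ultimately have "norm (z + (of_real \<rho> * circ s) *s axis j 1) < R"
        using norm_triangle_ineq[of z "(of_real \<rho> * circ s) *s axis j 1"] unfolding mem_cball_0 by linarith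
      then show "fst (z, s) + (of_real \<rho> * circ (snd (z, s))) *s axis j 1 \<in> ball 0 R"
        by (simp only: mem_ball_0 fst_conv snd_conv)
    qed
  qed
  have "continuous_on (cball 0 1) (\<lambda>z. integral (cbox 0 1) (\<lambda>s. f (z + (of_real \<rho> * circ s) *s axis j 1) * cnj (circ s)))"
    by (rule integral_continuous_on_param) (auto simp: case_prod_unfold intro: continuous_on_subset[OF cont])
  then show "continuous_on (cball 0 1) (coord_deriv f \<rho> j)"
  proof (rule continuous_on_eq)
    fix z :: "complex^'n" assume z: "z \<in> cball 0 1"
    have "continuous_on {0..1} (\<lambda>s. f (fst (z, s) + (of_real \<rho> * circ (snd (z, s))) *s axis j 1) * cnj (circ (snd (z, s))))"
      by (rule continuous_on_compose2[OF cont]) (use z in \<open>auto intro!: continuous_intros\<close>)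
    then show "integral (cbox 0 1) (\<lambda>s. f (z + (of_real \<rho> * circ s) *s axis j 1) * cnj (circ s)) = coord_deriv f \<rho> j z"
      by (simp add: coord_deriv_def integral_unit_ivl)
  qed
qed

text \<open>Along the radius towards a point \<open>x\<close> of the sphere, the \<open>j\<close>-th basis vector splits into
  \<open>cnj (x $ j) *s x\<close> and a complex tangential part. The radial part integrates to
  \<open>cnj (x $ j) * (f x - f 0)\<close>; tangentially the ball contains discs of radius
  \<open>sqrt (1 - t\<^sup>2)\<close>, so the tangential derivative has an integrable singularity at the sphere.\<close>

lemma coord_deriv_approx:
  fixes f :: "complex^'n \<Rightarrow> complex"
  assumes f: "hol_ball R f" and R: "R > 1" and \<rho>: "\<rho> = (R - 1) / 2" and d: "0 < d" "d < 1"
    and B: "\<And>z. z \<in> ball 0 R \<Longrightarrow> norm (f z) \<le> B" and eta: "\<And>z. norm z \<le> 1 - d / 2 \<Longrightarrow> norm (f z) \<le> \<eta>"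
    and x: "norm x = 1"
  shows "norm ((\<integral>t. coord_deriv f \<rho> j (t *\<^sub>R x) \<partial>unit_ivl) / of_real \<rho> - cnj (x $ j) * (f x - f 0)) \<le> 2 * \<eta> / d + 2 * B * sqrt (2 * d)"
proof -
  have "\<forall>z\<in>ball 0 R. \<exists>L. (f has_derivative L) (at z) \<and> (\<forall>c v. L (c *s v) = c * L v)"
    using f by (simp add: hol_ball_def)
  then obtain L where L: "\<And>z. z \<in> ball 0 R \<Longrightarrow> (f has_derivative L z) (at z)" "\<And>z c v. z \<in> ball 0 R \<Longrightarrow> L z (c *s v) = c * L z v"
    by metis
  have B0: "0 \<le> B" using order_trans[OF norm_ge_zero B[of 0]] R by simp
  have eta0: "0 \<le> \<eta>" using order_trans[OF norm_ge_zero eta[of 0]] d by simp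
  have \<rho>0: "\<rho> > 0" using R \<rho> by simp
  have inR: "t *\<^sub>R x \<in> ball 0 R" if "0 \<le> t" "t \<le> 1" for t using that R x by simp
  define v where "v = axis j 1 - cnj (x $ j) *s x"
  have xx: "cinner x x = 1" using x by (simp add: cinner_self)
  have vx: "cinner (c *s x) (l *s v) = 0" for c l
    unfolding v_def by (simp add: cinner_diff_right xx)
  have "(norm (cnj (x $ j) *s x + 1 *s v))\<^sup>2 = (norm (cnj (x $ j) *s x))\<^sup>2 + (norm (1 *s v))\<^sup>2"
    by (rule pythagoras_cinner[OF vx])
  moreover have "cnj (x $ j) *s x + 1 *s v = axis j 1" by (simp add: v_def)
  ultimately have "(norm (x $ j))\<^sup>2 + (norm v)\<^sup>2 = 1" by (simp add: x power_mult_distrib)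
  then have "(norm v)\<^sup>2 \<le> 1\<^sup>2" using zero_le_power2[of "norm (x $ j)"] unfolding one_power2 by linarith
  then have nv: "norm v \<le> 1" by (rule power2_le_imp_le) simp
  define T where "T t = L (t *\<^sub>R x) v" for t
  have contD: "continuous_on {0..1} (\<lambda>t. coord_deriv f \<rho> j (t *\<^sub>R x))"
    by (intro continuous_on_compose2[OF coord_deriv_continuous(1)[OF f R \<rho>]] continuous_intros) (use x in auto)
  have FTC: "((\<lambda>t. L (t *\<^sub>R x) x) has_integral (f (1 *\<^sub>R x) - f (0 *\<^sub>R x))) {0..1}"
  proof (rule fundamental_theorem_of_calculus)
    fix t :: real assume t: "t \<in> {0..1}"
    have "((\<lambda>l. f (0 + l *s x)) has_field_derivative L (t *\<^sub>R x) x) (at (of_real t))"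
      using L[OF inR, of t] t by (intro line_has_field_derivative) (auto simp: scaleR_eq_scale)
    then have "((\<lambda>t. f (0 + of_real t *s x)) has_vector_derivative L (t *\<^sub>R x) x) (at t within {0..1})"
      by (rule has_vector_derivative_real_field)
    then show "((\<lambda>t. f (t *\<^sub>R x)) has_vector_derivative L (t *\<^sub>R x) x) (at t within {0..1})"
      by (simp add: scaleR_eq_scale)
  qed simp
  define E where "E = integral {0..1} (\<lambda>t. coord_deriv f \<rho> j (t *\<^sub>R x)) / of_real \<rho> - cnj (x $ j) * (f x - f 0)"
  have "((\<lambda>t. coord_deriv f \<rho> j (t *\<^sub>R x) / of_real \<rho> - cnj (x $ j) * L (t *\<^sub>R x) x) has_integral E) {0..1}"
    unfolding E_def
    using has_integral_mult_right[OF FTC, of "cnj (x $ j)"]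
    by (intro has_integral_diff has_integral_divide integrable_integral integrable_continuous_real contD) simp_all
  moreover have "coord_deriv f \<rho> j (t *\<^sub>R x) / of_real \<rho> - cnj (x $ j) * L (t *\<^sub>R x) x = T t" if t: "t \<in> {0..1}" for t
  proof -
    have tR: "t *\<^sub>R x \<in> ball 0 R" using t by (intro inR) auto
    have "norm (t *\<^sub>R x) \<le> 1" using t x by simp
    from coord_deriv_eq[OF f R \<rho> this L(1)[OF tR] L(2)[OF tR], of j]
    have "coord_deriv f \<rho> j (t *\<^sub>R x) / of_real \<rho> = L (t *\<^sub>R x) (axis j 1)" using \<rho>0 by simp
    moreover have "linear (L (t *\<^sub>R x))" using has_derivative_linear[OF L(1)[OF tR]] .
    then have "T t = L (t *\<^sub>R x) (axis j 1) - L (t *\<^sub>R x) (cnj (x $ j) *s x)"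
      unfolding T_def v_def by (rule linear_diff)
    ultimately show ?thesis by (simp add: L(2)[OF tR])
  qed
  ultimately have T: "(T has_integral E) {0..1}"
    by (rule has_integral_eq[rotated])
  have ints: "T integrable_on {0..1 - d}" "T integrable_on {1 - d..1}"
    using T d by (auto intro!: integrable_on_subinterval[OF has_integral_integrable[OF T]])
  have E: "E = integral {0..1 - d} T + integral {1 - d..1} T"
    using Henstock_Kurzweil_Integration.integral_combine[of 0 "1 - d" 1 T] d T by (auto simp: has_integral_integrable integral_unique)
  have "norm (integral {0..1 - d} T) \<le> integral {0..1 - d} (\<lambda>t. 2 * \<eta> / d)"
  proof (rule integral_norm_bound_integral[OF ints(1)])
    fix t assume t: "t \<in> {0..1 - d}"
    \<comment> \<open>For \<open>t \<le> 1 - d\<close> a disc of radius \<open>d / 2\<close> in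
      direction \<open>v\<close> stays where \<open>f\<close> is bounded by
      \<open>\<eta>\<close>.\<close>
    have "norm (L (t *\<^sub>R x) v) \<le> \<eta> / (d / 2)"
    proof (rule directional_derivative_bound[OF f])
      fix l :: complex assume l: "norm l \<le> d / 2"
      have "norm (t *\<^sub>R x + l *s v) \<le> t + norm l * norm v"
        using norm_triangle_ineq[of "t *\<^sub>R x" "l *s v"] t x by simp
      also have "\<dots> \<le> (1 - d) + d / 2 * 1" using t l nv d by (intro add_mono mult_mono) auto
      finally have n: "norm (t *\<^sub>R x + l *s v) \<le> 1 - d / 2" by simp
      then show "t *\<^sub>R x + l *s v \<in> ball 0 R \<and> norm (f (t *\<^sub>R x + l *s v)) \<le> \<eta>"
        using eta[OF n] d R by simp
    qed (use L[OF inR, of t] t d in auto)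
    then show "norm (T t) \<le> 2 * \<eta> / d" by (simp add: T_def mult.commute)
  qed (rule integrable_const_ivl)
  also have "\<dots> \<le> 2 * \<eta> / d"
  proof -
    have "(2 - d * 2) * \<eta> / d \<le> 2 * \<eta> / d"
      using d eta0 mult_nonneg_nonneg[of d \<eta>] by (intro divide_right_mono) (auto simp: algebra_simps)
    then show ?thesis using d by (simp add: algebra_simps)
  qed
  finally have part1: "norm (integral {0..1 - d} T) \<le> 2 * \<eta> / d" .
  \<comment> \<open>\<open>S\<close> lies slightly beyond the sphere but inside the domain.
    Measuring tangential discs against radius \<open>S\<close> makes the majorant
    \<open>B / sqrt (S - t)\<close> continuous up to \<open>t = 1\<close>, with an explicit
    antiderivative.\<close>
  define S where "S = min ((1 + R) / 2) (1 + d)"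
  have S: "1 < S" "S < R" "S \<le> 1 + d" using R d by (auto simp: S_def min_def)
  have G: "((\<lambda>t. B / sqrt (S - t)) has_integral (- 2 * B * sqrt (S - 1) - (- 2 * B * sqrt (S - (1 - d))))) {1 - d..1}"
  proof (rule fundamental_theorem_of_calculus)
    fix t assume t: "t \<in> {1 - d..1}"
    have pos: "0 < S - t" using t S by simp
    have "((\<lambda>t. - 2 * B * sqrt (S - t)) has_real_derivative B / sqrt (S - t)) (at t within {1 - d..1})"
      using pos by (auto intro!: derivative_eq_intros simp: field_simps)
    then show "((\<lambda>t. - 2 * B * sqrt (S - t)) has_vector_derivative B / sqrt (S - t)) (at t within {1 - d..1})"
      by (simp add: has_real_derivative_iff_has_vector_derivative)
  qed (use d in simp)
  have T_le: "norm (integral {1 - d..1} T) \<le> integral {1 - d..1} (\<lambda>t. B / sqrt (S - t))"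
  proof (rule integral_norm_bound_integral[OF ints(2) has_integral_integrable[OF G]])
    fix t assume t: "t \<in> {1 - d..1}"
    have pos: "0 < S - t" using t S by simp
    have t01: "0 \<le> t" "t \<le> 1" using t d by auto
    have sq: "S - t \<le> S\<^sup>2 - t\<^sup>2"
    proof -
      have "(S - t) * 1 \<le> (S - t) * (S + t)" using pos S t01 by (intro mult_left_mono) auto
      then show ?thesis by (simp add: power2_eq_square algebra_simps)
    qed
    have "norm (L (t *\<^sub>R x) v) \<le> B / sqrt (S\<^sup>2 - t\<^sup>2)"
    proof (rule directional_derivative_bound[OF f])
      show "0 < sqrt (S\<^sup>2 - t\<^sup>2)" using sq pos by simp
      fix l :: complex assume l: "norm l \<le> sqrt (S\<^sup>2 - t\<^sup>2)"
      have "(norm (t *\<^sub>R x + l *s v))\<^sup>2 = t\<^sup>2 + (norm l)\<^sup>2 * (norm v)\<^sup>2"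
        unfolding scaleR_eq_scale by (subst pythagoras_cinner[OF vx]) (simp add: x power_mult_distrib)
      also have "\<dots> \<le> t\<^sup>2 + (S\<^sup>2 - t\<^sup>2) * 1"
      proof -
        have "(norm l)\<^sup>2 \<le> (sqrt (S\<^sup>2 - t\<^sup>2))\<^sup>2" using l by (intro power_mono) auto
        then have "(norm l)\<^sup>2 \<le> S\<^sup>2 - t\<^sup>2" using sq pos by simp
        moreover have "(norm v)\<^sup>2 \<le> 1" using nv by (simp add: power_le_one)
        ultimately show ?thesis using sq pos by (intro add_left_mono mult_mono) auto
      qed
      finally have "(norm (t *\<^sub>R x + l *s v))\<^sup>2 \<le> S\<^sup>2" by simp
      then have "norm (t *\<^sub>R x + l *s v) \<le> S" by (rule power2_le_imp_le) (use S in simp)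
      then have "t *\<^sub>R x + l *s v \<in> ball 0 R" using S by simp
      with B show "t *\<^sub>R x + l *s v \<in> ball 0 R \<and> norm (f (t *\<^sub>R x + l *s v)) \<le> B" by blast
    qed (use L[OF inR, of t] t01 in auto)
    also have "\<dots> \<le> B / sqrt (S - t)" using sq pos B0 by (intro divide_left_mono mult_pos_pos) auto
    finally show "norm (T t) \<le> B / sqrt (S - t)" by (simp add: T_def)
  qed
  have G_eq: "integral {1 - d..1} (\<lambda>t. B / sqrt (S - t)) = - 2 * B * sqrt (S - 1) - (- 2 * B * sqrt (S - (1 - d)))"
    by (rule integral_unique[OF G])
  have part2: "norm (integral {1 - d..1} T) \<le> 2 * B * sqrt (2 * d)"
  proof -
    have "sqrt (S - (1 - d)) \<le> sqrt (2 * d)" using S by simp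
    then have "2 * B * sqrt (S - (1 - d)) \<le> 2 * B * sqrt (2 * d)" using B0 by (intro mult_left_mono) auto
    moreover have "0 \<le> 2 * B * sqrt (S - 1)" using B0 S by simp
    ultimately show ?thesis using T_le unfolding G_eq by linarith
  qed
  have "norm E \<le> 2 * \<eta> / d + 2 * B * sqrt (2 * d)"
    unfolding E using norm_triangle_ineq[of "integral {0..1 - d} T" "integral {1 - d..1} T"] part1 part2 by linarith
  then show ?thesis unfolding E_def integral_unit_ivl[OF contD] .
qed

lemma L2_mult_continuous:
  fixes M :: "(complex^'n) measure"
  assumes M: "finite_measure M" "sets M = sets (restrict_space borel (sphere 0 1))"
    and u: "u \<in> L2_space M" and g: "continuous_on (sphere 0 1) g"
  shows "(\<lambda>x. g x * u x) \<in> L2_space M"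
    and "\<And>B. 0 \<le> B \<Longrightarrow> (\<And>x. norm x = 1 \<Longrightarrow> norm (g x) \<le> B) \<Longrightarrow> L2.nrm M (\<lambda>x. g x * u x) \<le> B * L2.nrm M u"
proof -
  have sp: "space M = sphere 0 1" using sets_eq_imp_space_eq[OF M(2)] by (simp add: space_restrict_space)
  have [measurable]: "g \<in> borel_measurable M" by (rule integrable_sphere_continuous(1)[OF M g])
  have [measurable]: "u \<in> borel_measurable M" using u by (simp add: L2_space_def)
  have key: "(\<lambda>x. g x * u x) \<in> L2_space M \<and> L2.nrm M (\<lambda>x. g x * u x) \<le> B * L2.nrm M u"
    if B: "0 \<le> B" "\<And>x. norm x = 1 \<Longrightarrow> norm (g x) \<le> B" for B
  proof -
    have "(\<integral>\<^sup>+x. ennreal ((norm (g x * u x))\<^sup>2) \<partial>M) \<le> (\<integral>\<^sup>+x. ennreal ((norm (of_real B * u x))\<^sup>2) \<partial>M)"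
    proof (intro nn_integral_mono ennreal_leI power_mono)
      fix x assume "x \<in> space M"
      then have "norm (g x) \<le> norm (complex_of_real B)" using B by (simp add: sp)
      then show "norm (g x * u x) \<le> norm (of_real B * u x)" unfolding norm_mult by (rule mult_right_mono) simp
    qed simp
    also have "\<dots> = ennreal ((L2.nrm M (\<lambda>x. of_real B * u x))\<^sup>2)" by (rule nn_integral_L2_nrm[OF L2_scale[OF u]])
    also have "L2.nrm M (\<lambda>x. of_real B * u x) = B * L2.nrm M u" using B(1) by (simp add: L2.nrm_scale[OF u])
    finally show ?thesis
      using L2_nrm_le[of "\<lambda>x. g x * u x" M "B * L2.nrm M u"] B(1) L2.nrm_nonneg[OF u] by simp
  qed
  have "compact (g ` sphere 0 1)" by (intro compact_continuous_image g compact_sphere)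
  then obtain B where "\<forall>y\<in>g ` sphere 0 1. norm y \<le> B" by (meson bounded_iff compact_imp_bounded)
  then have "norm (g x) \<le> max B 0" if "norm x = 1" for x using that by (simp add: max.coboundedI1)
  then show "(\<lambda>x. g x * u x) \<in> L2_space M" using key[of "max B 0"] by simp
  show "\<And>B. 0 \<le> B \<Longrightarrow> (\<And>x. norm x = 1 \<Longrightarrow> norm (g x) \<le> B) \<Longrightarrow> L2.nrm M (\<lambda>x. g x * u x) \<le> B * L2.nrm M u"
    using key by blast
qed

section \<open>Functions in L2 of \<open>\<sigma>\<close> orthogonal to everything holomorphic near
  the closed ball\<close>

context clark_setting
begin

text \<open>The test functions are all functions holomorphic on some larger ball rather than the
  kernels alone: this class is stable under products, dilations towards the origin and small
  translations, on which the arguments below rely.\<close>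

definition annihilator :: "(complex^'n \<Rightarrow> complex) set" where
  "annihilator = {u \<in> L2_space \<sigma>. \<forall>R>1. \<forall>f. hol_ball R f \<longrightarrow> (\<integral>x. f x * cnj (u x) \<partial>\<sigma>) = 0}"

lemma annihilatorD: "u \<in> annihilator \<Longrightarrow> hol_ball R f \<Longrightarrow> R > 1 \<Longrightarrow> (\<integral>x. f x * cnj (u x) \<partial>\<sigma>) = 0"
  by (auto simp: annihilator_def)

lemma annihilator_L2: "u \<in> annihilator \<Longrightarrow> u \<in> L2_space \<sigma>"
  by (simp add: annihilator_def)

lemma integrable_cnj_L2:
  assumes "u \<in> L2_space \<sigma>"
  shows "integrable \<sigma> (\<lambda>x. cnj (u x))"
  using L2_integrable(1)[OF finite_sigma assms] by simp

lemma hol_ball_continuous_sphere: "hol_ball R f \<Longrightarrow> R > 1 \<Longrightarrow> continuous_on (sphere 0 1) f"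
  by (rule continuous_on_subset[OF hol_ball_continuous]) auto

lemma integrable_mult_cnj:
  assumes "u \<in> L2_space \<sigma>" "continuous_on (sphere 0 1) g"
  shows "integrable \<sigma> (\<lambda>x. g x * cnj (u x))"
  using integrable_mult_continuous[OF finite_sigma sets_sigma integrable_cnj_L2[OF assms(1)] assms(2)]
  by (simp add: mult.commute)

text \<open>The Cauchy formula for a dilate writes \<open>f\<close> on the sphere as a superposition
  of functions \<open>cauchy_kernel x w\<close> with \<open>norm w = 1 / s\<close>; Fubini then
  transfers the orthogonality.\<close>

lemma annihilator_kernels:
  assumes u: "u \<in> L2_space \<sigma>" and orth: "\<And>w. norm w < 1 \<Longrightarrow> L2_inner \<sigma> (\<lambda>x. cauchy_kernel x w) u = 0"
  shows "u \<in> annihilator"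
  unfolding annihilator_def
proof safe
  fix R :: real and f :: "complex^'n \<Rightarrow> complex" assume R: "1 < R" and f: "hol_ball R f"
  define s where "s = (1 + R) / 2"
  have s: "1 < s" "s < R" using R by (auto simp: s_def)
  define F where "F z = f (s *\<^sub>R z)" for z
  have F: "hol_ball (R / s) F" unfolding F_def using s by (intro hol_ball_dilate[OF f]) auto
  have Rs: "R / s > 1" using s by simp
  have contF: "continuous_on (sphere 0 1) F" by (rule hol_ball_continuous_sphere[OF F Rs])
  have nz: "norm ((1 / s) *\<^sub>R z) < 1" if "norm z = 1" for z :: "complex^'n" using that s by simp
  have rep: "f x = (\<integral>z. F z * cauchy_kernel x ((1 / s) *\<^sub>R z) \<partial>sphere_measure)" if x: "norm x = 1" for x
  proof -
    have "(\<integral>z. F z * cauchy_kernel ((1 / s) *\<^sub>R x) z \<partial>sphere_measure) = F ((1 / s) *\<^sub>R x)"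
      by (rule cauchy_sphere[OF F Rs nz[OF x]])
    moreover have "cauchy_kernel ((1 / s) *\<^sub>R x) z = cauchy_kernel x ((1 / s) *\<^sub>R z)" for z
      by (simp add: cauchy_kernel_def)
    ultimately show ?thesis using s by (simp add: F_def)
  qed
  have cont: "continuous_on (sphere 0 1 \<times> sphere 0 1) (\<lambda>p. F (fst p) * cauchy_kernel (snd p) ((1 / s) *\<^sub>R fst p))"
    by (intro continuous_intros continuous_on_cauchy_kernel continuous_on_compose2[OF contF]) (use s in auto)
  have "(\<integral>x. f x * cnj (u x) \<partial>\<sigma>) = (\<integral>x. (\<integral>z. F z * cauchy_kernel x ((1 / s) *\<^sub>R z) * cnj (u x) \<partial>sphere_measure) \<partial>\<sigma>)"
    by (intro Bochner_Integration.integral_cong refl) (simp add: rep space_sigma)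
  also have "\<dots> = (\<integral>z. (\<integral>x. F z * cauchy_kernel x ((1 / s) *\<^sub>R z) * cnj (u x) \<partial>\<sigma>) \<partial>sphere_measure)"
    by (rule fubini_compact[OF sphere.finite_measure_axioms sets_sphere_measure compact_sphere finite_sigma sets_sigma compact_sphere cont integrable_cnj_L2[OF u], symmetric])
  also have "\<dots> = (\<integral>z. 0 \<partial>(sphere_measure :: (complex^'n) measure))"
  proof (rule Bochner_Integration.integral_cong)
    fix z :: "complex^'n" assume "z \<in> space sphere_measure"
    then have "L2_inner \<sigma> (\<lambda>x. cauchy_kernel x ((1 / s) *\<^sub>R z)) u = 0" by (intro orth nz) simp
    then show "(\<integral>x. F z * cauchy_kernel x ((1 / s) *\<^sub>R z) * cnj (u x) \<partial>\<sigma>) = 0"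
      by (simp add: L2_inner_def mult.assoc)
  qed simp
  finally show "(\<integral>x. f x * cnj (u x) \<partial>\<sigma>) = 0" by simp
qed (rule u)

lemma annihilator_comb:
  assumes u: "u \<in> annihilator" and v: "v \<in> annihilator"
  shows "(\<lambda>x. a * u x + b * v x) \<in> annihilator"
proof -
  have "(\<integral>x. f x * cnj (a * u x + b * v x) \<partial>\<sigma>) = 0" if R: "R > 1" and f: "hol_ball R f" for R f
  proof -
    have "(\<integral>x. f x * cnj (a * u x + b * v x) \<partial>\<sigma>) = (\<integral>x. cnj a * (f x * cnj (u x)) + cnj b * (f x * cnj (v x)) \<partial>\<sigma>)"
      by (simp add: algebra_simps)
    also have "\<dots> = 0"
      using integrable_mult_cnj[OF annihilator_L2[OF u] hol_ball_continuous_sphere[OF f R]] integrable_mult_cnj[OF annihilator_L2[OF v] hol_ball_continuous_sphere[OF f R]]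
      by (simp add: annihilatorD[OF u f R] annihilatorD[OF v f R])
    finally show ?thesis .
  qed
  then show ?thesis using L2.comb_closed[OF annihilator_L2[OF u] annihilator_L2[OF v]] by (simp add: annihilator_def)
qed

text \<open>Under the conjugation of \<open>u\<close> the factor becomes the holomorphic coordinate,
  which the test function absorbs.\<close>

lemma annihilator_cnj_coord:
  assumes u: "u \<in> annihilator"
  shows "(\<lambda>x. cnj (x $ j) * u x) \<in> annihilator"
proof -
  have "(\<integral>x. f x * cnj (cnj (x $ j) * u x) \<partial>\<sigma>) = 0" if R: "R > 1" and f: "hol_ball R f" for R f
    using annihilatorD[OF u hol_ball_mult[OF f hol_ball_coord[of R j]] R] by (simp add: mult.assoc)
  moreover have "(\<lambda>x. cnj (x $ j) * u x) \<in> L2_space \<sigma>"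
    by (intro L2_mult_continuous(1)[OF finite_sigma sets_sigma annihilator_L2[OF u]] continuous_intros)
  ultimately show ?thesis by (simp add: annihilator_def)
qed

text \<open>Two exchanges of integrals peel off the radius and the circle average; what remains is a
  dilated translate of \<open>f\<close>, holomorphic on the ball of radius
  \<open>1 + \<rho>\<close>.\<close>

lemma annihilator_coord_deriv:
  assumes u: "u \<in> annihilator" and f: "hol_ball R f" and R: "R > 1" and \<rho>: "\<rho> = (R - 1) / 2"
  shows "(\<integral>x. (\<integral>t. coord_deriv f \<rho> j (t *\<^sub>R x) \<partial>unit_ivl) * cnj (u x) \<partial>\<sigma>) = 0"
proof -
  note uL2 = annihilator_L2[OF u]
  note cont = coord_deriv_continuous[OF f R \<rho>, of j]
  have cont1: "continuous_on ({0..1} \<times> sphere 0 1) (\<lambda>p. coord_deriv f \<rho> j (fst p *\<^sub>R snd p))"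
    by (intro continuous_on_compose2[OF cont(1)] continuous_intros) auto
  have fixed: "(\<integral>x. coord_deriv f \<rho> j (t *\<^sub>R x) * cnj (u x) \<partial>\<sigma>) = 0" if t: "t \<in> {0..1}" for t
  proof -
    let ?G = "\<lambda>s x. f (t *\<^sub>R x + (of_real \<rho> * circ s) *s axis j 1) * cnj (circ s)"
    have "continuous_on ({0..1} \<times> sphere 0 1)
      (\<lambda>p. f (fst (t *\<^sub>R snd p, fst p) + (of_real \<rho> * circ (snd (t *\<^sub>R snd p, fst p))) *s axis j 1) * cnj (circ (snd (t *\<^sub>R snd p, fst p))))"
      by (rule continuous_on_compose2[OF cont(2)]) (use t in \<open>auto intro!: continuous_intros\<close>)
    then have contG: "continuous_on ({0..1} \<times> sphere 0 1) (\<lambda>p. ?G (fst p) (snd p))" by simp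
    have "(\<integral>x. coord_deriv f \<rho> j (t *\<^sub>R x) * cnj (u x) \<partial>\<sigma>) = (\<integral>x. (\<integral>s. ?G s x * cnj (u x) \<partial>unit_ivl) \<partial>\<sigma>)"
      by (simp add: coord_deriv_def)
    also have "\<dots> = (\<integral>s. (\<integral>x. ?G s x * cnj (u x) \<partial>\<sigma>) \<partial>unit_ivl)"
      by (rule fubini_compact[OF unit_ivl.finite_measure_axioms sets_unit_ivl compact_Icc finite_sigma sets_sigma compact_sphere contG integrable_cnj_L2[OF uL2], symmetric])
    also have "\<dots> = (\<integral>s. 0 \<partial>unit_ivl)"
    proof (rule Bochner_Integration.integral_cong)
      fix s
      have "hol_ball (1 + \<rho>) (\<lambda>x. f (of_real t *s x + (of_real \<rho> * circ s) *s axis j 1))"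
      proof (rule hol_ball_scale_add[OF f])
        fix z :: "complex^'n" assume z: "z \<in> ball 0 (1 + \<rho>)"
        have "norm ((of_real \<rho> * circ s) *s axis j 1 :: complex^'n) = \<rho>" using R \<rho> by (simp add: norm_mult)
        moreover have "norm (of_real t *s z) = t * norm z" using t by simp
        ultimately have "norm (of_real t *s z + (of_real \<rho> * circ s) *s axis j 1) \<le> t * norm z + \<rho>"
          using norm_triangle_ineq[of "of_real t *s z" "(of_real \<rho> * circ s) *s axis j 1"] by linarith
        also have "\<dots> \<le> 1 * norm z + \<rho>" using t by (intro add_right_mono mult_right_mono) auto
        also have "\<dots> < R" using z \<rho> by (simp add: field_simps)
        finally show "of_real t *s z + (of_real \<rho> * circ s) *s axis j 1 \<in> ball 0 R" by simp
      qed
      then have zero: "(\<integral>x. f (of_real t *s x + (of_real \<rho> * circ s) *s axis j 1) * cnj (u x) \<partial>\<sigma>) = 0"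
        by (rule annihilatorD[OF u]) (use R \<rho> in simp)
      have "(\<integral>x. ?G s x * cnj (u x) \<partial>\<sigma>)
        = (\<integral>x. cnj (circ s) * (f (of_real t *s x + (of_real \<rho> * circ s) *s axis j 1) * cnj (u x)) \<partial>\<sigma>)"
        by (intro Bochner_Integration.integral_cong refl) (simp add: scaleR_eq_scale mult_ac)
      then show "(\<integral>x. ?G s x * cnj (u x) \<partial>\<sigma>) = 0" by (simp only: integral_mult_right_zero zero mult_zero_right)
    qed simp
    finally show ?thesis by simp
  qed
  have "(\<integral>x. (\<integral>t. coord_deriv f \<rho> j (t *\<^sub>R x) \<partial>unit_ivl) * cnj (u x) \<partial>\<sigma>) = (\<integral>x. (\<integral>t. coord_deriv f \<rho> j (t *\<^sub>R x) * cnj (u x) \<partial>unit_ivl) \<partial>\<sigma>)"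
    by simp
  also have "\<dots> = (\<integral>t. (\<integral>x. coord_deriv f \<rho> j (t *\<^sub>R x) * cnj (u x) \<partial>\<sigma>) \<partial>unit_ivl)"
    by (rule fubini_compact[OF unit_ivl.finite_measure_axioms sets_unit_ivl compact_Icc finite_sigma sets_sigma compact_sphere cont1 integrable_cnj_L2[OF uL2], symmetric])
  also have "\<dots> = (\<integral>t. 0 \<partial>unit_ivl)"
    by (intro Bochner_Integration.integral_cong refl) (simp add: fixed)
  finally show ?thesis by simp
qed

text \<open>The radial average \<open>H\<close> of the derivative is annihilated, so only the error
  of \<open>coord_deriv_approx\<close> is left; the additional \<open>\<eta>\<close> accounts for
  the term with \<open>g 0\<close>.\<close>

lemma coord_orth_estimate:
  assumes u: "u \<in> annihilator" and g: "hol_ball R g" and R: "R > 1" and d: "0 < d" "d < 1"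
    and B: "\<And>z. z \<in> ball 0 R \<Longrightarrow> norm (g z) \<le> B" and eta: "\<And>z. norm z \<le> 1 - d / 2 \<Longrightarrow> norm (g z) \<le> \<eta>"
  shows "norm (\<integral>x. cnj (x $ j) * g x * cnj (u x) \<partial>\<sigma>) \<le> (2 * \<eta> / d + 2 * B * sqrt (2 * d) + \<eta>) * (\<integral>x. norm (u x) \<partial>\<sigma>)"
proof -
  note uL2 = annihilator_L2[OF u]
  define \<rho> where "\<rho> = (R - 1) / 2"
  define H where "H x = (\<integral>t. coord_deriv g \<rho> j (t *\<^sub>R x) \<partial>unit_ivl) / of_real \<rho>" for x
  have contg: "continuous_on (sphere 0 1) g" by (rule hol_ball_continuous_sphere[OF g R])
  have contH: "continuous_on (sphere 0 1) H"
  proof -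
    have "continuous_on (sphere 0 1 \<times> cbox 0 1) (\<lambda>(x, t). coord_deriv g \<rho> j (t *\<^sub>R x))"
      unfolding case_prod_unfold
      by (intro continuous_on_compose2[OF coord_deriv_continuous(1)[OF g R \<rho>_def]] continuous_intros) auto
    from integral_continuous_on_param[OF this]
    have "continuous_on (sphere 0 1) (\<lambda>x. integral (cbox 0 1) (\<lambda>t. coord_deriv g \<rho> j (t *\<^sub>R x)) / of_real \<rho>)"
      by (intro continuous_intros) (use R in \<open>auto simp: \<rho>_def\<close>)
    then show ?thesis
    proof (rule continuous_on_eq)
      fix x :: "complex^'n" assume x: "x \<in> sphere 0 1"
      have "continuous_on {0..1} (\<lambda>t. coord_deriv g \<rho> j (t *\<^sub>R x))"
        by (intro continuous_on_compose2[OF coord_deriv_continuous(1)[OF g R \<rho>_def]] continuous_intros) (use x in auto)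
      then show "integral (cbox 0 1) (\<lambda>t. coord_deriv g \<rho> j (t *\<^sub>R x)) / of_real \<rho> = H x"
        by (simp add: H_def integral_unit_ivl)
    qed
  qed
  have eta0: "norm (g 0) \<le> \<eta>" using eta[of 0] d by simp
  define K where "K = 2 * \<eta> / d + 2 * B * sqrt (2 * d) + \<eta>"
  have pt: "norm (cnj (x $ j) * g x - H x) \<le> K" if x: "norm x = 1" for x
  proof -
    have xj: "norm (cnj (x $ j)) \<le> 1" using Finite_Cartesian_Product.norm_nth_le[where x = x and i = j] x by simp
    have "norm (H x - cnj (x $ j) * (g x - g 0)) \<le> 2 * \<eta> / d + 2 * B * sqrt (2 * d)"
      unfolding H_def by (rule coord_deriv_approx[OF g R \<rho>_def d B eta x])
    moreover have "norm (cnj (x $ j) * g 0) \<le> 1 * \<eta>" unfolding norm_mult by (intro mult_mono xj eta0) auto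
    moreover have eq: "cnj (x $ j) * g x - H x = cnj (x $ j) * g 0 - (H x - cnj (x $ j) * (g x - g 0))" by (simp add: algebra_simps)
    ultimately show ?thesis
      unfolding eq K_def using norm_triangle_ineq4[of "cnj (x $ j) * g 0" "H x - cnj (x $ j) * (g x - g 0)"] by linarith
  qed
  have "(\<integral>x. H x * cnj (u x) \<partial>\<sigma>)
      = (\<integral>x. 1 / of_real \<rho> * ((\<integral>t. coord_deriv g \<rho> j (t *\<^sub>R x) \<partial>unit_ivl) * cnj (u x)) \<partial>\<sigma>)"
    by (intro Bochner_Integration.integral_cong refl) (simp only: H_def divide_inverse mult_1_left mult_ac)
  then have H0: "(\<integral>x. H x * cnj (u x) \<partial>\<sigma>) = 0"
    by (simp only: integral_mult_right_zero annihilator_coord_deriv[OF u g R \<rho>_def] mult_zero_right)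
  have "(\<integral>x. cnj (x $ j) * g x * cnj (u x) \<partial>\<sigma>) = (\<integral>x. (cnj (x $ j) * g x - H x) * cnj (u x) \<partial>\<sigma>) + (\<integral>x. H x * cnj (u x) \<partial>\<sigma>)"
    by (subst Bochner_Integration.integral_add[symmetric])
       (auto simp: left_diff_distrib intro!: integrable_mult_cnj[OF uL2] continuous_intros contg contH
         integrable_mult_cnj[OF uL2, of "\<lambda>x. cnj (x $ j) * g x - H x", unfolded left_diff_distrib])
  then have "norm (\<integral>x. cnj (x $ j) * g x * cnj (u x) \<partial>\<sigma>) = norm (\<integral>x. (cnj (x $ j) * g x - H x) * cnj (u x) \<partial>\<sigma>)"
    by (simp add: H0)
  also have "\<dots> \<le> (\<integral>x. norm ((cnj (x $ j) * g x - H x) * cnj (u x)) \<partial>\<sigma>)" by (rule integral_norm_bound)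
  also have "\<dots> \<le> (\<integral>x. K * norm (u x) \<partial>\<sigma>)"
  proof (rule integral_mono)
    show "integrable \<sigma> (\<lambda>x. norm ((cnj (x $ j) * g x - H x) * cnj (u x)))"
      by (intro integrable_norm integrable_mult_cnj[OF uL2] continuous_intros contg contH)
    show "integrable \<sigma> (\<lambda>x. K * norm (u x))" using L2_integrable(1)[OF finite_sigma uL2] by simp
    fix x assume "x \<in> space \<sigma>"
    then show "norm ((cnj (x $ j) * g x - H x) * cnj (u x)) \<le> K * norm (u x)"
      unfolding norm_mult complex_mod_cnj by (intro mult_right_mono pt) (auto simp: space_sigma)
  qed
  finally show ?thesis by (simp add: K_def)
qed

text \<open>Powers of dilates of \<open>cnj \<alpha> * I\<close> tend to \<open>1\<close> in \<open>L\<^sup>2(\<sigma>)\<close> although they tend to \<open>0\<close>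
  locally uniformly in the ball: multiplying by them makes the error of \<open>coord_deriv_approx\<close> vanish.\<close>

lemma coord_orth:
  assumes u: "u \<in> annihilator" and f: "hol_ball R f" and R: "R > 1"
  shows "(\<integral>x. cnj (x $ j) * f x * cnj (u x) \<partial>\<sigma>) = 0"
proof -
  note uL2 = annihilator_L2[OF u]
  define R1 where "R1 = (1 + R) / 2"
  have R1: "1 < R1" "R1 < R" using R by (auto simp: R1_def)
  have contf: "continuous_on (sphere 0 1) f" by (rule hol_ball_continuous_sphere[OF f R])
  have "compact (f ` cball 0 R1)"
    using R1 by (intro compact_continuous_image continuous_on_subset[OF hol_ball_continuous[OF f]]) auto
  then obtain C0 where "\<forall>y\<in>f ` cball 0 R1. norm y \<le> C0" by (meson bounded_iff compact_imp_bounded)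
  then have C0: "norm (f z) \<le> C0" if "norm z \<le> R1" for z using that by simp
  have C00: "0 \<le> C0" using order_trans[OF norm_ge_zero C0[of 0]] R1 by simp
  \<comment> \<open>The power of exponent \<open>n\<close> of a number in the closed disc differs
    from \<open>1\<close> by at most \<open>n\<close> times the difference of its base from
    \<open>1\<close>; the dilation is chosen so close to \<open>1\<close> that even this product is
    small.\<close>
  have "\<exists>k. real n * nrm\<sigma> (\<lambda>x. I ((rad k * rad k) *\<^sub>R x) - \<alpha>) < 1 / real (Suc n)" for n
  proof -
    have "(\<lambda>k. real n * nrm\<sigma> (\<lambda>x. I ((rad k * rad k) *\<^sub>R x) - \<alpha>)) \<longlonglongrightarrow> real n * 0"
      by (intro tendsto_intros dilates_to_alpha)
    then have "\<forall>\<^sub>F k in sequentially. real n * nrm\<sigma> (\<lambda>x. I ((rad k * rad k) *\<^sub>R x) - \<alpha>) < 1 / real (Suc n)"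
      by (rule order_tendstoD) simp
    then show ?thesis using eventually_happens'[OF sequentially_bot] by blast
  qed
  then obtain k where k: "\<And>n. real n * nrm\<sigma> (\<lambda>x. I ((rad (k n) * rad (k n)) *\<^sub>R x) - \<alpha>) < 1 / real (Suc n)" by metis
  define q where "q n = rad (k n) * rad (k n)" for n
  have q: "0 < q n" "q n < 1" for n using mult_strict_mono[of "rad (k n)" 1 "rad (k n)" 1] by (auto simp: q_def)
  define \<phi> where "\<phi> n z = (cnj \<alpha> * I (q n *\<^sub>R z)) ^ n" for n z
  \<comment> \<open>A radius beyond \<open>1\<close> on which \<open>f\<close> is bounded by
    \<open>C0\<close> and the dilate of \<open>I\<close> is defined.\<close>
  define Rn where "Rn n = min R1 (1 / q n)" for n
  have Rn: "Rn n > 1" "Rn n \<le> R1" "Rn n \<le> 1 / q n" for n using R1 q[of n] by (auto simp: Rn_def)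
  have Iq: "norm (I (q n *\<^sub>R z)) < 1" if "z \<in> ball 0 (Rn n)" for n z
  proof (rule I_lt)
    have "q n * norm z < q n * (1 / q n)" using that Rn(3)[of n] q(1)[of n] by (intro mult_strict_left_mono) auto
    then show "norm (q n *\<^sub>R z) < 1" using q[of n] by simp
  qed
  have \<phi>_hol: "hol_ball (Rn n) (\<phi> n)" for n
    unfolding \<phi>_def[abs_def] using q(1)[of n] Rn(3)[of n]
    by (intro hol_ball_power hol_ball_mult hol_ball_const hol_ball_mono[OF hol_ball_dilate[OF I_hol]]) auto
  have \<phi>_le: "norm (\<phi> n z) \<le> 1" if "z \<in> ball 0 (Rn n)" for n z
    using Iq[OF that] alpha by (simp add: \<phi>_def norm_power norm_mult power_le_one less_imp_le)
  have \<phi>_cont: "continuous_on (sphere 0 1) (\<phi> n)" for n by (rule hol_ball_continuous_sphere[OF \<phi>_hol Rn(1)])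
  have \<phi>1: "nrm\<sigma> (\<lambda>x. \<phi> n x - 1) \<le> 1 / real (Suc n)" for n
  proof -
    have contJ: "continuous_on (sphere 0 1) (\<lambda>x. I (q n *\<^sub>R x) - \<alpha>)"
      using continuous_dil[OF I_hol, of "q n"] q[of n] by (intro continuous_intros) (simp add: dil_def[abs_def])
    have "(\<integral>x. (norm (\<phi> n x - 1))\<^sup>2 \<partial>\<sigma>) \<le> (\<integral>x. (real n)\<^sup>2 * (norm (I (q n *\<^sub>R x) - \<alpha>))\<^sup>2 \<partial>\<sigma>)"
    proof (rule integral_mono)
      show "integrable \<sigma> (\<lambda>x. (norm (\<phi> n x - 1))\<^sup>2)" "integrable \<sigma> (\<lambda>x. (real n)\<^sup>2 * (norm (I (q n *\<^sub>R x) - \<alpha>))\<^sup>2)"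
        by (intro integrable_sphere_continuous(2)[OF finite_sigma sets_sigma] continuous_intros \<phi>_cont contJ)+
      fix x assume "x \<in> space \<sigma>"
      then have x: "x \<in> ball 0 (Rn n)" using Rn(1)[of n] by (simp add: space_sigma)
      have "norm ((cnj \<alpha> * I (q n *\<^sub>R x)) ^ n - 1 ^ n) \<le> real n * norm (cnj \<alpha> * I (q n *\<^sub>R x) - 1)"
        using Iq[OF x] alpha by (intro norm_power_diff) (auto simp: norm_mult)
      moreover have "cnj \<alpha> * I (q n *\<^sub>R x) - 1 = - (cnj \<alpha> * (\<alpha> - I (q n *\<^sub>R x)))"
        unfolding factor(1)[symmetric] by simp
      then have "norm (cnj \<alpha> * I (q n *\<^sub>R x) - 1) = norm (I (q n *\<^sub>R x) - \<alpha>)"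
        using alpha by (simp add: norm_mult norm_minus_commute)
      ultimately have "norm ((cnj \<alpha> * I (q n *\<^sub>R x)) ^ n - 1 ^ n) \<le> real n * norm (I (q n *\<^sub>R x) - \<alpha>)" by (simp only:)
      then have "(norm (\<phi> n x - 1))\<^sup>2 \<le> (real n * norm (I (q n *\<^sub>R x) - \<alpha>))\<^sup>2"
        by (intro power_mono) (auto simp: \<phi>_def)
      then show "(norm (\<phi> n x - 1))\<^sup>2 \<le> (real n)\<^sup>2 * (norm (I (q n *\<^sub>R x) - \<alpha>))\<^sup>2" by (simp add: power_mult_distrib)
    qed
    then have "nrm\<sigma> (\<lambda>x. \<phi> n x - 1) \<le> sqrt ((real n)\<^sup>2 * (\<integral>x. (norm (I (q n *\<^sub>R x) - \<alpha>))\<^sup>2 \<partial>\<sigma>))"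
      by (simp add: L2_nrm)
    also have "\<dots> = real n * nrm\<sigma> (\<lambda>x. I (q n *\<^sub>R x) - \<alpha>)" by (simp add: L2_nrm real_sqrt_mult)
    finally show ?thesis using k[of n] by (simp add: q_def)
  qed
  define A where "A n = (\<integral>x. cnj (x $ j) * (f x * \<phi> n x) * cnj (u x) \<partial>\<sigma>)" for n
  define A\<^sub>0 where "A\<^sub>0 = (\<integral>x. cnj (x $ j) * f x * cnj (u x) \<partial>\<sigma>)"
  define U where "U = (\<integral>x. norm (u x) \<partial>\<sigma>)"
  have contxf: "continuous_on (sphere 0 1) (\<lambda>x. cnj (x $ j) * f x)" by (intro continuous_intros contf)
  have A_lim: "A \<longlonglongrightarrow> A\<^sub>0"
  proof -
    have l2: "(\<lambda>x. cnj (x $ j) * (f x * \<phi> n x)) \<in> L2_space \<sigma>" for n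
      by (intro L2_sigma_continuous continuous_intros contf \<phi>_cont)
    have l20: "(\<lambda>x. cnj (x $ j) * f x) \<in> L2_space \<sigma>" by (intro L2_sigma_continuous contxf)
    have "(\<lambda>n. nrm\<sigma> (\<lambda>x. cnj (x $ j) * (f x * \<phi> n x) - cnj (x $ j) * f x)) \<longlonglongrightarrow> 0"
    proof (rule tendsto_sandwich[where f = "\<lambda>_. 0"])
      show "(\<lambda>n. C0 * (1 / real (Suc n))) \<longlonglongrightarrow> 0"
        using tendsto_mult_left[OF LIMSEQ_inverse_real_of_nat, of C0] by (simp add: inverse_eq_divide)
      show "\<forall>\<^sub>F n in sequentially. nrm\<sigma> (\<lambda>x. cnj (x $ j) * (f x * \<phi> n x) - cnj (x $ j) * f x) \<le> C0 * (1 / real (Suc n))"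
      proof (rule always_eventually, rule allI)
        fix n
        have "(\<lambda>x. cnj (x $ j) * (f x * \<phi> n x) - cnj (x $ j) * f x) = (\<lambda>x. (cnj (x $ j) * f x) * (\<phi> n x - 1))"
          by (simp add: algebra_simps)
        moreover have "nrm\<sigma> (\<lambda>x. (cnj (x $ j) * f x) * (\<phi> n x - 1)) \<le> C0 * nrm\<sigma> (\<lambda>x. \<phi> n x - 1)"
        proof (rule L2_mult_continuous(2)[OF finite_sigma sets_sigma _ contxf C00])
          show "(\<lambda>x. \<phi> n x - 1) \<in> L2_space \<sigma>" by (intro L2_sigma_continuous continuous_intros \<phi>_cont)
          fix x :: "complex^'n" assume x: "norm x = 1"
          have "norm (x $ j) * norm (f x) \<le> 1 * C0"
            using Finite_Cartesian_Product.norm_nth_le[where x = x and i = j] x R1 by (intro mult_mono C0) auto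
          then show "norm (cnj (x $ j) * f x) \<le> C0" by (simp add: norm_mult)
        qed
        ultimately show "nrm\<sigma> (\<lambda>x. cnj (x $ j) * (f x * \<phi> n x) - cnj (x $ j) * f x) \<le> C0 * (1 / real (Suc n))"
          using mult_left_mono[OF \<phi>1[of n] C00] by simp
      qed
      show "\<forall>\<^sub>F n in sequentially. 0 \<le> nrm\<sigma> (\<lambda>x. cnj (x $ j) * (f x * \<phi> n x) - cnj (x $ j) * f x)"
        by (simp add: L2_nrm)
    qed simp
    from L2.tendsto_ip_left[OF l2 l20 uL2 this] show ?thesis by (simp add: A_def[abs_def] A\<^sub>0_def L2_inner_def)
  qed
  have bound: "norm A\<^sub>0 \<le> 2 * C0 * sqrt (2 * d) * U" if d: "0 < d" "d < 1" for d
  proof -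
    \<comment> \<open>The maximum of \<open>norm (I z)\<close> over a smaller closed ball is
      attained, hence \<open>c < 1\<close>, and \<open>c ^ n\<close> tends to \<open>0\<close> for
      fixed \<open>d\<close>; only afterwards is \<open>d\<close> sent to \<open>0\<close>.\<close>
    obtain m where m: "m \<in> cball 0 (1 - d / 2)" "\<And>z. z \<in> cball 0 (1 - d / 2) \<Longrightarrow> norm (I z) \<le> norm (I m)"
    proof -
      have "continuous_on (cball 0 (1 - d / 2)) (\<lambda>z. norm (I z))"
        using d by (intro continuous_intros continuous_on_subset[OF hol_ball_continuous[OF I_hol]]) auto
      then show ?thesis
        using continuous_attains_sup[of "cball 0 (1 - d / 2)" "\<lambda>z. norm (I z)"] d that by fastforce
    qed
    define c where "c = norm (I m)"
    have c: "0 \<le> c" "c < 1" using m(1) d by (auto simp: c_def intro!: I_lt)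
    have eta: "norm (f z * \<phi> n z) \<le> C0 * c ^ n" if z: "norm z \<le> 1 - d / 2" for n z
    proof -
      have "q n * norm z \<le> 1 * (1 - d / 2)" using q[of n] z d by (intro mult_mono) auto
      then have "norm (I (q n *\<^sub>R z)) \<le> c" unfolding c_def using q[of n] by (intro m(2)) simp
      then have "norm (\<phi> n z) \<le> c ^ n" using alpha by (simp add: \<phi>_def norm_power norm_mult power_mono)
      then show ?thesis unfolding norm_mult using z d R1 C00 by (intro mult_mono C0) auto
    qed
    have "norm (A n) \<le> (2 * (C0 * c ^ n) / d + 2 * C0 * sqrt (2 * d) + C0 * c ^ n) * U" for n
      unfolding A_def U_def
    proof (rule coord_orth_estimate[OF u _ Rn(1)[of n] d])
      show "hol_ball (Rn n) (\<lambda>x. f x * \<phi> n x)"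
        using Rn(2)[of n] R1 by (intro hol_ball_mult \<phi>_hol hol_ball_mono[OF f]) auto
      fix z :: "complex^'n" assume z: "z \<in> ball 0 (Rn n)"
      have "norm (f z) * norm (\<phi> n z) \<le> C0 * 1" using z Rn(2)[of n] C00 by (intro mult_mono C0 \<phi>_le) auto
      then show "norm (f z * \<phi> n z) \<le> C0" by (simp add: norm_mult)
    qed (rule eta)
    moreover have "(\<lambda>n. (2 * (C0 * c ^ n) / d + 2 * C0 * sqrt (2 * d) + C0 * c ^ n) * U) \<longlonglongrightarrow> (2 * (C0 * 0) / d + 2 * C0 * sqrt (2 * d) + C0 * 0) * U"
      using c d by (intro tendsto_intros LIMSEQ_power_zero) auto
    ultimately have "norm A\<^sub>0 \<le> (2 * (C0 * 0) / d + 2 * C0 * sqrt (2 * d) + C0 * 0) * U"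
      by (intro LIMSEQ_le[OF tendsto_norm[OF A_lim]]) auto
    then show ?thesis by simp
  qed
  have "norm A\<^sub>0 \<le> 0"
  proof (rule LIMSEQ_le_const)
    \<comment> \<open>The offset in \<open>Suc (n + 1)\<close> keeps \<open>d\<close> strictly below
      \<open>1\<close>.\<close>
    have "(\<lambda>n. 2 * C0 * sqrt (2 * inverse (real (Suc (n + 1)))) * U) \<longlonglongrightarrow> 2 * C0 * sqrt (2 * 0) * U"
      by (intro tendsto_intros LIMSEQ_ignore_initial_segment[OF LIMSEQ_inverse_real_of_nat, of 1])
    then show "(\<lambda>n. 2 * C0 * sqrt (2 * inverse (real (Suc (n + 1)))) * U) \<longlonglongrightarrow> 0" by simp
    show "\<exists>N. \<forall>n\<ge>N. norm A\<^sub>0 \<le> 2 * C0 * sqrt (2 * inverse (real (Suc (n + 1)))) * U"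
      by (intro exI[of _ 0] allI impI bound) (auto simp: field_simps)
  qed
  then show ?thesis by (simp add: A\<^sub>0_def)
qed

section \<open>From coordinate multipliers to continuous functions and Borel sets\<close>

lemma annihilator_coord:
  assumes u: "u \<in> annihilator"
  shows "(\<lambda>x. x $ j * u x) \<in> annihilator"
proof -
  have "(\<integral>x. f x * cnj (x $ j * u x) \<partial>\<sigma>) = 0" if R: "R > 1" and f: "hol_ball R f" for R f
    using coord_orth[OF u f R, of j] by (simp add: mult_ac)
  moreover have "(\<lambda>x. x $ j * u x) \<in> L2_space \<sigma>"
    by (intro L2_mult_continuous(1)[OF finite_sigma sets_sigma annihilator_L2[OF u]] continuous_intros)
  ultimately show ?thesis by (simp add: annihilator_def)
qed

lemma annihilator_zero: "(\<lambda>x. 0) \<in> annihilator"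
  by (simp add: annihilator_def L2_space_def)

lemma annihilator_sum:
  assumes "finite J" "\<And>j. j \<in> J \<Longrightarrow> (\<lambda>x. g j x) \<in> annihilator"
  shows "(\<lambda>x. \<Sum>j\<in>J. g j x) \<in> annihilator"
  using assms
proof (induction J rule: finite_induct)
  case (insert j J)
  then show ?case using annihilator_comb[of "g j" "\<lambda>x. \<Sum>j\<in>J. g j x" 1 1] by simp
qed (simp add: annihilator_zero)

text \<open>A real linear functional is a complex combination of the coordinates and their
  conjugates, and multiplication by either kind preserves the annihilator; products of polynomials
  compose two multiplications.\<close>

lemma annihilator_polynomial:
  assumes "real_polynomial_function p" "u \<in> annihilator"
  shows "(\<lambda>x. of_real (p x) * u x) \<in> annihilator"
  using assms
proof (induction arbitrary: u rule: real_polynomial_function.induct)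
  case (linear p)
  interpret p: bounded_linear p by fact
  \<comment> \<open>\<open>axis j 1\<close> and \<open>axis j \<i>\<close> are the real basis
    vectors that belong to the complex coordinate \<open>j\<close>.\<close>
  have rep: "x = (\<Sum>j\<in>UNIV. Re (x $ j) *\<^sub>R axis j 1 + Im (x $ j) *\<^sub>R axis j \<i>)" for x :: "complex^'n"
    by (simp add: vec_eq_iff sum_component axis_component if_distrib complex_eq_iff cong: if_cong)
  have px: "of_real (p x) * u x = (\<Sum>j\<in>UNIV. (of_real (p (axis j 1)) / 2 + of_real (p (axis j \<i>)) / (2 * \<i>)) * (x $ j * u x)
      + (of_real (p (axis j 1)) / 2 - of_real (p (axis j \<i>)) / (2 * \<i>)) * (cnj (x $ j) * u x))" for x
  proof -
    have px: "p x = (\<Sum>j\<in>UNIV. Re (x $ j) * p (axis j 1) + Im (x $ j) * p (axis j \<i>))"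
      by (subst rep[of x]) (simp add: p.sum p.add p.scaleR)
    have "of_real (p x) * u x = (\<Sum>j\<in>UNIV. (of_real (Re (x $ j)) * of_real (p (axis j 1)) + of_real (Im (x $ j)) * of_real (p (axis j \<i>))) * u x)"
      by (simp only: px of_real_sum of_real_add of_real_mult sum_distrib_right)
    also have "\<dots> = (\<Sum>j\<in>UNIV. (of_real (p (axis j 1)) / 2 + of_real (p (axis j \<i>)) / (2 * \<i>)) * (x $ j * u x)
      + (of_real (p (axis j 1)) / 2 - of_real (p (axis j \<i>)) / (2 * \<i>)) * (cnj (x $ j) * u x))"
    proof (rule sum.cong)
      fix j
      have "(of_real (Re c) * a + of_real (Im c) * b) * y = (a / 2 + b / (2 * \<i>)) * (c * y) + (a / 2 - b / (2 * \<i>)) * (cnj c * y)" for a b c y :: complex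
      proof -
        have 1: "c + cnj c = 2 * of_real (Re c)" and 2: "c - cnj c = 2 * \<i> * of_real (Im c)"
          by (simp_all add: complex_eq_iff)
        have "(a / 2 + b / (2 * \<i>)) * (c * y) + (a / 2 - b / (2 * \<i>)) * (cnj c * y) = (a / 2 * (c + cnj c) + b / (2 * \<i>) * (c - cnj c)) * y"
          by (simp only: ring_distribs mult_ac add_ac diff_conv_add_uminus mult_minus_left mult_minus_right)
        also have "\<dots> = (of_real (Re c) * a + of_real (Im c) * b) * y"
          unfolding 1 2 by (simp add: mult.left_commute[of b \<i>] mult.commute[of "of_real (Im c)" b])
        finally show ?thesis by simp
      qed
      then show "(of_real (Re (x $ j)) * of_real (p (axis j 1)) + of_real (Im (x $ j)) * of_real (p (axis j \<i>))) * u x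
         = (of_real (p (axis j 1)) / 2 + of_real (p (axis j \<i>)) / (2 * \<i>)) * (x $ j * u x)
      + (of_real (p (axis j 1)) / 2 - of_real (p (axis j \<i>)) / (2 * \<i>)) * (cnj (x $ j) * u x)" .
    qed simp
    finally show ?thesis .
  qed
  show ?case unfolding px
    by (intro annihilator_sum annihilator_comb annihilator_coord annihilator_cnj_coord linear.prems) simp
next
  case (const c)
  then show ?case using annihilator_comb[of u u "of_real c" 0] by simp
next
  case (add p q)
  then show ?case using annihilator_comb[of "\<lambda>x. of_real (p x) * u x" "\<lambda>x. of_real (q x) * u x" 1 1] by (simp add: distrib_right)
next
  case (mult p q)
  then show ?case using mult.IH(1)[OF mult.IH(2)[OF mult.prems]] by (simp add: mult.assoc)
qed

lemma annihilator_continuous: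
  fixes \<phi> :: "complex^'n \<Rightarrow> real"
  assumes u: "u \<in> annihilator" and \<phi>: "continuous_on (sphere 0 1) \<phi>"
  shows "(\<integral>x. of_real (\<phi> x) * cnj (u x) \<partial>\<sigma>) = 0"
proof -
  note uL2 = annihilator_L2[OF u]
  define U where "U = (\<integral>x. norm (u x) \<partial>\<sigma>)"
  have U: "0 \<le> U" by (simp add: U_def)
  have "norm (\<integral>x. of_real (\<phi> x) * cnj (u x) \<partial>\<sigma>) \<le> 0 + e" if e: "e > 0" for e
  proof -
    \<comment> \<open>The uniform error is multiplied by the L1 norm \<open>U\<close> of
      \<open>u\<close>, which may be \<open>0\<close>; hence \<open>U + 1\<close>.\<close>
    define e' where "e' = e / (U + 1)"
    have e': "e' > 0" using e U by (simp add: e'_def)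
    obtain p where p: "real_polynomial_function p" "\<And>x. x \<in> sphere 0 1 \<Longrightarrow> \<bar>\<phi> x - p x\<bar> < e'"
      using Stone_Weierstrass_real_polynomial_function[OF compact_sphere \<phi> e'] by blast
    have contp: "continuous_on (sphere 0 1) p"
      using p(1) by (simp add: continuous_on_polymonial_function real_polynomial_function_eq)
    have p0: "(\<integral>x. of_real (p x) * cnj (u x) \<partial>\<sigma>) = 0"
      using annihilatorD[OF annihilator_polynomial[OF p(1) u] hol_ball_const[of 2 1]] by simp
    have i1: "integrable \<sigma> (\<lambda>x. of_real (\<phi> x) * cnj (u x))" and i2: "integrable \<sigma> (\<lambda>x. of_real (p x) * cnj (u x))"
      by (intro integrable_mult_cnj[OF uL2] continuous_intros \<phi> contp)+
    have diff: "(\<integral>x. of_real (\<phi> x) * cnj (u x) \<partial>\<sigma>) = (\<integral>x. of_real (\<phi> x) * cnj (u x) - of_real (p x) * cnj (u x) \<partial>\<sigma>)"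
      using i1 i2 p0 by simp
    have "norm (\<integral>x. of_real (\<phi> x) * cnj (u x) \<partial>\<sigma>) \<le> (\<integral>x. norm (of_real (\<phi> x) * cnj (u x) - of_real (p x) * cnj (u x)) \<partial>\<sigma>)"
      unfolding diff by (rule integral_norm_bound)
    also have "\<dots> \<le> (\<integral>x. e' * norm (u x) \<partial>\<sigma>)"
    proof (rule integral_mono)
      show "integrable \<sigma> (\<lambda>x. norm (of_real (\<phi> x) * cnj (u x) - of_real (p x) * cnj (u x)))" using i1 i2 by simp
      show "integrable \<sigma> (\<lambda>x. e' * norm (u x))" using L2_integrable(1)[OF finite_sigma uL2] by simp
      fix x assume "x \<in> space \<sigma>"
      then have "\<bar>\<phi> x - p x\<bar> \<le> e'" using p(2)[of x] by (simp add: space_sigma)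
      then have "norm (of_real (\<phi> x - p x) * cnj (u x)) \<le> e' * norm (u x)"
        unfolding norm_mult complex_mod_cnj norm_of_real by (rule mult_right_mono) simp
      then show "norm (of_real (\<phi> x) * cnj (u x) - of_real (p x) * cnj (u x)) \<le> e' * norm (u x)"
        by (simp add: left_diff_distrib)
    qed
    also have "\<dots> = e' * U" by (simp add: U_def)
    also have "\<dots> \<le> e" using e U by (simp add: e'_def field_simps)
    finally show ?thesis by simp
  qed
  then have "norm (\<integral>x. of_real (\<phi> x) * cnj (u x) \<partial>\<sigma>) \<le> 0" by (rule field_le_epsilon)
  then show ?thesis by simp
qed

text \<open>Continuous functions decreasing to the indicator of a closed set carry the vanishing to
  closed sets, a Dynkin argument carries it to Borel sets, and a function with zero integral over
  all measurable sets is zero almost everywhere.\<close>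

theorem annihilator_trivial:
  assumes u: "u \<in> annihilator"
  shows "AE x in \<sigma>. u x = 0"
proof -
  note uL2 = annihilator_L2[OF u]
  have int: "integrable \<sigma> (\<lambda>x. cnj (u x))" by (rule integrable_cnj_L2[OF uL2])
  have ind [measurable]: "A \<inter> sphere 0 1 \<in> sets \<sigma>" if "A \<in> sets borel" for A
    using that by (auto simp: sets_sigma sets_restrict_space)
  have closed: "(\<integral>x. indicator A x *\<^sub>R cnj (u x) \<partial>\<sigma>) = 0" if A: "closed A" for A
  \<comment> \<open>\<open>infdist x {}\<close> is \<open>0\<close>, so for the empty set the
    approximating functions would be constantly \<open>1\<close>.\<close>
  proof (cases "A = {}")
    case False
    define \<phi> where "\<phi> n x = max 0 (1 - real n * infdist x A)" for n x
    have "(\<lambda>n. \<integral>x. of_real (\<phi> n x) * cnj (u x) \<partial>\<sigma>) \<longlonglongrightarrow> (\<integral>x. indicator A x *\<^sub>R cnj (u x) \<partial>\<sigma>)"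
    proof (rule integral_dominated_convergence[where w = "\<lambda>x. norm (u x)"])
      show "(\<lambda>x. indicator A x *\<^sub>R cnj (u x)) \<in> borel_measurable \<sigma>"
      proof -
        have "(\<lambda>x. indicator (A \<inter> sphere 0 1) x *\<^sub>R cnj (u x)) \<in> borel_measurable \<sigma>"
          using int ind[OF borel_closed[OF A]] by measurable
        then show ?thesis by (rule measurable_cong[THEN iffD1, rotated]) (simp add: space_sigma indicator_def)
      qed
      show "(\<lambda>x. of_real (\<phi> n x) * cnj (u x)) \<in> borel_measurable \<sigma>" for n
        unfolding \<phi>_def by (intro borel_measurable_integrable integrable_mult_cnj[OF uL2] continuous_intros)
      show "integrable \<sigma> (\<lambda>x. norm (u x))" using L2_integrable(1)[OF finite_sigma uL2] by simp
      show "AE x in \<sigma>. (\<lambda>n. of_real (\<phi> n x) * cnj (u x)) \<longlonglongrightarrow> indicator A x *\<^sub>R cnj (u x)"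
      proof (rule AE_I2)
        fix x
        show "(\<lambda>n. of_real (\<phi> n x) * cnj (u x)) \<longlonglongrightarrow> indicator A x *\<^sub>R cnj (u x)"
        proof (cases "x \<in> A")
          case True
          then show ?thesis by (simp add: \<phi>_def)
        next
          case notA: False
          then have "infdist x A \<noteq> 0" using in_closed_iff_infdist_zero[OF A False] by simp
          then have pos: "infdist x A > 0" using infdist_nonneg[of x A] by linarith
          obtain N where N: "1 / infdist x A < real N" using reals_Archimedean2 by blast
          have "\<phi> n x = 0" if "n \<ge> N" for n
          proof -
            have "1 / infdist x A \<le> real n" using N that by simp
            then have "1 \<le> real n * infdist x A" using pos by (simp add: field_simps)
            then show ?thesis by (simp add: \<phi>_def)
          qed
          then have "\<forall>\<^sub>F n in sequentially. of_real (\<phi> n x) * cnj (u x) = 0"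
            by (intro eventually_sequentiallyI[of N]) simp
          then have "(\<lambda>n. of_real (\<phi> n x) * cnj (u x)) \<longlonglongrightarrow> 0" by (rule tendsto_eventually)
          then show ?thesis using notA by simp
        qed
      qed
      show "AE x in \<sigma>. norm (of_real (\<phi> n x) * cnj (u x)) \<le> norm (u x)" for n
      proof (rule AE_I2)
        fix x
        have "\<bar>\<phi> n x\<bar> \<le> 1" using infdist_nonneg[of x A] by (simp add: \<phi>_def)
        then show "norm (of_real (\<phi> n x) * cnj (u x)) \<le> norm (u x)" by (simp add: norm_mult mult_left_le_one_le)
      qed
    qed
    moreover have "(\<integral>x. of_real (\<phi> n x) * cnj (u x) \<partial>\<sigma>) = 0" for n
      unfolding \<phi>_def by (intro annihilator_continuous[OF u] continuous_intros)
    ultimately show ?thesis by (simp only: LIMSEQ_const_iff)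
  next
    case True
    then have "(\<lambda>x. indicator A x *\<^sub>R cnj (u x)) = (\<lambda>x. 0)" by (auto simp: fun_eq_iff)
    then show ?thesis by (simp only: Bochner_Integration.integral_zero)
  qed
  have int_ind: "integrable \<sigma> (\<lambda>x. indicator A x *\<^sub>R cnj (u x))" if A: "A \<in> sets borel" for A
  proof -
    have "integrable \<sigma> (\<lambda>x. indicator (A \<inter> sphere 0 1) x *\<^sub>R cnj (u x))"
      using int by (intro integrable_mult_indicator ind A)
    then show ?thesis
      by (rule Bochner_Integration.integrable_cong[THEN iffD1, rotated 2]) (simp_all add: space_sigma indicator_def)
  qed
  have borel: "(\<integral>x. indicator A x *\<^sub>R cnj (u x) \<partial>\<sigma>) = 0" if "A \<in> sets borel" for A
  proof -
    have "Int_stable (Collect closed :: (complex^'n) set set)" by (auto simp: Int_stable_def)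
    moreover have "Collect closed \<subseteq> Pow (UNIV :: (complex^'n) set)" by simp
    moreover have "A \<in> sigma_sets UNIV (Collect closed)" using that by (simp add: borel_eq_closed)
    ultimately show ?thesis
    proof (induction rule: sigma_sets_induct_disjoint)
      case (basic A) then show ?case by (intro closed) simp
    next
      case empty show ?case by simp
    next
      case (compl A)
      have A: "A \<in> sets borel" using compl.hyps by (simp add: borel_eq_closed)
      have "(\<lambda>x. indicator (UNIV - A) x *\<^sub>R cnj (u x)) = (\<lambda>x. indicator UNIV x *\<^sub>R cnj (u x) - indicator A x *\<^sub>R cnj (u x))"
        by (auto simp: indicator_def)
      then show ?case
        using compl.IH closed[of UNIV] int_ind[OF A] int_ind[of UNIV] by simp
    next
      case (union A)
      have A: "A i \<in> sets borel" for i using union.hyps(2) by (auto simp: borel_eq_closed)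
      have "(\<lambda>n. \<integral>x. indicator (\<Union>i<n. A i) x *\<^sub>R cnj (u x) \<partial>\<sigma>) \<longlonglongrightarrow> (\<integral>x. indicator (\<Union>i. A i) x *\<^sub>R cnj (u x) \<partial>\<sigma>)"
      proof (rule integral_dominated_convergence[where w = "\<lambda>x. norm (u x)"])
        show "(\<lambda>x. indicator (\<Union>i. A i) x *\<^sub>R cnj (u x)) \<in> borel_measurable \<sigma>" "(\<lambda>x. indicator (\<Union>i<n. A i) x *\<^sub>R cnj (u x)) \<in> borel_measurable \<sigma>" for n
          using A by (intro borel_measurable_integrable int_ind; auto)+
        show "integrable \<sigma> (\<lambda>x. norm (u x))" using L2_integrable(1)[OF finite_sigma uL2] by simp
        show "AE x in \<sigma>. (\<lambda>n. indicator (\<Union>i<n. A i) x *\<^sub>R cnj (u x)) \<longlonglongrightarrow> indicator (\<Union>i. A i) x *\<^sub>R cnj (u x)"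
          by (intro AE_I2 tendsto_intros LIMSEQ_indicator_UN)
      qed (auto simp: indicator_def)
      moreover have "(\<integral>x. indicator (\<Union>i<n. A i) x *\<^sub>R cnj (u x) \<partial>\<sigma>) = 0" for n
      proof -
        have eq: "(\<lambda>x. indicator (\<Union>i<n. A i) x *\<^sub>R cnj (u x)) = (\<lambda>x. \<Sum>i<n. indicator (A i) x *\<^sub>R cnj (u x))"
        proof
          fix x
          show "indicator (\<Union>i<n. A i) x *\<^sub>R cnj (u x) = (\<Sum>i<n. indicator (A i) x *\<^sub>R cnj (u x))"
            using union.hyps(1) by (subst indicator_UN_disjoint) (auto simp: disjoint_family_on_def scaleR_sum_left)
        qed
        have "(\<integral>x. (\<Sum>i<n. indicator (A i) x *\<^sub>R cnj (u x)) \<partial>\<sigma>) = (\<Sum>i<n. \<integral>x. indicator (A i) x *\<^sub>R cnj (u x) \<partial>\<sigma>)"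
          by (rule Bochner_Integration.integral_sum) (rule int_ind[OF A])
        then show ?thesis unfolding eq by (simp only: union.IH sum.neutral_const)
      qed
      ultimately show ?case by (simp only: LIMSEQ_const_iff)
    qed
  qed
  have "AE x in \<sigma>. cnj (u x) = 0"
  proof (rule density_unique_banach)
    fix A assume "A \<in> sets \<sigma>"
    then have "A \<in> sets borel" by (auto simp: sets_sigma sets_restrict_space)
    then show "set_lebesgue_integral \<sigma> A (\<lambda>x. cnj (u x)) = set_lebesgue_integral \<sigma> A (\<lambda>x. 0)"
      using borel by (simp add: set_lebesgue_integral_def)
  qed (use int in auto)
  then show ?thesis by simp
qed

end

section \<open>The unitary operator\<close>

text \<open>The two convergence predicates agree for every candidate limit, so \<open>Lim\<close>
  gives the same value even where no limit exists.\<close>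

lemma radial_limit_cong:
  fixes f g :: "complex^'n \<Rightarrow> complex"
  assumes eq: "\<And>z. z \<in> ball 0 1 \<Longrightarrow> f z = g z" and z: "norm z = 1"
  shows "radial_limit f z = radial_limit g z"
proof -
  have "\<forall>\<^sub>F r in at_left 1. f (r *\<^sub>R z) = g (r *\<^sub>R z)"
    using z by (subst eventually_at_left[of 0]) (auto intro!: exI[of _ 0] eq)
  then have "((\<lambda>r. f (r *\<^sub>R z)) \<longlongrightarrow> l) (at_left 1) \<longleftrightarrow> ((\<lambda>r. g (r *\<^sub>R z)) \<longlongrightarrow> l) (at_left 1)" for l
    by (rule tendsto_cong)
  then show ?thesis by (simp add: radial_limit_def t2_space_class.Lim_def)
qed

lemma hardy_inner_cong:
  fixes f f' g g' :: "complex^'n \<Rightarrow> complex"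
  assumes "\<And>z. z \<in> ball 0 1 \<Longrightarrow> f z = f' z" "\<And>z. z \<in> ball 0 1 \<Longrightarrow> g z = g' z"
  shows "hardy_inner f g = hardy_inner f' g'"
proof -
  have "radial_limit f x = radial_limit f' x" "radial_limit g x = radial_limit g' x" if "norm x = 1" for x
    using that by (auto intro: radial_limit_cong assms)
  then show ?thesis
    unfolding hardy_inner_def L2_inner_def by (intro Bochner_Integration.integral_cong refl) simp
qed

lemma hol_ball_cong:
  fixes f g :: "complex^'n \<Rightarrow> complex"
  assumes f: "hol_ball R f" and eq: "\<And>z. z \<in> ball 0 R \<Longrightarrow> f z = g z"
  shows "hol_ball R g"
  unfolding hol_ball_def
proof
  fix z :: "complex^'n" assume z: "z \<in> ball 0 R"
  then obtain L where L: "(f has_derivative L) (at z)" "\<forall>c v. L (c *s v) = c * L v"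
    using f unfolding hol_ball_def by blast
  have "(g has_derivative L) (at z)"
    by (rule has_derivative_transform_within_open[OF L(1) open_ball z eq])
  with L(2) show "\<exists>L. (g has_derivative L) (at z) \<and> (\<forall>c v. L (c *s v) = c * L v)" by blast
qed

lemma hardy_space_cong:
  fixes f g :: "complex^'n \<Rightarrow> complex"
  assumes f: "f \<in> hardy_space" and eq: "\<And>z. z \<in> ball 0 1 \<Longrightarrow> f z = g z"
  shows "g \<in> hardy_space"
  by (rule hardy_dominated[OF hol_ball_cong[OF hardy_hol[OF f] eq] f]) (auto simp: eq)

lemma model_space_cong:
  fixes f g :: "complex^'n \<Rightarrow> complex"
  assumes f: "f \<in> model_space I" and eq: "\<And>z. z \<in> ball 0 1 \<Longrightarrow> f z = g z"
  shows "g \<in> model_space I"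
proof -
  have "hardy_inner g (\<lambda>z. I z * h z) = 0" if "h \<in> hardy_space" for h
    using f that hardy_inner_cong[of g f "\<lambda>z. I z * h z" "\<lambda>z. I z * h z"] eq by (simp add: model_space_def)
  then show ?thesis using hardy_space_cong[OF model_space_hardy[OF f] eq] by (simp add: model_space_def)
qed

text \<open>The linear span in inductive form, so that identities for kernels extend to it by rule
  induction.\<close>

inductive_set kernel_span :: "(complex^'n \<Rightarrow> complex) set" where
  kernel: "norm w < 1 \<Longrightarrow> (\<lambda>x. cauchy_kernel x w) \<in> kernel_span"
| comb: "f \<in> kernel_span \<Longrightarrow> g \<in> kernel_span \<Longrightarrow> (\<lambda>x. a * f x + b * g x) \<in> kernel_span"

lemma L2_nrm_eq_0:
  assumes u: "u \<in> L2_space M"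
  shows "L2.nrm M u = 0 \<longleftrightarrow> (AE x in M. u x = 0)"
proof -
  have "integrable M (\<lambda>x. (norm (u x))\<^sup>2)" using u by (simp add: L2_space_def)
  from integral_nonneg_eq_0_iff_AE[OF this] show ?thesis by (simp add: L2_nrm)
qed

section \<open>The isometry \<open>W\<close> onto the model space and its inverse\<close>

context clark_setting
begin

lemma L2_kernel: "norm w < 1 \<Longrightarrow> (\<lambda>x. cauchy_kernel x w) \<in> L2_space \<sigma>"
  by (intro L2_sigma_continuous continuous_on_cauchy_kernel continuous_intros) auto

lemma kernel_span_L2: "d \<in> kernel_span \<Longrightarrow> d \<in> L2_space \<sigma>"
  by (induction rule: kernel_span.induct) (auto intro: L2_kernel L2.comb_closed)

lemma orthogonal_to_kernels:
  assumes u: "u \<in> L2_space \<sigma>" and orth: "\<And>w. norm w < 1 \<Longrightarrow> L2_inner \<sigma> u (\<lambda>x. cauchy_kernel x w) = 0"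
  shows "AE x in \<sigma>. u x = 0"
proof (rule annihilator_trivial, rule annihilator_kernels[OF u])
  fix w :: "complex^'n" assume w: "norm w < 1"
  show "L2_inner \<sigma> (\<lambda>x. cauchy_kernel x w) u = 0"
    using L2.ip_cnj[OF u L2_kernel[OF w]] orth[OF w] by simp
qed

text \<open>The minimizing sequence of \<open>projection\<close> converges to some \<open>y\<close>;
  since \<open>h - y\<close> is orthogonal to every kernel, it vanishes almost everywhere, and the
  same sequence converges to \<open>h\<close>.\<close>

lemma kernel_span_dense:
  assumes h: "h \<in> L2_space \<sigma>"
  obtains d where "\<And>n. d n \<in> kernel_span" "(\<lambda>n. nrm\<sigma> (\<lambda>x. d n x - h x)) \<longlonglongrightarrow> 0"
proof -
  have "(\<lambda>x. cauchy_kernel x 0) \<in> (kernel_span :: (complex^'n \<Rightarrow> complex) set)" by (rule kernel_span.kernel) simp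
  then have ne: "(kernel_span :: (complex^'n \<Rightarrow> complex) set) \<noteq> {}" by blast
  obtain y d where yd: "y \<in> L2_space \<sigma>" "\<And>n. d n \<in> kernel_span" "(\<lambda>n. nrm\<sigma> (\<lambda>x. d n x - y x)) \<longlonglongrightarrow> 0"
    "\<And>g. g \<in> kernel_span \<Longrightarrow> L2_inner \<sigma> (\<lambda>x. h x - y x) g = 0"
  proof (rule L2.projection[where M = \<sigma> and D = kernel_span and Y = "L2_space \<sigma>" and h = h])
    fix d :: "nat \<Rightarrow> complex^'n \<Rightarrow> complex"
    assume "\<And>n. d n \<in> kernel_span" "\<And>e. e > 0 \<Longrightarrow> \<exists>N. \<forall>m\<ge>N. \<forall>n\<ge>N. nrm\<sigma> (\<lambda>x. d m x - d n x) < e"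
    then show "\<exists>y\<in>L2_space \<sigma>. (\<lambda>n. nrm\<sigma> (\<lambda>x. d n x - y x)) \<longlonglongrightarrow> 0"
      by (intro L2_complete[OF finite_sigma] kernel_span_L2)
  qed (use ne h in \<open>auto intro: kernel_span.comb kernel_span_L2\<close>)
  have hy: "(\<lambda>x. h x - y x) \<in> L2_space \<sigma>" by (rule L2.diff_closed[OF h yd(1)])
  have "AE x in \<sigma>. h x - y x = 0"
    by (rule orthogonal_to_kernels[OF hy]) (intro yd(4) kernel_span.kernel)
  then have "nrm\<sigma> (\<lambda>x. h x - y x) = 0" by (simp add: L2_nrm_eq_0[OF hy])
  then have yh: "nrm\<sigma> (\<lambda>x. y x - h x) = 0" using L2.nrm_diff_commute[OF h yd(1)] by simp
  have "(\<lambda>n. nrm\<sigma> (\<lambda>x. d n x - h x)) \<longlonglongrightarrow> 0"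
  proof (rule tendsto_sandwich[where f = "\<lambda>_. 0"])
    show "\<forall>\<^sub>F n in sequentially. nrm\<sigma> (\<lambda>x. d n x - h x) \<le> nrm\<sigma> (\<lambda>x. d n x - y x)"
      using L2.nrm_triangle_diff[OF kernel_span_L2[OF yd(2)] yd(1) h] yh by simp
  qed (use yd(3) in \<open>auto simp: L2_nrm\<close>)
  with yd(2) show ?thesis using that by blast
qed

text \<open>The inverse of the operator of the theorem; it is set to \<open>0\<close> off the ball, which makes it
  linear as a map on functions.\<close>

definition W :: "(complex^'n \<Rightarrow> complex) \<Rightarrow> complex^'n \<Rightarrow> complex" where
  "W h z = (if norm z < 1 then (1 - cnj \<alpha> * I z) * L2_inner \<sigma> h (\<lambda>x. cauchy_kernel x z) else 0)"

lemma W_comb: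
  assumes "h \<in> L2_space \<sigma>" "g \<in> L2_space \<sigma>"
  shows "W (\<lambda>x. a * h x + b * g x) = (\<lambda>z. a * W h z + b * W g z)"
  by (rule ext) (simp add: W_def L2.ip_comb[OF assms L2_kernel] algebra_simps)

lemma W_diff:
  assumes "h \<in> L2_space \<sigma>" "g \<in> L2_space \<sigma>"
  shows "W (\<lambda>x. h x - g x) = (\<lambda>z. W h z - W g z)"
  using W_comb[OF assms, of 1 "-1"] by simp

lemma W_hol:
  assumes h: "h \<in> L2_space \<sigma>"
  shows "hol_ball 1 (W h)"
proof (rule hol_ball_cong)
  show "hol_ball 1 (\<lambda>z. (1 - cnj \<alpha> * I z) * (\<integral>x. h x * cauchy_kernel z x \<partial>\<sigma>))"
    by (intro hol_ball_mult hol_ball_diff hol_ball_const I_hol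
        hol_ball_cauchy_transform[OF finite_sigma sets_sigma L2_integrable(1)[OF finite_sigma h]])
qed (simp add: W_def L2_inner_def)

lemma W_kernel:
  assumes w: "norm w < 1" and z: "norm z < 1"
  shows "W (\<lambda>x. cauchy_kernel x w) z = 1 / (1 - \<alpha> * cnj (I w)) * model_kernel I w z"
proof -
  have "L2_inner \<sigma> (\<lambda>x. cauchy_kernel x w) (\<lambda>x. cauchy_kernel x z) = kernel z w"
    unfolding L2_inner_def using clark_kernel[OF z w] by (simp add: mult.commute)
  then show ?thesis
    using z nonzero(2)[OF z] by (simp add: W_def kernel_def model_kernel_def)
qed

lemma model_scaled_kernel:
  assumes w: "norm w < 1"
  shows "(\<lambda>z. c * model_kernel I w z) \<in> model_space I"
  using model_space_comb[OF inner model_kernel_in_model_space[OF inner w] model_kernel_in_model_space[OF inner w], of c 0] by simp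

lemma W_kernel_model:
  assumes w: "norm w < 1"
  shows "W (\<lambda>x. cauchy_kernel x w) \<in> model_space I"
  by (rule model_space_cong[OF model_scaled_kernel[OF w, of "1 / (1 - \<alpha> * cnj (I w))"]]) (simp add: W_kernel[OF w])

lemma W_span_model: "d \<in> kernel_span \<Longrightarrow> W d \<in> model_space I"
proof (induction rule: kernel_span.induct)
  case (comb f g a b)
  then show ?case
    unfolding W_comb[OF kernel_span_L2[OF comb.hyps(1)] kernel_span_L2[OF comb.hyps(2)]]
    by (intro model_space_comb inner)
qed (rule W_kernel_model)

text \<open>\<open>W\<close> maps a Cauchy kernel to a multiple of the reproducing kernel, so
  pairing with its image is a multiple of evaluation at \<open>w\<close>.\<close>

lemma inner_W_kernel:
  assumes f: "f \<in> model_space I" and w: "norm w < 1"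
  shows "hardy_inner f (W (\<lambda>x. cauchy_kernel x w)) = f w / (1 - cnj \<alpha> * I w)"
proof -
  have "hardy_inner f (W (\<lambda>x. cauchy_kernel x w)) = hardy_inner f (\<lambda>z. 1 / (1 - \<alpha> * cnj (I w)) * model_kernel I w z)"
    by (rule hardy_inner_cong) (simp_all add: W_kernel[OF w])
  also have "\<dots> = cnj (1 / (1 - \<alpha> * cnj (I w))) * f w"
    by (simp only: H2.ip_scale_right[OF model_space_hardy[OF model_kernel_in_model_space[OF inner w]] model_space_hardy[OF f]]
        model_reproducing[OF inner w f])
  finally show ?thesis by simp
qed

text \<open>For a single kernel both sides are evaluations: on the left by the reproducing property,
  on the right by the definition of \<open>W\<close>. Membership of \<open>W h\<close> in the model
  space is an assumption because it is obtained for general \<open>h\<close> only through the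
  isometry on the span.\<close>

lemma W_inner_span:
  assumes "d \<in> kernel_span" and h: "h \<in> L2_space \<sigma>" and Wh: "W h \<in> model_space I"
  shows "hardy_inner (W h) (W d) = L2_inner \<sigma> h d"
  using assms(1)
proof (induction rule: kernel_span.induct)
  case (kernel w)
  then show ?case
    using nonzero(2)[OF kernel] by (simp add: inner_W_kernel[OF Wh kernel]) (simp add: W_def)
next
  case (comb f g a b)
  note fL = kernel_span_L2[OF comb.hyps(1)] and gL = kernel_span_L2[OF comb.hyps(2)]
  note fH = model_space_hardy[OF W_span_model[OF comb.hyps(1)]] and gH = model_space_hardy[OF W_span_model[OF comb.hyps(2)]]
  have "hardy_inner (W h) (\<lambda>z. a * W f z + b * W g z) = cnj a * hardy_inner (W h) (W f) + cnj b * hardy_inner (W h) (W g)"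
    by (simp only: H2.ip_add_right[OF H2.scale_closed[OF fH] H2.scale_closed[OF gH] model_space_hardy[OF Wh]]
        H2.ip_scale_right[OF fH model_space_hardy[OF Wh]] H2.ip_scale_right[OF gH model_space_hardy[OF Wh]])
  moreover have "L2_inner \<sigma> h (\<lambda>x. a * f x + b * g x) = cnj a * L2_inner \<sigma> h f + cnj b * L2_inner \<sigma> h g"
    by (simp only: L2.ip_add_right[OF L2_scale[OF fL] L2_scale[OF gL] h] L2.ip_scale_right[OF fL h] L2.ip_scale_right[OF gL h])
  ultimately show ?case using comb.IH by (simp only: W_comb[OF fL gL])
qed

lemma W_span_nrm:
  assumes d: "d \<in> kernel_span"
  shows "H2.nrm (W d) = nrm\<sigma> d"
  using W_inner_span[OF d kernel_span_L2[OF d] W_span_model[OF d]] by (simp add: H2.nrm_def L2.nrm_def)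

text \<open>The images of the approximating sequence converge to \<open>W h\<close> pointwise,
  because pairing with a kernel is continuous, and are Cauchy in norm by the isometry on the span;
  Fatou's lemma for each dilate upgrades this to norm convergence.\<close>

lemma W_model_limit:
  assumes h: "h \<in> L2_space \<sigma>" and d: "\<And>n. d n \<in> kernel_span" and lim: "(\<lambda>n. nrm\<sigma> (\<lambda>x. d n x - h x)) \<longlonglongrightarrow> 0"
  shows "W h \<in> model_space I" and "(\<lambda>n. H2.nrm (\<lambda>z. W (d n) z - W h z)) \<longlonglongrightarrow> 0"
proof -
  have dL: "d n \<in> L2_space \<sigma>" for n by (rule kernel_span_L2[OF d])
  have WdM: "W (d n) \<in> model_space I" for n by (rule W_span_model[OF d])
  have WdH: "W (d n) \<in> hardy_space" for n by (rule model_space_hardy[OF WdM])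
  have pointwise: "(\<lambda>n. W (d n) z) \<longlonglongrightarrow> W h z" for z
  proof (cases "norm z < 1")
    case True
    have "(\<lambda>n. L2_inner \<sigma> (d n) (\<lambda>x. cauchy_kernel x z)) \<longlonglongrightarrow> L2_inner \<sigma> h (\<lambda>x. cauchy_kernel x z)"
      by (rule L2.tendsto_ip_left[OF dL h L2_kernel[OF True] lim])
    then show ?thesis using True by (auto simp: W_def intro!: tendsto_intros)
  qed (simp add: W_def)
  have nrm_diff: "H2.nrm (\<lambda>z. W (d m) z - W (d n) z) = nrm\<sigma> (\<lambda>x. d m x - d n x)" for m n
  proof -
    have "(\<lambda>x. d m x - d n x) \<in> kernel_span" using kernel_span.comb[OF d[of m] d[of n], of 1 "-1"] by simp
    from W_span_nrm[OF this] show ?thesis by (simp add: W_diff[OF dL dL])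
  qed
  have close: "(\<lambda>z. W (d n) z - W h z) \<in> hardy_space \<and> H2.nrm (\<lambda>z. W (d n) z - W h z) \<le> 2 * e"
    if N: "\<And>m. m \<ge> N \<Longrightarrow> nrm\<sigma> (\<lambda>x. d m x - h x) < e" and n: "n \<ge> N" for N n e
  proof -
    have e: "0 < e" using N[OF order_refl] L2.nrm_nonneg[OF L2.diff_closed[OF dL h]] order_le_less_trans by blast
    have mn: "nrm\<sigma> (\<lambda>x. d n x - d m x) \<le> 2 * e" if "m \<ge> N" for m
      using L2.nrm_triangle_diff[OF dL[of n] h dL[of m]] N[OF n] N[OF that] L2.nrm_diff_commute[OF h dL[of m]] by simp
    have hol: "hol_ball 1 (\<lambda>z. W (d n) z - W h z)" by (intro hol_ball_diff W_hol dL h)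
    have le: "nrmS (dil (\<lambda>z. W (d n) z - W h z) r) \<le> 2 * e" if r: "0 < r" "r < 1" for r
    proof (rule L2_fatou(2)[where F = "\<lambda>m. dil (\<lambda>z. W (d n) z - W (d m) z) r"])
      have H: "(\<lambda>z. W (d n) z - W (d m) z) \<in> hardy_space" for m by (intro H2.diff_closed WdH)
      show "dil (\<lambda>z. W (d n) z - W (d m) z) r \<in> L2_space sphere_measure" for m
        using r by (intro dil_L2 hardy_hol H) auto
      show "dil (\<lambda>z. W (d n) z - W h z) r \<in> borel_measurable sphere_measure"
        using dil_L2[OF hol, of r] r by (simp add: L2_space_def)
      show "AE x in sphere_measure. (\<lambda>m. dil (\<lambda>z. W (d n) z - W (d m) z) r x) \<longlonglongrightarrow> dil (\<lambda>z. W (d n) z - W h z) r x"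
        unfolding dil_def by (intro AE_I2 tendsto_intros pointwise)
      show "\<forall>\<^sub>F m in sequentially. nrmS (dil (\<lambda>z. W (d n) z - W (d m) z) r) \<le> 2 * e"
      proof (rule eventually_sequentiallyI[of N])
        fix m assume m: "N \<le> m"
        have "nrmS (dil (\<lambda>z. W (d n) z - W (d m) z) r) \<le> H2.nrm (\<lambda>z. W (d n) z - W (d m) z)"
          using r by (intro dil_le_hardy_nrm H) auto
        then show "nrmS (dil (\<lambda>z. W (d n) z - W (d m) z) r) \<le> 2 * e" using mn[OF m] by (simp add: nrm_diff)
      qed
    qed (use e in simp)
    have H: "(\<lambda>z. W (d n) z - W h z) \<in> hardy_space" by (rule hardyI[OF hol le])
    show ?thesis using H hardy_nrm_le[OF H le] by blast
  qed
  have ev: "\<exists>N. \<forall>m\<ge>N. nrm\<sigma> (\<lambda>x. d m x - h x) < e" if "e > 0" for e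
    using order_tendstoD(2)[OF lim that] by (simp add: eventually_sequentially)
  obtain N where N: "\<And>m. m \<ge> N \<Longrightarrow> nrm\<sigma> (\<lambda>x. d m x - h x) < 1" using ev[of 1] by auto
  have WhH: "W h \<in> hardy_space"
  proof -
    have "(\<lambda>z. W (d N) z - (W (d N) z - W h z)) \<in> hardy_space"
      by (rule H2.diff_closed[OF WdH]) (rule close[OF N order_refl, THEN conjunct1])
    then show ?thesis by simp
  qed
  show lim2: "(\<lambda>n. H2.nrm (\<lambda>z. W (d n) z - W h z)) \<longlonglongrightarrow> 0"
  proof (rule LIMSEQ_I)
    fix e :: real assume e: "e > 0"
    obtain N where N: "\<And>m. m \<ge> N \<Longrightarrow> nrm\<sigma> (\<lambda>x. d m x - h x) < e / 3" using ev[of "e / 3"] e by auto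
    have "norm (H2.nrm (\<lambda>z. W (d n) z - W h z) - 0) < e" if "n \<ge> N" for n
      using close[OF N that] e H2.nrm_nonneg[of "\<lambda>z. W (d n) z - W h z"] by simp
    then show "\<exists>N. \<forall>n\<ge>N. norm (H2.nrm (\<lambda>z. W (d n) z - W h z) - 0) < e" by blast
  qed
  have "hardy_inner (W h) (\<lambda>z. I z * g z) = 0" if g: "g \<in> hardy_space" for g
  proof -
    have "(\<lambda>n. hardy_inner (W (d n)) (\<lambda>z. I z * g z)) \<longlonglongrightarrow> hardy_inner (W h) (\<lambda>z. I z * g z)"
      by (rule H2.tendsto_ip_left[OF WdH WhH inner_mult_hardy[OF inner g] lim2])
    moreover have "hardy_inner (W (d n)) (\<lambda>z. I z * g z) = 0" for n
      using WdM[of n] g by (simp add: model_space_def)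
    ultimately show ?thesis by (simp add: LIMSEQ_const_iff)
  qed
  then show "W h \<in> model_space I" using WhH by (simp add: model_space_def)
qed

lemma W_model:
  assumes h: "h \<in> L2_space \<sigma>"
  shows "W h \<in> model_space I"
  by (rule kernel_span_dense[OF h]) (rule W_model_limit(1)[OF h])

theorem W_isometry:
  assumes h: "h \<in> L2_space \<sigma>" and g: "g \<in> L2_space \<sigma>"
  shows "hardy_inner (W h) (W g) = L2_inner \<sigma> h g"
proof -
  obtain d where d: "\<And>n. d n \<in> kernel_span" "(\<lambda>n. nrm\<sigma> (\<lambda>x. d n x - g x)) \<longlonglongrightarrow> 0"
    by (rule kernel_span_dense[OF g]) blast
  have "(\<lambda>n. hardy_inner (W h) (W (d n))) \<longlonglongrightarrow> hardy_inner (W h) (W g)"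
    by (rule H2.tendsto_ip_right[OF model_space_hardy[OF W_span_model[OF d(1)]] model_space_hardy[OF W_model[OF g]]
        model_space_hardy[OF W_model[OF h]] W_model_limit(2)[OF g d]])
  moreover have "(\<lambda>n. L2_inner \<sigma> h (d n)) \<longlonglongrightarrow> L2_inner \<sigma> h g"
    by (rule L2.tendsto_ip_right[OF kernel_span_L2[OF d(1)] g h d(2)])
  ultimately show ?thesis
    using LIMSEQ_unique by (simp add: W_inner_span[OF d(1) h W_model[OF h]])
qed

lemma W_nrm_diff:
  assumes h: "h \<in> L2_space \<sigma>" and g: "g \<in> L2_space \<sigma>"
  shows "H2.nrm (\<lambda>z. W h z - W g z) = nrm\<sigma> (\<lambda>x. h x - g x)"
  using W_isometry[OF L2.diff_closed[OF h g] L2.diff_closed[OF h g]]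
  by (simp add: H2.nrm_def L2.nrm_def W_diff[OF h g])

lemma W_injective:
  assumes h: "h \<in> L2_space \<sigma>" and g: "g \<in> L2_space \<sigma>" and eq: "\<And>z. z \<in> ball 0 1 \<Longrightarrow> W h z = W g z"
  shows "AE x in \<sigma>. h x = g x"
proof -
  \<comment> \<open>Both functions are \<open>0\<close> off the ball, so equality on the ball is
    equality of functions.\<close>
  have "W h = W g" using eq by (auto simp: W_def)
  moreover have "H2.nrm (\<lambda>z. W h z - W h z) = nrm\<sigma> (\<lambda>x. h x - h x)" by (rule W_nrm_diff[OF h h])
  ultimately have "nrm\<sigma> (\<lambda>x. h x - g x) = 0" using W_nrm_diff[OF h g] by (simp add: L2_nrm)
  then show ?thesis using L2_nrm_eq_0[OF L2.diff_closed[OF h g]] by simp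
qed

text \<open>The range of \<open>W\<close> is complete, being an isometric image of L2, so
  \<open>f\<close> can be projected onto it. The remainder lies in the model space and is orthogonal
  to the images of the Cauchy kernels, which by \<open>inner_W_kernel\<close> means that it vanishes
  at every point of the ball.\<close>

theorem W_surjective:
  assumes f: "f \<in> model_space I"
  shows "\<exists>h\<in>L2_space \<sigma>. \<forall>z\<in>ball 0 1. W h z = f z"
proof -
  have fH: "f \<in> hardy_space" by (rule model_space_hardy[OF f])
  have zero: "(\<lambda>_. 0) \<in> L2_space \<sigma>" by (simp add: L2_space_def)
  obtain y d where y: "y \<in> W ` L2_space \<sigma>" and orth: "\<And>g. g \<in> W ` L2_space \<sigma> \<Longrightarrow> hardy_inner (\<lambda>z. f z - y z) g = 0"
    and "\<And>n. d n \<in> W ` L2_space \<sigma>" "(\<lambda>n. H2.nrm (\<lambda>z. d n z - y z)) \<longlonglongrightarrow> 0"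
  proof (rule H2.projection[where D = "W ` L2_space \<sigma>" and Y = "W ` L2_space \<sigma>" and h = f])
    show "W ` L2_space \<sigma> \<subseteq> hardy_space" "W ` L2_space \<sigma> \<subseteq> hardy_space" using W_model model_space_hardy by blast+
    show "W ` L2_space \<sigma> \<noteq> {}" using zero by blast
    show "(\<lambda>x. a * f x + b * g x) \<in> W ` L2_space \<sigma>" if "f \<in> W ` L2_space \<sigma>" "g \<in> W ` L2_space \<sigma>" for f g a b
      using that by (auto simp: W_comb[symmetric] intro!: imageI L2.comb_closed)
    fix d :: "nat \<Rightarrow> complex^'n \<Rightarrow> complex" assume d: "\<And>n. d n \<in> W ` L2_space \<sigma>"
      and cauchy: "\<And>e. e > 0 \<Longrightarrow> \<exists>N. \<forall>m\<ge>N. \<forall>n\<ge>N. H2.nrm (\<lambda>x. d m x - d n x) < e"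
    have "\<forall>n. \<exists>h. h \<in> L2_space \<sigma> \<and> d n = W h" using d by blast
    then obtain h where h: "\<And>n. h n \<in> L2_space \<sigma>" "\<And>n. d n = W (h n)" by metis
    have "\<exists>N. \<forall>m\<ge>N. \<forall>n\<ge>N. nrm\<sigma> (\<lambda>x. h m x - h n x) < e" if "e > 0" for e
      using cauchy[OF that] by (simp add: h(2) W_nrm_diff[OF h(1) h(1)])
    from L2_complete[OF finite_sigma h(1) this]
    obtain h\<^sub>0 where h\<^sub>0: "h\<^sub>0 \<in> L2_space \<sigma>" "(\<lambda>n. nrm\<sigma> (\<lambda>x. h n x - h\<^sub>0 x)) \<longlonglongrightarrow> 0" by blast
    show "\<exists>y\<in>W ` L2_space \<sigma>. (\<lambda>n. H2.nrm (\<lambda>x. d n x - y x)) \<longlonglongrightarrow> 0"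
    proof
      show "(\<lambda>n. H2.nrm (\<lambda>x. d n x - W h\<^sub>0 x)) \<longlonglongrightarrow> 0"
        unfolding h(2) W_nrm_diff[OF h(1) h\<^sub>0(1)] by (rule h\<^sub>0(2))
    qed (rule imageI[OF h\<^sub>0(1)])
  qed (use fH in auto)
  obtain h where h: "h \<in> L2_space \<sigma>" "y = W h" using y by blast
  have diff: "(\<lambda>z. f z - W h z) \<in> model_space I"
    using model_space_comb[OF inner f W_model[OF h(1)], of 1 "-1"] by simp
  have "W h w = f w" if w: "norm w < 1" for w
  proof -
    have "hardy_inner (\<lambda>z. f z - W h z) (W (\<lambda>x. cauchy_kernel x w)) = 0"
      unfolding h(2)[symmetric] using L2_kernel[OF w] by (intro orth imageI)
    then show ?thesis using nonzero(2)[OF w] by (simp add: inner_W_kernel[OF diff w])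
  qed
  then show ?thesis using h(1) by (intro bexI[of _ h]) auto
qed

text \<open>A preimage under \<open>W\<close> is unique only almost everywhere, hence the choice;
  \<open>clark_operator_eqI\<close> then yields linearity and the values on kernels up to null
  sets.\<close>

definition clark_operator :: "(complex^'n \<Rightarrow> complex) \<Rightarrow> complex^'n \<Rightarrow> complex" where
  "clark_operator f = (SOME h. h \<in> L2_space \<sigma> \<and> (\<forall>z\<in>ball 0 1. W h z = f z))"

lemma clark_operator:
  assumes "f \<in> model_space I"
  shows "clark_operator f \<in> L2_space \<sigma>" "\<And>z. z \<in> ball 0 1 \<Longrightarrow> W (clark_operator f) z = f z"
proof -
  have "\<exists>h. h \<in> L2_space \<sigma> \<and> (\<forall>z\<in>ball 0 1. W h z = f z)" using W_surjective[OF assms] by blast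
  from someI_ex[OF this] show "clark_operator f \<in> L2_space \<sigma>" "\<And>z. z \<in> ball 0 1 \<Longrightarrow> W (clark_operator f) z = f z"
    unfolding clark_operator_def by blast+
qed

lemma clark_operator_eqI:
  assumes f: "f \<in> model_space I" and h: "h \<in> L2_space \<sigma>" and eq: "\<And>z. z \<in> ball 0 1 \<Longrightarrow> W h z = f z"
  shows "AE x in \<sigma>. clark_operator f x = h x"
  by (rule W_injective[OF clark_operator(1)[OF f] h]) (simp add: clark_operator(2)[OF f] eq)

theorem clark_operator_extension: "clark_unitary_extension I \<alpha> \<sigma> clark_operator"
  unfolding clark_unitary_extension_def unitary_onto_L2_def
proof (intro conjI ballI allI impI)
  fix f assume f: "f \<in> model_space I"
  show "clark_operator f \<in> L2_space \<sigma>" by (rule clark_operator(1)[OF f])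
  fix g assume g: "g \<in> model_space I"
  note F = clark_operator[OF f] and G = clark_operator[OF g]
  show "AE \<zeta> in \<sigma>. clark_operator f \<zeta> = clark_operator g \<zeta>" if "\<forall>z\<in>ball 0 1. f z = g z"
    using that by (intro clark_operator_eqI[OF f G(1)]) (simp add: G(2))
  show "AE \<zeta> in \<sigma>. clark_operator (\<lambda>z. a * f z + b * g z) \<zeta> = a * clark_operator f \<zeta> + b * clark_operator g \<zeta>" for a b
    by (intro clark_operator_eqI model_space_comb inner f g L2.comb_closed F(1) G(1))
       (simp add: W_comb[OF F(1) G(1)] F(2) G(2))
  show "L2_inner \<sigma> (clark_operator f) (clark_operator g) = hardy_inner f g"
    unfolding W_isometry[OF F(1) G(1), symmetric] by (rule hardy_inner_cong) (simp_all add: F(2) G(2))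
next
  fix h assume h: "h \<in> L2_space \<sigma>"
  show "\<exists>f\<in>model_space I. AE \<zeta> in \<sigma>. clark_operator f \<zeta> = h \<zeta>"
    by (intro bexI[of _ "W h"] clark_operator_eqI W_model h) simp
next
  fix w :: "complex^'n" assume "w \<in> ball 0 1"
  then have w: "norm w < 1" by simp
  show "AE \<zeta> in \<sigma>. clark_operator (model_kernel I w) \<zeta> = (1 - \<alpha> * cnj (I w)) * cauchy_kernel \<zeta> w"
  proof (rule clark_operator_eqI[OF model_kernel_in_model_space[OF inner w] L2_scale[OF L2_kernel[OF w]]])
    fix z :: "complex^'n" assume z: "z \<in> ball 0 1"
    have "W (\<lambda>x. (1 - \<alpha> * cnj (I w)) * cauchy_kernel x w) z = (1 - \<alpha> * cnj (I w)) * W (\<lambda>x. cauchy_kernel x w) z"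
      using W_comb[OF L2_kernel[OF w] L2_kernel[OF w], of "1 - \<alpha> * cnj (I w)" 0] by simp
    then show "W (\<lambda>x. (1 - \<alpha> * cnj (I w)) * cauchy_kernel x w) z = model_kernel I w z"
      using z nonzero(3)[OF w] by (simp add: W_kernel[OF w])
  qed
qed

text \<open>Preservation of inner products and the prescribed values on the reproducing kernels
  force the pairings of \<open>T f\<close> with Cauchy kernels: up to an explicit factor they are
  the values of \<open>f\<close>.\<close>

lemma clark_extension_inner_kernel:
  assumes T: "clark_unitary_extension I \<alpha> \<sigma> T" and f: "f \<in> model_space I" and w: "norm w < 1"
  shows "cnj (1 - \<alpha> * cnj (I w)) * L2_inner \<sigma> (T f) (\<lambda>x. cauchy_kernel x w) = f w"
proof -
  note K = model_kernel_in_model_space[OF inner w]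
  have TL2: "T f \<in> L2_space \<sigma>" "T (model_kernel I w) \<in> L2_space \<sigma>"
    using T f K by (auto simp: clark_unitary_extension_def unitary_onto_L2_def)
  have "f w = L2_inner \<sigma> (T f) (T (model_kernel I w))"
    using T f K model_reproducing[OF inner w f] by (simp add: clark_unitary_extension_def unitary_onto_L2_def)
  also have "\<dots> = L2_inner \<sigma> (T f) (\<lambda>x. (1 - \<alpha> * cnj (I w)) * cauchy_kernel x w)"
    unfolding L2_inner_def
  proof (rule integral_cong_AE)
    have [measurable]: "T f \<in> borel_measurable \<sigma>" "T (model_kernel I w) \<in> borel_measurable \<sigma>"
      "(\<lambda>x. cauchy_kernel x w) \<in> borel_measurable \<sigma>"
      using TL2 L2_kernel[OF w] by (auto simp: L2_space_def)
    show "(\<lambda>x. T f x * cnj (T (model_kernel I w) x)) \<in> borel_measurable \<sigma>"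
      "(\<lambda>x. T f x * cnj ((1 - \<alpha> * cnj (I w)) * cauchy_kernel x w)) \<in> borel_measurable \<sigma>" by measurable
    have "AE x in \<sigma>. T (model_kernel I w) x = (1 - \<alpha> * cnj (I w)) * cauchy_kernel x w"
      using T w by (simp add: clark_unitary_extension_def)
    then show "AE x in \<sigma>. T f x * cnj (T (model_kernel I w) x) = T f x * cnj ((1 - \<alpha> * cnj (I w)) * cauchy_kernel x w)"
      by eventually_elim simp
  qed
  also have "\<dots> = cnj (1 - \<alpha> * cnj (I w)) * L2_inner \<sigma> (T f) (\<lambda>x. cauchy_kernel x w)"
    by (rule L2.ip_scale_right[OF L2_kernel[OF w] TL2(1)])
  finally show ?thesis by simp
qed

text \<open>The images of \<open>f\<close> under two extensions have the same pairings with all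
  Cauchy kernels, and only the zero class of L2 of \<open>\<sigma>\<close> is orthogonal to all of
  these.\<close>

lemma clark_extension_unique:
  assumes S: "clark_unitary_extension I \<alpha> \<sigma> S" and T: "clark_unitary_extension I \<alpha> \<sigma> T" and f: "f \<in> model_space I"
  shows "AE x in \<sigma>. S f x = T f x"
proof -
  have L2: "S f \<in> L2_space \<sigma>" "T f \<in> L2_space \<sigma>"
    using S T f by (auto simp: clark_unitary_extension_def unitary_onto_L2_def)
  have "AE x in \<sigma>. S f x - T f x = 0"
  proof (rule orthogonal_to_kernels[OF L2.diff_closed[OF L2]])
    fix w :: "complex^'n" assume w: "norm w < 1"
    have "cnj (1 - \<alpha> * cnj (I w)) \<noteq> 0" using nonzero(3)[OF w] complex_cnj_zero_iff by blast
    then have "L2_inner \<sigma> (S f) (\<lambda>x. cauchy_kernel x w) = L2_inner \<sigma> (T f) (\<lambda>x. cauchy_kernel x w)"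
      using clark_extension_inner_kernel[OF S f w] clark_extension_inner_kernel[OF T f w] mult_left_cancel by metis
    then show "L2_inner \<sigma> (\<lambda>x. S f x - T f x) (\<lambda>x. cauchy_kernel x w) = 0"
      by (simp add: L2.ip_diff[OF L2 L2_kernel[OF w]])
  qed
  then show ?thesis by simp
qed

end

theorem theorem5p1:
  fixes I :: "complex^'n \<Rightarrow> complex" and \<alpha> :: complex and \<sigma> :: "(complex^'n) measure"
  assumes "CARD('n) \<ge> 2"
    and "inner_function I"
    and "\<alpha> \<in> sphere 0 1"
    and "clark_measure I \<alpha> \<sigma>"
  shows "(\<forall>w\<in>ball 0 1. model_kernel I w \<in> model_space I \<and>
            (\<forall>f\<in>model_space I. hardy_inner f (model_kernel I w) = f w)) \<and>
         (\<exists>T. clark_unitary_extension I \<alpha> \<sigma> T \<and>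
            (\<forall>T'. clark_unitary_extension I \<alpha> \<sigma> T' \<longrightarrow>
               (\<forall>f\<in>model_space I. AE \<zeta> in \<sigma>. T' f \<zeta> = T f \<zeta>)))"
proof -
  interpret clark_setting I \<alpha> \<sigma>
    using assms by unfold_locales auto
  have "model_kernel I w \<in> model_space I \<and> (\<forall>f\<in>model_space I. hardy_inner f (model_kernel I w) = f w)" if "w \<in> ball 0 1" for w
    using that by (auto intro: model_kernel_in_model_space model_reproducing inner)
  then show ?thesis
    using clark_operator_extension clark_extension_unique by blast
qed

end
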